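(* There is an absolute constant $c>0$ such that the following holds. Let $\delta\in(0,1)$, let $T\ge 1$ be an integer, let $\overline{\mathbf W}\in\mathcal W$ be a reference model, and let $(\mathbf W(t))_{t=0}^{T}$ be the gradient descent iterates with step size $\eta>0$ started from the random initialization $\mathbf W(0)$. If $$m\ \ge\ c\,L^{16}(\log m)^4\log(nL/\delta)\,F_S(\overline{\mathbf W})^4,\qquad \eta\le\min\Big\{\frac{4}{5L},\ \frac{1}{20L\,\tilde F_S(\overline{\mathbf W})}\Big\},$$ then with probability at least $1-\delta$, for all $t\le T$, $$\max_{l\in[L]}\|\mathbf W^l(t)-\overline{\mathbf W}^l\|_2^2\ \le\ \|\mathbf W(t)-\overline{\mathbf W}\|_F^2\ \le\ F_S(\overline{\mathbf W})\qquad\text{and}\qquad \eta\sum_{k=0}^{t-1}\mathcal L_S(\mathbf W(k))\ \le\ F_S(\overline{\mathbf W}).$$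
   Context: Network: $d,m,L$ are positive integers, $m$ even, $L\ge2$ (implicit in the initialization). $\sigma(t)=\max\{t,0\}$ entrywise. $\mathcal W=\mathbb R^{m\times d}\times(\mathbb R^{m\times m})^{L-1}$ with elements $\mathbf W=(\mathbf W^1,\dots,\mathbf W^L)$; $(\mathbf w_r^l)^\top$ is the $r$-th row of $\mathbf W^l$. For $\mathbf x\in\mathcal X=S^{d-1}$ (unit sphere of $\mathbb R^d$): $h^0(\mathbf x)=\mathbf x$, $h^l(\mathbf x)=\sqrt{2/m}\,\sigma(\mathbf W^l h^{l-1}(\mathbf x))$, $f_{\mathbf W}(\mathbf x)=\mathbf a^\top h^L(\mathbf x)$, where $\mathbf a\in\mathbb R^m$ is fixed (not trained). Initialization: $a_{r+m/2}=-a_r\in\{-1,+1\}$ for $1\le r\le m/2$. $\mathbf W(0)$ is random: all rows $\mathbf w^l_r(0)$ with $l\le L-1$, $r\in[m]$, and $\mathbf w^L_r(0)$ with $r\le m/2$, are independent standard Gaussian vectors ($\mathcal N(0,\mathbf I_d)$ for $l=1$, $\mathcal N(0,\mathbf I_m)$ for $l\ge 2$), and $\mathbf w^L_{r+m/2}(0)=\mathbf w^L_r(0)$ for $r\le m/2$. Gradients: $\Sigma^l(\mathbf x)=\mathrm{diag}_{r\in[m]}(\mathbb I\{\langle\mathbf w^l_r,h^{l-1}(\mathbf x)\rangle\ge0\})$, $\mathbf G^l_L(\mathbf x)=\sqrt{2/m}\,\Sigma^L(\mathbf x)\mathbf W^L\cdots\sqrt{2/m}\,\Sigma^{l+1}(\mathbf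 x)\mathbf W^{l+1}\sqrt{2/m}\,\Sigma^l(\mathbf x)$ (with $\mathbf G^L_L(\mathbf x)=\sqrt{2/m}\,\Sigma^L(\mathbf x)$), and by convention $\frac{\partial f_{\mathbf W}(\mathbf x)}{\partial\mathbf W^l}:=(\mathbf G_L^l(\mathbf x))^\top\mathbf a\,(h^{l-1}(\mathbf x))^\top$. Data and loss: $S=\{(\mathbf x_i,y_i)\}_{i=1}^n$ is a training sample drawn from a probability measure $\rho$ on $\mathcal X\times\{1,-1\}$ (independently of the initialization); $\ell(z)=\log(1+e^{-z})$; $\mathcal L_S(\mathbf W)=\frac1n\sum_{i=1}^n\ell(y_if_{\mathbf W}(\mathbf x_i))$, with $\frac{\partial\mathcal L_S(\mathbf W)}{\partial\mathbf W^l}=\frac1n\sum_i y_i\ell'(y_if_{\mathbf W}(\mathbf x_i))\frac{\partial f_{\mathbf W}(\mathbf x_i)}{\partial\mathbf W^l}$. Gradient descent: $\mathbf W^l(t+1)=\mathbf W^l(t)-\eta\frac{\partial\mathcal L_S(\mathbf W(t))}{\partial\mathbf W^l(t)}$ for all $l\in[L]$, $t=0,\dots,T-1$. Reference model quantities: $F_S(\overline{\mathbf W})=3\eta T\mathcal L_S(\overline{\mathbf W})+\|\mathbf W(0)-\overline{\mathbf W}\|_F^2$, $\tilde F_S(\overline{\mathbf W})=\frac1n\sum_{i=1}^n|\ell'(y_if_{\overline{\mathbf W}}(\mathbf x_i))|$, and $F_S(\overline{\mathbf W})\ge1$ is assumed. The reference model $\overline{\mathbf W}$ may be chosen depending on $\mathbf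 W(0)$. For tuples $\|\mathbf W\|_F^2=\sum_l\|\mathbf W^l\|_F^2$; $\|\cdot\|_2$ of a matrix is the spectral norm. *)

theory Defs
  imports "HOL-Probability.Probability" "Jordan_Normal_Form.Matrix"
begin

no_notation inner (infix "\<bullet>" 70)
no_notation vec_nth (infixl "$" 90)

section \<open>Network\<close>

text \<open>
  Dimensions vary inside the statement, so matrices and vectors are those of
  Jordan_Normal_Form, with rows and columns indexed from 0.
  Layers are indexed by \<open>1, \<dots>, L\<close>. A parameter tuple is a function from layers to matrices,
  of which only the values at layers \<open>1, \<dots>, L\<close> matter.
\<close>

type_synonym params = "nat \<Rightarrow> real mat"

definition in_dim :: "nat \<Rightarrow> nat \<Rightarrow> nat \<Rightarrow> nat" where
  "in_dim d m l = (if l = 1 then d else m)"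

definition param_space :: "nat \<Rightarrow> nat \<Rightarrow> nat \<Rightarrow> params set" where
  "param_space d m L = {W. \<forall>l\<in>{1..L}. W l \<in> carrier_mat m (in_dim d m l)}"

definition relu :: "real \<Rightarrow> real" where
  "relu t = max t 0"

primrec hidden :: "nat \<Rightarrow> params \<Rightarrow> real Matrix.vec \<Rightarrow> nat \<Rightarrow> real Matrix.vec" where
  "hidden m W x 0 = x"
| "hidden m W x (Suc l) = sqrt (2 / real m) \<cdot>\<^sub>v map_vec relu (W (Suc l) *\<^sub>v hidden m W x l)"

definition net :: "nat \<Rightarrow> nat \<Rightarrow> real Matrix.vec \<Rightarrow> params \<Rightarrow> real Matrix.vec \<Rightarrow> real" where
  "net m L a W x = a \<bullet> hidden m W x L"


section \<open>Gradients\<close>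

definition act_pattern :: "nat \<Rightarrow> params \<Rightarrow> real Matrix.vec \<Rightarrow> nat \<Rightarrow> real mat" where
  "act_pattern m W x l =
     mat_diag m (\<lambda>r. if Matrix.row (W l) r \<bullet> hidden m W x (l - 1) \<ge> 0 then 1 else 0)"

text \<open>\<open>backprop m W x l k\<close> is \<open>G\<close> with lower index \<open>l + k\<close> and upper index \<open>l\<close>.\<close>

primrec backprop :: "nat \<Rightarrow> params \<Rightarrow> real Matrix.vec \<Rightarrow> nat \<Rightarrow> nat \<Rightarrow> real mat" where
  "backprop m W x l 0 = sqrt (2 / real m) \<cdot>\<^sub>m act_pattern m W x l"
| "backprop m W x l (Suc k) =
     (sqrt (2 / real m) \<cdot>\<^sub>m act_pattern m W x (l + Suc k)) * W (l + Suc k) * backprop m W x l k"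

definition outer_product :: "real Matrix.vec \<Rightarrow> real Matrix.vec \<Rightarrow> real mat" where
  "outer_product u v = Matrix.mat (dim_vec u) (dim_vec v) (\<lambda>(r, j). u $ r * v $ j)"

definition net_grad ::
  "nat \<Rightarrow> nat \<Rightarrow> real Matrix.vec \<Rightarrow> params \<Rightarrow> real Matrix.vec \<Rightarrow> nat \<Rightarrow> real mat" where
  "net_grad m L a W x l =
     outer_product (transpose_mat (backprop m W x l (L - l)) *\<^sub>v a) (hidden m W x (l - 1))"


section \<open>Loss and gradient descent\<close>

type_synonym sample = "nat \<Rightarrow> real Matrix.vec \<times> real"

definition logistic :: "real \<Rightarrow> real" where
  "logistic z = ln (1 + exp (- z))"

definition emp_loss ::
  "nat \<Rightarrow> nat \<Rightarrow> nat \<Rightarrow> real Matrix.vec \<Rightarrow> sample \<Rightarrow> params \<Rightarrow> real" where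
  "emp_loss m L n a S W =
     (\<Sum>i<n. logistic (snd (S i) * net m L a W (fst (S i)))) / real n"

text \<open>The average over the sample is taken entrywise.\<close>

definition loss_grad ::
  "nat \<Rightarrow> nat \<Rightarrow> nat \<Rightarrow> nat \<Rightarrow> real Matrix.vec \<Rightarrow> sample \<Rightarrow> params \<Rightarrow> nat \<Rightarrow> real mat" where
  "loss_grad d m L n a S W l = Matrix.mat m (in_dim d m l) (\<lambda>(r, j).
     (\<Sum>i<n. snd (S i) * deriv logistic (snd (S i) * net m L a W (fst (S i)))
              * net_grad m L a W (fst (S i)) l $$ (r, j)) / real n)"

primrec gd ::
  "nat \<Rightarrow> nat \<Rightarrow> nat \<Rightarrow> nat \<Rightarrow> real Matrix.vec \<Rightarrow> sample \<Rightarrow> real \<Rightarrow> params \<Rightarrow> nat \<Rightarrow> params" where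
  "gd d m L n a S \<eta> W0 0 = W0"
| "gd d m L n a S \<eta> W0 (Suc t) =
     (\<lambda>l. gd d m L n a S \<eta> W0 t l - \<eta> \<cdot>\<^sub>m loss_grad d m L n a S (gd d m L n a S \<eta> W0 t) l)"


section \<open>Norms and reference model quantities\<close>

definition vec_l2_norm :: "real Matrix.vec \<Rightarrow> real" where
  "vec_l2_norm v = sqrt (v \<bullet> v)"

definition spectral_norm :: "real mat \<Rightarrow> real" where
  "spectral_norm A =
     (SUP v \<in> {v \<in> carrier_vec (dim_col A). vec_l2_norm v = 1}. vec_l2_norm (A *\<^sub>v v))"

definition frob_norm_sq :: "real mat \<Rightarrow> real" where
  "frob_norm_sq A = (\<Sum>r<dim_row A. \<Sum>j<dim_col A. (A $$ (r, j))\<^sup>2)"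

definition params_dist_sq :: "nat \<Rightarrow> params \<Rightarrow> params \<Rightarrow> real" where
  "params_dist_sq L W V = (\<Sum>l=1..L. frob_norm_sq (W l - V l))"

definition ref_F ::
  "nat \<Rightarrow> nat \<Rightarrow> nat \<Rightarrow> real Matrix.vec \<Rightarrow> sample \<Rightarrow> real \<Rightarrow> nat \<Rightarrow> params \<Rightarrow> params \<Rightarrow> real" where
  "ref_F m L n a S \<eta> T W0 V = 3 * \<eta> * real T * emp_loss m L n a S V + params_dist_sq L W0 V"

definition ref_F_tilde ::
  "nat \<Rightarrow> nat \<Rightarrow> nat \<Rightarrow> real Matrix.vec \<Rightarrow> sample \<Rightarrow> params \<Rightarrow> real" where
  "ref_F_tilde m L n a S V =
     (\<Sum>i<n. \<bar>deriv logistic (snd (S i) * net m L a V (fst (S i)))\<bar>) / real n"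


section \<open>Randomness\<close>

definition antisymmetric_signs :: "nat \<Rightarrow> real Matrix.vec \<Rightarrow> bool" where
  "antisymmetric_signs m a \<longleftrightarrow> a \<in> carrier_vec m \<and>
     (\<forall>r < m div 2. a $ r \<in> {-1, 1} \<and> a $ (r + m div 2) = - (a $ r))"

text \<open>
  The independent standard Gaussian rows are realised by independent standard normal
  entries \<open>g (l, r, j)\<close>; in layer \<open>L\<close> only the first \<open>m / 2\<close> rows are drawn and
  \<open>init_params\<close> repeats them.
\<close>

definition init_index :: "nat \<Rightarrow> nat \<Rightarrow> nat \<Rightarrow> (nat \<times> nat \<times> nat) set" where
  "init_index d m L =
     {(l, r, j). l \<in> {1..L} \<and> r < (if l = L then m div 2 else m) \<and> j < in_dim d m l}"

definition init_measure :: "nat \<Rightarrow> nat \<Rightarrow> nat \<Rightarrow> (nat \<times> nat \<times> nat \<Rightarrow> real) measure" where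
  "init_measure d m L =
     (\<Pi>\<^sub>M k\<in>init_index d m L. density lborel (\<lambda>x. ennreal (std_normal_density x)))"

definition init_params :: "nat \<Rightarrow> nat \<Rightarrow> nat \<Rightarrow> (nat \<times> nat \<times> nat \<Rightarrow> real) \<Rightarrow> params" where
  "init_params d m L g = (\<lambda>l. Matrix.mat m (in_dim d m l)
     (\<lambda>(r, j). g (l, if l = L \<and> r \<ge> m div 2 then r - m div 2 else r, j)))"

text \<open>
  \<open>data_space d\<close> only provides the Borel \<open>\<sigma>\<close>-algebra on the product of the unit sphere with
  the labels; points of the sphere are coordinate functions on \<open>{..<d}\<close>, converted
  to vectors by \<open>sample_of\<close>.
\<close>

type_synonym data_point = "(nat \<Rightarrow> real) \<times> real"

definition data_space :: "nat \<Rightarrow> data_point measure" where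
  "data_space d =
     restrict_space (\<Pi>\<^sub>M j\<in>{..<d}. (borel :: real measure)) {x. (\<Sum>j<d. (x j)\<^sup>2) = 1}
       \<Otimes>\<^sub>M count_space {1, -1}"

definition sample_of :: "nat \<Rightarrow> (nat \<Rightarrow> data_point) \<Rightarrow> sample" where
  "sample_of d z = (\<lambda>i. (Matrix.vec d (fst (z i)), snd (z i)))"

text \<open>An i.i.d. sample of size \<open>n\<close> from \<open>\<rho>\<close>, independent of the initialization.\<close>

definition outcome_measure ::
  "nat \<Rightarrow> nat \<Rightarrow> nat \<Rightarrow> nat \<Rightarrow> data_point measure
     \<Rightarrow> ((nat \<Rightarrow> data_point) \<times> (nat \<times> nat \<times> nat \<Rightarrow> real)) measure" where
  "outcome_measure d m L n \<rho> = (\<Pi>\<^sub>M i\<in>{..<n}. \<rho>) \<Otimes>\<^sub>M init_measure d m L"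

end

(*
  Write f for the network and W, V for two parameters close to W(0). If
    |f_V(x_i) - f_W(x_i) - <grad f_W(x_i), V - W>| <= 1/50   and   |grad f_W(x_i)|^2 <= 12/5,
  then convexity of the logistic loss l and |l'| <= l show that one step of gradient descent changes
  |W - V|^2 by at most 2 eta L_S(V) - eta L_S(W); summation gives both claims and keeps the iterates
  within 2 sqrt F of W(0), where the two estimates hold.

  Approximate linearity fails only through flipped gates. Few preactivations are small at
  initialization, so at most s gates per layer flip, with s a small fraction of m. Propagation
  through the initial network from s-sparse vectors to s coordinates has norm O(1/L), which makes
  the recursion over the flips of all layers contract. Since the output weights are antisymmetric
  and the last layer is duplicated, the backpropagated signal below the last layer vanishes at W(0)
  and stays of order sqrt s, so it meets the sparse errors with a total of order
  L^(3/2) rho sqrt(s/m), where rho = 2 sqrt F.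

  The required bounds on the initial network come from conditioning on all layers but one. For fixed
  h and z the gated sum of squares over the rows w of a Gaussian layer has the exponential moment
  (1 + E exp(theta <w,z>^2)) / 2 per row, by the symmetry of w, so each layer preserves norms up to a
  factor 1 + 1/L with probability 1 - exp(-c m / L^2). A union bound over lattice nets supported on
  s-sparse sets and on about L^2 blocks of coordinates turns this into operator bounds.
*)
theory Submission
  imports Defs
begin

text \<open>Both F and the reference model may depend on the outcome, so no probability estimate may
  mention them. The width condition is therefore inverted: \<open>\<Phi>\<close> is the largest
  value of F that the given \<open>m\<close> allows, a deterministic number, and one event that
  knows only \<open>\<Phi>\<close> serves all reference models at once. Everything after that event
  is deterministic and holds for all parameters in the ball of radius \<open>2 sqrt \<Phi>\<close>
  around W(0).

  The number \<open>s\<close> of admissible flips is pinned from both sides. The union bound counts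
  about \<open>m^s\<close> supports, which asks for \<open>s ln m\<close> below
  \<open>m / L^2\<close>, and the linearization error asks for \<open>s\<close> below
  \<open>m / (L^3 \<Phi>)\<close>; the choice is \<open>s\<close> of order
  \<open>m / (L^3 \<Phi> ln m)\<close>. On the other side flips must really number at most
  \<open>s\<close>. Few preactivations lie below \<open>\<beta>\<close> only for
  \<open>\<beta>\<close> of order \<open>s / m\<close>, and the perturbation moves more than
  \<open>s / 2\<close> of the others past \<open>\<beta>\<close> unless \<open>\<beta>^2 s\<close>
  exceeds a multiple of \<open>L \<rho>^2\<close>. Hence \<open>s^3\<close> must exceed a multiple
  of \<open>m^2 L \<Phi>\<close>, and inserting the choice of \<open>s\<close> gives
  \<open>m\<close> of order \<open>L^10 (ln m)^3 \<Phi>^4\<close>: the origin of the fourth power of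
  F.\<close>

section \<open>The network in coordinates\<close>

text \<open>Vectors are functions of which only the coordinates below the dimension matter; the remaining
  values are junk, so every norm below is an \<open>L2_set\<close> over an explicit index set.\<close>

definition lin :: "nat \<Rightarrow> (nat \<Rightarrow> nat \<Rightarrow> real) \<Rightarrow> (nat \<Rightarrow> real) \<Rightarrow> nat \<Rightarrow> real" where
  "lin q A v r = (\<Sum>j<q. A r j * v j)"

primrec hid :: "nat \<Rightarrow> nat \<Rightarrow> (nat \<Rightarrow> nat \<Rightarrow> nat \<Rightarrow> real) \<Rightarrow> (nat \<Rightarrow> real) \<Rightarrow> nat \<Rightarrow> nat \<Rightarrow> real" where
  "hid d m w x 0 = x"
| "hid d m w x (Suc l) =
     (\<lambda>r. sqrt (2 / real m) * max (lin (in_dim d m (Suc l)) (w (Suc l)) (hid d m w x l) r) 0)"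

definition preact :: "nat \<Rightarrow> nat \<Rightarrow> (nat \<Rightarrow> nat \<Rightarrow> nat \<Rightarrow> real) \<Rightarrow> (nat \<Rightarrow> real) \<Rightarrow> nat \<Rightarrow> nat \<Rightarrow> real" where
  "preact d m w x l = lin (in_dim d m l) (w l) (hid d m w x (l - 1))"

definition gate :: "nat \<Rightarrow> nat \<Rightarrow> (nat \<Rightarrow> nat \<Rightarrow> nat \<Rightarrow> real) \<Rightarrow> (nat \<Rightarrow> real) \<Rightarrow> nat \<Rightarrow> nat \<Rightarrow> real" where
  "gate d m w x l r = (if preact d m w x l r \<ge> 0 then 1 else 0)"

text \<open>\<open>prp m D w k v i\<close> sends \<open>v\<close> through the linearized layers \<open>k + 1, \<dots>, k + i\<close> with gates \<open>D\<close>;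
  \<open>pre\<close> continues up to the preactivation of layer \<open>k + i + 1\<close>.\<close>

primrec prp :: "nat \<Rightarrow> (nat \<Rightarrow> nat \<Rightarrow> real) \<Rightarrow> (nat \<Rightarrow> nat \<Rightarrow> nat \<Rightarrow> real) \<Rightarrow> nat \<Rightarrow> (nat \<Rightarrow> real) \<Rightarrow> nat \<Rightarrow> nat \<Rightarrow> real" where
  "prp m D w k v 0 = v"
| "prp m D w k v (Suc i) =
     (\<lambda>r. sqrt (2 / real m) * D (k + Suc i) r * lin m (w (k + Suc i)) (prp m D w k v i) r)"

definition pre :: "nat \<Rightarrow> (nat \<Rightarrow> nat \<Rightarrow> real) \<Rightarrow> (nat \<Rightarrow> nat \<Rightarrow> nat \<Rightarrow> real) \<Rightarrow> nat \<Rightarrow> (nat \<Rightarrow> real) \<Rightarrow> nat \<Rightarrow> nat \<Rightarrow> real" where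
  "pre m D w k v i = (\<lambda>r. sqrt (2 / real m) * lin m (w (k + Suc i)) (prp m D w k v i) r)"

definition fro :: "nat \<Rightarrow> nat \<Rightarrow> (nat \<Rightarrow> nat \<Rightarrow> real) \<Rightarrow> real" where
  "fro p q A = L2_set (\<lambda>r. L2_set (A r) {..<q}) {..<p}"

lemma fro_nonneg [simp]: "0 \<le> fro p q A"
  by (simp add: fro_def)

lemma fro_sq: "(fro p q A)\<^sup>2 = (\<Sum>r<p. \<Sum>j<q. (A r j)\<^sup>2)"
  by (simp add: fro_def L2_set_def sum_nonneg)

lemma L2_set_sq: "(L2_set f A)\<^sup>2 = (\<Sum>i\<in>A. (f i)\<^sup>2)"
  by (simp add: L2_set_def sum_nonneg)

lemma L2_set_subset: "finite B \<Longrightarrow> A \<subseteq> B \<Longrightarrow> L2_set f A \<le> L2_set f B"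
  unfolding L2_set_def by (intro real_sqrt_le_mono sum_mono2) auto

lemma L2_set_abs_mono: "(\<And>i. i \<in> A \<Longrightarrow> \<bar>f i\<bar> \<le> \<bar>g i\<bar>) \<Longrightarrow> L2_set f A \<le> L2_set g A"
  unfolding L2_set_def by (intro real_sqrt_le_mono sum_mono) (simp add: abs_le_square_iff)

lemma L2_set_scale: "L2_set (\<lambda>r. a * f r) A = \<bar>a\<bar> * L2_set f A"
  by (simp add: L2_set_def power_mult_distrib real_sqrt_mult flip: sum_distrib_left)

lemma L2_set_sum_le: "L2_set (\<lambda>r. \<Sum>j\<in>J. f j r) A \<le> (\<Sum>j\<in>J. L2_set (f j) A)"
proof (induction J rule: infinite_finite_induct)
  case (insert j J)
  then show ?case
    using L2_set_triangle_ineq[of "f j" "\<lambda>r. \<Sum>j\<in>J. f j r" A] by simp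
qed (auto simp: L2_set_0')

lemma L2_set_diff_le: "L2_set (\<lambda>r. f r - g r) A \<le> L2_set f A + L2_set g A"
  using L2_set_triangle_ineq[of f "\<lambda>r. - g r" A] by (simp add: L2_set_def)

lemma L2_set_Un_le: "finite A \<Longrightarrow> finite B \<Longrightarrow> L2_set f (A \<union> B) \<le> L2_set f A + L2_set f B"
proof -
  assume fin: "finite A" "finite B"
  have "(L2_set f (A \<union> B))\<^sup>2 \<le> (L2_set f A)\<^sup>2 + (L2_set f B)\<^sup>2"
    unfolding L2_set_sq using fin sum.union_inter[of A B "\<lambda>i. (f i)\<^sup>2"]
      sum_nonneg[of "A \<inter> B" "\<lambda>i. (f i)\<^sup>2"] by auto
  also have "\<dots> \<le> (L2_set f A + L2_set f B)\<^sup>2"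
    by (simp add: power2_sum)
  finally show ?thesis
    by (rule power2_le_imp_le) simp
qed

lemma sum_mult_le_L2_set: "\<bar>\<Sum>i\<in>A. f i * g i\<bar> \<le> L2_set f A * L2_set g A"
  by (rule order_trans[OF sum_abs]) (use L2_set_mult_ineq[of f g A] in \<open>simp add: abs_mult\<close>)

lemma sum_le_sqrt_card_L2_set: "(\<Sum>i\<in>A. \<bar>f i\<bar>) \<le> sqrt (real (card A)) * L2_set f A"
  using L2_set_mult_ineq[of "\<lambda>_. 1" f A] by (simp add: L2_set_constant)

lemma L2_set_lin_le:
  assumes "T \<subseteq> {..<p}"
  shows "L2_set (lin q A v) T \<le> fro p q A * L2_set v {..<q}"
proof -
  have "L2_set (lin q A v) T \<le> L2_set (lin q A v) {..<p}"
    using assms by (intro L2_set_subset) auto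
  also have "\<dots> \<le> L2_set (\<lambda>r. L2_set v {..<q} * L2_set (A r) {..<q}) {..<p}"
    using sum_mult_le_L2_set[of "A _" v "{..<q}"]
    by (intro L2_set_abs_mono) (simp add: lin_def mult.commute)
  also have "\<dots> = fro p q A * L2_set v {..<q}"
    by (subst L2_set_scale) (simp add: fro_def)
  finally show ?thesis .
qed

lemma lin_add: "lin q A (\<lambda>j. u j + v j) r = lin q A u r + lin q A v r"
  by (simp add: lin_def distrib_left sum.distrib)

lemma lin_diff: "lin q A (\<lambda>j. u j - v j) r = lin q A u r - lin q A v r"
  by (simp add: lin_def right_diff_distrib sum_subtractf)

lemma lin_mat_diff: "lin q (\<lambda>r j. A r j - B r j) v r = lin q A v r - lin q B v r"
  by (simp add: lin_def left_diff_distrib sum_subtractf)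

lemma lin_scale: "lin q A (\<lambda>j. a * v j) r = a * lin q A v r"
  by (simp add: lin_def sum_distrib_left mult_ac)

lemma lin_sum: "lin q A (\<lambda>j. \<Sum>i\<in>I. f i j) r = (\<Sum>i\<in>I. lin q A (f i) r)"
  unfolding lin_def by (subst sum.swap) (simp add: sum_distrib_left)

lemma lin_cong: "(\<And>j. j < q \<Longrightarrow> v j = v' j) \<Longrightarrow> lin q A v r = lin q A v' r"
  by (simp add: lin_def)

lemma prp_add: "prp m D w k (\<lambda>r. u r + v r) i = (\<lambda>r. prp m D w k u i r + prp m D w k v i r)"
  by (induction i) (simp_all add: lin_add algebra_simps)

lemma prp_scale: "prp m D w k (\<lambda>r. a * v r) i = (\<lambda>r. a * prp m D w k v i r)"
  by (induction i) (simp_all add: lin_scale mult_ac)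

lemma prp_cong:
  assumes "\<And>r. r < m \<Longrightarrow> u r = v r" "r < m"
  shows "prp m D w k u i r = prp m D w k v i r"
  using assms(2)
proof (induction i arbitrary: r)
  case (Suc i)
  have "lin m (w (k + Suc i)) (prp m D w k u i) r = lin m (w (k + Suc i)) (prp m D w k v i) r"
    by (rule lin_cong) (rule Suc.IH)
  then show ?case by simp
qed (simp add: assms(1))

lemma pre_add: "pre m D w k (\<lambda>r. u r + v r) i = (\<lambda>r. pre m D w k u i r + pre m D w k v i r)"
  by (simp add: pre_def prp_add lin_add algebra_simps)

lemma pre_scale: "pre m D w k (\<lambda>r. a * v r) i = (\<lambda>r. a * pre m D w k v i r)"
  by (simp add: pre_def prp_scale lin_scale mult_ac)

text \<open>Duhamel's formula: a perturbed trajectory is the free one plus propagated sources.\<close>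

lemma prp_unroll:
  assumes "y 0 = (\<lambda>r. v r + f 0 r)"
    and "\<And>i. i < n \<Longrightarrow> y (Suc i) =
      (\<lambda>r. sqrt (2 / real m) * D (k + Suc i) r * lin m (w (k + Suc i)) (y i) r + f (Suc i) r)"
    and "i \<le> n"
  shows "y i = (\<lambda>r. prp m D w k v i r + (\<Sum>j\<le>i. prp m D w (k + j) (f j) (i - j) r))"
  using assms(3)
proof (induction i)
  case 0
  then show ?case by (simp add: assms(1))
next
  case (Suc i)
  have eq: "prp m D w (k + j) (f j) (Suc i - j) r = sqrt (2 / real m) * D (k + Suc i) r *
      lin m (w (k + Suc i)) (prp m D w (k + j) (f j) (i - j)) r" if "j \<le> i" for j r
    using that by (simp add: Suc_diff_le)
  show ?case
    using Suc assms(2)[of i]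
    by (simp add: lin_add lin_sum eq distrib_left sum_distrib_left add.assoc flip: mult.assoc)
qed

text \<open>The version before the gate: the ungated preactivation measures the error made by the
  flipped gates of the next layer.\<close>

lemma pre_unroll:
  assumes "y 0 = (\<lambda>r. v r + f 0 r)"
    and "\<And>i. i < n \<Longrightarrow> y (Suc i) =
      (\<lambda>r. sqrt (2 / real m) * D (k + Suc i) r * lin m (w (k + Suc i)) (y i) r + f (Suc i) r)"
    and "i \<le> n"
  shows "sqrt (2 / real m) * lin m (w (k + Suc i)) (y i) r
    = pre m D w k v i r + (\<Sum>j\<le>i. pre m D w (k + j) (f j) (i - j) r)"
proof -
  have "y i = (\<lambda>r. prp m D w k v i r + (\<Sum>j\<le>i. prp m D w (k + j) (f j) (i - j) r))"
    by (rule prp_unroll[OF assms])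
  then show ?thesis
    by (simp add: lin_add lin_sum pre_def distrib_left sum_distrib_left)
qed

section \<open>Perturbation of a good initialization\<close>

lemma L2_set_supp:
  assumes "finite A" "B \<subseteq> A" "\<And>r. r \<in> A \<Longrightarrow> r \<notin> B \<Longrightarrow> f r = 0"
  shows "L2_set f A = L2_set f B"
  unfolding L2_set_def using assms by (intro arg_cong[where f = sqrt] sum.mono_neutral_right) auto

lemma hid_Suc_gate:
  "hid d m w x (Suc l) r = sqrt (2 / real m) * (gate d m w x (Suc l) r * preact d m w x (Suc l) r)"
  by (simp add: gate_def preact_def max_def)

lemma gate_bounds: "\<bar>gate d m w x l r\<bar> \<le> 1" "\<bar>gate d m w x l r - gate d m w' x l r\<bar> \<le> 1"
  by (simp_all add: gate_def)

text \<open>Different gates put the two preactivations on opposite sides of 0, so the modulus of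
  each is at most their distance.\<close>

lemma gate_flip_preact_le:
  assumes "gate d m w x l r \<noteq> gate d m w' x l r"
  shows "\<bar>preact d m w x l r\<bar> \<le> \<bar>preact d m w x l r - preact d m w' x l r\<bar>"
  using assms by (auto simp: gate_def split: if_splits)

definition near :: "nat \<Rightarrow> nat \<Rightarrow> nat \<Rightarrow> real \<Rightarrow> (nat \<Rightarrow> nat \<Rightarrow> nat \<Rightarrow> real) \<Rightarrow> (nat \<Rightarrow> nat \<Rightarrow> nat \<Rightarrow> real) \<Rightarrow> bool" where
  "near d m L \<rho> w0 w \<longleftrightarrow>
     (\<Sum>l=1..L. (fro m (in_dim d m l) (\<lambda>r j. w l r j - w0 l r j))\<^sup>2) \<le> \<rho>\<^sup>2"

definition flips :: "nat \<Rightarrow> nat \<Rightarrow> (nat \<Rightarrow> nat \<Rightarrow> nat \<Rightarrow> real) \<Rightarrow> (nat \<Rightarrow> nat \<Rightarrow> nat \<Rightarrow> real) \<Rightarrow> (nat \<Rightarrow> real) \<Rightarrow> nat \<Rightarrow> nat set" where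
  "flips d m w0 w x l = {r. r < m \<and> gate d m w x l r \<noteq> gate d m w0 x l r}"

lemma flips_subset: "flips d m w0 w x l \<subseteq> {..<m}"
  by (auto simp: flips_def)

text \<open>\<open>s\<close> bounds the number of gates that a perturbation of size \<open>\<rho>\<close> can flip in one layer. The factor
  \<open>1 / (4 L)\<close> from sparse inputs to sparse outputs makes the recursion over the flipped gates of
  all layers a contraction, which is what avoids an exponential dependence on the depth.\<close>

locale good_init =
  fixes d m L s :: nat and C \<beta> \<rho> :: real
    and w0 :: "nat \<Rightarrow> nat \<Rightarrow> nat \<Rightarrow> real" and x :: "nat \<Rightarrow> real"
  assumes m_pos: "m > 0" and L2: "L \<ge> 2" and C1: "C \<ge> 1" and rho: "\<rho> \<ge> 0" and s_pos: "s > 0"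
    and x_norm: "L2_set x {..<d} = 1"
    and hid_norm: "\<And>l. 1 \<le> l \<Longrightarrow> l < L \<Longrightarrow> L2_set (hid d m w0 x l) {..<m} \<le> 103 / 100"
    and pre_all: "\<And>k i T v. 1 \<le> k \<Longrightarrow> k + Suc i \<le> L \<Longrightarrow> T \<subseteq> {..<m} \<Longrightarrow> card T \<le> s \<Longrightarrow>
      L2_set (pre m (gate d m w0 x) w0 k v i) T \<le> C * L2_set v {..<m}"
    and pre_sparse: "\<And>k i T Q v. 1 \<le> k \<Longrightarrow> k + Suc i \<le> L \<Longrightarrow> T \<subseteq> {..<m} \<Longrightarrow> card T \<le> s \<Longrightarrow>
      Q \<subseteq> {..<m} \<Longrightarrow> card Q \<le> s \<Longrightarrow> (\<And>r. r < m \<Longrightarrow> r \<notin> Q \<Longrightarrow> v r = 0) \<Longrightarrow>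
      L2_set (pre m (gate d m w0 x) w0 k v i) T \<le> L2_set v {..<m} / (4 * real L)"
    and prp_all: "\<And>k i v. 1 \<le> k \<Longrightarrow> k + i < L \<Longrightarrow>
      L2_set (prp m (gate d m w0 x) w0 k v i) {..<m} \<le> C * real L * L2_set v {..<m}"
    and prp_sparse: "\<And>k i Q v. 1 \<le> k \<Longrightarrow> k + i < L \<Longrightarrow>
      Q \<subseteq> {..<m} \<Longrightarrow> card Q \<le> s \<Longrightarrow> (\<And>r. r < m \<Longrightarrow> r \<notin> Q \<Longrightarrow> v r = 0) \<Longrightarrow>
      L2_set (prp m (gate d m w0 x) w0 k v i) {..<m} \<le> C * L2_set v {..<m}"
    and small_count: "\<And>l. 1 \<le> l \<Longrightarrow> l \<le> L \<Longrightarrow>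
      real (card {r. r < m \<and> \<bar>preact d m w0 x l r\<bar> \<le> \<beta>}) \<le> real s / 4"
    and beta: "0 < \<beta>" "\<beta> \<le> 1" "128 * C\<^sup>2 * real L * \<rho>\<^sup>2 \<le> \<beta>\<^sup>2 * real s"
    and rho_small: "1000 * C\<^sup>2 * real L * (sqrt (2 / real m) * sqrt (real L) * \<rho>) \<le> 1"
begin

abbreviation "cc \<equiv> sqrt (2 / real m)"
abbreviation "D0 \<equiv> gate d m w0 x"
abbreviation "nm v \<equiv> L2_set v {..<m}"

text \<open>By \<open>sum_dl\<close> this bounds \<open>cc\<close> times the sum of the layerwise
  Frobenius drifts, that is, the total size of the sources that weight drift injects into
  activations of norm one.\<close>

definition sr :: real where "sr = cc * sqrt (real L) * \<rho>"

lemma cc_pos: "cc > 0" using m_pos by simp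

lemma sr_nonneg: "sr \<ge> 0" using rho by (simp add: sr_def)

lemma sr_small: "1000 * C\<^sup>2 * real L * sr \<le> 1"
  using rho_small by (simp add: sr_def)

section \<open>Forward pass: stability of activations and gates\<close>

definition dl :: "(nat \<Rightarrow> nat \<Rightarrow> nat \<Rightarrow> real) \<Rightarrow> nat \<Rightarrow> real" where
  "dl w l = fro m (in_dim d m l) (\<lambda>r j. w l r j - w0 l r j)"

lemma dl_nonneg: "dl w l \<ge> 0" by (simp add: dl_def)

text \<open>Cauchy-Schwarz over at most \<open>L\<close> layers turns the joint Frobenius radius
  into a sum of layerwise drifts; this is where the \<open>sqrt L\<close> in \<open>sr\<close> comes
  from.\<close>

lemma sum_dl:
  assumes "near d m L \<rho> w0 w" "A \<subseteq> {1..L}"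
  shows "(\<Sum>l\<in>A. dl w l) \<le> sqrt (real L) * \<rho>"
proof -
  have "(\<Sum>l\<in>A. dl w l) \<le> (\<Sum>l\<in>{1..L}. \<bar>dl w l\<bar>)"
    using assms(2) dl_nonneg by (simp add: sum_mono2)
  also have "\<dots> \<le> sqrt (real L) * L2_set (dl w) {1..L}"
    using sum_le_sqrt_card_L2_set[of "dl w" "{1..L}"] by simp
  also have "L2_set (dl w) {1..L} \<le> \<rho>"
    using assms(1) rho by (simp add: L2_set_def near_def dl_def real_le_lsqrt)
  finally show ?thesis by (simp add: mult_left_mono)
qed

lemma dl_le:
  assumes "near d m L \<rho> w0 w" "l \<in> {1..L}"
  shows "dl w l \<le> \<rho>"
proof -
  have "dl w l \<le> L2_set (dl w) {1..L}"
    using assms(2) by (intro member_le_L2_set) auto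
  also have "\<dots> \<le> \<rho>"
    using assms(1) rho by (simp add: L2_set_def near_def dl_def real_le_lsqrt)
  finally show ?thesis .
qed

text \<open>The sources of a perturbed trajectory are of two kinds. Those from weight drift
  (\<open>p\<close>) are dense but sum to order \<open>sr\<close>; those from flipped gates
  (\<open>q\<close>) are sparse but have only a uniform bound per layer. On a sparse test set the
  sparse kind gains \<open>1 / (4 L)\<close>, so up to \<open>L\<close> of them together cost a
  quarter of the largest one.\<close>

lemma unroll_bounds:
  assumes k: "1 \<le> k" "k + n < L"
    and y0: "y 0 = (\<lambda>r. v r + (p 0 r + q 0 r))"
    and yS: "\<And>i. i < n \<Longrightarrow> y (Suc i) =
      (\<lambda>r. cc * D0 (k + Suc i) r * lin m (w0 (k + Suc i)) (y i) r + (p (Suc i) r + q (Suc i) r))"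
    and Q: "\<And>j. j \<le> i \<Longrightarrow> Q j \<subseteq> {..<m}" "\<And>j. j \<le> i \<Longrightarrow> card (Q j) \<le> s"
      "\<And>j r. j \<le> i \<Longrightarrow> r < m \<Longrightarrow> r \<notin> Q j \<Longrightarrow> q j r = 0"
    and i: "i \<le> n"
  shows "T \<subseteq> {..<m} \<Longrightarrow> card T \<le> s \<Longrightarrow> L2_set (\<lambda>r. cc * lin m (w0 (k + Suc i)) (y i) r) T
      \<le> L2_set (pre m D0 w0 k v i) T + C * (\<Sum>j\<le>i. nm (p j)) + (\<Sum>j\<le>i. nm (q j)) / (4 * real L)"
    and "nm (y i) \<le> nm (prp m D0 w0 k v i) + C * real L * (\<Sum>j\<le>i. nm (p j)) + C * (\<Sum>j\<le>i. nm (q j))"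
proof -
  define f where "f j = (\<lambda>r. p j r + q j r)" for j
  have y0': "y 0 = (\<lambda>r. v r + f 0 r)" and yS': "\<And>i. i < n \<Longrightarrow> y (Suc i) =
      (\<lambda>r. cc * D0 (k + Suc i) r * lin m (w0 (k + Suc i)) (y i) r + f (Suc i) r)"
    using y0 yS by (simp_all add: f_def)
  show "L2_set (\<lambda>r. cc * lin m (w0 (k + Suc i)) (y i) r) T
      \<le> L2_set (pre m D0 w0 k v i) T + C * (\<Sum>j\<le>i. nm (p j)) + (\<Sum>j\<le>i. nm (q j)) / (4 * real L)"
    if T: "T \<subseteq> {..<m}" "card T \<le> s"
  proof -
    have eq: "(\<lambda>r. cc * lin m (w0 (k + Suc i)) (y i) r)
        = (\<lambda>r. pre m D0 w0 k v i r + (\<Sum>j\<le>i. pre m D0 w0 (k + j) (f j) (i - j) r))"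
      by (rule ext, rule pre_unroll[OF y0' yS' i])
    have "L2_set (pre m D0 w0 (k + j) (f j) (i - j)) T \<le> C * nm (p j) + nm (q j) / (4 * real L)"
      if j: "j \<le> i" for j
    proof -
      have "k + j + Suc (i - j) \<le> L" using j i k by simp
      then have "L2_set (pre m D0 w0 (k + j) (p j) (i - j)) T \<le> C * nm (p j)"
        "L2_set (pre m D0 w0 (k + j) (q j) (i - j)) T \<le> nm (q j) / (4 * real L)"
        using pre_all[of "k + j" "i - j" T "p j"] pre_sparse[of "k + j" "i - j" T "Q j" "q j"] T Q j k
        by auto
      moreover have "L2_set (pre m D0 w0 (k + j) (f j) (i - j)) T
        \<le> L2_set (pre m D0 w0 (k + j) (p j) (i - j)) T + L2_set (pre m D0 w0 (k + j) (q j) (i - j)) T"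
        unfolding f_def pre_add by (rule L2_set_triangle_ineq)
      ultimately show ?thesis by linarith
    qed
    then have "(\<Sum>j\<le>i. L2_set (pre m D0 w0 (k + j) (f j) (i - j)) T)
        \<le> (\<Sum>j\<le>i. C * nm (p j) + nm (q j) / (4 * real L))"
      by (intro sum_mono) auto
    moreover have "L2_set (\<lambda>r. cc * lin m (w0 (k + Suc i)) (y i) r) T \<le> L2_set (pre m D0 w0 k v i) T
        + (\<Sum>j\<le>i. L2_set (pre m D0 w0 (k + j) (f j) (i - j)) T)"
      unfolding eq by (rule order_trans[OF L2_set_triangle_ineq]) (simp add: L2_set_sum_le)
    ultimately show ?thesis
      by (simp add: sum.distrib sum_divide_distrib sum_distrib_left)
  qed
  have eq: "y i = (\<lambda>r. prp m D0 w0 k v i r + (\<Sum>j\<le>i. prp m D0 w0 (k + j) (f j) (i - j) r))"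
    by (rule prp_unroll[OF y0' yS' i])
  have "nm (prp m D0 w0 (k + j) (f j) (i - j)) \<le> C * real L * nm (p j) + C * nm (q j)"
    if j: "j \<le> i" for j
  proof -
    have "k + j + (i - j) < L" using j i k by simp
    then have "nm (prp m D0 w0 (k + j) (p j) (i - j)) \<le> C * real L * nm (p j)"
      "nm (prp m D0 w0 (k + j) (q j) (i - j)) \<le> C * nm (q j)"
      using prp_all[of "k + j" "i - j" "p j"] prp_sparse[of "k + j" "i - j" "Q j" "q j"] Q j k
      by auto
    moreover have "nm (prp m D0 w0 (k + j) (f j) (i - j))
      \<le> nm (prp m D0 w0 (k + j) (p j) (i - j)) + nm (prp m D0 w0 (k + j) (q j) (i - j))"
      unfolding f_def prp_add by (rule L2_set_triangle_ineq)
    ultimately show ?thesis by linarith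
  qed
  then have "(\<Sum>j\<le>i. nm (prp m D0 w0 (k + j) (f j) (i - j)))
      \<le> (\<Sum>j\<le>i. C * real L * nm (p j) + C * nm (q j))"
    by (intro sum_mono) auto
  moreover have "nm (y i) \<le> nm (prp m D0 w0 k v i)
      + (\<Sum>j\<le>i. nm (prp m D0 w0 (k + j) (f j) (i - j)))"
    unfolding eq by (rule order_trans[OF L2_set_triangle_ineq]) (simp add: L2_set_sum_le)
  ultimately show "nm (y i) \<le> nm (prp m D0 w0 k v i) + C * real L * (\<Sum>j\<le>i. nm (p j)) + C * (\<Sum>j\<le>i. nm (q j))"
    by (simp add: sum.distrib sum_distrib_left)
qed

text \<open>Chosen to close the recursion in \<open>forward\<close>: the drift of the layer itself
  gives \<open>2 sr\<close>, the drift of earlier layers \<open>2 C sr\<close>, and their flips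
  \<open>eps / 4\<close>; for \<open>C >= 1\<close> the total is at most
  \<open>8 C sr\<close>.\<close>

definition eps :: real where "eps = 8 * C * sr"

text \<open>The two contributions to the full norm: \<open>2 C L sr\<close> from drift and
  \<open>C L eps = 8 C^2 L sr\<close> from flips.\<close>

definition eta :: real where "eta = 10 * C\<^sup>2 * real L * sr"

lemma eta_small: "eta \<le> 1 / 100" using sr_small by (simp add: eta_def)

lemma eps_nonneg: "eps \<ge> 0" using sr_nonneg C1 by (simp add: eps_def)

lemma eta_nonneg: "eta \<ge> 0" unfolding eta_def using sr_nonneg by (intro mult_nonneg_nonneg) auto

text \<open>A flipped gate has a preactivation no larger than its change, and only few initial preactivations
  are below \<open>\<beta>\<close>. Testing a set of exactly \<open>s\<close> flipped gates therefore shows that there are at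
  most \<open>s\<close> of them.\<close>

lemma forward:
  assumes near: "near d m L \<rho> w0 w" and l: "1 \<le> l" "l \<le> L"
  shows "(\<forall>T. T \<subseteq> {..<m} \<longrightarrow> card T \<le> s \<longrightarrow>
        cc * L2_set (\<lambda>r. preact d m w x l r - preact d m w0 x l r) T \<le> eps)
    \<and> card (flips d m w0 w x l) \<le> s
    \<and> (l < L \<longrightarrow> nm (\<lambda>r. hid d m w x l r - hid d m w0 x l r) \<le> eta)"
  using l
proof (induction l rule: less_induct)
  case (less l)
  \<comment> \<open>Index shift: \<open>y i\<close> is the change in layer \<open>i + 1\<close>,
    because layer 0 is the input and does not change.\<close>
  define y where "y i = (\<lambda>r. hid d m w x (Suc i) r - hid d m w0 x (Suc i) r)" for i
  define p where "p j = (\<lambda>r. cc * D0 (Suc j) r *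
    lin (in_dim d m (Suc j)) (\<lambda>r c. w (Suc j) r c - w0 (Suc j) r c) (hid d m w x j) r)" for j
  \<comment> \<open>Pairing the gate difference with the perturbed preactivation leaves the initial
    gate on the remaining term. Then \<open>q\<close> vanishes off the flips, and on a flip it is no
    larger than the change of the preactivation.\<close>
  define q where "q j = (\<lambda>r. cc * (gate d m w x (Suc j) r - D0 (Suc j) r) * preact d m w x (Suc j) r)" for j
  let ?g = "\<lambda>l r. preact d m w x l r - preact d m w0 x l r"
  have g_eq: "?g (Suc j) r = lin (in_dim d m (Suc j)) (\<lambda>r c. w (Suc j) r c - w0 (Suc j) r c) (hid d m w x j) r
     + lin (in_dim d m (Suc j)) (w0 (Suc j)) (\<lambda>r. hid d m w x j r - hid d m w0 x j r) r" for j r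
    by (simp add: preact_def lin_mat_diff lin_diff)
  have y_eq: "y j r = cc * D0 (Suc j) r * ?g (Suc j) r + q j r" for j r
    unfolding y_def q_def hid_Suc_gate by (simp add: algebra_simps)
  have y0: "y 0 = (\<lambda>r. 0 + (p 0 r + q 0 r))"
    by (rule ext, subst y_eq, subst g_eq) (simp add: p_def lin_def)
  have yS: "y (Suc i) = (\<lambda>r. cc * D0 (1 + Suc i) r * lin m (w0 (1 + Suc i)) (y i) r
      + (p (Suc i) r + q (Suc i) r))" for i
    by (rule ext, subst y_eq, subst g_eq) (simp add: p_def y_def in_dim_def distrib_left)
  \<comment> \<open>The drift acts on the perturbed activations; the induction hypothesis bounds
    them by \<open>1 / 100 + 103 / 100\<close>.\<close>
  have hw: "L2_set (hid d m w x j) {..<in_dim d m (Suc j)} \<le> 2" if "Suc j \<le> l" for j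
  proof (cases j)
    case 0
    then show ?thesis using x_norm by (simp add: in_dim_def)
  next
    case (Suc i)
    have "nm (\<lambda>r. hid d m w x j r - hid d m w0 x j r) \<le> 1 / 100"
      using less.IH[of j] that less.prems eta_small Suc by auto
    moreover have "nm (hid d m w0 x j) \<le> 103 / 100"
      using hid_norm[of j] that less.prems Suc by auto
    moreover have "nm (hid d m w x j) \<le> nm (\<lambda>r. hid d m w x j r - hid d m w0 x j r) + nm (hid d m w0 x j)"
      using L2_set_triangle_ineq[of "\<lambda>r. hid d m w x j r - hid d m w0 x j r" "hid d m w0 x j" "{..<m}"] by simp
    ultimately show ?thesis using Suc by (simp add: in_dim_def)
  qed
  have lind: "L2_set (lin (in_dim d m (Suc j)) (\<lambda>r c. w (Suc j) r c - w0 (Suc j) r c) (hid d m w x j)) T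
      \<le> 2 * dl w (Suc j)" if "Suc j \<le> l" "T \<subseteq> {..<m}" for j T
  proof -
    have "L2_set (lin (in_dim d m (Suc j)) (\<lambda>r c. w (Suc j) r c - w0 (Suc j) r c) (hid d m w x j)) T
      \<le> dl w (Suc j) * L2_set (hid d m w x j) {..<in_dim d m (Suc j)}"
      unfolding dl_def by (rule L2_set_lin_le[OF that(2)])
    also have "\<dots> \<le> dl w (Suc j) * 2"
      using hw[OF that(1)] dl_nonneg by (intro mult_left_mono) auto
    finally show ?thesis by simp
  qed
  have pn: "nm (p j) \<le> cc * (2 * dl w (Suc j))" if "Suc j \<le> l" for j
  proof -
    have "nm (p j) \<le> nm (\<lambda>r. cc * lin (in_dim d m (Suc j)) (\<lambda>r c. w (Suc j) r c - w0 (Suc j) r c) (hid d m w x j) r)"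
      unfolding p_def by (intro L2_set_abs_mono) (simp add: gate_def)
    also have "\<dots> \<le> cc * (2 * dl w (Suc j))"
      unfolding L2_set_scale using lind[OF that] cc_pos by (simp add: mult_left_mono)
    finally show ?thesis .
  qed
  have psum: "(\<Sum>j\<le>i. nm (p j)) \<le> 2 * sr" if "Suc i \<le> l" for i
  proof -
    have "(\<Sum>j\<le>i. nm (p j)) \<le> (\<Sum>j\<le>i. cc * (2 * dl w (Suc j)))"
      using pn that by (intro sum_mono) auto
    also have "\<dots> = 2 * cc * (\<Sum>l\<in>Suc ` {..i}. dl w l)"
      by (simp add: sum_distrib_left sum.reindex mult_ac)
    also have "\<dots> \<le> 2 * cc * (sqrt (real L) * \<rho>)"
      using that less.prems cc_pos by (intro mult_left_mono sum_dl near) auto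
    finally show ?thesis by (simp add: sr_def mult_ac)
  qed
  have qz: "q j r = 0" if "r < m" "r \<notin> flips d m w0 w x (Suc j)" for j r
    using that by (simp add: q_def flips_def)
  have q_le: "nm (q j) \<le> cc * L2_set (?g (Suc j)) (flips d m w0 w x (Suc j))" for j
  proof -
    have "nm (q j) = L2_set (q j) (flips d m w0 w x (Suc j))"
      using qz flips_subset by (intro L2_set_supp) auto
    also have "\<dots> \<le> L2_set (\<lambda>r. cc * ?g (Suc j) r) (flips d m w0 w x (Suc j))"
    proof (intro L2_set_abs_mono)
      fix r assume "r \<in> flips d m w0 w x (Suc j)"
      then have "\<bar>preact d m w x (Suc j) r\<bar> \<le> \<bar>?g (Suc j) r\<bar>"
        by (intro gate_flip_preact_le) (simp add: flips_def)
      moreover have "\<bar>gate d m w x (Suc j) r - D0 (Suc j) r\<bar> \<le> 1"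
        by (rule gate_bounds)
      ultimately have "\<bar>gate d m w x (Suc j) r - D0 (Suc j) r\<bar> * \<bar>preact d m w x (Suc j) r\<bar> \<le> 1 * \<bar>?g (Suc j) r\<bar>"
        by (intro mult_mono) auto
      then show "\<bar>q j r\<bar> \<le> \<bar>cc * ?g (Suc j) r\<bar>"
        using cc_pos by (simp add: q_def abs_mult mult.assoc mult_left_mono)
    qed
    finally show ?thesis using cc_pos by (simp add: L2_set_scale)
  qed
  have qn: "nm (q j) \<le> eps" if "Suc j < l" for j
  proof -
    have "cc * L2_set (?g (Suc j)) (flips d m w0 w x (Suc j)) \<le> eps"
      using less.IH[of "Suc j"] that less.prems flips_subset by auto
    then show ?thesis using q_le[of j] by linarith
  qed
  have Qprops: "\<And>j. Suc j < l \<Longrightarrow> card (flips d m w0 w x (Suc j)) \<le> s"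
    using less.IH less.prems by auto
  have prp0: "prp m D0 w0 k (\<lambda>_. 0) i = (\<lambda>_. 0)" for k i
    using prp_scale[of m D0 w0 k 0 "\<lambda>_. 0" i] by simp
  have pre0: "pre m D0 w0 k (\<lambda>_. 0) i = (\<lambda>_. 0)" for k i
    using pre_scale[of m D0 w0 k 0 "\<lambda>_. 0" i] by simp
  \<comment> \<open>The sparse set \<open>T\<close> stays arbitrary because two choices follow:
    exactly \<open>s\<close> flipped gates in \<open>F\<close>, then all flipped gates in
    \<open>Y\<close>.\<close>
  have G: "cc * L2_set (?g l) T \<le> eps" if T: "T \<subseteq> {..<m}" "card T \<le> s" for T
  proof (cases "l = 1")
    case True
    have "?g l r = lin (in_dim d m (Suc 0)) (\<lambda>r c. w (Suc 0) r c - w0 (Suc 0) r c) (hid d m w x 0) r" for r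
      using g_eq[of 0 r] True by (simp add: lin_def)
    then have "L2_set (?g l) T \<le> 2 * dl w l"
      using lind[of 0 T] T True by simp
    also have "dl w l \<le> sqrt (real L) * \<rho>"
      using sum_dl[OF near, of "{l}"] less.prems by simp
    finally have "cc * L2_set (?g l) T \<le> cc * (2 * (sqrt (real L) * \<rho>))"
      using cc_pos by (intro mult_left_mono) auto
    also have "\<dots> = 2 * sr" by (simp add: sr_def)
    also have "\<dots> \<le> eps" unfolding eps_def using C1 sr_nonneg by (intro mult_right_mono) auto
    finally show ?thesis .
  next
    case False
    \<comment> \<open>With this index \<open>y i\<close> is the change in layer
      \<open>l - 1\<close>, the input of layer \<open>l\<close>.\<close>
    define i where "i = l - 2"
    have li: "l = Suc (Suc i)" using False less.prems by (simp add: i_def)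
    have "L2_set (\<lambda>r. cc * lin m (w0 (1 + Suc i)) (y i) r) T
      \<le> L2_set (pre m D0 w0 1 (\<lambda>_. 0) i) T + C * (\<Sum>j\<le>i. nm (p j)) + (\<Sum>j\<le>i. nm (q j)) / (4 * real L)"
      using less.prems li T qz flips_subset Qprops
      by (intro unroll_bounds(1)[where n = i and Q = "\<lambda>j. flips d m w0 w x (Suc j)", OF _ _ y0 yS]) auto
    also have "L2_set (pre m D0 w0 1 (\<lambda>_. 0) i) T = 0" by (simp add: pre0 L2_set_0')
    also have "C * (\<Sum>j\<le>i. nm (p j)) \<le> C * (2 * sr)"
      using psum[of i] li C1 by (intro mult_left_mono) auto
    also have "(\<Sum>j\<le>i. nm (q j)) / (4 * real L) \<le> eps / 4"
    proof -
      have "(\<Sum>j\<le>i. nm (q j)) \<le> (\<Sum>j\<le>i. eps)" using qn li by (intro sum_mono) auto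
      also have "\<dots> = real (Suc i) * eps" by simp
      also have "\<dots> \<le> real L * eps" using li less.prems eps_nonneg by (intro mult_right_mono) auto
      finally show ?thesis using L2 by (simp add: field_simps)
    qed
    finally have A: "L2_set (\<lambda>r. cc * lin m (w0 l) (y i) r) T \<le> C * (2 * sr) + eps / 4"
      using li by simp
    \<comment> \<open>The drift of layer \<open>l\<close> itself is not among the sources of
      \<open>y i\<close> and enters separately.\<close>
    have B: "L2_set (\<lambda>r. cc * lin (in_dim d m l) (\<lambda>r c. w l r c - w0 l r c) (hid d m w x (Suc i)) r) T \<le> 2 * sr"
    proof -
      have "cc * L2_set (lin (in_dim d m l) (\<lambda>r c. w l r c - w0 l r c) (hid d m w x (Suc i))) T \<le> cc * (2 * dl w l)"
        using lind[of "Suc i" T] T cc_pos unfolding li by (intro mult_left_mono) auto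
      also have "\<dots> \<le> cc * (2 * (sqrt (real L) * \<rho>))"
        using sum_dl[OF near, of "{l}"] less.prems cc_pos by (intro mult_left_mono) auto
      finally show ?thesis using cc_pos by (simp add: L2_set_scale sr_def)
    qed
    have "cc * L2_set (?g l) T = L2_set (\<lambda>r. cc * ?g l r) T"
      using cc_pos by (simp add: L2_set_scale)
    also have "(\<lambda>r. cc * ?g l r) = (\<lambda>r. cc * lin (in_dim d m l) (\<lambda>r c. w l r c - w0 l r c) (hid d m w x (Suc i)) r
        + cc * lin m (w0 l) (y i) r)"
      unfolding li g_eq by (simp add: y_def in_dim_def distrib_left)
    also have "L2_set \<dots> T \<le> 2 * sr + (C * (2 * sr) + eps / 4)"
      by (rule order_trans[OF L2_set_triangle_ineq add_mono[OF B A]])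
    also have "\<dots> \<le> eps"
      using C1 sr_nonneg mult_right_mono[OF C1 sr_nonneg] by (simp add: eps_def algebra_simps)
    finally show ?thesis .
  qed
  have F: "card (flips d m w0 w x l) \<le> s"
  proof (rule ccontr)
    assume "\<not> ?thesis"
    then obtain T where T: "T \<subseteq> flips d m w0 w x l" "card T = s"
      by (meson nat_le_linear obtain_subset_with_card_n)
    have Tm: "T \<subseteq> {..<m}" using T flips_subset by blast
    then have fT: "finite T" using finite_subset by blast
    let ?A = "{r. r < m \<and> \<bar>preact d m w0 x l r\<bar> \<le> \<beta>}" and ?B = "{r \<in> T. \<beta> < \<bar>?g l r\<bar>}"
    have sub: "T \<subseteq> ?A \<union> ?B"
    proof
      fix r assume r: "r \<in> T"
      then have "\<bar>preact d m w0 x l r\<bar> \<le> \<bar>preact d m w0 x l r - preact d m w x l r\<bar>"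
        using T by (intro gate_flip_preact_le) (auto simp: flips_def)
      then show "r \<in> ?A \<union> ?B" using r Tm by (auto simp: abs_minus_commute)
    qed
    have "real s \<le> real (card ?A) + real (card ?B)"
      using card_mono[OF _ sub] card_Un_le[of ?A ?B] fT T(2) by simp
    moreover have "real (card ?A) \<le> real s / 4" by (rule small_count) (use less.prems in auto)
    \<comment> \<open>Each element of \<open>?B\<close> costs \<open>\<beta>^2\<close> out of a
      budget of \<open>(eps / cc)^2 = 64 C^2 L \<rho>^2\<close>; the 128 in the assumption on
      \<open>\<beta>\<close> makes that half of \<open>s\<close>.\<close>
    moreover have "real (card ?B) * \<beta>\<^sup>2 \<le> real s / 2 * \<beta>\<^sup>2"
    proof -
      have "real (card ?B) * \<beta>\<^sup>2 = (\<Sum>r\<in>?B. \<beta>\<^sup>2)" by simp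
      also have "\<dots> \<le> (\<Sum>r\<in>?B. (?g l r)\<^sup>2)"
        using beta by (intro sum_mono) (auto simp flip: abs_le_square_iff)
      also have "\<dots> \<le> (\<Sum>r\<in>T. (?g l r)\<^sup>2)" using fT by (intro sum_mono2) auto
      also have "\<dots> = (L2_set (?g l) T)\<^sup>2" by (simp add: L2_set_sq)
      also have "\<dots> \<le> (eps / cc)\<^sup>2"
        using G[OF Tm] T(2) cc_pos by (intro power_mono) (simp_all add: field_simps)
      also have "\<dots> = 64 * C\<^sup>2 * real L * \<rho>\<^sup>2"
        using m_pos by (simp add: eps_def sr_def power_mult_distrib power_divide)
      also have "\<dots> \<le> real s / 2 * \<beta>\<^sup>2" using beta by (simp add: field_simps)
      finally show ?thesis .
    qed
    then have "real (card ?B) \<le> real s / 2" using beta by simp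
    ultimately show False using s_pos by simp
  qed
  have Y: "nm (\<lambda>r. hid d m w x l r - hid d m w0 x l r) \<le> eta" if "l < L"
  proof -
    define i where "i = l - 1"
    have li: "l = Suc i" using less.prems by (simp add: i_def)
    \<comment> \<open>Layer \<open>l\<close> itself can be included now that \<open>F\<close> has
      bounded its flips by \<open>s\<close>.\<close>
    have qn': "nm (q j) \<le> eps" if "j \<le> i" for j
    proof (cases "j = i")
      case True
      then show ?thesis using q_le[of i] G[of "flips d m w0 w x l"] F flips_subset li by force
    qed (use qn[of j] that li in auto)
    have "nm (y i) \<le> nm (prp m D0 w0 1 (\<lambda>_. 0) i) + C * real L * (\<Sum>j\<le>i. nm (p j)) + C * (\<Sum>j\<le>i. nm (q j))"
    proof (intro unroll_bounds(2)[where n = i and Q = "\<lambda>j. flips d m w0 w x (Suc j)", OF _ _ y0 yS])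
      show "card (flips d m w0 w x (Suc j)) \<le> s" if "j \<le> i" for j
        using Qprops[of j] F that li by (cases "j = i") auto
    qed (use \<open>l < L\<close> li qz flips_subset in auto)
    also have "nm (prp m D0 w0 1 (\<lambda>_. 0) i) = 0" by (simp add: prp0 L2_set_0')
    also have "C * real L * (\<Sum>j\<le>i. nm (p j)) \<le> C * real L * (2 * sr)"
      using psum[of i] li C1 by (intro mult_left_mono) auto
    also have "(\<Sum>j\<le>i. nm (q j)) \<le> real L * eps"
    proof -
      have "(\<Sum>j\<le>i. nm (q j)) \<le> (\<Sum>j\<le>i. eps)" using qn' li by (intro sum_mono) auto
      also have "\<dots> = real (Suc i) * eps" by simp
      also have "\<dots> \<le> real L * eps" using li less.prems eps_nonneg by (intro mult_right_mono) auto
      finally show ?thesis .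
    qed
    finally have "nm (y i) \<le> C * real L * (2 * sr) + C * (real L * eps)"
      using C1 by (simp add: mult_left_mono)
    also have "\<dots> \<le> eta"
    proof -
      have "C * (real L * sr) \<le> C * (C * (real L * sr))"
        using C1 sr_nonneg mult_right_mono[OF C1, of "real L * sr"] by (intro mult_left_mono) auto
      then show ?thesis by (simp add: eta_def eps_def power2_eq_square algebra_simps)
    qed
    finally show ?thesis using li by (simp add: y_def)
  qed
  show ?case using G F Y by blast
qed

end

section \<open>Linearized propagation under perturbed weights and gates\<close>

context good_init
begin

lemma flips_card: "near d m L \<rho> w0 w \<Longrightarrow> 1 \<le> l \<Longrightarrow> l \<le> L \<Longrightarrow> card (flips d m w0 w x l) \<le> s"
  using forward by blast

lemma forward_preact:
  "near d m L \<rho> w0 w \<Longrightarrow> 1 \<le> l \<Longrightarrow> l \<le> L \<Longrightarrow> T \<subseteq> {..<m} \<Longrightarrow> card T \<le> s \<Longrightarrow>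
    cc * L2_set (\<lambda>r. preact d m w x l r - preact d m w0 x l r) T \<le> eps"
  using forward by blast

lemma forward_hid:
  "near d m L \<rho> w0 w \<Longrightarrow> 1 \<le> l \<Longrightarrow> l < L \<Longrightarrow> nm (\<lambda>r. hid d m w x l r - hid d m w0 x l r) \<le> eta"
  using forward by simp

text \<open>The gates belong to the input \<open>x\<close>, not to the propagated vector, so a
  flipped gate no longer implies a small preactivation. Its error is controlled instead by being
  confined to \<open>s\<close> coordinates, through the bound \<open>\<gamma>\<close> on such sets.
  Dense and sparse injections differ only in the values of \<open>\<alpha>\<close> and
  \<open>\<gamma>\<close>.\<close>

lemma prp_pert:
  assumes near: "near d m L \<rho> w0 w" and k: "1 \<le> k" "k + n < L"
    and \<alpha>: "\<And>i. i \<le> n \<Longrightarrow> nm (prp m D0 w0 k v i) \<le> \<alpha>"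
    and \<gamma>: "\<And>i T. i < n \<Longrightarrow> T \<subseteq> {..<m} \<Longrightarrow> card T \<le> s \<Longrightarrow> L2_set (pre m D0 w0 k v i) T \<le> \<gamma>"
    and \<gamma>0: "0 \<le> \<gamma>"
  shows "nm (prp m (gate d m w x) w k v n) \<le> 2 * \<alpha> + 3 * C * real L * \<gamma>"
proof -
  define y where "y i = prp m (gate d m w x) w k v i" for i
  \<comment> \<open>No source at index 0, since both trajectories start from the same
    \<open>v\<close>.\<close>
  define p where "p j = (case j of 0 \<Rightarrow> (\<lambda>_. 0) | Suc i \<Rightarrow> (\<lambda>r. cc * gate d m w x (k + Suc i) r *
    lin m (\<lambda>r c. w (k + Suc i) r c - w0 (k + Suc i) r c) (y i) r))" for j
  define q where "q j = (case j of 0 \<Rightarrow> (\<lambda>_. 0) | Suc i \<Rightarrow> (\<lambda>r. (gate d m w x (k + Suc i) r - D0 (k + Suc i) r) *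
    (cc * lin m (w0 (k + Suc i)) (y i) r)))" for j
  define Y where "Y = 2 * \<alpha> + 3 * C * real L * \<gamma>"
  \<comment> \<open>The solution of \<open>Q = \<gamma> + C sr Y + Q / 4\<close>, the balance for
    the errors of flipped gates; the smallness of \<open>C^2 L sr\<close> then closes the bound by
    \<open>Y\<close>.\<close>
  define Q where "Q = 4 / 3 * (\<gamma> + C * (sr * Y))"
  have \<alpha>0: "0 \<le> \<alpha>" using \<alpha>[of 0] by (rule order_trans[rotated]) simp_all
  have Y0: "0 \<le> Y" using \<alpha>0 \<gamma>0 C1 by (simp add: Y_def)
  have Q0: "0 \<le> Q" using \<gamma>0 Y0 sr_nonneg C1 by (simp add: Q_def)
  have y0: "y 0 = (\<lambda>r. v r + (p 0 r + q 0 r))" by (simp add: y_def p_def q_def)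
  have yS: "y (Suc i) = (\<lambda>r. cc * D0 (k + Suc i) r * lin m (w0 (k + Suc i)) (y i) r
      + (p (Suc i) r + q (Suc i) r))" for i
    by (rule ext) (simp add: y_def p_def q_def lin_mat_diff algebra_simps)
  define F where "F j = flips d m w0 w x (k + j)" for j
  have qz: "q j r = 0" if "r < m" "r \<notin> F j" for j r
    using that by (cases j) (auto simp: q_def F_def flips_def)
  have Fc: "F j \<subseteq> {..<m}" "j \<le> n \<Longrightarrow> card (F j) \<le> s" for j
    using flips_subset flips_card[OF near, of "k + j"] k by (auto simp: F_def)
  have dim: "in_dim d m (k + Suc i) = m" for i using k by (simp add: in_dim_def)
  have bounds: "nm (y i) \<le> Y \<and> nm (q i) \<le> Q" if "i \<le> n" for i
    using that
  proof (induction i rule: less_induct)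
    case (less i)
    have pj: "nm (p (Suc j)) \<le> cc * dl w (k + Suc j) * Y" if "j < i" for j
    proof -
      have "nm (p (Suc j)) \<le> nm (\<lambda>r. cc * lin m (\<lambda>r c. w (k + Suc j) r c - w0 (k + Suc j) r c) (y j) r)"
        unfolding p_def by (intro L2_set_abs_mono) (simp add: gate_def)
      also have "\<dots> = cc * nm (lin m (\<lambda>r c. w (k + Suc j) r c - w0 (k + Suc j) r c) (y j))"
        using cc_pos by (simp add: L2_set_scale)
      also have "\<dots> \<le> cc * (dl w (k + Suc j) * nm (y j))"
        using cc_pos unfolding dl_def dim by (intro mult_left_mono L2_set_lin_le) auto
      also have "\<dots> \<le> cc * (dl w (k + Suc j) * Y)"
        using less.IH[OF that] less.prems that cc_pos dl_nonneg by (intro mult_left_mono) auto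
      finally show ?thesis by (simp add: mult.assoc)
    qed
    have psum: "(\<Sum>j\<le>i. nm (p j)) \<le> sr * Y"
    proof -
      have "(\<Sum>j\<le>i. nm (p j)) = (\<Sum>j<i. nm (p (Suc j)))"
        by (subst lessThan_Suc_atMost[symmetric], subst sum.lessThan_Suc_shift) (simp add: p_def L2_set_0')
      also have "\<dots> \<le> (\<Sum>j<i. cc * dl w (k + Suc j) * Y)"
        using pj by (intro sum_mono) auto
      also have "\<dots> = cc * Y * (\<Sum>l\<in>(\<lambda>j. k + Suc j) ` {..<i}. dl w l)"
        by (subst sum.reindex) (auto simp: inj_on_def sum_distrib_left mult_ac)
      also have "\<dots> \<le> cc * Y * (sqrt (real L) * \<rho>)"
        using less.prems k cc_pos Y0 by (intro mult_left_mono sum_dl near) auto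
      finally show ?thesis by (simp add: sr_def mult_ac)
    qed
    have q_i: "nm (q i) \<le> Q"
    proof (cases i)
      case 0
      then show ?thesis using Q0 by (simp add: q_def L2_set_0')
    next
      case (Suc i')
      have "nm (q i) = L2_set (q i) (F i)"
        using qz Fc by (intro L2_set_supp) auto
      also have "\<dots> \<le> L2_set (\<lambda>r. cc * lin m (w0 (k + Suc i')) (y i') r) (F i)"
      proof (intro L2_set_abs_mono)
        fix r
        have "\<bar>gate d m w x (k + Suc i') r - D0 (k + Suc i') r\<bar> * \<bar>cc * lin m (w0 (k + Suc i')) (y i') r\<bar>
          \<le> 1 * \<bar>cc * lin m (w0 (k + Suc i')) (y i') r\<bar>"
          using gate_bounds by (intro mult_right_mono) auto
        then show "\<bar>q i r\<bar> \<le> \<bar>cc * lin m (w0 (k + Suc i')) (y i') r\<bar>"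
          using Suc by (simp add: q_def abs_mult)
      qed
      also have "\<dots> \<le> L2_set (pre m D0 w0 k v i') (F i) + C * (\<Sum>j\<le>i'. nm (p j))
          + (\<Sum>j\<le>i'. nm (q j)) / (4 * real L)"
        using k less.prems Suc Fc qz
        by (intro unroll_bounds(1)[where n = n and Q = F, OF _ _ y0 yS]) auto
      also have "L2_set (pre m D0 w0 k v i') (F i) \<le> \<gamma>"
        using Suc less.prems Fc by (intro \<gamma>) auto
      also have "C * (\<Sum>j\<le>i'. nm (p j)) \<le> C * (sr * Y)"
      proof -
        have "(\<Sum>j\<le>i'. nm (p j)) \<le> (\<Sum>j\<le>i. nm (p j))" using Suc by simp
        then show ?thesis using psum C1 by (intro mult_left_mono) auto
      qed
      also have "(\<Sum>j\<le>i'. nm (q j)) / (4 * real L) \<le> Q / 4"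
      proof -
        have "(\<Sum>j\<le>i'. nm (q j)) \<le> (\<Sum>j\<le>i'. Q)"
          using less.IH less.prems Suc by (intro sum_mono) auto
        also have "\<dots> = real (Suc i') * Q" by simp
        also have "\<dots> \<le> real L * Q" using less.prems k Suc Q0 by (intro mult_right_mono) auto
        finally show ?thesis using L2 by (simp add: field_simps)
      qed
      finally have "nm (q i) \<le> (\<gamma> + C * (sr * Y)) + Q / 4" by simp
      also have "\<gamma> + C * (sr * Y) = 3 / 4 * Q" by (simp add: Q_def)
      finally show ?thesis by simp
    qed
    have "nm (y i) \<le> nm (prp m D0 w0 k v i) + C * real L * (\<Sum>j\<le>i. nm (p j)) + C * (\<Sum>j\<le>i. nm (q j))"
      using k less.prems Fc qz by (intro unroll_bounds(2)[where n = n and Q = F, OF _ _ y0 yS]) auto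
    also have "nm (prp m D0 w0 k v i) \<le> \<alpha>" using less.prems by (intro \<alpha>)
    also have "C * real L * (\<Sum>j\<le>i. nm (p j)) \<le> C * real L * (sr * Y)"
      using psum C1 by (intro mult_left_mono) auto
    also have "C * (\<Sum>j\<le>i. nm (q j)) \<le> C * (real L * Q)"
    proof -
      have "nm (q j) \<le> Q" if "j \<le> i" for j
        using less.IH[of j] less.prems q_i that by (cases "j = i") auto
      then have "(\<Sum>j\<le>i. nm (q j)) \<le> (\<Sum>j\<le>i. Q)" by (intro sum_mono) auto
      also have "\<dots> = real (Suc i) * Q" by simp
      also have "\<dots> \<le> real L * Q" using less.prems k Q0 by (intro mult_right_mono) auto
      finally show ?thesis using C1 by (simp add: mult_left_mono)
    qed
    finally have "nm (y i) \<le> \<alpha> + C * real L * (sr * Y) + C * (real L * Q)" by simp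
    also have "\<dots> \<le> Y"
    proof -
      have "C * (real L * sr * Y) \<le> C * (C * (real L * sr * Y))"
        using C1 sr_nonneg Y0 mult_right_mono[OF C1, of "real L * sr * Y"] by (intro mult_left_mono) auto
      moreover have "(C\<^sup>2 * real L * sr) * Y \<le> (1 / 1000) * Y"
        using sr_small Y0 by (intro mult_right_mono) auto
      moreover have "0 \<le> C * real L * \<gamma>" using \<gamma>0 C1 by simp
      ultimately show ?thesis
        using \<alpha>0 by (simp add: Y_def Q_def power2_eq_square algebra_simps)
    qed
    finally show ?case using q_i by simp
  qed
  show ?thesis using bounds[of n] by (simp add: y_def Y_def)
qed

lemma prp_pert_all:
  assumes "near d m L \<rho> w0 w" "1 \<le> k" "k + n < L"
  shows "nm (prp m (gate d m w x) w k v n) \<le> 5 * C\<^sup>2 * real L * nm v"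
proof -
  have "nm (prp m (gate d m w x) w k v n) \<le> 2 * (C * real L * nm v) + 3 * C * real L * (C * nm v)"
    using assms C1 prp_all pre_all by (intro prp_pert) auto
  also have "\<dots> \<le> 5 * C\<^sup>2 * real L * nm v"
  proof -
    have "C * (real L * nm v) \<le> C * (C * (real L * nm v))"
      using C1 mult_right_mono[OF C1, of "real L * nm v"] by (intro mult_left_mono) auto
    then show ?thesis by (simp add: power2_eq_square algebra_simps)
  qed
  finally show ?thesis .
qed

lemma prp_pert_sparse:
  assumes "near d m L \<rho> w0 w" "1 \<le> k" "k + n < L"
    and "Q \<subseteq> {..<m}" "card Q \<le> s" "\<And>r. r < m \<Longrightarrow> r \<notin> Q \<Longrightarrow> v r = 0"
  shows "nm (prp m (gate d m w x) w k v n) \<le> 3 * C * nm v"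
proof -
  have "nm (prp m (gate d m w x) w k v n) \<le> 2 * (C * nm v) + 3 * C * real L * (nm v / (4 * real L))"
    using assms C1 prp_sparse pre_sparse[of k _ _ Q v] by (intro prp_pert) auto
  also have "\<dots> \<le> 3 * C * nm v" using L2 C1 by (simp add: field_simps)
  finally show ?thesis .
qed

lemma cc_sqrt_m: "cc * sqrt (real m) = sqrt 2"
  using m_pos by (simp flip: real_sqrt_mult)

text \<open>Lets the drift of the last layer be charged to the same \<open>sqrt s\<close> as its
  flips. It comes from the assumed lower bound on \<open>\<beta>^2 s\<close>, as
  \<open>\<beta> <= 1\<close>.\<close>

lemma rho_le_s: "sqrt 2 * \<rho> \<le> C * sqrt (real s)"
proof (rule power2_le_imp_le)
  have "2 * \<rho>\<^sup>2 \<le> 128 * (C\<^sup>2 * real L * \<rho>\<^sup>2)"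
  proof -
    have "1 * 1 \<le> C\<^sup>2 * real L" using C1 L2 by (intro mult_mono) (auto simp: one_le_power)
    then have "1 * \<rho>\<^sup>2 \<le> C\<^sup>2 * real L * \<rho>\<^sup>2" by (intro mult_right_mono) auto
    then show ?thesis using zero_le_power2[of \<rho>] by linarith
  qed
  also have "\<dots> \<le> \<beta>\<^sup>2 * real s" using beta by simp
  also have "\<dots> \<le> 1 * real s" using beta by (intro mult_right_mono) (auto simp: power_le_one)
  also have "\<dots> \<le> C\<^sup>2 * real s" using C1 by (intro mult_right_mono) (auto simp: one_le_power)
  finally show "(sqrt 2 * \<rho>)\<^sup>2 \<le> (C * sqrt (real s))\<^sup>2"
    by (simp add: power_mult_distrib)
qed (use C1 in simp)

end

section \<open>The output functional and its cancellation\<close>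

text \<open>The antisymmetric output weights annihilate the duplicated last layer at initialization, so
  only the drift of the last layer and its flipped gates enter the backpropagated signal.\<close>

locale antisym_init = good_init +
  fixes a :: "nat \<Rightarrow> real"
  assumes m_even: "even m"
    and a_abs: "\<And>r. r < m \<Longrightarrow> \<bar>a r\<bar> = 1"
    and a_anti: "\<And>r. r < m div 2 \<Longrightarrow> a (r + m div 2) = - a r"
    and w0_dup: "\<And>r j. r < m div 2 \<Longrightarrow> j < m \<Longrightarrow> w0 L (r + m div 2) j = w0 L r j"
begin

lemma L2_set_a: "T \<subseteq> {..<m} \<Longrightarrow> L2_set a T = sqrt (real (card T))"
proof -
  assume T: "T \<subseteq> {..<m}"
  have "(a r)\<^sup>2 = 1" if "r \<in> T" for r
    using a_abs[of r] that T by (metis lessThan_iff one_power2 power2_abs subsetD)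
  then show ?thesis by (simp add: L2_set_def)
qed

lemma sum_a_dup_zero:
  assumes "\<And>r. r < m div 2 \<Longrightarrow> f (r + m div 2) = (f r :: real)"
  shows "(\<Sum>r<m. a r * f r) = 0"
proof -
  have mm: "m = m div 2 + m div 2" using m_even by presburger
  have "(\<Sum>r<m. a r * f r) = (\<Sum>r<m div 2 + m div 2. a r * f r)" using mm by simp
  also have "\<dots> = (\<Sum>r<m div 2. a r * f r) + (\<Sum>r<m div 2. a (m div 2 + r) * f (m div 2 + r))"
    by (simp add: lessThan_atLeast0 sum.atLeastLessThan_concat[of 0 "m div 2" "m div 2 + m div 2", symmetric]
        sum.shift_bounds_nat_ivl[of _ 0 "m div 2" "m div 2", simplified] add.commute)
  also have "(\<Sum>r<m div 2. a (m div 2 + r) * f (m div 2 + r)) = (\<Sum>r<m div 2. - (a r * f r))"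
    using assms a_anti by (intro sum.cong) (auto simp: add.commute)
  finally show ?thesis by (simp add: sum_negf)
qed

text \<open>The drift contributes \<open>sqrt m * cc * \<rho> = sqrt 2 * \<rho>\<close>, which
  \<open>rho_le_s\<close> compares with \<open>sqrt s\<close>. The flips pair at most
  \<open>s\<close> signs with an initial preactivation restricted to a sparse set.\<close>

lemma last_layer:
  assumes near: "near d m L \<rho> w0 w"
  shows "\<bar>\<Sum>r<m. a r * (cc * gate d m w x L r * lin m (w L) v r)\<bar> \<le> 2 * C * sqrt (real s) * nm v"
proof -
  let ?A = "\<Sum>r<m. a r * (cc * gate d m w x L r * lin m (\<lambda>r c. w L r c - w0 L r c) v r)"
  let ?g = "\<lambda>r. (gate d m w x L r - D0 L r) * (cc * lin m (w0 L) v r)"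
  let ?B = "\<Sum>r<m. a r * ?g r"
  let ?F = "flips d m w0 w x L"
  have inL: "in_dim d m L = m" using L2 by (simp add: in_dim_def)
  have "(\<Sum>r<m. a r * (cc * D0 L r * lin m (w0 L) v r)) = 0"
  proof (rule sum_a_dup_zero)
    fix r assume r: "r < m div 2"
    then have "lin m (w0 L) u (r + m div 2) = lin m (w0 L) u r" for u by (simp add: lin_def w0_dup)
    then show "cc * D0 L (r + m div 2) * lin m (w0 L) v (r + m div 2) = cc * D0 L r * lin m (w0 L) v r"
      by (simp add: gate_def preact_def inL)
  qed
  then have "(\<Sum>r<m. a r * (cc * gate d m w x L r * lin m (w L) v r))
    = ?A + ?B + (\<Sum>r<m. a r * (cc * D0 L r * lin m (w0 L) v r))
      - (\<Sum>r<m. a r * (cc * D0 L r * lin m (w0 L) v r))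
      + (\<Sum>r<m. a r * (cc * D0 L r * lin m (w0 L) v r))"
    unfolding sum.distrib[symmetric] sum_subtractf[symmetric]
    by (intro sum.cong refl) (simp add: lin_mat_diff algebra_simps)
  also have "\<dots> = ?A + ?B"
    using \<open>(\<Sum>r<m. a r * (cc * D0 L r * lin m (w0 L) v r)) = 0\<close> by simp
  finally have eq: "(\<Sum>r<m. a r * (cc * gate d m w x L r * lin m (w L) v r)) = ?A + ?B" .
  have "\<bar>?A\<bar> \<le> L2_set a {..<m} * nm (\<lambda>r. cc * gate d m w x L r * lin m (\<lambda>r c. w L r c - w0 L r c) v r)"
    by (rule sum_mult_le_L2_set)
  also have "\<dots> \<le> sqrt (real m) * (cc * (\<rho> * nm v))"
  proof (intro mult_mono)
    show "L2_set a {..<m} \<le> sqrt (real m)" by (simp add: L2_set_a)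
    have "nm (\<lambda>r. cc * gate d m w x L r * lin m (\<lambda>r c. w L r c - w0 L r c) v r)
       \<le> nm (\<lambda>r. cc * lin m (\<lambda>r c. w L r c - w0 L r c) v r)"
      by (intro L2_set_abs_mono) (simp add: gate_def)
    also have "\<dots> = cc * nm (lin m (\<lambda>r c. w L r c - w0 L r c) v)"
      using cc_pos by (simp add: L2_set_scale)
    also have "\<dots> \<le> cc * (dl w L * nm v)"
      using cc_pos unfolding dl_def inL by (intro mult_left_mono L2_set_lin_le) auto
    also have "\<dots> \<le> cc * (\<rho> * nm v)"
      using cc_pos dl_le[OF near, of L] L2 by (intro mult_left_mono mult_right_mono) auto
    finally show "nm (\<lambda>r. cc * gate d m w x L r * lin m (\<lambda>r c. w L r c - w0 L r c) v r) \<le> cc * (\<rho> * nm v)" .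
  qed auto
  also have "\<dots> = sqrt 2 * \<rho> * nm v" by (simp flip: cc_sqrt_m)
  also have "\<dots> \<le> C * sqrt (real s) * nm v" using rho_le_s by (intro mult_right_mono) auto
  finally have A: "\<bar>?A\<bar> \<le> C * sqrt (real s) * nm v" .
  have Fc: "card ?F \<le> s" using flips_card[OF near, of L] L2 by simp
  have "?B = (\<Sum>r\<in>?F. a r * ?g r)"
    by (intro sum.mono_neutral_right) (auto simp: flips_def)
  then have "\<bar>?B\<bar> \<le> L2_set a ?F * L2_set ?g ?F"
    using sum_mult_le_L2_set[of a ?g ?F] by simp
  also have "\<dots> \<le> sqrt (real s) * (C * nm v)"
  proof (intro mult_mono)
    show "L2_set a ?F \<le> sqrt (real s)" using Fc by (simp add: L2_set_a flips_subset)
    \<comment> \<open>Here \<open>v\<close> is viewed as injected after layer \<open>L - 1\<close>,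
      so \<open>pre\<close> with no intermediate layer is the scaled initial preactivation of layer
      \<open>L\<close>.\<close>
    have "L2_set ?g ?F \<le> L2_set (pre m D0 w0 (L - 1) v 0) ?F"
    proof (intro L2_set_abs_mono)
      fix r
      have "\<bar>gate d m w x L r - D0 L r\<bar> * \<bar>cc * lin m (w0 L) v r\<bar> \<le> 1 * \<bar>cc * lin m (w0 L) v r\<bar>"
        using gate_bounds by (intro mult_right_mono) auto
      then show "\<bar>?g r\<bar> \<le> \<bar>pre m D0 w0 (L - 1) v 0 r\<bar>"
        using L2 by (simp add: pre_def abs_mult)
    qed
    also have "\<dots> \<le> C * nm v" using L2 Fc flips_subset by (intro pre_all) auto
    finally show "L2_set ?g ?F \<le> C * nm v" .
  qed auto
  finally have "\<bar>?B\<bar> \<le> C * sqrt (real s) * nm v" by (simp add: mult_ac)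
  then show ?thesis unfolding eq using A by (simp add: abs_le_iff algebra_simps)
qed

text \<open>\<open>psi w l u\<close> is the output of the linearized network when \<open>u\<close> is injected after layer \<open>l\<close>.\<close>

definition psi :: "(nat \<Rightarrow> nat \<Rightarrow> nat \<Rightarrow> real) \<Rightarrow> nat \<Rightarrow> (nat \<Rightarrow> real) \<Rightarrow> real" where
  "psi w l u = (\<Sum>r<m. a r * prp m (gate d m w x) w l u (L - l) r)"

lemma psi_add: "psi w l (\<lambda>r. u r + v r) = psi w l u + psi w l v"
  by (simp add: psi_def prp_add distrib_left sum.distrib)

text \<open>An injection after layer \<open>L\<close> meets the signs \<open>a\<close> directly,
  with nothing left to cancel, hence \<open>sqrt m\<close>. This is why the top layer is split off
  in \<open>near_linear\<close> and \<open>grad_bound\<close>.\<close>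

lemma psi_last: "\<bar>psi w L u\<bar> \<le> sqrt (real m) * nm u"
  using sum_mult_le_L2_set[of a u "{..<m}"] by (simp add: psi_def L2_set_a)

lemma psi_last_sparse:
  assumes "T \<subseteq> {..<m}" "card T \<le> s" "\<And>r. r < m \<Longrightarrow> r \<notin> T \<Longrightarrow> u r = 0"
  shows "\<bar>psi w L u\<bar> \<le> sqrt (real s) * nm u"
proof -
  have "psi w L u = (\<Sum>r\<in>T. a r * u r)"
    unfolding psi_def using assms by (intro sum.mono_neutral_cong_right) auto
  also have "\<bar>\<dots>\<bar> \<le> L2_set a T * L2_set u T" by (rule sum_mult_le_L2_set)
  also have "\<dots> \<le> sqrt (real s) * nm u"
    using assms by (intro mult_mono L2_set_subset) (auto simp: L2_set_a)
  finally show ?thesis .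
qed

lemma psi_lt:
  assumes "near d m L \<rho> w0 w" "l < L"
  shows "\<bar>psi w l u\<bar> \<le> 2 * C * sqrt (real s) * nm (prp m (gate d m w x) w l u (L - Suc l))"
proof -
  have "L - l = Suc (L - Suc l)" using assms by simp
  then have "psi w l u = (\<Sum>r<m. a r * (cc * gate d m w x L r *
      lin m (w L) (prp m (gate d m w x) w l u (L - Suc l)) r))"
    using assms by (simp add: psi_def)
  then show ?thesis using last_layer[OF assms(1)] by simp
qed

lemma psi_lt_all:
  assumes "near d m L \<rho> w0 w" "1 \<le> l" "l < L"
  shows "\<bar>psi w l u\<bar> \<le> 10 * C ^ 3 * real L * sqrt (real s) * nm u"
proof -
  have "\<bar>psi w l u\<bar> \<le> 2 * C * sqrt (real s) * (5 * C\<^sup>2 * real L * nm u)"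
    using assms C1 by (intro order_trans[OF psi_lt] mult_left_mono prp_pert_all) auto
  then show ?thesis by (simp add: power2_eq_square power3_eq_cube mult_ac)
qed

lemma psi_sparse:
  assumes "near d m L \<rho> w0 w" "1 \<le> l" "l \<le> L"
    and "T \<subseteq> {..<m}" "card T \<le> s" "\<And>r. r < m \<Longrightarrow> r \<notin> T \<Longrightarrow> u r = 0"
  shows "\<bar>psi w l u\<bar> \<le> 6 * C\<^sup>2 * sqrt (real s) * nm u"
proof (cases "l = L")
  case True
  have "\<bar>psi w l u\<bar> \<le> 1 * (sqrt (real s) * nm u)"
    using psi_last_sparse[OF assms(4-6)] True by simp
  also have "\<dots> \<le> 6 * C\<^sup>2 * (sqrt (real s) * nm u)"
    using one_le_power[OF C1, of 2] by (intro mult_right_mono) auto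
  finally show ?thesis by (simp add: mult_ac)
next
  case False
  then have "\<bar>psi w l u\<bar> \<le> 2 * C * sqrt (real s) * (3 * C * nm u)"
    using assms C1 by (intro order_trans[OF psi_lt] mult_left_mono prp_pert_sparse[where Q = T]) auto
  then show ?thesis by (simp add: power2_eq_square mult_ac)
qed

end

section \<open>Deviation from the linearization and size of the gradient\<close>

context antisym_init
begin

text \<open>The inner product of the layer-\<open>l\<close> gradient with the direction
  \<open>A\<close>, written as a propagated injection; \<open>net_grad_directional\<close>
  identifies the two.\<close>

definition directional :: "(nat \<Rightarrow> nat \<Rightarrow> nat \<Rightarrow> real) \<Rightarrow> nat \<Rightarrow> (nat \<Rightarrow> nat \<Rightarrow> real) \<Rightarrow> real" where
  "directional w l A = psi w l (\<lambda>r. cc * gate d m w x l r * lin (in_dim d m l) A (hid d m w x (l - 1)) r)"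

text \<open>Duhamel's formula is applied around \<open>w\<close>, not around \<open>w0\<close>, so
  the sources \<open>A\<close> reproduce the derivative at \<open>w\<close> exactly. What remains is
  \<open>B\<close>, a drift applied to a change of activations, and \<open>E\<close>, the gates on
  which \<open>w\<close> and \<open>w'\<close> disagree.\<close>

lemma near_linear:
  assumes near: "near d m L \<rho> w0 w" and near': "near d m L \<rho> w0 w'"
  shows "\<bar>(\<Sum>r<m. a r * hid d m w' x L r) - (\<Sum>r<m. a r * hid d m w x L r)
      - (\<Sum>l=1..L. directional w l (\<lambda>r j. w' l r j - w l r j))\<bar>
    \<le> 6 * \<rho> * eta + 40 * C ^ 3 * (real L)\<^sup>2 * sqrt (real s) * cc * \<rho> * eta
      + 24 * C\<^sup>2 * real L * sqrt (real s) * eps"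
proof -
  define y where "y i = (\<lambda>r. hid d m w' x (Suc i) r - hid d m w x (Suc i) r)" for i
  define \<Delta> where "\<Delta> j = (\<lambda>r c. w' j r c - w j r c)" for j
  let ?g = "gate d m w x" and ?g' = "gate d m w' x"
  define A where "A j = (\<lambda>r. cc * ?g (Suc j) r * lin (in_dim d m (Suc j)) (\<Delta> (Suc j)) (hid d m w x j) r)" for j
  define B where "B j = (\<lambda>r. cc * ?g (Suc j) r * lin (in_dim d m (Suc j)) (\<Delta> (Suc j))
    (\<lambda>r. hid d m w' x j r - hid d m w x j r) r)" for j
  define E where "E j = (\<lambda>r. cc * ((?g' (Suc j) r - ?g (Suc j) r) * preact d m w' x (Suc j) r))" for j
  have p_eq: "preact d m w' x (Suc j) r - preact d m w x (Suc j) r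
      = lin (in_dim d m (Suc j)) (\<Delta> (Suc j)) (hid d m w x j) r
      + lin (in_dim d m (Suc j)) (\<Delta> (Suc j)) (\<lambda>r. hid d m w' x j r - hid d m w x j r) r
      + lin (in_dim d m (Suc j)) (w (Suc j)) (\<lambda>r. hid d m w' x j r - hid d m w x j r) r" for j r
    by (simp add: preact_def \<Delta>_def lin_mat_diff lin_diff)
  have y_eq: "y j r = cc * ?g (Suc j) r * (preact d m w' x (Suc j) r - preact d m w x (Suc j) r) + E j r" for j r
    unfolding y_def E_def hid_Suc_gate by (simp add: algebra_simps)
  define f where "f j = (\<lambda>r. A j r + B j r + E j r)" for j
  have y0: "y 0 = (\<lambda>r. 0 + f 0 r)"
    by (rule ext, subst y_eq, subst p_eq) (simp add: f_def A_def B_def lin_def)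
  have yS: "y (Suc i) = (\<lambda>r. cc * ?g (1 + Suc i) r * lin m (w (1 + Suc i)) (y i) r + f (Suc i) r)" for i
    by (rule ext, subst y_eq, subst p_eq) (simp add: f_def A_def B_def y_def in_dim_def algebra_simps)
  have prp0: "prp m ?g w k (\<lambda>_. 0) i = (\<lambda>_. 0)" for k i
    using prp_scale[of m ?g w k 0 "\<lambda>_. 0" i] by simp
  have "(\<Sum>r<m. a r * hid d m w' x L r) - (\<Sum>r<m. a r * hid d m w x L r) = (\<Sum>r<m. a r * y (L - 1) r)"
    using L2 by (simp add: y_def right_diff_distrib sum_subtractf)
  also have "y (L - 1) = (\<lambda>r. prp m ?g w 1 (\<lambda>_. 0) (L - 1) r
      + (\<Sum>j\<le>L - 1. prp m ?g w (1 + j) (f j) (L - 1 - j) r))"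
    by (rule prp_unroll[where n = "L - 1"]) (use y0 yS in auto)
  also have "(\<Sum>r<m. a r * \<dots> r) = (\<Sum>j\<le>L - 1. psi w (Suc j) (f j))"
    unfolding psi_def prp0 by (simp add: sum_distrib_left) (rule sum.swap)
  also have "\<dots> = (\<Sum>j<L. psi w (Suc j) (f j))"
    using L2 by (intro sum.cong) auto
  finally have split: "(\<Sum>r<m. a r * hid d m w' x L r) - (\<Sum>r<m. a r * hid d m w x L r)
     = (\<Sum>j<L. psi w (Suc j) (A j)) + (\<Sum>j<L. psi w (Suc j) (B j)) + (\<Sum>j<L. psi w (Suc j) (E j))"
    by (simp add: f_def psi_add sum.distrib)
  have A_dir: "(\<Sum>j<L. psi w (Suc j) (A j)) = (\<Sum>l=1..L. directional w l (\<lambda>r j. w' l r j - w l r j))"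
    by (simp add: sum.atLeast1_atMost_eq directional_def A_def \<Delta>_def)
  have fro\<Delta>: "fro m (in_dim d m (Suc j)) (\<Delta> (Suc j)) \<le> 2 * \<rho>" if "j < L" for j
  proof -
    let ?q = "in_dim d m (Suc j)"
    have "fro m ?q (\<Delta> (Suc j)) \<le> L2_set (\<lambda>r. L2_set (\<lambda>c. w' (Suc j) r c - w0 (Suc j) r c) {..<?q}
        + L2_set (\<lambda>c. w (Suc j) r c - w0 (Suc j) r c) {..<?q}) {..<m}"
      unfolding fro_def
    proof (intro L2_set_mono)
      fix r
      have "\<Delta> (Suc j) r = (\<lambda>c. (w' (Suc j) r c - w0 (Suc j) r c) - (w (Suc j) r c - w0 (Suc j) r c))"
        by (simp add: \<Delta>_def)
      then show "L2_set (\<Delta> (Suc j) r) {..<?q} \<le> L2_set (\<lambda>c. w' (Suc j) r c - w0 (Suc j) r c) {..<?q}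
        + L2_set (\<lambda>c. w (Suc j) r c - w0 (Suc j) r c) {..<?q}"
        using L2_set_diff_le by metis
    qed simp
    also have "\<dots> \<le> dl w' (Suc j) + dl w (Suc j)"
      unfolding dl_def fro_def by (rule L2_set_triangle_ineq)
    also have "\<dots> \<le> 2 * \<rho>"
      using dl_le[OF near, of "Suc j"] dl_le[OF near', of "Suc j"] that by simp
    finally show ?thesis .
  qed
  \<comment> \<open>Both factors 2 arise because \<open>w\<close> and \<open>w'\<close> are compared
    with each other through \<open>w0\<close>.\<close>
  have Bn: "nm (B j) \<le> cc * (2 * \<rho> * (2 * eta))" if "j < L" for j
  proof -
    have h: "L2_set (\<lambda>r. hid d m w' x j r - hid d m w x j r) {..<in_dim d m (Suc j)} \<le> 2 * eta"
    proof (cases j)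
      case 0
      then show ?thesis using eta_nonneg by (simp add: L2_set_0')
    next
      case (Suc i)
      have "L2_set (\<lambda>r. (hid d m w' x j r - hid d m w0 x j r) - (hid d m w x j r - hid d m w0 x j r)) {..<m}
        \<le> nm (\<lambda>r. hid d m w' x j r - hid d m w0 x j r) + nm (\<lambda>r. hid d m w x j r - hid d m w0 x j r)"
        by (rule L2_set_diff_le)
      also have "\<dots> \<le> 2 * eta"
        using forward_hid[OF near, of j] forward_hid[OF near', of j] that Suc by simp
      finally show ?thesis using Suc by (simp add: in_dim_def)
    qed
    have "nm (B j) \<le> nm (\<lambda>r. cc * lin (in_dim d m (Suc j)) (\<Delta> (Suc j)) (\<lambda>r. hid d m w' x j r - hid d m w x j r) r)"
      unfolding B_def by (intro L2_set_abs_mono) (simp add: gate_def)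
    also have "\<dots> \<le> cc * (fro m (in_dim d m (Suc j)) (\<Delta> (Suc j)) *
        L2_set (\<lambda>r. hid d m w' x j r - hid d m w x j r) {..<in_dim d m (Suc j)})"
      using cc_pos by (simp add: L2_set_scale L2_set_lin_le)
    also have "\<dots> \<le> cc * (2 * \<rho> * (2 * eta))"
      using cc_pos fro\<Delta>[OF that] h rho by (intro mult_left_mono mult_mono) auto
    finally show ?thesis .
  qed
  have Bsum: "\<bar>\<Sum>j<L. psi w (Suc j) (B j)\<bar>
    \<le> 6 * \<rho> * eta + 40 * C ^ 3 * (real L)\<^sup>2 * sqrt (real s) * cc * \<rho> * eta"
  proof -
    define n where "n = L - 1"
    have Ln: "L = Suc n" using L2 by (simp add: n_def)
    have "\<bar>\<Sum>j<L. psi w (Suc j) (B j)\<bar> \<le> (\<Sum>j<L. \<bar>psi w (Suc j) (B j)\<bar>)" by (rule sum_abs)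
    also have "\<dots> = (\<Sum>j<n. \<bar>psi w (Suc j) (B j)\<bar>) + \<bar>psi w L (B n)\<bar>" by (simp add: Ln)
    also have "\<bar>psi w L (B n)\<bar> \<le> sqrt (real m) * (cc * (2 * \<rho> * (2 * eta)))"
      using Bn[of n] Ln by (intro order_trans[OF psi_last] mult_left_mono) auto
    also have "\<dots> = sqrt 2 * (4 * \<rho> * eta)" by (simp flip: cc_sqrt_m)
    also have "\<dots> \<le> (3/2) * (4 * \<rho> * eta)"
      using rho eta_nonneg by (intro mult_right_mono real_le_lsqrt) (auto simp: power2_eq_square)
    also have "(\<Sum>j<n. \<bar>psi w (Suc j) (B j)\<bar>)
        \<le> (\<Sum>j<n. 10 * C ^ 3 * real L * sqrt (real s) * (cc * (2 * \<rho> * (2 * eta))))"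
    proof (intro sum_mono)
      fix j assume j: "j \<in> {..<n}"
      have "\<bar>psi w (Suc j) (B j)\<bar> \<le> 10 * C ^ 3 * real L * sqrt (real s) * nm (B j)"
        using j Ln by (intro psi_lt_all near) auto
      also have "\<dots> \<le> 10 * C ^ 3 * real L * sqrt (real s) * (cc * (2 * \<rho> * (2 * eta)))"
        using Bn[of j] C1 j Ln by (intro mult_left_mono) auto
      finally show "\<bar>psi w (Suc j) (B j)\<bar> \<le> 10 * C ^ 3 * real L * sqrt (real s) * (cc * (2 * \<rho> * (2 * eta)))" .
    qed
    also have "\<dots> = real n * (40 * C ^ 3 * real L * sqrt (real s) * cc * \<rho> * eta)" by simp
    also have "\<dots> \<le> real L * (40 * C ^ 3 * real L * sqrt (real s) * cc * \<rho> * eta)"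
      using C1 cc_pos rho eta_nonneg Ln by (intro mult_right_mono) auto
    finally show ?thesis by (simp add: power2_eq_square mult_ac)
  qed
  have E1: "\<bar>psi w (Suc j) (\<lambda>r. if r \<in> T then E j r else 0)\<bar> \<le> 12 * C\<^sup>2 * sqrt (real s) * eps"
    if j: "j < L" and T: "T \<subseteq> {..<m}" "card T \<le> s" for j T
  proof -
    let ?u = "\<lambda>r. if r \<in> T then E j r else 0"
    let ?p = "\<lambda>w r. preact d m w x (Suc j) r"
    have "nm ?u = L2_set ?u T" using T by (intro L2_set_supp) auto
    also have "\<dots> \<le> L2_set (\<lambda>r. cc * ((?p w' r - ?p w0 r) - (?p w r - ?p w0 r))) T"
    proof (intro L2_set_abs_mono)
      fix r assume "r \<in> T"
      have "\<bar>?g' (Suc j) r - ?g (Suc j) r\<bar> * \<bar>?p w' r\<bar> \<le> \<bar>?p w' r - ?p w r\<bar>"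
      proof (cases "?g' (Suc j) r = ?g (Suc j) r")
        case False
        have "\<bar>?g' (Suc j) r - ?g (Suc j) r\<bar> * \<bar>?p w' r\<bar> \<le> 1 * \<bar>?p w' r - ?p w r\<bar>"
          using gate_flip_preact_le[OF False] gate_bounds by (intro mult_mono) auto
        then show ?thesis by simp
      qed simp
      then have "cc * (\<bar>?g' (Suc j) r - ?g (Suc j) r\<bar> * \<bar>?p w' r\<bar>) \<le> cc * \<bar>?p w' r - ?p w r\<bar>"
        using cc_pos by (intro mult_left_mono) auto
      then show "\<bar>?u r\<bar> \<le> \<bar>cc * ((?p w' r - ?p w0 r) - (?p w r - ?p w0 r))\<bar>"
        using cc_pos \<open>r \<in> T\<close> by (simp add: E_def abs_mult)
    qed
    also have "\<dots> = cc * L2_set (\<lambda>r. (?p w' r - ?p w0 r) - (?p w r - ?p w0 r)) T"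
      using cc_pos by (simp add: L2_set_scale)
    also have "\<dots> \<le> cc * (L2_set (\<lambda>r. ?p w' r - ?p w0 r) T + L2_set (\<lambda>r. ?p w r - ?p w0 r) T)"
      using cc_pos by (intro mult_left_mono L2_set_diff_le) auto
    also have "\<dots> \<le> 2 * eps"
      using forward_preact[OF near _ _ T, of "Suc j"] forward_preact[OF near' _ _ T, of "Suc j"] j
      by (simp add: distrib_left)
    finally have "nm ?u \<le> 2 * eps" .
    have "\<bar>psi w (Suc j) ?u\<bar> \<le> 6 * C\<^sup>2 * sqrt (real s) * nm ?u"
      using j T by (intro psi_sparse[where T = T] near) auto
    also have "\<dots> \<le> 6 * C\<^sup>2 * sqrt (real s) * (2 * eps)"
      using \<open>nm ?u \<le> 2 * eps\<close> by (intro mult_left_mono) auto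
    finally show ?thesis by simp
  qed
  have Esum: "\<bar>\<Sum>j<L. psi w (Suc j) (E j)\<bar> \<le> 24 * C\<^sup>2 * real L * sqrt (real s) * eps"
  proof -
    have "\<bar>psi w (Suc j) (E j)\<bar> \<le> 24 * C\<^sup>2 * sqrt (real s) * eps" if j: "j < L" for j
    proof -
      \<comment> \<open>A gate on which \<open>w\<close> and \<open>w'\<close> disagree is flipped
        by one of them relative to \<open>w0\<close>. The union of both sets of flips may have
        \<open>2 s\<close> elements, so it is cut into two disjoint sets of at most
        \<open>s\<close>.\<close>
      let ?T1 = "flips d m w0 w' x (Suc j)" and ?T2 = "flips d m w0 w x (Suc j) - flips d m w0 w' x (Suc j)"
      define u1 where "u1 r = (if r \<in> ?T1 then E j r else 0)" for r
      define u2 where "u2 r = (if r \<in> ?T2 then E j r else 0)" for r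
      have agree: "r < m \<Longrightarrow> E j r = u1 r + u2 r" for r
        by (auto simp: u1_def u2_def E_def flips_def)
      have "psi w (Suc j) (E j) = psi w (Suc j) (\<lambda>r. u1 r + u2 r)"
      proof -
        have "prp m ?g w k (E j) i r = prp m ?g w k (\<lambda>r. u1 r + u2 r) i r" if "r < m" for k i r
          using agree that by (rule prp_cong)
        then show ?thesis by (simp add: psi_def)
      qed
      also have "\<dots> = psi w (Suc j) u1 + psi w (Suc j) u2" by (rule psi_add)
      finally have "\<bar>psi w (Suc j) (E j)\<bar> \<le> \<bar>psi w (Suc j) u1\<bar> + \<bar>psi w (Suc j) u2\<bar>" by simp
      moreover have "\<bar>psi w (Suc j) u1\<bar> \<le> 12 * C\<^sup>2 * sqrt (real s) * eps"
        unfolding u1_def using j flips_subset flips_card[OF near', of "Suc j"] by (intro E1) auto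
      moreover have "\<bar>psi w (Suc j) u2\<bar> \<le> 12 * C\<^sup>2 * sqrt (real s) * eps"
      proof -
        have "card ?T2 \<le> card (flips d m w0 w x (Suc j))"
          by (rule card_mono) (auto simp: flips_def)
        then show ?thesis
          unfolding u2_def using j flips_subset[of d m w0 w x "Suc j"] flips_card[OF near, of "Suc j"]
          by (intro E1) auto
      qed
      ultimately show ?thesis by linarith
    qed
    then have "(\<Sum>j<L. \<bar>psi w (Suc j) (E j)\<bar>) \<le> (\<Sum>j<L. 24 * C\<^sup>2 * sqrt (real s) * eps)"
      by (intro sum_mono) auto
    then show ?thesis by (intro order_trans[OF sum_abs]) (simp add: mult_ac)
  qed
  show ?thesis using split A_dir Bsum Esum by linarith
qed

text \<open>At the top layer \<open>sqrt m * cc = sqrt 2\<close>, a constant; below it the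
  cancellation leaves the factor \<open>sqrt s * cc = sqrt (2 s / m)\<close>.\<close>

definition grad_bound :: "nat \<Rightarrow> real" where
  "grad_bound l = (if l = L then sqrt 2 else 10 * C ^ 3 * real L * sqrt (real s) * cc)"

lemma psi_gate:
  assumes near: "near d m L \<rho> w0 w" and l: "1 \<le> l" "l \<le> L"
  shows "\<bar>psi w l (\<lambda>r. cc * gate d m w x l r * u r)\<bar> \<le> grad_bound l * nm u"
proof -
  let ?v = "\<lambda>r. cc * gate d m w x l r * u r"
  have "nm ?v \<le> nm (\<lambda>r. cc * u r)"
    using cc_pos by (intro L2_set_abs_mono) (simp add: gate_def)
  also have "\<dots> = cc * nm u" using cc_pos by (simp add: L2_set_scale)
  finally have v: "nm ?v \<le> cc * nm u" .
  show ?thesis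
  proof (cases "l = L")
    case True
    have "\<bar>psi w L ?v\<bar> \<le> sqrt (real m) * (cc * nm u)"
      using v by (intro order_trans[OF psi_last] mult_left_mono) auto
    also have "\<dots> = grad_bound L * nm u" by (simp add: grad_bound_def flip: cc_sqrt_m)
    finally show ?thesis using True by simp
  next
    case False
    have "\<bar>psi w l ?v\<bar> \<le> 10 * C ^ 3 * real L * sqrt (real s) * (cc * nm u)"
      using v False l near C1 by (intro order_trans[OF psi_lt_all] mult_left_mono) auto
    then show ?thesis using False by (simp add: grad_bound_def)
  qed
qed

lemma hid_pert_norm:
  assumes "near d m L \<rho> w0 w" "l < L"
  shows "L2_set (hid d m w x l) {..<in_dim d m (Suc l)} \<le> 104 / 100"
proof (cases "l = 0")
  case True
  then show ?thesis using x_norm by (simp add: in_dim_def)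
next
  case False
  have "nm (hid d m w x l) \<le> nm (\<lambda>r. hid d m w x l r - hid d m w0 x l r) + nm (hid d m w0 x l)"
    using L2_set_triangle_ineq[of "\<lambda>r. hid d m w x l r - hid d m w0 x l r" "hid d m w0 x l" "{..<m}"] by simp
  also have "\<dots> \<le> 1 / 100 + 103 / 100"
    using forward_hid[OF assms(1), of l] hid_norm[of l] eta_small assms(2) False by (intro add_mono) auto
  finally show ?thesis using False by (simp add: in_dim_def)
qed

end

section \<open>Descent under approximate linearity\<close>

lemma deriv_logistic: "deriv logistic z = - 1 / (1 + exp z)"
proof -
  have "(logistic has_real_derivative - exp (- z) / (1 + exp (- z))) (at z)"
    unfolding logistic_def by (auto intro!: derivative_eq_intros simp: add_pos_pos)
  moreover have "- exp (- z) / (1 + exp (- z)) = - 1 / (1 + exp z)"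
    by (simp add: exp_minus field_simps)
  ultimately show ?thesis by (simp add: DERIV_imp_deriv)
qed

lemma logistic_deriv: "(logistic has_real_derivative deriv logistic z) (at z)"
proof -
  have "(logistic has_real_derivative - exp (- z) / (1 + exp (- z))) (at z)"
    unfolding logistic_def by (auto intro!: derivative_eq_intros simp: add_pos_pos)
  then show ?thesis by (simp add: DERIV_imp_deriv)
qed

lemma logistic_pos: "logistic z > 0"
  unfolding logistic_def by (rule ln_gt_zero) simp

lemma abs_deriv_logistic: "\<bar>deriv logistic z\<bar> = 1 / (1 + exp z)"
  by (simp add: deriv_logistic add_pos_pos)

lemma abs_deriv_logistic_le_1: "\<bar>deriv logistic z\<bar> \<le> 1"
  using exp_gt_zero[of z] by (simp add: abs_deriv_logistic divide_le_eq del: exp_gt_zero)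

lemma abs_deriv_logistic_le: "\<bar>deriv logistic z\<bar> \<le> logistic z"
proof -
  have pos: "0 < 1 + exp z" "0 < 1 + exp (- z)" for z :: real by (simp_all add: add_pos_pos)
  \<comment> \<open>The inequality \<open>ln u <= u - 1\<close> is used at the sigmoid value
    \<open>u = 1 / (1 + exp (- z))\<close>.\<close>
  have "ln (1 / (1 + exp (- z))) = - ln (1 + exp (- z))"
    using pos by (simp add: ln_div)
  then have "1 - 1 / (1 + exp (- z)) \<le> ln (1 + exp (- z))"
    using ln_le_minus_one[of "1 / (1 + exp (- z))"] pos by simp
  moreover have "1 - 1 / (1 + exp (- z)) = 1 / (1 + exp z)"
    using pos[of z] by (simp add: exp_minus divide_simps)
  ultimately show ?thesis by (simp add: abs_deriv_logistic logistic_def)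
qed

lemma logistic_convex: "logistic u + deriv logistic u * (v - u) \<le> logistic v"
proof -
  have "convex_on UNIV logistic"
  proof (rule f''_ge0_imp_convex[where f' = "deriv logistic" and f'' = "\<lambda>z. exp z / (1 + exp z)\<^sup>2"])
    show "(deriv logistic has_real_derivative exp z / (1 + exp z)\<^sup>2) (at z)" for z
      unfolding deriv_logistic[abs_def]
      by (auto intro!: derivative_eq_intros simp: add_pos_pos power2_eq_square dest: less_imp_neq[symmetric])
        (metis add_pos_pos exp_gt_zero less_numeral_extra(1,3))
  qed (auto simp: logistic_deriv)
  then have "deriv logistic u * (v - u) \<le> logistic v - logistic u"
    by (rule convex_on_imp_above_tangent) (auto intro: logistic_deriv)
  then show ?thesis by simp
qed

section \<open>Inner products and distances of parameter tuples, entry by entry\<close>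

definition psum :: "nat \<Rightarrow> nat \<Rightarrow> nat \<Rightarrow> (nat \<Rightarrow> nat \<Rightarrow> nat \<Rightarrow> real) \<Rightarrow> real" where
  "psum d m L f = (\<Sum>l=1..L. \<Sum>r<m. \<Sum>j<in_dim d m l. f l r j)"

lemma psum_mono: "(\<And>l r j. l \<in> {1..L} \<Longrightarrow> r < m \<Longrightarrow> j < in_dim d m l \<Longrightarrow> f l r j \<le> g l r j)
    \<Longrightarrow> psum d m L f \<le> psum d m L g"
  unfolding psum_def by (intro sum_mono) auto

lemma psum_cong: "(\<And>l r j. l \<in> {1..L} \<Longrightarrow> r < m \<Longrightarrow> j < in_dim d m l \<Longrightarrow> f l r j = g l r j)
    \<Longrightarrow> psum d m L f = psum d m L g"
  unfolding psum_def by (intro sum.cong refl) auto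

lemma psum_add: "psum d m L (\<lambda>l r j. f l r j + g l r j) = psum d m L f + psum d m L g"
  by (simp add: psum_def sum.distrib)

lemma psum_scale: "psum d m L (\<lambda>l r j. c * f l r j) = c * psum d m L f"
  by (simp add: psum_def sum_distrib_left)

lemma psum_sum: "psum d m L (\<lambda>l r j. \<Sum>i\<in>I. f i l r j) = (\<Sum>i\<in>I. psum d m L (f i))"
  by (induction I rule: infinite_finite_induct) (simp_all add: psum_add, simp_all add: psum_def)

lemma params_dist_sq_psum:
  assumes "W \<in> param_space d m L" "V \<in> param_space d m L"
  shows "params_dist_sq L W V = psum d m L (\<lambda>l r j. (W l $$ (r, j) - V l $$ (r, j))\<^sup>2)"
  unfolding params_dist_sq_def psum_def
proof (intro sum.cong refl)
  fix l assume "l \<in> {1..L}"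
  then have "W l \<in> carrier_mat m (in_dim d m l)" "V l \<in> carrier_mat m (in_dim d m l)"
    using assms by (auto simp: param_space_def)
  then show "frob_norm_sq (W l - V l) = (\<Sum>r<m. \<Sum>j<in_dim d m l. (W l $$ (r, j) - V l $$ (r, j))\<^sup>2)"
    unfolding frob_norm_sq_def by (intro sum.cong) auto
qed

text \<open>Distances are kept squared, so the triangle inequality doubles each term: two parameters
  within squared distance F of \<open>V\<close> are within \<open>4 F\<close> of each other.\<close>

lemma params_dist_sq_triangle:
  assumes "W \<in> param_space d m L" "V \<in> param_space d m L" "U \<in> param_space d m L"
  shows "params_dist_sq L W U \<le> 2 * params_dist_sq L W V + 2 * params_dist_sq L U V"
  unfolding params_dist_sq_psum[OF assms(1,3)] params_dist_sq_psum[OF assms(1,2)]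
    params_dist_sq_psum[OF assms(3,2)] psum_scale[symmetric] psum_add[symmetric]
proof (rule psum_mono)
  fix l r j
  have "((W l $$ (r, j) - V l $$ (r, j)) + (U l $$ (r, j) - V l $$ (r, j)))\<^sup>2 \<ge> 0" by simp
  then show "(W l $$ (r, j) - U l $$ (r, j))\<^sup>2
    \<le> 2 * (W l $$ (r, j) - V l $$ (r, j))\<^sup>2 + 2 * (U l $$ (r, j) - V l $$ (r, j))\<^sup>2"
    by (simp add: power2_eq_square algebra_simps)
qed

lemma gd_param_space:
  assumes "W0 \<in> param_space d m L"
  shows "gd d m L n a S \<eta> W0 t \<in> param_space d m L"
  by (induction t) (use assms in \<open>auto simp: param_space_def loss_grad_def\<close>)

text \<open>Cauchy-Schwarz in each row. A positive number of columns keeps the set of unit vectors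
  nonempty, so that the supremum is meaningful.\<close>

lemma spectral_norm_le_frob:
  assumes "dim_col A > 0"
  shows "(spectral_norm A)\<^sup>2 \<le> frob_norm_sq A"
proof -
  let ?X = "{v \<in> carrier_vec (dim_col A). vec_l2_norm v = 1}"
  have bound: "vec_l2_norm (A *\<^sub>v v) \<le> sqrt (frob_norm_sq A)" if v: "v \<in> ?X" for v
    unfolding vec_l2_norm_def
  proof (rule real_sqrt_le_mono)
    have v1: "(\<Sum>j<dim_col A. (v $ j)\<^sup>2) = 1"
      using v by (auto simp: vec_l2_norm_def scalar_prod_def power2_eq_square lessThan_atLeast0)
    have "(A *\<^sub>v v) \<bullet> (A *\<^sub>v v) = (\<Sum>r<dim_row A. (\<Sum>j<dim_col A. A $$ (r, j) * v $ j)\<^sup>2)"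
      using v unfolding scalar_prod_def
      by (auto simp: power2_eq_square lessThan_atLeast0 scalar_prod_def intro!: sum.cong arg_cong2[where f = "(*)"])
    also have "\<dots> \<le> (\<Sum>r<dim_row A. \<Sum>j<dim_col A. (A $$ (r, j))\<^sup>2)"
    proof (rule sum_mono)
      fix r
      have "(\<Sum>j<dim_col A. A $$ (r, j) * v $ j)\<^sup>2
        \<le> (\<Sum>j<dim_col A. (A $$ (r, j))\<^sup>2) * (\<Sum>j<dim_col A. (v $ j)\<^sup>2)"
        by (rule Cauchy_Schwarz_ineq_sum)
      then show "(\<Sum>j<dim_col A. A $$ (r, j) * v $ j)\<^sup>2 \<le> (\<Sum>j<dim_col A. (A $$ (r, j))\<^sup>2)"
        by (simp add: v1)
    qed
    finally show "(A *\<^sub>v v) \<bullet> (A *\<^sub>v v) \<le> frob_norm_sq A" by (simp add: frob_norm_sq_def)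
  qed
  have ne: "unit_vec (dim_col A) 0 \<in> ?X"
    using assms by (simp add: vec_l2_norm_def)
  have "spectral_norm A \<le> sqrt (frob_norm_sq A)"
    unfolding spectral_norm_def by (rule cSUP_least) (use bound ne in blast)+
  \<comment> \<open>Squaring an upper bound requires a nonnegative norm, which a single unit vector
    provides.\<close>
  moreover have "0 \<le> spectral_norm A"
  proof -
    have "0 \<le> vec_l2_norm (A *\<^sub>v unit_vec (dim_col A) 0)"
      by (auto simp: vec_l2_norm_def scalar_prod_def intro!: sum_nonneg)
    also have "\<dots> \<le> spectral_norm A"
      unfolding spectral_norm_def using bound ne by (intro cSUP_upper bdd_aboveI2[where M = "sqrt (frob_norm_sq A)"]) auto
    finally show ?thesis .
  qed
  ultimately have "(spectral_norm A)\<^sup>2 \<le> (sqrt (frob_norm_sq A))\<^sup>2" by (intro power_mono)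
  also have "\<dots> = frob_norm_sq A" by (simp add: frob_norm_sq_def sum_nonneg)
  finally show ?thesis .
qed

lemma Max_spectral_le:
  assumes "W \<in> param_space d m L" "V \<in> param_space d m L" "d > 0" "m > 0" "L > 0"
  shows "Max ((\<lambda>l. (spectral_norm (W l - V l))\<^sup>2) ` {1..L}) \<le> params_dist_sq L W V"
proof (rule Max.boundedI)
  fix b assume "b \<in> (\<lambda>l. (spectral_norm (W l - V l))\<^sup>2) ` {1..L}"
  then obtain l where l: "l \<in> {1..L}" "b = (spectral_norm (W l - V l))\<^sup>2" by auto
  have "V l \<in> carrier_mat m (in_dim d m l)" using assms l by (auto simp: param_space_def)
  then have "dim_col (W l - V l) > 0" using assms by (auto simp: in_dim_def)
  then have "b \<le> frob_norm_sq (W l - V l)" using spectral_norm_le_frob l by simp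
  also have "\<dots> \<le> (\<Sum>l=1..L. frob_norm_sq (W l - V l))"
    using l by (intro member_le_sum) (auto simp: frob_norm_sq_def intro!: sum_nonneg)
  finally show "b \<le> params_dist_sq L W V" by (simp add: params_dist_sq_def)
qed (use assms in auto)

lemma sq_mean_le: "((\<Sum>i<n. f i) / real n)\<^sup>2 \<le> (\<Sum>i<n. (f i)\<^sup>2) / real n"
proof (cases "n = 0")
  case False
  have "(\<Sum>i<n. 1 * f i)\<^sup>2 \<le> (\<Sum>i<n. 1\<^sup>2) * (\<Sum>i<n. (f i)\<^sup>2)"
    by (rule Cauchy_Schwarz_ineq_sum)
  then show ?thesis using False by (simp add: power_divide divide_simps power2_eq_square mult_ac)
qed simp

section \<open>One gradient step and its iteration\<close>

text \<open>The self-bounding property \<open>\<bar>\<ell>'\<bar> \<le> \<ell>\<close> absorbs both the linearization error and the squared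
  gradient into the current loss.\<close>

lemma gd_step:
  assumes W: "W \<in> param_space d m L" and V: "V \<in> param_space d m L" and n: "n > 0" and L: "L \<ge> 2"
    and y: "\<And>i. i < n \<Longrightarrow> snd (S i) \<in> {1, -1}"
    and lin: "\<And>i. i < n \<Longrightarrow> \<bar>net m L a V (fst (S i)) - net m L a W (fst (S i))
       - psum d m L (\<lambda>l r j. net_grad m L a W (fst (S i)) l $$ (r, j) * (V l $$ (r, j) - W l $$ (r, j)))\<bar> \<le> 1 / 50"
    and gb: "\<And>i. i < n \<Longrightarrow> psum d m L (\<lambda>l r j. (net_grad m L a W (fst (S i)) l $$ (r, j))\<^sup>2) \<le> 12 / 5"
    and \<eta>: "0 < \<eta>" "\<eta> \<le> 4 / (5 * real L)"
  shows "params_dist_sq L (\<lambda>l. W l - \<eta> \<cdot>\<^sub>m loss_grad d m L n a S W l) V + \<eta> * emp_loss m L n a S W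
    \<le> params_dist_sq L W V + 2 * \<eta> * emp_loss m L n a S V"
proof -
  define p where "p i = deriv logistic (snd (S i) * net m L a W (fst (S i)))" for i
  define ng where "ng i l r j = net_grad m L a W (fst (S i)) l $$ (r, j)" for i l r j
  define g where "g l r j = (\<Sum>i<n. snd (S i) * p i * ng i l r j) / real n" for l r j
  define e where "e l r j = W l $$ (r, j) - V l $$ (r, j)" for l r j
  let ?W' = "\<lambda>l. W l - \<eta> \<cdot>\<^sub>m loss_grad d m L n a S W l"
  let ?LW = "emp_loss m L n a S W" and ?LV = "emp_loss m L n a S V"
  have W': "?W' \<in> param_space d m L" using W by (auto simp: param_space_def loss_grad_def)
  have "params_dist_sq L ?W' V = psum d m L (\<lambda>l r j. (e l r j)\<^sup>2 + ((- 2 * \<eta>) * (g l r j * e l r j) + \<eta>\<^sup>2 * (g l r j)\<^sup>2))"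
    unfolding params_dist_sq_psum[OF W' V]
  proof (rule psum_cong)
    fix l r j assume l: "l \<in> {1..L}" and rj: "r < m" "j < in_dim d m l"
    have "W l \<in> carrier_mat m (in_dim d m l)" using W l by (auto simp: param_space_def)
    then have "?W' l $$ (r, j) = W l $$ (r, j) - \<eta> * g l r j"
      using rj by (simp add: loss_grad_def g_def p_def ng_def)
    then show "(?W' l $$ (r, j) - V l $$ (r, j))\<^sup>2
      = (e l r j)\<^sup>2 + ((- 2 * \<eta>) * (g l r j * e l r j) + \<eta>\<^sup>2 * (g l r j)\<^sup>2)"
      by (simp only:) (simp add: e_def power2_eq_square algebra_simps)
  qed
  also have "\<dots> = params_dist_sq L W V - 2 * \<eta> * psum d m L (\<lambda>l r j. g l r j * e l r j)
      + \<eta>\<^sup>2 * psum d m L (\<lambda>l r j. (g l r j)\<^sup>2)"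
    unfolding psum_add psum_scale params_dist_sq_psum[OF W V] by (simp add: e_def)
  finally have step: "params_dist_sq L ?W' V = \<dots>" .
  have inner: "98 / 100 * ?LW - ?LV \<le> psum d m L (\<lambda>l r j. g l r j * e l r j)"
  proof -
    have "psum d m L (\<lambda>l r j. g l r j * e l r j)
        = psum d m L (\<lambda>l r j. (1 / real n) * (\<Sum>i<n. (snd (S i) * p i) * (ng i l r j * e l r j)))"
      by (rule psum_cong) (simp add: g_def sum_distrib_right sum_distrib_left sum_divide_distrib mult_ac)
    also have "\<dots> = (\<Sum>i<n. (snd (S i) * p i) * psum d m L (\<lambda>l r j. ng i l r j * e l r j)) / real n"
      unfolding psum_scale psum_sum by simp
    also have "\<dots> \<ge> (\<Sum>i<n. 98 / 100 * logistic (snd (S i) * net m L a W (fst (S i)))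
        - logistic (snd (S i) * net m L a V (fst (S i)))) / real n"
    proof (intro divide_right_mono sum_mono)
      fix i assume i: "i \<in> {..<n}"
      define u v P where "u = net m L a W (fst (S i))" and "v = net m L a V (fst (S i))"
        and "P = psum d m L (\<lambda>l r j. ng i l r j * e l r j)"
      have "psum d m L (\<lambda>l r j. ng i l r j * (V l $$ (r, j) - W l $$ (r, j))) = psum d m L (\<lambda>l r j. (-1) * (ng i l r j * e l r j))"
        by (rule psum_cong) (simp add: e_def algebra_simps)
      also have "\<dots> = - P" unfolding psum_scale P_def by simp
      finally have "\<bar>v - u + P\<bar> \<le> 1 / 50"
        using lin[of i] i by (simp add: u_def v_def ng_def)
      moreover have yi: "snd (S i) = 1 \<or> snd (S i) = -1" using y i by auto
      ultimately have "\<bar>snd (S i) * (v - u + P)\<bar> \<le> 1 / 50" by (auto simp: abs_mult)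
      then have "\<bar>p i\<bar> * \<bar>snd (S i) * (v - u + P)\<bar> \<le> \<bar>p i\<bar> * (1 / 50)"
        by (intro mult_left_mono) auto
      also have "\<dots> \<le> logistic (snd (S i) * u) * (1 / 50)"
        using abs_deriv_logistic_le by (intro mult_right_mono) (auto simp: p_def u_def)
      finally have "- (p i * (snd (S i) * (v - u + P))) \<le> logistic (snd (S i) * u) / 50"
        by (simp add: abs_mult[symmetric])
      moreover have "logistic (snd (S i) * u) + p i * (snd (S i) * v - snd (S i) * u) \<le> logistic (snd (S i) * v)"
        unfolding p_def u_def by (rule logistic_convex)
      ultimately show "98 / 100 * logistic (snd (S i) * u) - logistic (snd (S i) * v) \<le> snd (S i) * p i * P"
        by (simp add: algebra_simps)
    qed simp
    finally show ?thesis
      by (simp add: emp_loss_def sum_subtractf sum_distrib_left diff_divide_distrib)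
  qed
  have sq: "psum d m L (\<lambda>l r j. (g l r j)\<^sup>2) \<le> 12 / 5 * ?LW"
  proof -
    have "psum d m L (\<lambda>l r j. (g l r j)\<^sup>2) \<le> psum d m L (\<lambda>l r j. (1 / real n) * (\<Sum>i<n. (snd (S i) * p i)\<^sup>2 * (ng i l r j)\<^sup>2))"
    proof (rule psum_mono)
      fix l r j
      show "(g l r j)\<^sup>2 \<le> (1 / real n) * (\<Sum>i<n. (snd (S i) * p i)\<^sup>2 * (ng i l r j)\<^sup>2)"
        using sq_mean_le[of "\<lambda>i. snd (S i) * p i * ng i l r j" n] by (simp add: g_def power_mult_distrib)
    qed
    also have "\<dots> = (\<Sum>i<n. (snd (S i) * p i)\<^sup>2 * psum d m L (\<lambda>l r j. (ng i l r j)\<^sup>2)) / real n"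
      unfolding psum_scale psum_sum by simp
    also have "\<dots> \<le> (\<Sum>i<n. logistic (snd (S i) * net m L a W (fst (S i))) * (12 / 5)) / real n"
    proof (intro divide_right_mono sum_mono)
      fix i assume i: "i \<in> {..<n}"
      have "(snd (S i) * p i)\<^sup>2 = \<bar>p i\<bar> * \<bar>p i\<bar>" using y[of i] i by (auto simp: power2_eq_square)
      also have "\<dots> \<le> 1 * logistic (snd (S i) * net m L a W (fst (S i)))"
        unfolding p_def by (intro mult_mono abs_deriv_logistic_le abs_deriv_logistic_le_1) auto
      finally show "(snd (S i) * p i)\<^sup>2 * psum d m L (\<lambda>l r j. (ng i l r j)\<^sup>2)
         \<le> logistic (snd (S i) * net m L a W (fst (S i))) * (12 / 5)"
        using gb[of i] i logistic_pos
        by (intro mult_mono) (auto simp: ng_def psum_def less_imp_le intro!: sum_nonneg)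
    qed simp
    also have "\<dots> = 12 / 5 * ?LW" by (simp add: emp_loss_def flip: sum_distrib_right sum_divide_distrib)
    finally show ?thesis .
  qed
  have LW: "0 \<le> ?LW" using logistic_pos by (auto simp: emp_loss_def less_imp_le intro!: sum_nonneg divide_nonneg_nonneg)
  have "\<eta>\<^sup>2 * psum d m L (\<lambda>l r j. (g l r j)\<^sup>2) \<le> \<eta>\<^sup>2 * (12 / 5 * ?LW)"
    using sq by (intro mult_left_mono) auto
  also have "\<dots> = \<eta> * ?LW * (12 / 5 * \<eta>)" by (simp add: power2_eq_square)
  also have "\<dots> \<le> \<eta> * ?LW * (96 / 100)"
  proof (rule mult_left_mono)
    have "\<eta> \<le> 4 / (5 * 2)" using \<eta>(2) L by (elim order_trans) (intro divide_left_mono, auto)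
    then show "12 / 5 * \<eta> \<le> 96 / 100" by simp
  qed (use \<eta> LW in simp)
  finally have A: "\<eta>\<^sup>2 * psum d m L (\<lambda>l r j. (g l r j)\<^sup>2) \<le> \<eta> * ?LW * (96 / 100)" .
  \<comment> \<open>The constants close exactly: \<open>2 * 98 / 100 - 96 / 100 = 1\<close>, where
    \<open>98 / 100 = 1 - 1 / 50\<close> is left by the linearization error and
    \<open>96 / 100 = 12 / 5 * 4 / 10\<close> by the squared gradient, with
    \<open>\<eta> <= 4 / 10\<close> from \<open>L >= 2\<close>.\<close>
  have B: "2 * \<eta> * (98 / 100 * ?LW - ?LV) \<le> 2 * \<eta> * psum d m L (\<lambda>l r j. g l r j * e l r j)"
    using inner \<eta> by (intro mult_left_mono) auto
  show ?thesis unfolding step using A B by (simp add: algebra_simps)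
qed

text \<open>The estimates are available only near \<open>W0\<close>, so they have to be regained at
  every step: the telescoped inequality up to \<open>t\<close> bounds the distance to
  \<open>V\<close>, hence to \<open>W0\<close>, before step \<open>t\<close> is taken. Telescoping
  also explains the form of \<open>lin\<close>: the network is linearized at the moving iterate and
  tested at the fixed \<open>V\<close>.\<close>

lemma gd_bound:
  assumes W0: "W0 \<in> param_space d m L" and V: "V \<in> param_space d m L"
    and pos: "d > 0" "m > 0" "n > 0" "L \<ge> 2"
    and y: "\<And>i. i < n \<Longrightarrow> snd (S i) \<in> {1, -1}"
    and lin: "\<And>i W. i < n \<Longrightarrow> W \<in> param_space d m L \<Longrightarrow> params_dist_sq L W W0 \<le> R \<Longrightarrow>
      \<bar>net m L a V (fst (S i)) - net m L a W (fst (S i))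
       - psum d m L (\<lambda>l r j. net_grad m L a W (fst (S i)) l $$ (r, j) * (V l $$ (r, j) - W l $$ (r, j)))\<bar> \<le> 1 / 50"
    and gb: "\<And>i W. i < n \<Longrightarrow> W \<in> param_space d m L \<Longrightarrow> params_dist_sq L W W0 \<le> R \<Longrightarrow>
      psum d m L (\<lambda>l r j. (net_grad m L a W (fst (S i)) l $$ (r, j))\<^sup>2) \<le> 12 / 5"
    and \<eta>: "0 < \<eta>" "\<eta> \<le> 4 / (5 * real L)"
    and F: "4 * ref_F m L n a S \<eta> T W0 V \<le> R"
    and t: "t \<le> T"
  shows "params_dist_sq L (gd d m L n a S \<eta> W0 t) V \<le> ref_F m L n a S \<eta> T W0 V"
    and "\<eta> * (\<Sum>k<t. emp_loss m L n a S (gd d m L n a S \<eta> W0 k)) \<le> ref_F m L n a S \<eta> T W0 V"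
proof -
  let ?W = "gd d m L n a S \<eta> W0" and ?F = "ref_F m L n a S \<eta> T W0 V"
  let ?LV = "emp_loss m L n a S V"
  have loss0: "0 \<le> emp_loss m L n a S U" for U
    using logistic_pos by (auto simp: emp_loss_def less_imp_le intro!: sum_nonneg divide_nonneg_nonneg)
  have dist0: "0 \<le> params_dist_sq L U U'" for U U'
    by (auto simp: params_dist_sq_def frob_norm_sq_def intro!: sum_nonneg)
  have le_F: "params_dist_sq L W0 V + 2 * \<eta> * real t * ?LV \<le> ?F" if "t \<le> T" for t
  proof -
    have "2 * \<eta> * real t * ?LV \<le> 3 * \<eta> * real T * ?LV"
      using that \<eta> loss0 by (intro mult_right_mono mult_mono) auto
    then show ?thesis by (simp add: ref_F_def)
  qed
  have main: "params_dist_sq L (?W t) V + \<eta> * (\<Sum>k<t. emp_loss m L n a S (?W k))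
      \<le> params_dist_sq L W0 V + 2 * \<eta> * real t * ?LV" if "t \<le> T" for t
    using that
  proof (induction t)
    case (Suc t)
    have Wt: "?W t \<in> param_space d m L" by (rule gd_param_space[OF W0])
    have "0 \<le> \<eta> * (\<Sum>k<t. emp_loss m L n a S (?W k))"
      using \<eta> loss0 by (intro mult_nonneg_nonneg sum_nonneg) auto
    then have "params_dist_sq L (?W t) V \<le> ?F"
      using Suc le_F[of t] by simp
    moreover have "params_dist_sq L W0 V \<le> ?F" using le_F[of 0] by simp
    ultimately have near: "params_dist_sq L (?W t) W0 \<le> R"
      using params_dist_sq_triangle[OF Wt V W0] F by linarith
    have "params_dist_sq L (?W (Suc t)) V + \<eta> * emp_loss m L n a S (?W t)
        \<le> params_dist_sq L (?W t) V + 2 * \<eta> * ?LV"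
      unfolding gd.simps(2)
      by (rule gd_step) (use Wt V pos y lin[OF _ Wt near] gb[OF _ Wt near] \<eta> in auto)
    then show ?case using Suc by (simp add: algebra_simps)
  qed simp
  have "0 \<le> \<eta> * (\<Sum>k<t. emp_loss m L n a S (?W k))"
    using \<eta> loss0 by (intro mult_nonneg_nonneg sum_nonneg) auto
  then show "params_dist_sq L (?W t) V \<le> ?F" using main[OF t] le_F[OF t] by simp
  show "\<eta> * (\<Sum>k<t. emp_loss m L n a S (?W k)) \<le> ?F"
    using main[OF t] le_F[OF t] dist0[of "?W t" V] by simp
qed

section \<open>Transfer to matrices\<close>

definition entries :: "params \<Rightarrow> nat \<Rightarrow> nat \<Rightarrow> nat \<Rightarrow> real" where
  "entries W = (\<lambda>l r j. W l $$ (r, j))"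

definition coords :: "real Matrix.vec \<Rightarrow> nat \<Rightarrow> real" where
  "coords v = (\<lambda>j. v $ j)"

lemma near_entries:
  assumes "W \<in> param_space d m L" "W0 \<in> param_space d m L" "params_dist_sq L W W0 \<le> \<rho>\<^sup>2"
  shows "near d m L \<rho> (entries W0) (entries W)"
  using assms(3) unfolding near_def fro_sq params_dist_sq_psum[OF assms(1,2)]
  by (simp add: psum_def entries_def)

lemma param_space_carrier:
  "W \<in> param_space d m L \<Longrightarrow> 1 \<le> l \<Longrightarrow> l \<le> L \<Longrightarrow> W l \<in> carrier_mat m (in_dim d m l)"
  by (simp add: param_space_def)

lemma mult_mat_vec_lin:
  assumes "A \<in> carrier_mat p q" "v \<in> carrier_vec q" "r < p"
  shows "(A *\<^sub>v v) $ r = lin q (\<lambda>r j. A $$ (r, j)) (\<lambda>j. v $ j) r"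
  using assms by (auto simp: scalar_prod_def lin_def lessThan_atLeast0 intro!: sum.cong)

context
  fixes d m L :: nat and W :: params and x :: "real Matrix.vec"
  assumes W: "W \<in> param_space d m L" and x: "x \<in> carrier_vec d"
begin

lemma hidden_hid:
  assumes "l \<le> L"
  shows "hidden m W x l \<in> carrier_vec (in_dim d m (Suc l)) \<and>
    (\<forall>r<in_dim d m (Suc l). hidden m W x l $ r = hid d m (entries W) (coords x) l r)"
  using assms
proof (induction l)
  case 0
  then show ?case using x by (simp add: in_dim_def coords_def)
next
  case (Suc l)
  have Wc: "W (Suc l) \<in> carrier_mat m (in_dim d m (Suc l))"
    using param_space_carrier[OF W] Suc by simp
  have IH: "hidden m W x l \<in> carrier_vec (in_dim d m (Suc l))"
    "\<And>r. r < in_dim d m (Suc l) \<Longrightarrow> hidden m W x l $ r = hid d m (entries W) (coords x) l r"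
    using Suc by auto
  have "(W (Suc l) *\<^sub>v hidden m W x l) $ r = lin (in_dim d m (Suc l)) (entries W (Suc l)) (hid d m (entries W) (coords x) l) r"
    if "r < m" for r
    unfolding mult_mat_vec_lin[OF Wc IH(1) that] entries_def
    by (rule lin_cong) (simp add: IH(2) entries_def)
  moreover have "W (Suc l) *\<^sub>v hidden m W x l \<in> carrier_vec m"
    by (rule mult_mat_vec_carrier[OF Wc IH(1)])
  ultimately show ?case using carrier_matD(1)[OF Wc] by (auto simp: in_dim_def relu_def)
qed

lemma row_hidden:
  assumes "1 \<le> l" "l \<le> L" "r < m"
  shows "Matrix.row (W l) r \<bullet> hidden m W x (l - 1) = preact d m (entries W) (coords x) l r"
proof -
  have Wc: "W l \<in> carrier_mat m (in_dim d m l)" using param_space_carrier[OF W assms(1,2)] .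
  have h: "hidden m W x (l - 1) \<in> carrier_vec (in_dim d m l)"
    "\<And>r. r < in_dim d m l \<Longrightarrow> hidden m W x (l - 1) $ r = hid d m (entries W) (coords x) (l - 1) r"
    using hidden_hid[of "l - 1"] assms by auto
  have "Matrix.row (W l) r \<bullet> hidden m W x (l - 1) = (W l *\<^sub>v hidden m W x (l - 1)) $ r"
    using Wc assms by simp
  also have "\<dots> = preact d m (entries W) (coords x) l r"
    unfolding mult_mat_vec_lin[OF Wc h(1) assms(3)] entries_def preact_def
    by (rule lin_cong) (use h(2) in \<open>simp add: entries_def\<close>)
  finally show ?thesis .
qed

lemma act_pattern_gate:
  assumes "1 \<le> l" "l \<le> L"
  shows "act_pattern m W x l = mat_diag m (gate d m (entries W) (coords x) l)"
  unfolding act_pattern_def mat_diag_def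
  by (rule cong_mat) (use row_hidden[OF assms] in \<open>auto simp: gate_def\<close>)

lemma scaled_act_mult:
  assumes "1 \<le> l" "l \<le> L" "v \<in> carrier_vec m" "r < m"
  shows "((c \<cdot>\<^sub>m act_pattern m W x l) *\<^sub>v v) $ r = c * gate d m (entries W) (coords x) l r * v $ r"
proof -
  have "((c \<cdot>\<^sub>m act_pattern m W x l) *\<^sub>v v) $ r
    = (\<Sum>j<m. c * (if j = r then gate d m (entries W) (coords x) l r else 0) * v $ j)"
    unfolding act_pattern_gate[OF assms(1,2)]
    using assms by (auto simp: scalar_prod_def mat_diag_def lessThan_atLeast0 intro!: sum.cong)
  also have "\<dots> = (\<Sum>j<m. if j = r then c * gate d m (entries W) (coords x) l r * v $ j else 0)"
    by (intro sum.cong) auto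
  also have "\<dots> = c * gate d m (entries W) (coords x) l r * v $ r" using assms by simp
  finally show ?thesis .
qed

text \<open>The first gate of the matrix product acts on the injected vector, so it goes into the
  starting value; the other factors are the layers after \<open>l\<close>, as in
  \<open>prp\<close>.\<close>

lemma backprop_prp:
  assumes "1 \<le> l" "l + k \<le> L"
  shows "backprop m W x l k \<in> carrier_mat m m \<and> (\<forall>u\<in>carrier_vec m. \<forall>r<m. (backprop m W x l k *\<^sub>v u) $ r
    = prp m (gate d m (entries W) (coords x)) (entries W) l
        (\<lambda>r. sqrt (2 / real m) * gate d m (entries W) (coords x) l r * coords u r) k r)"
  using assms
proof (induction k)
  case 0
  then show ?case using scaled_act_mult[of l] by (auto simp: act_pattern_gate coords_def)
next
  case (Suc k)
  let ?B = "backprop m W x l k" and ?A = "sqrt (2 / real m) \<cdot>\<^sub>m act_pattern m W x (l + Suc k)"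
  let ?p = "\<lambda>u. prp m (gate d m (entries W) (coords x)) (entries W) l
        (\<lambda>r. sqrt (2 / real m) * gate d m (entries W) (coords x) l r * coords u r) k"
  have B: "?B \<in> carrier_mat m m" and IH: "\<And>u r. u \<in> carrier_vec m \<Longrightarrow> r < m \<Longrightarrow> (?B *\<^sub>v u) $ r = ?p u r"
    using Suc by auto
  have Wc: "W (l + Suc k) \<in> carrier_mat m m"
    using param_space_carrier[OF W, of "l + Suc k"] Suc.prems by (simp add: in_dim_def)
  have A: "?A \<in> carrier_mat m m" using Suc.prems by (simp add: act_pattern_gate)
  show ?case
  proof (intro conjI ballI allI impI)
    show "backprop m W x l (Suc k) \<in> carrier_mat m m" using A B Wc by simp
    fix u :: "real Matrix.vec" and r assume u: "u \<in> carrier_vec m" and r: "r < m"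
    have Bu: "?B *\<^sub>v u \<in> carrier_vec m" and WBu: "W (l + Suc k) *\<^sub>v (?B *\<^sub>v u) \<in> carrier_vec m"
      using B Wc u by auto
    have "backprop m W x l (Suc k) *\<^sub>v u = ?A *\<^sub>v (W (l + Suc k) *\<^sub>v (?B *\<^sub>v u))"
      using A B Wc u by (simp add: assoc_mult_mat_vec[of _ m m _ m])
    then have "(backprop m W x l (Suc k) *\<^sub>v u) $ r
      = sqrt (2 / real m) * gate d m (entries W) (coords x) (l + Suc k) r * (W (l + Suc k) *\<^sub>v (?B *\<^sub>v u)) $ r"
      using scaled_act_mult[OF _ _ WBu r, of "l + Suc k"] Suc.prems by simp
    also have "(W (l + Suc k) *\<^sub>v (?B *\<^sub>v u)) $ r = lin m (entries W (l + Suc k)) (?p u) r"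
      unfolding mult_mat_vec_lin[OF Wc Bu r] entries_def
      by (rule lin_cong) (use IH[OF u] in \<open>simp add: entries_def\<close>)
    finally show "(backprop m W x l (Suc k) *\<^sub>v u) $ r
      = prp m (gate d m (entries W) (coords x)) (entries W) l
        (\<lambda>r. sqrt (2 / real m) * gate d m (entries W) (coords x) l r * coords u r) (Suc k) r"
      by simp
  qed
qed

end

text \<open>Moves the backpropagation matrix from \<open>a\<close> onto the test direction, so that
  gradients can be bounded by forward propagation alone.\<close>

lemma transpose_mult_inner:
  fixes G :: "real mat"
  assumes "G \<in> carrier_mat m m" "a \<in> carrier_vec m" "u \<in> carrier_vec m"
  shows "(\<Sum>r<m. (transpose_mat G *\<^sub>v a) $ r * u $ r) = (\<Sum>r<m. a $ r * (G *\<^sub>v u) $ r)"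
proof -
  have "(\<Sum>r<m. (transpose_mat G *\<^sub>v a) $ r * u $ r) = (\<Sum>r<m. \<Sum>i<m. G $$ (i, r) * a $ i * u $ r)"
    using assms by (auto simp: scalar_prod_def lessThan_atLeast0 sum_distrib_right intro!: sum.cong)
  also have "\<dots> = (\<Sum>i<m. \<Sum>r<m. G $$ (i, r) * a $ i * u $ r)" by (rule sum.swap)
  also have "\<dots> = (\<Sum>r<m. a $ r * (G *\<^sub>v u) $ r)"
    using assms by (auto simp: scalar_prod_def lessThan_atLeast0 sum_distrib_left mult_ac intro!: sum.cong)
  finally show ?thesis .
qed

section \<open>Gradients as linearized propagation\<close>

locale net_init = antisym_init d m L s C \<beta> \<rho> "entries W0" "coords x" "coords a"
  for d m L s :: nat and C \<beta> \<rho> :: real and W0 :: params and x a :: "real Matrix.vec" +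
  assumes W0: "W0 \<in> param_space d m L" and x_carrier: "x \<in> carrier_vec d" and a_carrier: "a \<in> carrier_vec m"
begin

lemma net_hid:
  assumes "W \<in> param_space d m L"
  shows "net m L a W x = (\<Sum>r<m. coords a r * hid d m (entries W) (coords x) L r)"
proof -
  have "hidden m W x L \<in> carrier_vec m" "\<And>r. r < m \<Longrightarrow> hidden m W x L $ r = hid d m (entries W) (coords x) L r"
    using hidden_hid[OF assms x_carrier, of L] L2 by (auto simp: in_dim_def)
  then show ?thesis by (auto simp: net_def scalar_prod_def coords_def lessThan_atLeast0 intro!: sum.cong)
qed

definition output_signal :: "params \<Rightarrow> nat \<Rightarrow> real Matrix.vec" where
  "output_signal W l = transpose_mat (backprop m W x l (L - l)) *\<^sub>v a"

lemma output_signal_psi: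
  assumes W: "W \<in> param_space d m L" and l: "1 \<le> l" "l \<le> L"
  shows "output_signal W l \<in> carrier_vec m"
    and "(\<Sum>r<m. output_signal W l $ r * u r)
      = psi (entries W) l (\<lambda>r. cc * gate d m (entries W) (coords x) l r * u r)"
proof -
  let ?G = "backprop m W x l (L - l)"
  have G: "?G \<in> carrier_mat m m" using backprop_prp[OF W x_carrier, of l "L - l"] l by auto
  then show "output_signal W l \<in> carrier_vec m" using a_carrier by (simp add: output_signal_def)
  define v where "v = Matrix.vec m u"
  have v: "v \<in> carrier_vec m" by (simp add: v_def)
  have "(\<Sum>r<m. output_signal W l $ r * u r) = (\<Sum>r<m. output_signal W l $ r * v $ r)" by (simp add: v_def)
  also have "\<dots> = (\<Sum>r<m. a $ r * (?G *\<^sub>v v) $ r)"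
    unfolding output_signal_def by (rule transpose_mult_inner[OF G a_carrier v])
  also have "\<dots> = (\<Sum>r<m. coords a r * prp m (gate d m (entries W) (coords x)) (entries W) l
        (\<lambda>r. cc * gate d m (entries W) (coords x) l r * coords v r) (L - l) r)"
    using backprop_prp[OF W x_carrier, of l "L - l"] l v by (intro sum.cong) (auto simp: coords_def)
  also have "\<dots> = psi (entries W) l (\<lambda>r. cc * gate d m (entries W) (coords x) l r * coords v r)"
    by (simp add: psi_def)
  also have "\<dots> = psi (entries W) l (\<lambda>r. cc * gate d m (entries W) (coords x) l r * u r)"
  proof -
    have "prp m (gate d m (entries W) (coords x)) (entries W) l
        (\<lambda>r. cc * gate d m (entries W) (coords x) l r * coords v r) i r
      = prp m (gate d m (entries W) (coords x)) (entries W) l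
        (\<lambda>r. cc * gate d m (entries W) (coords x) l r * u r) i r" if "r < m" for i r
      using _ that by (rule prp_cong) (simp add: v_def coords_def)
    then show ?thesis by (simp add: psi_def)
  qed
  finally show "(\<Sum>r<m. output_signal W l $ r * u r)
      = psi (entries W) l (\<lambda>r. cc * gate d m (entries W) (coords x) l r * u r)" .
qed

lemma net_grad_entry:
  assumes W: "W \<in> param_space d m L" and l: "1 \<le> l" "l \<le> L" and rj: "r < m" "j < in_dim d m l"
  shows "net_grad m L a W x l $$ (r, j) = output_signal W l $ r * hid d m (entries W) (coords x) (l - 1) j"
proof -
  have h: "hidden m W x (l - 1) \<in> carrier_vec (in_dim d m l)"
    "hidden m W x (l - 1) $ j = hid d m (entries W) (coords x) (l - 1) j"
    using hidden_hid[OF W x_carrier, of "l - 1"] l rj by auto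
  then show ?thesis
    using output_signal_psi(1)[OF W l] rj unfolding net_grad_def output_signal_def[symmetric]
    by (simp add: outer_product_def)
qed

lemma net_grad_directional:
  assumes W: "W \<in> param_space d m L" and l: "1 \<le> l" "l \<le> L"
  shows "(\<Sum>r<m. \<Sum>j<in_dim d m l. net_grad m L a W x l $$ (r, j) * A r j) = directional (entries W) l A"
proof -
  have "(\<Sum>r<m. \<Sum>j<in_dim d m l. net_grad m L a W x l $$ (r, j) * A r j)
    = (\<Sum>r<m. output_signal W l $ r * lin (in_dim d m l) A (hid d m (entries W) (coords x) (l - 1)) r)"
    unfolding lin_def sum_distrib_left
    using net_grad_entry[OF W l] by (intro sum.cong) (auto simp: mult_ac)
  also have "\<dots> = directional (entries W) l A"
    unfolding directional_def by (rule output_signal_psi(2)[OF W l])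
  finally show ?thesis .
qed

text \<open>The gradient is an outer product, so its Frobenius norm factors. The norm of the output
  signal follows by duality, testing the signal against itself.\<close>

lemma net_grad_sq:
  assumes W: "W \<in> param_space d m L" "params_dist_sq L W W0 \<le> \<rho>\<^sup>2" and l: "1 \<le> l" "l \<le> L"
  shows "(\<Sum>r<m. \<Sum>j<in_dim d m l. (net_grad m L a W x l $$ (r, j))\<^sup>2) \<le> (grad_bound l * (104 / 100))\<^sup>2"
proof -
  have near: "near d m L \<rho> (entries W0) (entries W)" using near_entries W W0 by blast
  let ?h = "hid d m (entries W) (coords x) (l - 1)"
  have "(\<Sum>r<m. \<Sum>j<in_dim d m l. (net_grad m L a W x l $$ (r, j))\<^sup>2)
    = (\<Sum>r<m. \<Sum>j<in_dim d m l. (output_signal W l $ r)\<^sup>2 * (?h j)\<^sup>2)"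
    by (intro sum.cong refl) (simp only: lessThan_iff net_grad_entry[OF W(1) l] power_mult_distrib)
  also have "\<dots> = (nm (coords (output_signal W l)) * L2_set ?h {..<in_dim d m l})\<^sup>2"
    by (simp add: power_mult_distrib L2_set_sq coords_def sum_product)
  also have "\<dots> \<le> (grad_bound l * (104 / 100))\<^sup>2"
  proof (intro power_mono mult_mono)
    have "(nm (coords (output_signal W l)))\<^sup>2 = (\<Sum>r<m. output_signal W l $ r * coords (output_signal W l) r)"
      unfolding L2_set_sq by (simp add: coords_def power2_eq_square)
    also have "\<dots> \<le> grad_bound l * nm (coords (output_signal W l))"
      unfolding output_signal_psi(2)[OF W(1) l] using psi_gate[OF near l, of "coords (output_signal W l)"] by linarith
    finally have le: "(nm (coords (output_signal W l)))\<^sup>2 \<le> grad_bound l * nm (coords (output_signal W l))" .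
    show "nm (coords (output_signal W l)) \<le> grad_bound l"
    proof (cases "nm (coords (output_signal W l)) = 0")
      case True
      then show ?thesis using C1 cc_pos by (simp add: grad_bound_def)
    next
      case False
      then have "0 < nm (coords (output_signal W l))" using L2_set_nonneg[of "coords (output_signal W l)" "{..<m}"] by linarith
      then show ?thesis using le by (simp add: power2_eq_square)
    qed
    show "L2_set ?h {..<in_dim d m l} \<le> 104 / 100"
      using hid_pert_norm[OF near, of "l - 1"] l by simp
    show "0 \<le> grad_bound l" using C1 cc_pos by (simp add: grad_bound_def)
  qed auto
  finally show ?thesis .
qed

lemma net_near_linear:
  assumes W: "W \<in> param_space d m L" "params_dist_sq L W W0 \<le> \<rho>\<^sup>2"
    and V: "V \<in> param_space d m L" "params_dist_sq L V W0 \<le> \<rho>\<^sup>2"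
  shows "\<bar>net m L a V x - net m L a W x
       - psum d m L (\<lambda>l r j. net_grad m L a W x l $$ (r, j) * (V l $$ (r, j) - W l $$ (r, j)))\<bar>
    \<le> 6 * \<rho> * eta + 40 * C ^ 3 * (real L)\<^sup>2 * sqrt (real s) * cc * \<rho> * eta
      + 24 * C\<^sup>2 * real L * sqrt (real s) * eps"
proof -
  have "psum d m L (\<lambda>l r j. net_grad m L a W x l $$ (r, j) * (V l $$ (r, j) - W l $$ (r, j)))
    = (\<Sum>l=1..L. directional (entries W) l (\<lambda>r j. entries V l r j - entries W l r j))"
    unfolding psum_def by (intro sum.cong) (auto simp: net_grad_directional[OF W(1)] entries_def)
  then show ?thesis
    using near_linear[OF near_entries[OF W(1) W0 W(2)] near_entries[OF V(1) W0 V(2)]]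
    by (simp add: net_hid W V)
qed

text \<open>For the top layer \<open>2 * (104 / 100)^2 < 22 / 10\<close>. The distance to the
  \<open>12 / 5\<close> demanded by \<open>gd_step\<close> is left to the lower layers, whose total
  carries the factor \<open>s / m\<close>.\<close>

lemma net_grad_total:
  assumes "W \<in> param_space d m L" "params_dist_sq L W W0 \<le> \<rho>\<^sup>2"
  shows "psum d m L (\<lambda>l r j. (net_grad m L a W x l $$ (r, j))\<^sup>2)
    \<le> 22 / 10 + 220 * C ^ 6 * real L ^ 3 * (real s / real m)"
proof -
  define n where "n = L - 1"
  have Ln: "L = Suc n" using L2 by (simp add: n_def)
  have "psum d m L (\<lambda>l r j. (net_grad m L a W x l $$ (r, j))\<^sup>2) \<le> (\<Sum>l=1..L. (grad_bound l * (104 / 100))\<^sup>2)"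
    unfolding psum_def using net_grad_sq[OF assms] by (intro sum_mono) auto
  also have "\<dots> = (\<Sum>l=1..n. (grad_bound l * (104 / 100))\<^sup>2) + (grad_bound L * (104 / 100))\<^sup>2"
    by (simp add: Ln)
  also have "(grad_bound L * (104 / 100))\<^sup>2 \<le> 22 / 10"
    by (simp add: grad_bound_def power_mult_distrib power2_eq_square)
  also have "(\<Sum>l=1..n. (grad_bound l * (104 / 100))\<^sup>2) \<le> (\<Sum>l=1..n. 220 * C ^ 6 * (real L)\<^sup>2 * (real s / real m))"
  proof (rule sum_mono)
    fix l assume "l \<in> {1..n}"
    then have "l \<noteq> L" using Ln by simp
    have C6: "(C ^ 3)\<^sup>2 = C ^ 6" by (simp flip: power_mult)
    have "(grad_bound l * (104 / 100))\<^sup>2 = (10816 / 10000 * 200) * (C ^ 6 * (real L)\<^sup>2 * (real s / real m))"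
      using m_pos \<open>l \<noteq> L\<close> by (simp add: grad_bound_def power_mult_distrib power_divide C6 mult_ac)
    also have "\<dots> \<le> 220 * (C ^ 6 * (real L)\<^sup>2 * (real s / real m))"
      using C1 by (intro mult_right_mono) auto
    finally show "(grad_bound l * (104 / 100))\<^sup>2 \<le> 220 * C ^ 6 * (real L)\<^sup>2 * (real s / real m)"
      by simp
  qed
  also have "\<dots> = real n * (220 * C ^ 6 * (real L)\<^sup>2 * (real s / real m))" by simp
  also have "\<dots> \<le> real L * (220 * C ^ 6 * (real L)\<^sup>2 * (real s / real m))"
    using Ln C1 by (intro mult_right_mono) auto
  also have "\<dots> = 220 * C ^ 6 * real L ^ 3 * (real s / real m)" by (simp add: power2_eq_square power3_eq_cube)
  finally show ?thesis by simp
qed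

end

section \<open>Gaussian rows\<close>

abbreviation gaussian :: "real measure" where
  "gaussian \<equiv> density lborel (\<lambda>x. ennreal (std_normal_density x))"

lemma prob_space_gaussian: "prob_space gaussian"
  by (rule prob_space_normal_density) simp

lemma prob_space_PiM_gaussian: "prob_space (PiM J (\<lambda>_. gaussian))"
  by (intro prob_space_PiM prob_space_gaussian)

lemma product_prob_space_gaussian: "product_prob_space (\<lambda>_. gaussian)"
  by (intro product_prob_spaceI prob_space_gaussian)

lemma gaussian_uminus: "distr gaussian gaussian uminus = gaussian"
proof -
  interpret prob_space gaussian by (rule prob_space_gaussian)
  have "distributed gaussian lborel (\<lambda>x. x) std_normal_density"
    by (auto simp: distributed_def distr_id2)
  then have "distributed gaussian lborel (\<lambda>x. 0 + (-1) * x) (normal_density (0 + (-1) * 0) (\<bar>-1\<bar> * 1))"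
    by (rule normal_density_affine) auto
  then have "distr gaussian lborel uminus = gaussian"
    by (simp add: distributed_def)
  moreover have "distr gaussian gaussian uminus = distr gaussian lborel uminus"
    by (rule distr_cong) simp_all
  ultimately show ?thesis by simp
qed

lemma PiM_gaussian_uminus:
  assumes "finite J"
  shows "distr (PiM J (\<lambda>_. gaussian)) (PiM J (\<lambda>_. gaussian)) (compose J uminus) = PiM J (\<lambda>_. gaussian)"
  by (subst distr_PiM_finite_prob_space)
     (use assms in \<open>auto intro: product_prob_space_gaussian simp: gaussian_uminus\<close>)

lemma gaussian_component:
  assumes "i \<in> J"
  shows "distributed (PiM J (\<lambda>_. gaussian)) lborel (\<lambda>\<omega>. \<omega> i) std_normal_density"
proof -
  have "distr (PiM J (\<lambda>_. gaussian)) lborel (\<lambda>\<omega>. \<omega> i) = distr (PiM J (\<lambda>_. gaussian)) gaussian (\<lambda>\<omega>. \<omega> i)"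
    by (rule distr_cong) simp_all
  also have "\<dots> = gaussian"
    using assms by (intro distr_PiM_component[of J "\<lambda>_. gaussian"] prob_space_gaussian)
  finally show ?thesis
    using measurable_component_singleton[OF assms, of "\<lambda>_. gaussian"]
    by (auto simp: distributed_def cong: measurable_cong_sets)
qed

lemma gaussian_indep:
  assumes "J \<noteq> {}"
  shows "prob_space.indep_vars (PiM J (\<lambda>_. gaussian)) (\<lambda>_. gaussian) (\<lambda>i \<omega>. \<omega> i) J"
proof -
  interpret prob_space "PiM J (\<lambda>_. gaussian)" by (rule prob_space_PiM_gaussian)
  have "distr (PiM J (\<lambda>_. gaussian)) (PiM J (\<lambda>_. gaussian)) (\<lambda>x. \<lambda>i\<in>J. x i)
      = distr (PiM J (\<lambda>_. gaussian)) (PiM J (\<lambda>_. gaussian)) (\<lambda>x. x)"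
    by (rule distr_cong) (auto simp: space_PiM)
  also have "\<dots> = PiM J (\<lambda>_. gaussian)" by simp
  also have "\<dots> = PiM J (\<lambda>i. distr (PiM J (\<lambda>_. gaussian)) gaussian (\<lambda>\<omega>. \<omega> i))"
    by (intro PiM_cong refl distr_PiM_component[of J "\<lambda>_. gaussian", symmetric] prob_space_gaussian)
  finally show ?thesis
    using assms by (subst indep_vars_iff_distr_eq_PiM') auto
qed

lemma gaussian_lincomb:
  assumes J: "finite J" and b: "k0 \<in> J" "b k0 \<noteq> 0"
  shows "distributed (PiM J (\<lambda>_. gaussian)) lborel (\<lambda>y. \<Sum>k\<in>J. b k * y k)
           (normal_density 0 (L2_set b J))"
proof -
  interpret prob_space "PiM J (\<lambda>_. gaussian)" by (rule prob_space_PiM_gaussian)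
  \<comment> \<open>Zero coefficients are dropped because the sum rule for independent normals asks
    for positive deviations.\<close>
  define K where "K = {k \<in> J. b k \<noteq> 0}"
  have K: "finite K" "K \<noteq> {}" "K \<subseteq> J" using J b by (auto simp: K_def)
  have "indep_vars (\<lambda>_. gaussian) (\<lambda>i \<omega>. \<omega> i) K"
    by (rule indep_vars_subset[OF gaussian_indep K(3)]) (use b in auto)
  then have ind: "indep_vars (\<lambda>_. borel) (\<lambda>k y. b k * y k) K"
    by (rule indep_vars_compose2) simp
  have dist: "distributed (PiM J (\<lambda>_. gaussian)) lborel (\<lambda>y. b k * y k) (normal_density 0 \<bar>b k\<bar>)" if "k \<in> K" for k
    using normal_density_affine[OF gaussian_component[of k J], of "b k" 0] that K by (auto simp: K_def)
  have "distributed (PiM J (\<lambda>_. gaussian)) lborel (\<lambda>y. \<Sum>k\<in>K. b k * y k)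
      (normal_density (\<Sum>k\<in>K. 0) (sqrt (\<Sum>k\<in>K. \<bar>b k\<bar>\<^sup>2)))"
    by (rule sum_indep_normal[OF K(1,2) ind]) (use dist in \<open>auto simp: K_def\<close>)
  moreover have "(\<Sum>k\<in>K. b k * y k) = (\<Sum>k\<in>J. b k * y k)" for y
    using J by (intro sum.mono_neutral_left) (auto simp: K_def)
  moreover have "(\<Sum>k\<in>K. \<bar>b k\<bar>\<^sup>2) = (\<Sum>k\<in>J. (b k)\<^sup>2)"
    using J by (intro sum.mono_neutral_cong_left) (auto simp: K_def)
  ultimately show ?thesis by (simp add: L2_set_def)
qed

text \<open>Tilting a centred normal density by \<open>exp (\<theta> t^2)\<close> gives a multiple
  of another centred normal density, with variance
  \<open>\<sigma>^2 / (1 - 2 \<theta> \<sigma>^2)\<close>.\<close>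

lemma normal_exp_sq:
  assumes \<sigma>: "0 < \<sigma>" and \<theta>: "2 * \<theta> * \<sigma>\<^sup>2 < 1"
  shows "(\<integral>\<^sup>+t. ennreal (exp (\<theta> * t\<^sup>2)) \<partial>density lborel (normal_density 0 \<sigma>))
    = ennreal (1 / sqrt (1 - 2 * \<theta> * \<sigma>\<^sup>2))"
proof -
  define D where "D = 1 - 2 * \<theta> * \<sigma>\<^sup>2"
  have D: "D > 0" using \<theta> by (simp add: D_def)
  define \<tau> where "\<tau> = \<sigma> / sqrt D"
  have \<tau>: "\<tau> > 0" using \<sigma> D by (simp add: \<tau>_def)
  have eq: "normal_density 0 \<sigma> t * exp (\<theta> * t\<^sup>2) = 1 / sqrt D * normal_density 0 \<tau> t" for t
  proof -
    have "\<tau>\<^sup>2 = \<sigma>\<^sup>2 / D" using D by (simp add: \<tau>_def power_divide)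
    have e: "exp (- t\<^sup>2 / (2 * \<sigma>\<^sup>2)) * exp (\<theta> * t\<^sup>2) = exp (- t\<^sup>2 / (2 * \<tau>\<^sup>2))"
      unfolding exp_add[symmetric] \<open>\<tau>\<^sup>2 = \<sigma>\<^sup>2 / D\<close>
      using \<sigma> D by (simp add: field_simps) (simp add: D_def algebra_simps)
    have s: "sqrt (2 * pi * \<tau>\<^sup>2) = sqrt (2 * pi * \<sigma>\<^sup>2) / sqrt D"
      unfolding \<open>\<tau>\<^sup>2 = \<sigma>\<^sup>2 / D\<close> by (simp add: real_sqrt_divide[symmetric])
    have "normal_density 0 \<sigma> t * exp (\<theta> * t\<^sup>2) = 1 / sqrt (2 * pi * \<sigma>\<^sup>2) * (exp (- t\<^sup>2 / (2 * \<sigma>\<^sup>2)) * exp (\<theta> * t\<^sup>2))"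
      by (simp add: normal_density_def)
    also have "\<dots> = 1 / sqrt D * normal_density 0 \<tau> t"
      unfolding e using D by (simp add: normal_density_def s)
    finally show ?thesis .
  qed
  have "(\<integral>\<^sup>+t. ennreal (exp (\<theta> * t\<^sup>2)) \<partial>density lborel (normal_density 0 \<sigma>))
    = (\<integral>\<^sup>+t. ennreal (normal_density 0 \<sigma> t * exp (\<theta> * t\<^sup>2)) \<partial>lborel)"
    by (subst nn_integral_density) (auto simp: ennreal_mult)
  also have "\<dots> = (\<integral>\<^sup>+t. ennreal (1 / sqrt D) * ennreal (normal_density 0 \<tau> t) \<partial>lborel)"
    unfolding eq using D by (intro nn_integral_cong) (subst ennreal_mult[symmetric], auto)
  also have "\<dots> = ennreal (1 / sqrt D) * emeasure (density lborel (normal_density 0 \<tau>)) UNIV"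
    by (subst nn_integral_cmult) (auto simp: emeasure_density)
  also have "emeasure (density lborel (normal_density 0 \<tau>)) UNIV = 1"
    using prob_space.emeasure_space_1[OF prob_space_normal_density[OF \<tau>, of 0]] by simp
  finally show ?thesis by (simp add: D_def)
qed

lemma normal_small_ball:
  assumes \<sigma>: "0 < \<sigma>" and \<beta>: "0 \<le> \<beta>"
  shows "emeasure (density lborel (normal_density 0 \<sigma>)) {-\<beta>..\<beta>} \<le> ennreal (\<beta> / \<sigma>)"
proof -
  \<comment> \<open>The density is largest at 0, and \<open>2 * pi >= 4\<close>.\<close>
  have le: "normal_density 0 \<sigma> t \<le> 1 / (2 * \<sigma>)" for t
  proof -
    have "normal_density 0 \<sigma> t \<le> 1 / sqrt (2 * pi * \<sigma>\<^sup>2) * 1"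
      unfolding normal_density_def by (intro mult_left_mono) auto
    also have "\<dots> \<le> 1 / (2 * \<sigma>)"
    proof -
      have "(2 * \<sigma>)\<^sup>2 \<le> 2 * pi * \<sigma>\<^sup>2" using pi_gt3 by (simp add: power_mult_distrib mult_right_mono)
      then have "2 * \<sigma> \<le> sqrt (2 * pi * \<sigma>\<^sup>2)" by (rule real_le_rsqrt)
      then show ?thesis using \<sigma> by (simp add: frac_le)
    qed
    finally show ?thesis .
  qed
  have "emeasure (density lborel (normal_density 0 \<sigma>)) {-\<beta>..\<beta>}
      = (\<integral>\<^sup>+t. ennreal (normal_density 0 \<sigma> t) * indicator {-\<beta>..\<beta>} t \<partial>lborel)"
    by (subst emeasure_density) auto
  also have "\<dots> \<le> (\<integral>\<^sup>+t. ennreal (1 / (2 * \<sigma>)) * indicator {-\<beta>..\<beta>} t \<partial>lborel)"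
    using le by (intro nn_integral_mono mult_right_mono ennreal_leI) auto
  also have "\<dots> = ennreal (1 / (2 * \<sigma>)) * ennreal (2 * \<beta>)"
    using \<beta> by (subst nn_integral_cmult_indicator) auto
  also have "\<dots> = ennreal (\<beta> / \<sigma>)" using \<sigma> \<beta> by (subst ennreal_mult[symmetric]) auto
  finally show ?thesis .
qed

section \<open>Linear forms of a Gaussian row\<close>

context
  fixes J :: "'i set" and b :: "'i \<Rightarrow> real"
  assumes J: "finite J"
begin

lemma gaussian_lincomb_exp_sq:
  assumes "2 * \<theta> * (\<Sum>k\<in>J. (b k)\<^sup>2) < 1"
  shows "(\<integral>\<^sup>+y. ennreal (exp (\<theta> * (\<Sum>k\<in>J. b k * y k)\<^sup>2)) \<partial>PiM J (\<lambda>_. gaussian))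
    = ennreal (1 / sqrt (1 - 2 * \<theta> * (\<Sum>k\<in>J. (b k)\<^sup>2)))"
proof (cases "\<exists>k0\<in>J. b k0 \<noteq> 0")
  case True
  then obtain k0 where k0: "k0 \<in> J" "b k0 \<noteq> 0" by auto
  define \<sigma> where "\<sigma> = L2_set b J"
  have "b k0 \<noteq> 0 \<Longrightarrow> \<sigma> \<noteq> 0" using k0 J by (auto simp: \<sigma>_def L2_set_eq_0_iff)
  then have \<sigma>: "\<sigma> > 0" using k0 L2_set_nonneg[of b J] by (simp add: \<sigma>_def order_less_le)
  have \<sigma>2: "\<sigma>\<^sup>2 = (\<Sum>k\<in>J. (b k)\<^sup>2)" by (simp add: \<sigma>_def L2_set_def sum_nonneg)
  let ?X = "\<lambda>y. \<Sum>k\<in>J. b k * y k"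
  have D: "distr (PiM J (\<lambda>_. gaussian)) lborel ?X = density lborel (normal_density 0 \<sigma>)"
    and X: "?X \<in> measurable (PiM J (\<lambda>_. gaussian)) lborel"
    using gaussian_lincomb[where b = b, OF J k0] by (auto simp: distributed_def \<sigma>_def)
  have "(\<integral>\<^sup>+y. ennreal (exp (\<theta> * (?X y)\<^sup>2)) \<partial>PiM J (\<lambda>_. gaussian))
    = (\<integral>\<^sup>+t. ennreal (exp (\<theta> * t\<^sup>2)) \<partial>distr (PiM J (\<lambda>_. gaussian)) lborel ?X)"
    using X by (subst nn_integral_distr) auto
  also have "\<dots> = ennreal (1 / sqrt (1 - 2 * \<theta> * \<sigma>\<^sup>2))"
    unfolding D using \<sigma> assms by (intro normal_exp_sq) (auto simp: \<sigma>2)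
  finally show ?thesis by (simp add: \<sigma>2)
next
  case False
  then show ?thesis
    using prob_space.emeasure_space_1[OF prob_space_PiM_gaussian[of J]] by simp
qed

lemma gaussian_lincomb_small_ball:
  assumes "0 < L2_set b J" "0 \<le> \<beta>"
  shows "emeasure (PiM J (\<lambda>_. gaussian)) {y \<in> space (PiM J (\<lambda>_. gaussian)). \<bar>\<Sum>k\<in>J. b k * y k\<bar> \<le> \<beta>}
    \<le> ennreal (\<beta> / L2_set b J)"
proof -
  obtain k0 where k0: "k0 \<in> J" "b k0 \<noteq> 0"
    using assms(1) J L2_set_eq_0_iff[of J b] by auto
  let ?X = "\<lambda>y. \<Sum>k\<in>J. b k * y k"
  have D: "distr (PiM J (\<lambda>_. gaussian)) lborel ?X = density lborel (normal_density 0 (L2_set b J))"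
    and X: "?X \<in> measurable (PiM J (\<lambda>_. gaussian)) lborel"
    using gaussian_lincomb[where b = b, OF J k0] by (auto simp: distributed_def)
  have "{y \<in> space (PiM J (\<lambda>_. gaussian)). \<bar>?X y\<bar> \<le> \<beta>} = ?X -` {-\<beta>..\<beta>} \<inter> space (PiM J (\<lambda>_. gaussian))"
    by auto
  then have "emeasure (PiM J (\<lambda>_. gaussian)) {y \<in> space (PiM J (\<lambda>_. gaussian)). \<bar>?X y\<bar> \<le> \<beta>}
    = emeasure (distr (PiM J (\<lambda>_. gaussian)) lborel ?X) {-\<beta>..\<beta>}"
    using X by (subst emeasure_distr) auto
  also have "\<dots> \<le> ennreal (\<beta> / L2_set b J)"
    unfolding D using assms by (intro normal_small_ball) auto
  finally show ?thesis .
qed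

text \<open>Discards the hyperplane on which a row and its negative both open the gate.\<close>

lemma gaussian_lincomb_AE_nonzero:
  assumes "0 < L2_set b J"
  shows "AE y in PiM J (\<lambda>_. gaussian). (\<Sum>k\<in>J. b k * y k) \<noteq> 0"
proof -
  have "emeasure (PiM J (\<lambda>_. gaussian)) {y \<in> space (PiM J (\<lambda>_. gaussian)). \<bar>\<Sum>k\<in>J. b k * y k\<bar> \<le> 0} = 0"
    using gaussian_lincomb_small_ball[OF assms, of 0] by simp
  moreover have "{y \<in> space (PiM J (\<lambda>_. gaussian)). \<bar>\<Sum>k\<in>J. b k * y k\<bar> \<le> 0} \<in> sets (PiM J (\<lambda>_. gaussian))"
    by measurable
  ultimately show ?thesis
    by (intro AE_I[where N = "{y \<in> space (PiM J (\<lambda>_. gaussian)). \<bar>\<Sum>k\<in>J. b k * y k\<bar> \<le> 0}"]) auto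
qed

end

text \<open>Negating the row swaps the gate and keeps the square, so the gate exactly halves the weight
  of the exponential.\<close>

lemma gaussian_gated_exp_sq:
  assumes J: "finite J" and h: "0 < L2_set h J" and \<theta>: "2 * \<theta> * (\<Sum>k\<in>J. (b k)\<^sup>2) < 1"
  shows "(\<integral>\<^sup>+y. ennreal (exp (\<theta> * ((if (\<Sum>k\<in>J. h k * y k) \<ge> 0 then 1 else 0) * (\<Sum>k\<in>J. b k * y k)\<^sup>2)))
      \<partial>PiM J (\<lambda>_. gaussian))
    = ennreal ((1 + 1 / sqrt (1 - 2 * \<theta> * (\<Sum>k\<in>J. (b k)\<^sup>2))) / 2)"
proof -
  let ?M = "PiM J (\<lambda>_. gaussian)"
  define f where "f y = ennreal (exp (\<theta> * ((if (\<Sum>k\<in>J. h k * y k) \<ge> 0 then 1 else 0) * (\<Sum>k\<in>J. b k * y k)\<^sup>2)))" for y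
  have f[measurable]: "f \<in> borel_measurable ?M"
    unfolding f_def by measurable
  have comp[measurable]: "compose J uminus \<in> measurable ?M ?M"
    unfolding compose_def by measurable
  have sq: "1 / sqrt (1 - 2 * \<theta> * (\<Sum>k\<in>J. (b k)\<^sup>2)) \<ge> 0" using \<theta> by simp
  have "integral\<^sup>N ?M f = (\<integral>\<^sup>+y. f (compose J uminus y) \<partial>?M)"
    by (subst PiM_gaussian_uminus[OF J, symmetric], subst nn_integral_distr) auto
  then have "integral\<^sup>N ?M f + integral\<^sup>N ?M f = (\<integral>\<^sup>+y. f y + f (compose J uminus y) \<partial>?M)"
    by (subst nn_integral_add) auto
  also have "\<dots> = (\<integral>\<^sup>+y. 1 + ennreal (exp (\<theta> * (\<Sum>k\<in>J. b k * y k)\<^sup>2)) \<partial>?M)"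
  proof (rule nn_integral_cong_AE)
    have neg: "(\<Sum>k\<in>J. c k * compose J uminus y k) = - (\<Sum>k\<in>J. c k * y k)" for c y :: "'a \<Rightarrow> real"
      by (simp add: compose_def sum_negf cong: sum.cong)
    show "AE y in ?M. f y + f (compose J uminus y) = 1 + ennreal (exp (\<theta> * (\<Sum>k\<in>J. b k * y k)\<^sup>2))"
      using gaussian_lincomb_AE_nonzero[OF J h]
    proof eventually_elim
      case (elim y)
      then show ?case
        by (cases "(\<Sum>k\<in>J. h k * y k) > 0") (auto simp: f_def neg add.commute)
    qed
  qed
  also have "\<dots> = 1 + ennreal (1 / sqrt (1 - 2 * \<theta> * (\<Sum>k\<in>J. (b k)\<^sup>2)))"
    using prob_space.emeasure_space_1[OF prob_space_PiM_gaussian[of J]]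
    by (subst nn_integral_add) (auto simp: gaussian_lincomb_exp_sq[OF J \<theta>])
  also have "\<dots> = ennreal (1 + 1 / sqrt (1 - 2 * \<theta> * (\<Sum>k\<in>J. (b k)\<^sup>2)))"
    using sq by (simp add: ennreal_plus)
  also have "\<dots> = ennreal ((1 + 1 / sqrt (1 - 2 * \<theta> * (\<Sum>k\<in>J. (b k)\<^sup>2))) / 2)
      + ennreal ((1 + 1 / sqrt (1 - 2 * \<theta> * (\<Sum>k\<in>J. (b k)\<^sup>2))) / 2)"
    using sq by (subst ennreal_plus[symmetric]) auto
  finally have "integral\<^sup>N ?M f + integral\<^sup>N ?M f = \<dots>" .
  then have "2 * integral\<^sup>N ?M f = 2 * ennreal ((1 + 1 / sqrt (1 - 2 * \<theta> * (\<Sum>k\<in>J. (b k)\<^sup>2))) / 2)"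
    unfolding mult_2 .
  then have "integral\<^sup>N ?M f = ennreal ((1 + 1 / sqrt (1 - 2 * \<theta> * (\<Sum>k\<in>J. (b k)\<^sup>2))) / 2)"
    by (simp only: ennreal_mult_cancel_left) auto
  then show ?thesis unfolding f_def[abs_def] .
qed

text \<open>Fubini with the block \<open>J\<close> innermost: \<open>f\<close> is constant along
  \<open>J\<close>, and the bound on \<open>g\<close> holds for every frozen configuration outside
  it.\<close>

lemma PiM_nn_integral_mult_le:
  fixes f g :: "('i \<Rightarrow> real) \<Rightarrow> ennreal"
  assumes I: "finite I" "J \<subseteq> I"
    and f[measurable]: "f \<in> borel_measurable (PiM I (\<lambda>_. gaussian))"
    and g[measurable]: "g \<in> borel_measurable (PiM I (\<lambda>_. gaussian))"
    and dep: "\<And>\<omega> \<omega>'. (\<And>k. k \<in> I - J \<Longrightarrow> \<omega> k = \<omega>' k) \<Longrightarrow> f \<omega> = f \<omega>'"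
    and bound: "\<And>x. x \<in> space (PiM (I - J) (\<lambda>_. gaussian)) \<Longrightarrow>
      (\<integral>\<^sup>+y. g (merge (I - J) J (x, y)) \<partial>PiM J (\<lambda>_. gaussian)) \<le> A"
  shows "(\<integral>\<^sup>+\<omega>. f \<omega> * g \<omega> \<partial>PiM I (\<lambda>_. gaussian)) \<le> A * (\<integral>\<^sup>+\<omega>. f \<omega> \<partial>PiM I (\<lambda>_. gaussian))"
proof -
  interpret product_prob_space "\<lambda>_::'i. gaussian" by (rule product_prob_space_gaussian)
  let ?K = "I - J" and ?G = "\<lambda>_::'i. gaussian"
  have fin: "finite ?K" "finite J" using I by (auto intro: finite_subset)
  have IK: "I = ?K \<union> J" and dis: "?K \<inter> J = {}" using I by auto
  have mf: "f \<in> borel_measurable (PiM (?K \<union> J) ?G)" "(\<lambda>\<omega>. f \<omega> * g \<omega>) \<in> borel_measurable (PiM (?K \<union> J) ?G)"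
    "g \<in> borel_measurable (PiM (?K \<union> J) ?G)"
    unfolding IK[symmetric] by measurable
  have merge_f: "f (merge ?K J (x, y)) = f x" for x y
    by (rule dep) (auto simp: merge_def)
  have meas: "(\<lambda>y. g (merge ?K J (x, y))) \<in> borel_measurable (PiM J ?G)" if "x \<in> space (PiM ?K ?G)" for x
  proof -
    have "(\<lambda>xy. g (merge ?K J xy)) \<in> borel_measurable (PiM ?K ?G \<Otimes>\<^sub>M PiM J ?G)"
      using measurable_comp[OF measurable_merge mf(3)] by (simp add: comp_def)
    from measurable_compose[OF measurable_Pair1'[OF that] this] show ?thesis by simp
  qed
  \<comment> \<open>Since \<open>f\<close> ignores the block, inserting one fixed \<open>y\<close>
    there yields a measurable function on the smaller product.\<close>
  have meas_f: "f \<in> borel_measurable (PiM ?K ?G)"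
  proof -
    have "(\<lambda>xy. f (merge ?K J xy)) \<in> borel_measurable (PiM ?K ?G \<Otimes>\<^sub>M PiM J ?G)"
      using measurable_comp[OF measurable_merge mf(1)] by (simp add: comp_def)
    moreover obtain y where "y \<in> space (PiM J ?G)"
      using prob_space.not_empty[OF prob_space_PiM_gaussian[of J]] unfolding ex_in_conv[symmetric] by blast
    ultimately have "(\<lambda>x. f (merge ?K J (x, y))) \<in> borel_measurable (PiM ?K ?G)"
      using measurable_compose[OF measurable_Pair2'] by fastforce
    then show ?thesis by (simp add: merge_f)
  qed
  have "(\<integral>\<^sup>+\<omega>. f \<omega> * g \<omega> \<partial>PiM I ?G) = (\<integral>\<^sup>+x. \<integral>\<^sup>+y. f x * g (merge ?K J (x, y)) \<partial>PiM J ?G \<partial>PiM ?K ?G)"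
    using product_nn_integral_fold[OF dis fin mf(2)] by (simp add: Un_absorb2[OF I(2)] merge_f)
  also have "\<dots> \<le> (\<integral>\<^sup>+x. A * f x \<partial>PiM ?K ?G)"
  proof (rule nn_integral_mono)
    fix x assume x: "x \<in> space (PiM ?K ?G)"
    have "(\<integral>\<^sup>+y. f x * g (merge ?K J (x, y)) \<partial>PiM J ?G) = f x * (\<integral>\<^sup>+y. g (merge ?K J (x, y)) \<partial>PiM J ?G)"
      by (rule nn_integral_cmult) (rule meas[OF x])
    also have "\<dots> \<le> f x * A" by (intro mult_left_mono bound x) auto
    finally show "(\<integral>\<^sup>+y. f x * g (merge ?K J (x, y)) \<partial>PiM J ?G) \<le> A * f x" by (simp add: mult.commute)
  qed
  also have "\<dots> = A * (\<integral>\<^sup>+x. f x \<partial>PiM ?K ?G)" by (rule nn_integral_cmult) (rule meas_f)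
  also have "(\<integral>\<^sup>+x. f x \<partial>PiM ?K ?G) = (\<integral>\<^sup>+\<omega>. f \<omega> \<partial>PiM I ?G)"
    using product_nn_integral_fold[OF dis fin mf(1)] prob_space.emeasure_space_1[OF prob_space_PiM_gaussian[of J]]
    by (simp add: Un_absorb2[OF I(2)] merge_f)
  finally show ?thesis .
qed

text \<open>The factors may share the coordinates outside the blocks, so they are not independent in
  general. A bound uniform in those coordinates still lets the blocks be integrated out one at a
  time.\<close>

lemma PiM_nn_integral_prod_le:
  fixes F :: "'r \<Rightarrow> ('i \<Rightarrow> real) \<Rightarrow> ennreal"
  assumes I: "finite I" and R: "finite R" and J: "\<And>r. r \<in> R \<Longrightarrow> J r \<subseteq> I"
    and F[measurable]: "\<And>r. r \<in> R \<Longrightarrow> F r \<in> borel_measurable (PiM I (\<lambda>_. gaussian))"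
    and dep: "\<And>r r' \<omega> \<omega>'. r \<in> R \<Longrightarrow> r' \<in> R \<Longrightarrow> r \<noteq> r' \<Longrightarrow> (\<And>k. k \<in> I - J r' \<Longrightarrow> \<omega> k = \<omega>' k) \<Longrightarrow> F r \<omega> = F r \<omega>'"
    and bound: "\<And>r x. r \<in> R \<Longrightarrow> x \<in> space (PiM (I - J r) (\<lambda>_. gaussian)) \<Longrightarrow>
      (\<integral>\<^sup>+y. F r (merge (I - J r) (J r) (x, y)) \<partial>PiM (J r) (\<lambda>_. gaussian)) \<le> A"
  shows "(\<integral>\<^sup>+\<omega>. (\<Prod>r\<in>R. F r \<omega>) \<partial>PiM I (\<lambda>_. gaussian)) \<le> A ^ card R"
  using R J F dep bound
proof (induction R rule: finite_induct)
  case empty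
  then show ?case using prob_space.emeasure_space_1[OF prob_space_PiM_gaussian[of I]] by simp
next
  case (insert r R)
  have "(\<integral>\<^sup>+\<omega>. (\<Prod>r\<in>insert r R. F r \<omega>) \<partial>PiM I (\<lambda>_. gaussian))
    = (\<integral>\<^sup>+\<omega>. (\<Prod>r\<in>R. F r \<omega>) * F r \<omega> \<partial>PiM I (\<lambda>_. gaussian))"
    using insert.hyps by (simp add: mult.commute)
  also have "\<dots> \<le> A * (\<integral>\<^sup>+\<omega>. (\<Prod>r\<in>R. F r \<omega>) \<partial>PiM I (\<lambda>_. gaussian))"
  proof (rule PiM_nn_integral_mult_le[OF I, where J = "J r"])
    show "J r \<subseteq> I" using insert.prems by simp
    show "(\<lambda>\<omega>. \<Prod>r\<in>R. F r \<omega>) \<in> borel_measurable (PiM I (\<lambda>_. gaussian))"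
      using insert.prems(2) by (intro borel_measurable_prod_ennreal) auto
    show "F r \<in> borel_measurable (PiM I (\<lambda>_. gaussian))" using insert.prems(2) by simp
    show "(\<Prod>r\<in>R. F r \<omega>) = (\<Prod>r\<in>R. F r \<omega>')" if "\<And>k. k \<in> I - J r \<Longrightarrow> \<omega> k = \<omega>' k" for \<omega> \<omega>'
    proof (rule prod.cong)
      fix r' assume "r' \<in> R"
      then show "F r' \<omega> = F r' \<omega>'"
        using insert.hyps by (intro insert.prems(3)[of r' r] that) auto
    qed simp
  qed (use insert.prems in auto)
  also have "\<dots> \<le> A * A ^ card R"
  proof (intro mult_left_mono insert.IH)
    show "F a w = F a w'" if "a \<in> R" "b \<in> R" "a \<noteq> b" "\<And>k. k \<in> I - J b \<Longrightarrow> w k = w' k" for a b w w'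
      by (rule insert.prems(3)[of a b]) (use that in auto)
  qed (use insert.prems in auto)
  finally show ?case using insert.hyps by simp
qed

section \<open>Chernoff bounds for one fresh layer\<close>

lemma inv_sqrt_le:
  fixes \<theta> :: real
  assumes "\<bar>\<theta>\<bar> \<le> 1 / 8"
  shows "1 / sqrt (1 - 2 * \<theta>) \<le> 1 + \<theta> + 2 * \<theta>\<^sup>2"
proof -
  have pos: "0 < 1 - 2 * \<theta>" and pos': "0 < 1 + \<theta> + 2 * \<theta>\<^sup>2" using assms by (auto simp: abs_le_iff intro: add_pos_nonneg)
  \<comment> \<open>The difference
    \<open>(1 + \<theta> + 2 \<theta>^2)^2 (1 - 2 \<theta>) - 1\<close> is \<open>\<theta>^2\<close>
    times this cubic.\<close>
  have "0 \<le> 1 - 6 * \<theta> - 4 * \<theta>\<^sup>2 - 8 * \<theta> ^ 3"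
  proof -
    have "\<theta>\<^sup>2 \<le> (1 / 8)\<^sup>2" using assms by (simp only: abs_le_square_iff[symmetric])
    moreover have "\<theta> ^ 3 \<le> 1 / 512"
    proof -
      have "\<theta> ^ 3 \<le> \<bar>\<theta>\<bar> ^ 3" by (metis abs_ge_self power_abs)
      also have "\<dots> \<le> (1 / 8) ^ 3" using assms by (intro power_mono) auto
      finally show ?thesis by (simp add: power3_eq_cube)
    qed
    ultimately show ?thesis using assms by (simp add: power2_eq_square abs_le_iff)
  qed
  then have "0 \<le> \<theta>\<^sup>2 * (1 - 6 * \<theta> - 4 * \<theta>\<^sup>2 - 8 * \<theta> ^ 3)" by simp
  then have "1 \<le> (1 + \<theta> + 2 * \<theta>\<^sup>2)\<^sup>2 * (1 - 2 * \<theta>)"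
    by (simp add: power2_eq_square power3_eq_cube algebra_simps)
  then have "sqrt 1 \<le> sqrt ((1 + \<theta> + 2 * \<theta>\<^sup>2)\<^sup>2 * (1 - 2 * \<theta>))" by (rule real_sqrt_le_mono)
  also have "\<dots> = (1 + \<theta> + 2 * \<theta>\<^sup>2) * sqrt (1 - 2 * \<theta>)" using pos' by (simp add: real_sqrt_mult)
  finally show ?thesis using pos by (simp add: divide_le_eq)
qed

lemma emeasure_markov_le:
  assumes "prob_space M" "B \<in> sets M" "F \<in> borel_measurable M"
    and "(\<integral>\<^sup>+\<omega>. F \<omega> \<partial>M) \<le> ennreal (exp u)"
    and "\<And>\<omega>. \<omega> \<in> B \<Longrightarrow> ennreal (exp t) \<le> F \<omega>"
  shows "measure M B \<le> exp (u - t)"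
proof -
  interpret prob_space M by fact
  have "ennreal (exp t) * emeasure M B = (\<integral>\<^sup>+\<omega>. ennreal (exp t) * indicator B \<omega> \<partial>M)"
    by (subst nn_integral_cmult_indicator[OF assms(2)]) simp
  also have "\<dots> \<le> (\<integral>\<^sup>+\<omega>. F \<omega> \<partial>M)"
    using assms(5) by (intro nn_integral_mono) (auto simp: indicator_def)
  also have "\<dots> \<le> ennreal (exp u)" by fact
  finally have "exp t * measure M B \<le> exp u"
    by (simp add: emeasure_eq_measure ennreal_mult[symmetric])
  then show ?thesis by (simp add: exp_diff field_simps)
qed

text \<open>Layer \<open>l\<close> is integrated first, row by row, with its inputs \<open>h\<close> (which sets the gates) and \<open>z\<close>
  frozen because they do not involve the entries of that layer.\<close>

locale fresh_layer =
  fixes I :: "(nat \<times> nat \<times> nat) set" and l q :: nat and R :: "nat set"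
    and h z :: "(nat \<times> nat \<times> nat \<Rightarrow> real) \<Rightarrow> nat \<Rightarrow> real"
  assumes finI: "finite I" and finR: "finite R" and rows: "\<And>r j. r \<in> R \<Longrightarrow> j < q \<Longrightarrow> (l, r, j) \<in> I"
    and h_meas: "\<And>j. j < q \<Longrightarrow> (\<lambda>\<omega>. h \<omega> j) \<in> borel_measurable (PiM I (\<lambda>_. gaussian))"
    and z_meas: "\<And>j. j < q \<Longrightarrow> (\<lambda>\<omega>. z \<omega> j) \<in> borel_measurable (PiM I (\<lambda>_. gaussian))"
    and h_dep: "\<And>\<omega> \<omega>' j. (\<And>k. k \<in> I \<Longrightarrow> fst k \<noteq> l \<Longrightarrow> \<omega> k = \<omega>' k) \<Longrightarrow> j < q \<Longrightarrow> h \<omega> j = h \<omega>' j"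
    and z_dep: "\<And>\<omega> \<omega>' j. (\<And>k. k \<in> I \<Longrightarrow> fst k \<noteq> l \<Longrightarrow> \<omega> k = \<omega>' k) \<Longrightarrow> j < q \<Longrightarrow> z \<omega> j = z \<omega>' j"
begin

abbreviation "P \<equiv> PiM I (\<lambda>_. gaussian)"

definition rd :: "(nat \<times> nat \<times> nat \<Rightarrow> real) \<Rightarrow> nat \<Rightarrow> (nat \<Rightarrow> real) \<Rightarrow> real" where
  "rd \<omega> r v = (\<Sum>j<q. \<omega> (l, r, j) * v j)"

abbreviation J :: "nat \<Rightarrow> (nat \<times> nat \<times> nat) set" where
  "J r \<equiv> (\<lambda>j. (l, r, j)) ` {..<q}"

abbreviation cf :: "(nat \<Rightarrow> real) \<Rightarrow> nat \<times> nat \<times> nat \<Rightarrow> real" where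
  "cf v k \<equiv> v (snd (snd k))"

lemma J_sum: "(\<Sum>k\<in>J r. f k) = (\<Sum>j<q. f (l, r, j))"
  by (subst sum.reindex) (auto simp: inj_on_def)

lemma J_norm: "L2_set (cf v) (J r) = L2_set v {..<q}"
  by (simp add: L2_set_def J_sum)

lemma entry_meas: "r \<in> R \<Longrightarrow> j < q \<Longrightarrow> (\<lambda>\<omega>. \<omega> (l, r, j)) \<in> borel_measurable P"
  using measurable_component_singleton[OF rows, of r j "\<lambda>_. gaussian"] by (simp cong: measurable_cong_sets)

lemma rd_meas [measurable]:
  "r \<in> R \<Longrightarrow> (\<lambda>\<omega>. rd \<omega> r (h \<omega>)) \<in> borel_measurable P"
  "r \<in> R \<Longrightarrow> (\<lambda>\<omega>. rd \<omega> r (z \<omega>)) \<in> borel_measurable P"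
  unfolding rd_def using h_meas z_meas entry_meas by (auto intro!: borel_measurable_sum borel_measurable_times)

lemma norm_meas [measurable]:
  "(\<lambda>\<omega>. L2_set (h \<omega>) {..<q}) \<in> borel_measurable P" "(\<lambda>\<omega>. L2_set (z \<omega>) {..<q}) \<in> borel_measurable P"
  unfolding L2_set_def using h_meas z_meas
  by (auto intro!: borel_measurable_sum borel_measurable_sqrt borel_measurable_power)

text \<open>Each factor sees the layer only through one row applied to \<open>h\<close> and
  \<open>z\<close>, and these two are fixed once the layer is frozen out; what is left is an
  integral over a single Gaussian row.\<close>

lemma layer_integral:
  fixes \<Phi> :: "(nat \<Rightarrow> real) \<Rightarrow> (nat \<Rightarrow> real) \<Rightarrow> real \<Rightarrow> real \<Rightarrow> ennreal"
  assumes T: "T \<subseteq> R"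
    and meas: "\<And>r. r \<in> R \<Longrightarrow> (\<lambda>\<omega>. \<Phi> (h \<omega>) (z \<omega>) (rd \<omega> r (h \<omega>)) (rd \<omega> r (z \<omega>))) \<in> borel_measurable P"
    and cong: "\<And>u u' v v' a b. (\<And>j. j < q \<Longrightarrow> u j = u' j) \<Longrightarrow> (\<And>j. j < q \<Longrightarrow> v j = v' j) \<Longrightarrow> \<Phi> u v a b = \<Phi> u' v' a b"
    and bound: "\<And>u v r. (\<integral>\<^sup>+y. \<Phi> u v (\<Sum>k\<in>J r. cf u k * y k) (\<Sum>k\<in>J r. cf v k * y k) \<partial>PiM (J r) (\<lambda>_. gaussian)) \<le> A"
  shows "(\<integral>\<^sup>+\<omega>. (\<Prod>r\<in>T. \<Phi> (h \<omega>) (z \<omega>) (rd \<omega> r (h \<omega>)) (rd \<omega> r (z \<omega>))) \<partial>P) \<le> A ^ card T"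
proof (rule PiM_nn_integral_prod_le[OF finI, where J = J])
  show "finite T" using T finR by (rule finite_subset)
  show "J r \<subseteq> I" if "r \<in> T" for r using that T rows by auto
  show "(\<lambda>\<omega>. \<Phi> (h \<omega>) (z \<omega>) (rd \<omega> r (h \<omega>)) (rd \<omega> r (z \<omega>))) \<in> borel_measurable P" if "r \<in> T" for r
    using that T meas by auto
  show "\<Phi> (h \<omega>) (z \<omega>) (rd \<omega> r (h \<omega>)) (rd \<omega> r (z \<omega>)) = \<Phi> (h \<omega>') (z \<omega>') (rd \<omega>' r (h \<omega>')) (rd \<omega>' r (z \<omega>'))"
    if "r \<in> T" "r' \<in> T" "r \<noteq> r'" and eq: "\<And>k. k \<in> I - J r' \<Longrightarrow> \<omega> k = \<omega>' k" for r r' \<omega> \<omega>'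
  proof -
    have h: "h \<omega> j = h \<omega>' j" if "j < q" for j using that by (intro h_dep eq) auto
    have z: "z \<omega> j = z \<omega>' j" if "j < q" for j using that by (intro z_dep eq) auto
    have e: "\<omega> (l, r, j) = \<omega>' (l, r, j)" if "j < q" for j
      using that \<open>r \<in> T\<close> \<open>r \<noteq> r'\<close> T rows by (intro eq) auto
    have "rd \<omega> r (h \<omega>) = rd \<omega>' r (h \<omega>')" "rd \<omega> r (z \<omega>) = rd \<omega>' r (z \<omega>')"
      unfolding rd_def by (intro sum.cong; simp add: h z e)+
    then show ?thesis using cong[of "h \<omega>" "h \<omega>'" "z \<omega>" "z \<omega>'"] h z by simp
  qed
  fix r and x :: "nat \<times> nat \<times> nat \<Rightarrow> real" assume "r \<in> T"
  let ?m = "\<lambda>y. merge (I - J r) (J r) (x, y)"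
  have h: "h (?m y) j = h x j" if "j < q" for j y using that by (intro h_dep) (auto simp: merge_def)
  have z: "z (?m y) j = z x j" if "j < q" for j y using that by (intro z_dep) (auto simp: merge_def)
  have rd: "rd (?m y) r v = (\<Sum>k\<in>J r. cf v' k * y k)" if "\<And>j. j < q \<Longrightarrow> v j = v' j" for y v v'
    unfolding rd_def J_sum by (intro sum.cong) (auto simp: merge_def that)
  have "\<Phi> (h (?m y)) (z (?m y)) (rd (?m y) r (h (?m y))) (rd (?m y) r (z (?m y)))
    = \<Phi> (h x) (z x) (\<Sum>k\<in>J r. cf (h x) k * y k) (\<Sum>k\<in>J r. cf (z x) k * y k)" for y
    using cong[of "h (?m y)" "h x" "z (?m y)" "z x"] h z rd[of "h (?m y)" "h x" y] rd[of "z (?m y)" "z x" y] by simp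
  then show "(\<integral>\<^sup>+y. \<Phi> (h (?m y)) (z (?m y)) (rd (?m y) r (h (?m y))) (rd (?m y) r (z (?m y)))
     \<partial>PiM (J r) (\<lambda>_. gaussian)) \<le> A"
    using bound[of r "h x" "z x"] by simp
qed

lemma layer_markov:
  fixes \<Phi> :: "(nat \<Rightarrow> real) \<Rightarrow> (nat \<Rightarrow> real) \<Rightarrow> real \<Rightarrow> real \<Rightarrow> ennreal" and a t :: real
  assumes T: "T \<subseteq> R"
    and meas: "\<And>r. r \<in> R \<Longrightarrow> (\<lambda>\<omega>. \<Phi> (h \<omega>) (z \<omega>) (rd \<omega> r (h \<omega>)) (rd \<omega> r (z \<omega>))) \<in> borel_measurable P"
    and cong: "\<And>u u' v v' a b. (\<And>j. j < q \<Longrightarrow> u j = u' j) \<Longrightarrow> (\<And>j. j < q \<Longrightarrow> v j = v' j) \<Longrightarrow> \<Phi> u v a b = \<Phi> u' v' a b"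
    and bound: "\<And>u v r. (\<integral>\<^sup>+y. \<Phi> u v (\<Sum>k\<in>J r. cf u k * y k) (\<Sum>k\<in>J r. cf v k * y k) \<partial>PiM (J r) (\<lambda>_. gaussian)) \<le> ennreal (exp a)"
    and B: "B \<in> sets P"
    and le: "\<And>\<omega>. \<omega> \<in> B \<Longrightarrow> ennreal (exp t) \<le> (\<Prod>r\<in>T. \<Phi> (h \<omega>) (z \<omega>) (rd \<omega> r (h \<omega>)) (rd \<omega> r (z \<omega>)))"
  shows "measure P B \<le> exp (real (card T) * a - t)"
proof (rule emeasure_markov_le[OF prob_space_PiM_gaussian B _ _ le])
  show "(\<lambda>\<omega>. \<Prod>r\<in>T. \<Phi> (h \<omega>) (z \<omega>) (rd \<omega> r (h \<omega>)) (rd \<omega> r (z \<omega>))) \<in> borel_measurable P"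
    using meas T by (intro borel_measurable_prod_ennreal) auto
  have "(\<integral>\<^sup>+\<omega>. (\<Prod>r\<in>T. \<Phi> (h \<omega>) (z \<omega>) (rd \<omega> r (h \<omega>)) (rd \<omega> r (z \<omega>))) \<partial>P) \<le> ennreal (exp a) ^ card T"
    by (rule layer_integral[OF T meas cong bound])
  also have "\<dots> = ennreal (exp (real (card T) * a))"
    by (simp add: ennreal_power exp_of_nat_mult)
  finally show "(\<integral>\<^sup>+\<omega>. (\<Prod>r\<in>T. \<Phi> (h \<omega>) (z \<omega>) (rd \<omega> r (h \<omega>)) (rd \<omega> r (z \<omega>))) \<partial>P) \<le> ennreal (exp (real (card T) * a))" .
qed

lemma unit_coefficients:
  assumes "0 < L2_set v {..<q}"
  shows "(\<Sum>k\<in>J r. (cf v k / L2_set v {..<q})\<^sup>2) = 1"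
proof -
  have "(\<Sum>k\<in>J r. (cf v k / L2_set v {..<q})\<^sup>2) = (L2_set v {..<q})\<^sup>2 / (L2_set v {..<q})\<^sup>2"
    unfolding J_sum by (simp add: power_divide L2_set_sq flip: sum_divide_distrib)
  then show ?thesis using assms by simp
qed

lemma prod_exp_ennreal: "finite T \<Longrightarrow> (\<Prod>r\<in>T. ennreal (exp (f r))) = ennreal (exp (\<Sum>r\<in>T. f r))"
  by (simp add: prod_ennreal exp_sum)

definition gt :: "(nat \<times> nat \<times> nat \<Rightarrow> real) \<Rightarrow> nat \<Rightarrow> real" where
  "gt \<omega> r = (if rd \<omega> r (h \<omega>) \<ge> 0 then 1 else 0)"

text \<open>The sign of \<open>\<theta>\<close> selects the tail, so one statement yields upper and
  lower deviations. The rate per row averages the second-order bound of \<open>inv_sqrt_le\<close>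
  with the value 1 of a closed gate.\<close>

lemma layer_gate:
  fixes \<theta> t :: real
  assumes \<theta>: "\<bar>\<theta>\<bar> \<le> 1 / 8"
  defines "B \<equiv> {\<omega> \<in> space P. 0 < L2_set (h \<omega>) {..<q} \<and> 0 < L2_set (z \<omega>) {..<q} \<and>
    t * (L2_set (z \<omega>) {..<q})\<^sup>2 \<le> \<theta> * (\<Sum>r\<in>R. gt \<omega> r * (rd \<omega> r (z \<omega>))\<^sup>2)}"
  shows "B \<in> sets P" "measure P B \<le> exp (real (card R) * (\<theta> / 2 + \<theta>\<^sup>2) - t)"
proof -
  \<comment> \<open>The value 0 on degenerate inputs keeps the row bound true for all
    \<open>u\<close> and \<open>v\<close>; nothing is lost, since \<open>B\<close> demands positive
    norms.\<close>
  define \<Phi> where "\<Phi> u v a b = (if L2_set u {..<q} \<le> 0 \<or> L2_set v {..<q} \<le> 0 then 0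
    else ennreal (exp (\<theta> * ((if a \<ge> 0 then 1 else 0) * (b / L2_set v {..<q})\<^sup>2))))" for u v :: "nat \<Rightarrow> real" and a b :: real
  let ?F = "\<lambda>\<omega> r. \<Phi> (h \<omega>) (z \<omega>) (rd \<omega> r (h \<omega>)) (rd \<omega> r (z \<omega>))"
  have F_meas: "(\<lambda>\<omega>. ?F \<omega> r) \<in> borel_measurable P" if [simp]: "r \<in> R" for r
    unfolding \<Phi>_def by measurable
  have "(\<lambda>\<omega>. \<Sum>r\<in>R. gt \<omega> r * (rd \<omega> r (z \<omega>))\<^sup>2) \<in> borel_measurable P"
    unfolding gt_def by (intro borel_measurable_sum) measurable
  then have "{\<omega> \<in> space P. t * (L2_set (z \<omega>) {..<q})\<^sup>2 \<le> \<theta> * (\<Sum>r\<in>R. gt \<omega> r * (rd \<omega> r (z \<omega>))\<^sup>2)} \<in> sets P"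
    using norm_meas by (intro borel_measurable_le borel_measurable_times borel_measurable_power borel_measurable_const)
  moreover have "{\<omega> \<in> space P. 0 < L2_set (h \<omega>) {..<q} \<and> 0 < L2_set (z \<omega>) {..<q}} \<in> sets P"
    by measurable
  ultimately have "{\<omega> \<in> space P. 0 < L2_set (h \<omega>) {..<q} \<and> 0 < L2_set (z \<omega>) {..<q}}
    \<inter> {\<omega> \<in> space P. t * (L2_set (z \<omega>) {..<q})\<^sup>2 \<le> \<theta> * (\<Sum>r\<in>R. gt \<omega> r * (rd \<omega> r (z \<omega>))\<^sup>2)} \<in> sets P"
    by blast
  then show B: "B \<in> sets P"
    by (rule back_subst[where P = "\<lambda>X. X \<in> sets P"]) (auto simp: B_def)
  have row: "(\<integral>\<^sup>+y. \<Phi> u v (\<Sum>k\<in>J r. cf u k * y k) (\<Sum>k\<in>J r. cf v k * y k) \<partial>PiM (J r) (\<lambda>_. gaussian))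
      \<le> ennreal (exp (\<theta> / 2 + \<theta>\<^sup>2))" for u v r
  proof (cases "L2_set u {..<q} \<le> 0 \<or> L2_set v {..<q} \<le> 0")
    case True
    then have "\<Phi> u v a b = 0" for a b by (simp only: \<Phi>_def if_True)
    then show ?thesis by simp
  next
    case False
    let ?N = "L2_set v {..<q}"
    define b where "b k = cf v k / ?N" for k :: "nat \<times> nat \<times> nat"
    have b1: "(\<Sum>k\<in>J r. (b k)\<^sup>2) = 1"
      unfolding b_def by (rule unit_coefficients) (use False in auto)
    have "0 < L2_set (cf u) (J r)"
      unfolding J_norm using False L2_set_nonneg[of u "{..<q}"] by (simp add: order_less_le)
    then have "(\<integral>\<^sup>+y. ennreal (exp (\<theta> * ((if (\<Sum>k\<in>J r. cf u k * y k) \<ge> 0 then 1 else 0) * (\<Sum>k\<in>J r. b k * y k)\<^sup>2)))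
        \<partial>PiM (J r) (\<lambda>_. gaussian)) = ennreal ((1 + 1 / sqrt (1 - 2 * \<theta> * (\<Sum>k\<in>J r. (b k)\<^sup>2))) / 2)"
      by (intro gaussian_gated_exp_sq) (use \<theta> b1 in \<open>auto simp: abs_le_iff\<close>)
    moreover have "(\<Sum>k\<in>J r. b k * y k) = (\<Sum>k\<in>J r. cf v k * y k) / ?N" for y :: "nat \<times> nat \<times> nat \<Rightarrow> real"
      by (simp add: b_def sum_divide_distrib)
    ultimately have "(\<integral>\<^sup>+y. \<Phi> u v (\<Sum>k\<in>J r. cf u k * y k) (\<Sum>k\<in>J r. cf v k * y k) \<partial>PiM (J r) (\<lambda>_. gaussian))
      = ennreal ((1 + 1 / sqrt (1 - 2 * \<theta>)) / 2)"
      using False by (simp only: \<Phi>_def b1 if_False mult_1_right)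
    also have "\<dots> \<le> ennreal (exp (\<theta> / 2 + \<theta>\<^sup>2))"
    proof (rule ennreal_leI)
      have "(1 + 1 / sqrt (1 - 2 * \<theta>)) / 2 \<le> 1 + (\<theta> / 2 + \<theta>\<^sup>2)" using inv_sqrt_le[OF \<theta>] by simp
      also have "\<dots> \<le> exp (\<theta> / 2 + \<theta>\<^sup>2)" by (rule exp_ge_add_one_self)
      finally show "(1 + 1 / sqrt (1 - 2 * \<theta>)) / 2 \<le> exp (\<theta> / 2 + \<theta>\<^sup>2)" .
    qed
    finally show ?thesis .
  qed
  show "measure P B \<le> exp (real (card R) * (\<theta> / 2 + \<theta>\<^sup>2) - t)"
  proof (rule layer_markov[OF order_refl F_meas _ row B])
    fix u u' v v' :: "nat \<Rightarrow> real" and a b :: real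
    assume "\<And>j. j < q \<Longrightarrow> u j = u' j" "\<And>j. j < q \<Longrightarrow> v j = v' j"
    then have "L2_set u {..<q} = L2_set u' {..<q}" "L2_set v {..<q} = L2_set v' {..<q}"
      by (auto intro!: L2_set_cong)
    then show "\<Phi> u v a b = \<Phi> u' v' a b" by (simp only: \<Phi>_def)
  next
    fix \<omega> assume \<omega>: "\<omega> \<in> B"
    let ?N = "L2_set (z \<omega>) {..<q}"
    have nz: "0 < L2_set (h \<omega>) {..<q}" "0 < ?N" using \<omega> by (auto simp: B_def)
    have nz': "\<not> (L2_set (h \<omega>) {..<q} \<le> 0 \<or> ?N \<le> 0)" using nz by auto
    have "(\<Prod>r\<in>R. ?F \<omega> r) = (\<Prod>r\<in>R. ennreal (exp (\<theta> * (gt \<omega> r * (rd \<omega> r (z \<omega>) / ?N)\<^sup>2))))"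
      using nz' by (simp only: \<Phi>_def gt_def if_False)
    also have "\<dots> = ennreal (exp (\<Sum>r\<in>R. \<theta> * (gt \<omega> r * (rd \<omega> r (z \<omega>) / ?N)\<^sup>2)))"
      by (rule prod_exp_ennreal[OF finR])
    also have "(\<Sum>r\<in>R. \<theta> * (gt \<omega> r * (rd \<omega> r (z \<omega>) / ?N)\<^sup>2)) = \<theta> * (\<Sum>r\<in>R. gt \<omega> r * (rd \<omega> r (z \<omega>))\<^sup>2) / ?N\<^sup>2"
      by (simp add: sum_distrib_left sum_divide_distrib power_divide)
    also have "ennreal (exp \<dots>) \<ge> ennreal (exp t)"
      using \<omega> nz by (intro ennreal_leI) (simp add: B_def field_simps)
    finally show "ennreal (exp t) \<le> (\<Prod>r\<in>R. ?F \<omega> r)" .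
  qed
qed

text \<open>Meant for few rows and a threshold far above their number, where the fixed tilt
  \<open>1 / 4\<close> is enough; its moment is \<open>sqrt 2 <= exp (1 / 2)\<close>.\<close>

lemma layer_rows:
  fixes t :: real
  assumes T: "T \<subseteq> R"
  defines "B \<equiv> {\<omega> \<in> space P. 0 < L2_set (z \<omega>) {..<q} \<and>
    t * (L2_set (z \<omega>) {..<q})\<^sup>2 \<le> (\<Sum>r\<in>T. (rd \<omega> r (z \<omega>))\<^sup>2)}"
  shows "B \<in> sets P" "measure P B \<le> exp (real (card T) / 2 - t / 4)"
proof -
  have finT: "finite T" using T finR by (rule finite_subset)
  define \<Phi> where "\<Phi> u v a b = (if L2_set v {..<q} \<le> 0 then 0
    else ennreal (exp (1 / 4 * (b / L2_set v {..<q})\<^sup>2)))" for u v :: "nat \<Rightarrow> real" and a b :: real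
  let ?F = "\<lambda>\<omega> r. \<Phi> (h \<omega>) (z \<omega>) (rd \<omega> r (h \<omega>)) (rd \<omega> r (z \<omega>))"
  have F_meas: "(\<lambda>\<omega>. ?F \<omega> r) \<in> borel_measurable P" if [simp]: "r \<in> R" for r
    unfolding \<Phi>_def by measurable
  have "(\<lambda>\<omega>. \<Sum>r\<in>T. (rd \<omega> r (z \<omega>))\<^sup>2) \<in> borel_measurable P"
    using T by (intro borel_measurable_sum borel_measurable_power rd_meas) auto
  then have "{\<omega> \<in> space P. t * (L2_set (z \<omega>) {..<q})\<^sup>2 \<le> (\<Sum>r\<in>T. (rd \<omega> r (z \<omega>))\<^sup>2)} \<in> sets P"
    using norm_meas by (intro borel_measurable_le borel_measurable_times borel_measurable_power borel_measurable_const)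
  moreover have "{\<omega> \<in> space P. 0 < L2_set (z \<omega>) {..<q}} \<in> sets P"
    by measurable
  ultimately have "{\<omega> \<in> space P. 0 < L2_set (z \<omega>) {..<q}}
    \<inter> {\<omega> \<in> space P. t * (L2_set (z \<omega>) {..<q})\<^sup>2 \<le> (\<Sum>r\<in>T. (rd \<omega> r (z \<omega>))\<^sup>2)} \<in> sets P"
    by blast
  then show B: "B \<in> sets P"
    by (rule back_subst[where P = "\<lambda>X. X \<in> sets P"]) (auto simp: B_def)
  have row: "(\<integral>\<^sup>+y. \<Phi> u v (\<Sum>k\<in>J r. cf u k * y k) (\<Sum>k\<in>J r. cf v k * y k) \<partial>PiM (J r) (\<lambda>_. gaussian))
      \<le> ennreal (exp (1 / 2))" for u v r
  proof (cases "L2_set v {..<q} \<le> 0")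
    case True
    then have "\<Phi> u v a b = 0" for a b by (simp only: \<Phi>_def if_True)
    then show ?thesis by simp
  next
    case False
    let ?N = "L2_set v {..<q}"
    define b where "b k = cf v k / ?N" for k :: "nat \<times> nat \<times> nat"
    have b1: "(\<Sum>k\<in>J r. (b k)\<^sup>2) = 1"
      unfolding b_def by (rule unit_coefficients) (use False in auto)
    have "(\<integral>\<^sup>+y. ennreal (exp (1 / 4 * (\<Sum>k\<in>J r. b k * y k)\<^sup>2)) \<partial>PiM (J r) (\<lambda>_. gaussian))
        = ennreal (1 / sqrt (1 - 2 * (1 / 4) * (\<Sum>k\<in>J r. (b k)\<^sup>2)))"
      by (intro gaussian_lincomb_exp_sq) (use b1 in auto)
    moreover have "(\<Sum>k\<in>J r. b k * y k) = (\<Sum>k\<in>J r. cf v k * y k) / ?N" for y :: "nat \<times> nat \<times> nat \<Rightarrow> real"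
      by (simp add: b_def sum_divide_distrib)
    ultimately have "(\<integral>\<^sup>+y. \<Phi> u v (\<Sum>k\<in>J r. cf u k * y k) (\<Sum>k\<in>J r. cf v k * y k) \<partial>PiM (J r) (\<lambda>_. gaussian))
      = ennreal (1 / sqrt (1 - 2 * (1 / 4) * 1))"
      using False by (simp only: \<Phi>_def b1 if_False)
    also have "\<dots> = ennreal (1 / sqrt (1 / 2))" by simp
    also have "\<dots> \<le> ennreal (exp (1 / 2))"
    proof (rule ennreal_leI)
      have "1 / sqrt (1 / 2) = sqrt 2" by (simp add: real_sqrt_divide)
      also have "\<dots> \<le> 3 / 2" by (rule real_le_lsqrt) (auto simp: power2_eq_square)
      also have "\<dots> \<le> exp (1 / 2 :: real)" using exp_ge_add_one_self[of "1 / 2 :: real"] by simp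
      finally show "1 / sqrt (1 / 2) \<le> exp (1 / 2 :: real)" .
    qed
    finally show ?thesis .
  qed
  have "measure P B \<le> exp (real (card T) * (1 / 2) - t / 4)"
  proof (rule layer_markov[OF T F_meas _ row B])
    fix u u' v v' :: "nat \<Rightarrow> real" and a b :: real
    assume "\<And>j. j < q \<Longrightarrow> v j = v' j"
    then have "L2_set v {..<q} = L2_set v' {..<q}" by (auto intro!: L2_set_cong)
    then show "\<Phi> u v a b = \<Phi> u' v' a b" by (simp only: \<Phi>_def)
  next
    fix \<omega> assume \<omega>: "\<omega> \<in> B"
    let ?N = "L2_set (z \<omega>) {..<q}"
    have nz: "0 < ?N" using \<omega> by (auto simp: B_def)
    have nz': "\<not> ?N \<le> 0" using nz by auto
    have "(\<Prod>r\<in>T. ?F \<omega> r) = (\<Prod>r\<in>T. ennreal (exp (1 / 4 * (rd \<omega> r (z \<omega>) / ?N)\<^sup>2)))"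
      using nz' by (simp only: \<Phi>_def if_False)
    also have "\<dots> = ennreal (exp (\<Sum>r\<in>T. 1 / 4 * (rd \<omega> r (z \<omega>) / ?N)\<^sup>2))"
      by (rule prod_exp_ennreal[OF finT])
    also have "(\<Sum>r\<in>T. 1 / 4 * (rd \<omega> r (z \<omega>) / ?N)\<^sup>2) = (\<Sum>r\<in>T. (rd \<omega> r (z \<omega>))\<^sup>2) / ?N\<^sup>2 / 4"
      by (simp add: sum_divide_distrib power_divide mult.commute)
    also have "ennreal (exp \<dots>) \<ge> ennreal (exp (t / 4))"
      using \<omega> nz by (intro ennreal_leI) (simp add: B_def field_simps)
    finally show "ennreal (exp (t / 4)) \<le> (\<Prod>r\<in>T. ?F \<omega> r)" .
  qed
  then show "measure P B \<le> exp (real (card T) / 2 - t / 4)" by simp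
qed

text \<open>The exponential of an indicator is at most 1 plus twice the indicator, as
  \<open>e <= 3\<close>. With the norm of \<open>h\<close> at least \<open>1 / 2\<close> the small
  ball has probability at most \<open>2 \<beta>\<close>, hence the moment
  \<open>1 + 4 \<beta>\<close> per row.\<close>

lemma layer_small_ball:
  fixes \<beta> t :: real
  assumes \<beta>: "0 \<le> \<beta>"
  defines "B \<equiv> {\<omega> \<in> space P. L2_set (h \<omega>) {..<q} \<ge> 1 / 2 \<and> t \<le> real (card {r \<in> R. \<bar>rd \<omega> r (h \<omega>)\<bar> \<le> \<beta>})}"
  shows "B \<in> sets P" "measure P B \<le> exp (4 * \<beta> * real (card R) - t)"
proof -
  define \<Phi> where "\<Phi> u v a b = (if L2_set u {..<q} < 1 / 2 then 0
    else ennreal (exp (if \<bar>a\<bar> \<le> \<beta> then 1 else 0)))" for u v :: "nat \<Rightarrow> real" and a b :: real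
  let ?F = "\<lambda>\<omega> r. \<Phi> (h \<omega>) (z \<omega>) (rd \<omega> r (h \<omega>)) (rd \<omega> r (z \<omega>))"
  have F_meas: "(\<lambda>\<omega>. ?F \<omega> r) \<in> borel_measurable P" if [simp]: "r \<in> R" for r
    unfolding \<Phi>_def by measurable
  have count: "real (card {r \<in> R. \<bar>rd \<omega> r (h \<omega>)\<bar> \<le> \<beta>}) = (\<Sum>r\<in>R. if \<bar>rd \<omega> r (h \<omega>)\<bar> \<le> \<beta> then 1 else 0)" for \<omega>
    using finR by (simp add: sum.If_cases Int_def)
  have "(\<lambda>\<omega>. \<Sum>r\<in>R. if \<bar>rd \<omega> r (h \<omega>)\<bar> \<le> \<beta> then 1 else 0 :: real) \<in> borel_measurable P"
    by (intro borel_measurable_sum) measurable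
  note [measurable] = this
  show B: "B \<in> sets P" unfolding B_def count by measurable
  have row: "(\<integral>\<^sup>+y. \<Phi> u v (\<Sum>k\<in>J r. cf u k * y k) (\<Sum>k\<in>J r. cf v k * y k) \<partial>PiM (J r) (\<lambda>_. gaussian))
      \<le> ennreal (exp (4 * \<beta>))" for u v r
  proof (cases "L2_set u {..<q} < 1 / 2")
    case True
    then have "\<Phi> u v a b = 0" for a b by (simp only: \<Phi>_def if_True)
    then show ?thesis by simp
  next
    case False
    let ?S = "{y \<in> space (PiM (J r) (\<lambda>_. gaussian)). \<bar>\<Sum>k\<in>J r. cf u k * y k\<bar> \<le> \<beta>}"
    have S: "?S \<in> sets (PiM (J r) (\<lambda>_. gaussian))" by measurable
    have "(\<integral>\<^sup>+y. \<Phi> u v (\<Sum>k\<in>J r. cf u k * y k) (\<Sum>k\<in>J r. cf v k * y k) \<partial>PiM (J r) (\<lambda>_. gaussian))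
      \<le> (\<integral>\<^sup>+y. 1 + 2 * indicator ?S y \<partial>PiM (J r) (\<lambda>_. gaussian))"
    proof (rule nn_integral_mono)
      fix y assume y: "y \<in> space (PiM (J r) (\<lambda>_. gaussian))"
      show "\<Phi> u v (\<Sum>k\<in>J r. cf u k * y k) (\<Sum>k\<in>J r. cf v k * y k) \<le> 1 + 2 * indicator ?S y"
      proof (cases "y \<in> ?S")
        case True
        have "ennreal (exp 1) \<le> ennreal 3" using exp_le by (rule ennreal_leI)
        then show ?thesis using False True by (simp add: \<Phi>_def)
      next
        case nS: False
        then show ?thesis using False y by (simp add: \<Phi>_def)
      qed
    qed
    also have "\<dots> = 1 + 2 * emeasure (PiM (J r) (\<lambda>_. gaussian)) ?S"
      using S prob_space.emeasure_space_1[OF prob_space_PiM_gaussian[of "J r"]]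
      by (subst nn_integral_add) (auto simp: nn_integral_cmult)
    also have "\<dots> \<le> 1 + 2 * ennreal (\<beta> / L2_set u {..<q})"
      using gaussian_lincomb_small_ball[where b = "cf u" and J = "J r" and \<beta> = \<beta>] \<beta> False
      by (intro add_left_mono mult_left_mono) (auto simp: J_norm)
    also have "\<dots> \<le> 1 + 2 * ennreal (2 * \<beta>)"
    proof -
      have "\<beta> / L2_set u {..<q} \<le> \<beta> / (1 / 2)" using \<beta> False by (intro divide_left_mono) auto
      then show ?thesis by (intro add_left_mono mult_left_mono ennreal_leI) auto
    qed
    also have "\<dots> = ennreal (1 + 4 * \<beta>)"
    proof -
      have "2 * ennreal (2 * \<beta>) = ennreal (2 * (2 * \<beta>))" using \<beta> by (subst ennreal_mult) auto
      then show ?thesis using \<beta> by (simp add: ennreal_plus)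
    qed
    also have "\<dots> \<le> ennreal (exp (4 * \<beta>))" by (intro ennreal_leI exp_ge_add_one_self)
    finally show ?thesis .
  qed
  have "measure P B \<le> exp (real (card R) * (4 * \<beta>) - t)"
  proof (rule layer_markov[OF order_refl F_meas _ row B])
    fix u u' v v' :: "nat \<Rightarrow> real" and a b :: real
    assume "\<And>j. j < q \<Longrightarrow> u j = u' j"
    then have "L2_set u {..<q} = L2_set u' {..<q}" by (auto intro!: L2_set_cong)
    then show "\<Phi> u v a b = \<Phi> u' v' a b" by (simp only: \<Phi>_def)
  next
    fix \<omega> assume \<omega>: "\<omega> \<in> B"
    have "\<not> L2_set (h \<omega>) {..<q} < 1 / 2" using \<omega> by (auto simp: B_def)
    then have "(\<Prod>r\<in>R. ?F \<omega> r) = (\<Prod>r\<in>R. ennreal (exp (if \<bar>rd \<omega> r (h \<omega>)\<bar> \<le> \<beta> then 1 else 0)))"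
      by (simp only: \<Phi>_def if_False simp_thms)
    also have "\<dots> = ennreal (exp (\<Sum>r\<in>R. if \<bar>rd \<omega> r (h \<omega>)\<bar> \<le> \<beta> then 1 else 0))"
      by (rule prod_exp_ennreal[OF finR])
    also have "\<dots> \<ge> ennreal (exp t)"
      unfolding count[symmetric] using \<omega> by (intro ennreal_leI) (simp add: B_def)
    finally show "ennreal (exp t) \<le> (\<Prod>r\<in>R. ?F \<omega> r)" .
  qed
  then show "measure P B \<le> exp (4 * \<beta> * real (card R) - t)" by (simp add: mult.commute)
qed

end

section \<open>Operator bounds from a finite net\<close>

text \<open>Rounding to the lattice \<open>\<int> / sqrt q\<close> moves a vector with \<open>q\<close> coordinates by at most \<open>1 / 2\<close>; counting
  lattice points by a generating function keeps the net exponential in \<open>q\<close>.\<close>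

definition lattice_ball :: "nat set \<Rightarrow> nat \<Rightarrow> (nat \<Rightarrow> int) set" where
  "lattice_ball Q q = {z. (\<forall>j. j \<notin> Q \<longrightarrow> z j = 0) \<and> (\<Sum>j\<in>Q. (real_of_int (z j))\<^sup>2) \<le> 9 / 4 * real q}"

definition net_on :: "nat set \<Rightarrow> nat \<Rightarrow> (nat \<Rightarrow> real) set" where
  "net_on Q q = (\<lambda>z j. real_of_int (z j) / sqrt (real q)) ` lattice_ball Q q"

text \<open>The constant bound is not inductive, but \<open>3 - 2 (1 / 2)^B\<close> is: the next
  pair of terms adds at most \<open>2 (1 / 2)^(B + 1)\<close>.\<close>

lemma sum_exp_sq_int: "(\<Sum>i\<in>{- int B..int B}. exp (- (real_of_int i)\<^sup>2)) \<le> 3"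
proof (induction B)
  case 0
  then show ?case by simp
next
  case (Suc B)
  have "(\<Sum>i\<in>{- int B..int B}. exp (- (real_of_int i)\<^sup>2)) \<le> 3 - 2 * (1 / 2) ^ B" for B
  proof (induction B)
    case (Suc B)
    have split: "{- int (Suc B)..int (Suc B)} = insert (int (Suc B)) (insert (- int (Suc B)) {- int B..int B})"
      by auto
    have "real (Suc B) * 1 \<le> real (Suc B) * real (Suc B)" by (intro mult_left_mono) auto
    then have "exp (- (real (Suc B))\<^sup>2) \<le> exp (- real (Suc B))"
      by (simp only: exp_le_cancel_iff power2_eq_square neg_le_iff_le mult_1_right)
    also have "\<dots> = exp (- 1) ^ Suc B" by (subst exp_of_nat_mult[symmetric]) simp
    also have "\<dots> \<le> (1 / 2) ^ Suc B"
      using exp_ge_add_one_self[of "1 :: real"] by (intro power_mono) (auto simp: exp_minus field_simps)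
    finally have e: "exp (- (real (Suc B))\<^sup>2) \<le> (1 / 2) ^ Suc B" .
    have "(\<Sum>i\<in>{- int (Suc B)..int (Suc B)}. exp (- (real_of_int i)\<^sup>2))
      = 2 * exp (- (real (Suc B))\<^sup>2) + (\<Sum>i\<in>{- int B..int B}. exp (- (real_of_int i)\<^sup>2))"
      unfolding split by (simp add: power2_eq_square algebra_simps)
    then show ?case using e Suc by simp
  qed simp
  then show ?case by (rule order_trans) simp
qed

text \<open>On the ball the weight \<open>exp (9 / 4 q - sum of squares)\<close> is at least 1.
  Summed over a whole box it factors into one-dimensional sums of at most \<open>exp 2\<close>, and
  \<open>9 / 4 + 2 <= 5\<close>.\<close>

lemma lattice_ball_finite_card:
  assumes Q: "finite Q" "card Q \<le> q"
  shows "finite (lattice_ball Q q)" "real (card (lattice_ball Q q)) \<le> exp (5 * real q)"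
proof -
  \<comment> \<open>An integer satisfies \<open>\<bar>z\<bar> <= z^2 <= 9 / 4 q\<close>, so the box
    of this radius contains the ball.\<close>
  define B where "B = 3 * q"
  let ?D = "PiE Q (\<lambda>_. {- int B..int B})"
  let ?r = "\<lambda>z. restrict z Q"
  have fin: "finite ?D" using Q by (intro finite_PiE) auto
  have inj: "inj_on ?r (lattice_ball Q q)"
  proof (rule inj_onI)
    fix z z' assume a: "z \<in> lattice_ball Q q" "z' \<in> lattice_ball Q q" and eq: "?r z = ?r z'"
    show "z = z'"
    proof
      fix j show "z j = z' j"
        using a eq by (cases "j \<in> Q") (auto simp: lattice_ball_def restrict_def fun_eq_iff split: if_splits)
    qed
  qed
  have sub: "?r ` lattice_ball Q q \<subseteq> ?D"
  proof
    fix f assume "f \<in> ?r ` lattice_ball Q q"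
    then obtain z where z: "z \<in> lattice_ball Q q" "f = ?r z" by auto
    have "- int B \<le> z j \<and> z j \<le> int B" if j: "j \<in> Q" for j
    proof -
      have "(real_of_int (z j))\<^sup>2 \<le> (\<Sum>j\<in>Q. (real_of_int (z j))\<^sup>2)"
        using Q j by (intro member_le_sum) auto
      also have "\<dots> \<le> 9 / 4 * real q" using z by (simp add: lattice_ball_def)
      also have "\<dots> \<le> real B" by (simp add: B_def)
      finally have "(real_of_int (z j))\<^sup>2 \<le> real B" .
      moreover have "real_of_int \<bar>z j\<bar> \<le> (real_of_int (z j))\<^sup>2"
      proof -
        have "\<bar>z j\<bar> \<le> \<bar>z j\<bar> * \<bar>z j\<bar>" using mult_left_mono[of 1 "\<bar>z j\<bar>" "\<bar>z j\<bar>"] by (cases "z j = 0") auto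
        then have "real_of_int \<bar>z j\<bar> \<le> real_of_int (\<bar>z j\<bar> * \<bar>z j\<bar>)" by (simp only: of_int_le_iff)
        then show ?thesis by (simp add: power2_eq_square)
      qed
      ultimately have "real_of_int \<bar>z j\<bar> \<le> real_of_int (int B)" by simp
      then have "\<bar>z j\<bar> \<le> int B" by (simp only: of_int_le_iff)
      then show ?thesis by auto
    qed
    then show "f \<in> ?D" using z by auto
  qed
  show f: "finite (lattice_ball Q q)"
    using finite_imageD[OF finite_subset[OF sub fin] inj] .
  have "real (card (lattice_ball Q q)) = (\<Sum>f\<in>?r ` lattice_ball Q q. 1)"
    by (simp add: card_image[OF inj])
  also have "\<dots> \<le> (\<Sum>f\<in>?r ` lattice_ball Q q. exp (9 / 4 * real q) * (\<Prod>j\<in>Q. exp (- (real_of_int (f j))\<^sup>2)))"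
  proof (rule sum_mono)
    fix f assume "f \<in> ?r ` lattice_ball Q q"
    then obtain z where z: "z \<in> lattice_ball Q q" "f = ?r z" by auto
    have "(\<Prod>j\<in>Q. exp (- (real_of_int (f j))\<^sup>2)) = exp (- (\<Sum>j\<in>Q. (real_of_int (z j))\<^sup>2))"
      using Q z by (simp add: exp_sum sum_negf[symmetric])
    then have "exp (9 / 4 * real q) * (\<Prod>j\<in>Q. exp (- (real_of_int (f j))\<^sup>2))
      = exp (9 / 4 * real q + - (\<Sum>j\<in>Q. (real_of_int (z j))\<^sup>2))"
      by (simp only: exp_add)
    moreover have "1 \<le> \<dots>" using z by (simp add: lattice_ball_def)
    ultimately show "1 \<le> exp (9 / 4 * real q) * (\<Prod>j\<in>Q. exp (- (real_of_int (f j))\<^sup>2))" by simp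
  qed
  also have "\<dots> \<le> (\<Sum>f\<in>?D. exp (9 / 4 * real q) * (\<Prod>j\<in>Q. exp (- (real_of_int (f j))\<^sup>2)))"
    using fin sub by (intro sum_mono2) (auto intro!: mult_nonneg_nonneg prod_nonneg)
  also have "\<dots> = exp (9 / 4 * real q) * (\<Prod>j\<in>Q. \<Sum>i\<in>{- int B..int B}. exp (- (real_of_int i)\<^sup>2))"
    using Q by (subst prod_sum_PiE) (auto simp: sum_distrib_left)
  also have "\<dots> \<le> exp (9 / 4 * real q) * (\<Prod>j\<in>Q. exp 2)"
  proof (intro mult_left_mono prod_mono)
    have "(3::real) \<le> exp 2" using exp_ge_add_one_self[of "2::real"] by simp
    then show "0 \<le> (\<Sum>i\<in>{- int B..int B}. exp (- (real_of_int i)\<^sup>2))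
      \<and> (\<Sum>i\<in>{- int B..int B}. exp (- (real_of_int i)\<^sup>2)) \<le> exp 2" for j
      using sum_exp_sq_int[of B] by (auto intro: sum_nonneg)
  qed auto
  also have "\<dots> = exp (9 / 4 * real q + real (card Q) * 2)"
    by (simp add: exp_add exp_of_nat_mult)
  also have "\<dots> \<le> exp (5 * real q)" using Q by simp
  finally show "real (card (lattice_ball Q q)) \<le> exp (5 * real q)" .
qed

lemma net_on_finite_card:
  assumes "finite Q" "card Q \<le> q"
  shows "finite (net_on Q q)" "real (card (net_on Q q)) \<le> exp (5 * real q)"
proof -
  show "finite (net_on Q q)" unfolding net_on_def using lattice_ball_finite_card[OF assms] by simp
  have "card (net_on Q q) \<le> card (lattice_ball Q q)"
    unfolding net_on_def using lattice_ball_finite_card[OF assms] by (intro card_image_le)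
  then show "real (card (net_on Q q)) \<le> exp (5 * real q)"
    using lattice_ball_finite_card(2)[OF assms] by linarith
qed

lemma net_on_approx:
  assumes Q: "finite Q" "card Q \<le> q" "q > 0" and v: "\<And>j. j \<notin> Q \<Longrightarrow> v j = 0" "L2_set v Q \<le> 1"
  obtains u where "u \<in> net_on Q q" "L2_set (\<lambda>j. v j - u j) Q \<le> 1 / 2" "L2_set u Q \<le> 3 / 2" "\<And>j. j \<notin> Q \<Longrightarrow> u j = 0"
proof -
  define z where "z j = (if j \<in> Q then round (v j * sqrt (real q)) else 0)" for j
  define u where "u j = real_of_int (z j) / sqrt (real q)" for j
  have sq: "sqrt (real q) > 0" using Q by simp
  have "\<bar>v j - u j\<bar> \<le> 1 / (2 * sqrt (real q))" if "j \<in> Q" for j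
  proof -
    have "\<bar>real_of_int (z j) - v j * sqrt (real q)\<bar> \<le> 1 / 2"
      using that of_int_round_abs_le[of "v j * sqrt (real q)"] by (simp add: z_def)
    moreover have "v j - u j = - (real_of_int (z j) - v j * sqrt (real q)) / sqrt (real q)"
      using sq by (simp add: u_def field_simps)
    ultimately have "\<bar>v j - u j\<bar> \<le> 1 / 2 / sqrt (real q)"
      using sq divide_right_mono[of "\<bar>real_of_int (z j) - v j * sqrt (real q)\<bar>" "1 / 2" "sqrt (real q)"]
      by (simp only: abs_divide abs_minus_cancel) simp
    then show ?thesis by simp
  qed
  then have "L2_set (\<lambda>j. v j - u j) Q \<le> L2_set (\<lambda>_. 1 / (2 * sqrt (real q))) Q"
    by (intro L2_set_abs_mono) auto
  also have "\<dots> = sqrt (real (card Q)) / (2 * sqrt (real q))" by (simp add: L2_set_constant)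
  also have "\<dots> \<le> 1 / 2" using Q sq by (simp add: field_simps)
  finally have d: "L2_set (\<lambda>j. v j - u j) Q \<le> 1 / 2" .
  have "L2_set u Q \<le> L2_set v Q + L2_set (\<lambda>j. v j - u j) Q"
    using L2_set_diff_le[of v "\<lambda>j. v j - u j" Q] by simp
  then have n: "L2_set u Q \<le> 3 / 2" using d v(2) by simp
  have "(\<Sum>j\<in>Q. (real_of_int (z j))\<^sup>2) = real q * (L2_set u Q)\<^sup>2"
    using Q by (simp add: L2_set_sq u_def power_divide flip: sum_divide_distrib)
  \<comment> \<open>Rounding takes a vector of the unit ball to norm at most \<open>3 / 2\<close>;
    this is the origin of the \<open>9 / 4\<close> in \<open>lattice_ball\<close>.\<close>
  also have "\<dots> \<le> real q * (3 / 2)\<^sup>2" using n by (intro mult_left_mono power_mono) auto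
  finally have "z \<in> lattice_ball Q q" by (auto simp: lattice_ball_def z_def power2_eq_square)
  then have "u \<in> net_on Q q" unfolding net_on_def u_def[abs_def] by (rule imageI)
  moreover have "u j = 0" if "j \<notin> Q" for j using that by (simp add: u_def z_def)
  ultimately show ?thesis using that d n by blast
qed

section \<open>Seminorm bounds from a net\<close>

locale seminorm_fun =
  fixes f :: "(nat \<Rightarrow> real) \<Rightarrow> real"
  assumes f_add: "\<And>u v. f (\<lambda>j. u j + v j) \<le> f u + f v"
    and f_scale: "\<And>c v. f (\<lambda>j. c * v j) = \<bar>c\<bar> * f v"
begin

lemma f_zero: "f (\<lambda>_. 0) = 0"
  using f_scale[of 0 "\<lambda>_. 0"] by simp

lemma f_sum: "finite A \<Longrightarrow> f (\<lambda>j. \<Sum>i\<in>A. g i j) \<le> (\<Sum>i\<in>A. f (g i))"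
proof (induction A rule: finite_induct)
  case (insert i A)
  then show ?case using f_add[of "g i" "\<lambda>j. \<Sum>i\<in>A. g i j"] by simp
qed (simp add: f_zero)

text \<open>For the supremum \<open>M\<close> over the unit ball, a net point of norm at most
  \<open>3 / 2\<close> and a remainder of norm at most \<open>1 / 2\<close> give
  \<open>M <= 3 / 2 K + M / 2\<close>.\<close>

lemma net_bound:
  assumes Q: "finite Q" "card Q \<le> q" "q > 0"
    and net: "\<And>u. u \<in> net_on Q q \<Longrightarrow> f u \<le> K * L2_set u Q" and K: "K \<ge> 0"
    and v: "\<And>j. j \<notin> Q \<Longrightarrow> v j = 0"
  shows "f v \<le> 3 * K * L2_set v Q"
proof -
  define S where "S = {v. (\<forall>j. j \<notin> Q \<longrightarrow> v j = 0) \<and> L2_set v Q \<le> 1}"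
  define M where "M = (SUP v\<in>S. f v)"
  \<comment> \<open>Finiteness a priori, without which \<open>M / 2\<close> could not be subtracted;
    the values on coordinate vectors suffice.\<close>
  have bdd: "bdd_above (f ` S)"
  proof (rule bdd_aboveI2)
    fix v assume v: "v \<in> S"
    have "f v = f (\<lambda>j. \<Sum>i\<in>Q. v i * (if j = i then 1 else 0))"
    proof (rule arg_cong[where f = f], rule ext)
      fix j
      have "(\<Sum>i\<in>Q. v i * (if j = i then 1 else 0)) = (\<Sum>i\<in>Q. if j = i then v i else 0)"
        by (intro sum.cong) auto
      then show "v j = (\<Sum>i\<in>Q. v i * (if j = i then 1 else 0))"
        using v Q by (auto simp: S_def)
    qed
    also have "\<dots> \<le> (\<Sum>i\<in>Q. \<bar>v i\<bar> * f (\<lambda>j. if j = i then 1 else 0))"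
      using f_sum[OF Q(1), of "\<lambda>i j. v i * (if j = i then 1 else 0)"] unfolding f_scale .
    also have "\<dots> \<le> (\<Sum>i\<in>Q. 1 * \<bar>f (\<lambda>j. if j = i then 1 else 0)\<bar>)"
    proof (rule sum_mono)
      fix i assume i: "i \<in> Q"
      have "\<bar>v i\<bar> \<le> L2_set (\<lambda>j. \<bar>v j\<bar>) Q"
        using member_le_L2_set[OF Q(1) i, of "\<lambda>j. \<bar>v j\<bar>"] by simp
      also have "\<dots> = L2_set v Q" by (simp add: L2_set_def)
      also have "\<dots> \<le> 1" using v by (simp add: S_def)
      finally have "\<bar>v i\<bar> * \<bar>f (\<lambda>j. if j = i then 1 else 0)\<bar> \<le> 1 * \<bar>f (\<lambda>j. if j = i then 1 else 0)\<bar>"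
        by (intro mult_right_mono) auto
      moreover have "\<bar>v i\<bar> * f (\<lambda>j. if j = i then 1 else 0) \<le> \<bar>v i\<bar> * \<bar>f (\<lambda>j. if j = i then 1 else 0)\<bar>"
        by (intro mult_left_mono) auto
      ultimately show "\<bar>v i\<bar> * f (\<lambda>j. if j = i then 1 else 0) \<le> 1 * \<bar>f (\<lambda>j. if j = i then 1 else 0)\<bar>"
        by linarith
    qed
    finally show "f v \<le> (\<Sum>i\<in>Q. 1 * \<bar>f (\<lambda>j. if j = i then 1 else 0)\<bar>)" .
  qed
  have zero: "(\<lambda>_. 0) \<in> S" by (simp add: S_def L2_set_0')
  have "M \<le> 3 / 2 * K + M / 2"
    unfolding M_def
  proof (rule cSUP_least)
    show "S \<noteq> {}" using zero by blast
    fix v assume v: "v \<in> S"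
    obtain u where u: "u \<in> net_on Q q" "L2_set (\<lambda>j. v j - u j) Q \<le> 1 / 2" "L2_set u Q \<le> 3 / 2" "\<And>j. j \<notin> Q \<Longrightarrow> u j = 0"
      using net_on_approx[OF Q, of v] v by (auto simp: S_def)
    have "(\<lambda>j. 2 * (v j - u j)) \<in> S" using u v L2_set_scale[of 2 "\<lambda>j. v j - u j" Q] by (auto simp: S_def)
    then have "f (\<lambda>j. 2 * (v j - u j)) \<le> M" unfolding M_def using bdd by (intro cSUP_upper)
    then have "f (\<lambda>j. v j - u j) \<le> M / 2" unfolding f_scale by simp
    moreover have "f u \<le> K * (3 / 2)" using net[OF u(1)] u(3) K mult_left_mono by (meson order_trans)
    moreover have "f v \<le> f u + f (\<lambda>j. v j - u j)" using f_add[of u "\<lambda>j. v j - u j"] by simp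
    ultimately show "f v \<le> 3 / 2 * K + (SUP v\<in>S. f v) / 2" unfolding M_def by simp
  qed
  then have M: "M \<le> 3 * K" by simp
  show ?thesis
  proof (cases "L2_set v Q = 0")
    case True
    then have "v = (\<lambda>_. 0)" using Q(1) v by (auto simp: L2_set_eq_0_iff)
    then show ?thesis by (simp add: f_zero L2_set_0')
  next
    case False
    let ?N = "L2_set v Q"
    have N: "?N > 0" using False L2_set_nonneg[of v Q] by linarith
    have "(\<lambda>j. (1 / ?N) * v j) \<in> S" 
      using N v L2_set_scale[of "1 / ?N" v Q] by (simp add: S_def)
    then have "f (\<lambda>j. (1 / ?N) * v j) \<le> M" unfolding M_def using bdd by (intro cSUP_upper)
    then have "f v / ?N \<le> 3 * K" unfolding f_scale using M N by simp
    then show ?thesis using N by (simp add: divide_le_eq)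
  qed
qed

end

text \<open>Residue classes cut the coordinates into \<open>N\<close> blocks of nearly equal size
  without a special case for the remainder.\<close>

definition residue_block :: "nat \<Rightarrow> nat \<Rightarrow> nat \<Rightarrow> nat set" where
  "residue_block m N b = {r. r < m \<and> r mod N = b}"

lemma residue_block_card:
  assumes "N > 0"
  shows "finite (residue_block m N b)" "card (residue_block m N b) \<le> m div N + 1"
proof -
  show "finite (residue_block m N b)" by (simp add: residue_block_def)
  have "inj_on (\<lambda>r. r div N) (residue_block m N b)"
    by (rule inj_onI) (metis (mono_tags, lifting) div_mult_mod_eq mem_Collect_eq residue_block_def)
  moreover have "(\<lambda>r. r div N) ` residue_block m N b \<subseteq> {..m div N}"
    by (auto simp: residue_block_def intro: div_le_mono)
  ultimately have "card (residue_block m N b) \<le> card {..m div N}" by (intro card_inj_on_le) auto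
  then show "card (residue_block m N b) \<le> m div N + 1" by simp
qed

text \<open>The first family serves sparse vectors, the second dense vectors cut into blocks, so
  that one union bound covers both.\<close>

definition net_supports :: "nat \<Rightarrow> nat \<Rightarrow> nat \<Rightarrow> nat set set" where
  "net_supports m s N = {Q. Q \<subseteq> {..<m} \<and> card Q = s} \<union> residue_block m N ` {..<N}"

locale seminorm_net = seminorm_fun f for f +
  fixes m s N q :: nat and K :: real
  assumes f_cong: "\<And>u v. (\<And>r. r < m \<Longrightarrow> u r = v r) \<Longrightarrow> f u = f v"
    and N: "N > 0" and q: "q = m div N + 1" and s: "s \<le> m" "s \<le> q" and K: "K \<ge> 0"
    and net: "\<And>Q u. Q \<in> net_supports m s N \<Longrightarrow> u \<in> net_on Q q \<Longrightarrow> f u \<le> K * L2_set u {..<m}"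
begin

lemma support_bound:
  assumes Q: "Q \<in> net_supports m s N" and v: "\<And>r. r < m \<Longrightarrow> r \<notin> Q \<Longrightarrow> v r = 0"
  shows "f v \<le> 3 * K * L2_set v {..<m}"
proof -
  have Qm: "Q \<subseteq> {..<m}" "card Q \<le> q"
    using Q q s residue_block_card(2)[OF N] by (auto simp: net_supports_def residue_block_def)
  have finQ: "finite Q" using Qm finite_subset by blast
  have eq: "L2_set u Q = L2_set u {..<m}" if "\<And>r. r < m \<Longrightarrow> r \<notin> Q \<Longrightarrow> u r = 0" for u
    using that Qm by (intro L2_set_supp[symmetric]) auto
  define v' where "v' r = (if r \<in> Q then v r else 0)" for r
  have "f v = f v'" by (rule f_cong) (use v in \<open>auto simp: v'_def\<close>)
  also have "\<dots> \<le> 3 * K * L2_set v' Q"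
  proof (rule net_bound[OF finQ Qm(2)])
    show "f u \<le> K * L2_set u Q" if "u \<in> net_on Q q" for u
    proof -
      have "L2_set u Q = L2_set u {..<m}"
        by (rule eq) (use that in \<open>auto simp: net_on_def lattice_ball_def\<close>)
      then show ?thesis using net[OF Q that] by simp
    qed
  qed (use K q in \<open>auto simp: v'_def\<close>)
  also have "L2_set v' Q = L2_set v Q" by (intro L2_set_cong) (auto simp: v'_def)
  also have "\<dots> = L2_set v {..<m}" using v by (rule eq)
  finally show ?thesis .
qed

lemma sparse_bound:
  assumes "Q \<subseteq> {..<m}" "card Q \<le> s" and v: "\<And>r. r < m \<Longrightarrow> r \<notin> Q \<Longrightarrow> v r = 0"
  shows "f v \<le> 3 * K * L2_set v {..<m}"
proof -
  obtain Q' where "Q \<subseteq> Q'" "Q' \<subseteq> {..<m}" "card Q' = s"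
    using exists_subset_between[of Q s "{..<m}"] assms s by auto
  then show ?thesis
    using v by (intro support_bound[of Q']) (auto simp: net_supports_def)
qed

text \<open>The blocks of \<open>v\<close> are orthogonal, so Cauchy-Schwarz over the
  \<open>N\<close> of them costs \<open>sqrt N\<close>.\<close>

lemma all_bound: "f v \<le> 3 * K * sqrt (real N) * L2_set v {..<m}"
proof -
  let ?B = "residue_block m N"
  define g where "g b r = (if r \<in> ?B b then v r else 0)" for b r
  have "f v = f (\<lambda>r. \<Sum>b<N. g b r)"
  proof (rule f_cong)
    fix r assume "r < m"
    then have "(\<Sum>b<N. g b r) = (\<Sum>b<N. if b = r mod N then v r else 0)"
      by (intro sum.cong) (auto simp: g_def residue_block_def)
    then show "v r = (\<Sum>b<N. g b r)" using N by simp
  qed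
  also have "\<dots> \<le> (\<Sum>b<N. f (g b))" by (rule f_sum) simp
  also have "\<dots> \<le> (\<Sum>b<N. 3 * K * \<bar>L2_set (g b) {..<m}\<bar>)"
  proof (rule sum_mono)
    fix b assume "b \<in> {..<N}"
    then show "f (g b) \<le> 3 * K * \<bar>L2_set (g b) {..<m}\<bar>"
      using support_bound[of "?B b" "g b"] by (simp add: net_supports_def g_def)
  qed
  also have "\<dots> = 3 * K * (\<Sum>b<N. \<bar>L2_set (g b) {..<m}\<bar>)" by (simp add: sum_distrib_left)
  also have "\<dots> \<le> 3 * K * (sqrt (real N) * L2_set v {..<m})"
  proof (rule mult_left_mono)
    have "(\<Sum>b<N. (L2_set (g b) {..<m})\<^sup>2) = (\<Sum>r<m. \<Sum>b<N. (g b r)\<^sup>2)"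
      unfolding L2_set_sq by (rule sum.swap)
    also have "\<dots> = (\<Sum>r<m. (v r)\<^sup>2)"
    proof (rule sum.cong)
      fix r assume "r \<in> {..<m}"
      then have "(\<Sum>b<N. (g b r)\<^sup>2) = (\<Sum>b<N. if b = r mod N then (v r)\<^sup>2 else 0)"
        by (intro sum.cong) (auto simp: g_def residue_block_def)
      then show "(\<Sum>b<N. (g b r)\<^sup>2) = (v r)\<^sup>2" using N by simp
    qed simp
    finally have "L2_set (\<lambda>b. L2_set (g b) {..<m}) {..<N} = L2_set v {..<m}"
      by (simp add: L2_set_def)
    then show "(\<Sum>b<N. \<bar>L2_set (g b) {..<m}\<bar>) \<le> sqrt (real N) * L2_set v {..<m}"
      using sum_le_sqrt_card_L2_set[of "\<lambda>b. L2_set (g b) {..<m}" "{..<N}"] by simp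
  qed (use K in simp)
  finally show ?thesis by (simp add: mult_ac)
qed

end

section \<open>Good events\<close>

text \<open>Dense vectors are split into \<open>10\<^sup>6 L\<^sup>2\<close> blocks of coordinates: each block is short enough for the
  union bound against probabilities \<open>exp (- c m / L\<^sup>2)\<close>, at the price of a factor of order \<open>L\<close>.\<close>

abbreviation blocks :: "nat \<Rightarrow> nat" where
  "blocks L \<equiv> 10 ^ 6 * L\<^sup>2"

definition test_net :: "nat \<Rightarrow> nat \<Rightarrow> nat \<Rightarrow> (nat \<Rightarrow> real) set" where
  "test_net m L s = (\<Union>Q\<in>net_supports m s (blocks L). net_on Q (m div blocks L + 1))"

text \<open>In the last layer only the first half of the rows is drawn.\<close>

definition fresh_rows :: "nat \<Rightarrow> nat \<Rightarrow> nat \<Rightarrow> nat set" where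
  "fresh_rows m L l = (if l = L then {..<m div 2} else {..<m})"

lemma finite_fresh_rows [simp]: "finite (fresh_rows m L l)"
  by (simp add: fresh_rows_def)

text \<open>Origin of the constants: \<open>1 / (20 L)\<close> compounds over the layers to
  \<open>exp (1 / 20) <= (103 / 100)^2\<close>. With the normalization \<open>2 / m\<close>, the
  last bound reads \<open>1 / (48 L)\<close> after taking roots; a factor 2 from the earlier layers,
  2 from the halves of the last layer and 3 from the net turn it into the \<open>1 / (4 L)\<close>
  of \<open>good_init\<close>.\<close>

definition good_events :: "nat \<Rightarrow> nat \<Rightarrow> nat \<Rightarrow> nat \<Rightarrow> real \<Rightarrow> (nat \<Rightarrow> nat \<Rightarrow> nat \<Rightarrow> real) \<Rightarrow> (nat \<Rightarrow> real) \<Rightarrow> bool" where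
  "good_events d m L s \<beta> w x \<longleftrightarrow>
    (\<forall>l. 1 \<le> l \<longrightarrow> l < L \<longrightarrow>
      \<bar>(L2_set (hid d m w x l) {..<m})\<^sup>2 - (L2_set (hid d m w x (l - 1)) {..<in_dim d m l})\<^sup>2\<bar>
        \<le> (L2_set (hid d m w x (l - 1)) {..<in_dim d m l})\<^sup>2 / (20 * real L)) \<and>
    (\<forall>l. 1 \<le> l \<longrightarrow> l \<le> L \<longrightarrow>
      real (card {r \<in> fresh_rows m L l. \<bar>preact d m w x l r\<bar> \<le> \<beta>}) \<le> real s / 8) \<and>
    (\<forall>k i. 1 \<le> k \<longrightarrow> k + Suc i < L \<longrightarrow> (\<forall>u\<in>test_net m L s.
      (L2_set (prp m (gate d m w x) w k u (Suc i)) {..<m})\<^sup>2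
        \<le> (1 + 1 / real L) * (L2_set (prp m (gate d m w x) w k u i) {..<m})\<^sup>2)) \<and>
    (\<forall>k i. 1 \<le> k \<longrightarrow> k + Suc i \<le> L \<longrightarrow> (\<forall>u\<in>test_net m L s. \<forall>T. T \<subseteq> fresh_rows m L (k + Suc i) \<longrightarrow> card T = s \<longrightarrow>
      (\<Sum>r\<in>T. (lin m (w (k + Suc i)) (prp m (gate d m w x) w k u i) r)\<^sup>2)
        \<le> real m / (4608 * (real L)\<^sup>2) * (L2_set (prp m (gate d m w x) w k u i) {..<m})\<^sup>2))"

lemma exp_one_twentieth: "exp (1 / 20 :: real) \<le> (103 / 100)\<^sup>2"
proof -
  have "exp (1 / 20 :: real) \<le> 1 + 1 / 20 + (1 / 20)\<^sup>2" by (rule exp_bound) auto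
  also have "\<dots> \<le> (103 / 100)\<^sup>2" by (simp add: power2_eq_square)
  finally show ?thesis .
qed

lemma power_one_plus_le_exp:
  assumes "0 \<le> c" "i \<le> L" "L > 0"
  shows "(1 + c / real L) ^ i \<le> exp c"
proof -
  have "(1 + c / real L) ^ i \<le> exp (c / real L) ^ i"
    using assms by (intro power_mono exp_ge_add_one_self) auto
  also have "\<dots> \<le> exp (c / real L) ^ L" using assms by (intro power_increasing) auto
  also have "\<dots> = exp c" using assms by (simp flip: exp_of_nat_mult)
  finally show ?thesis .
qed

section \<open>From good events to a good initialization\<close>

context
  fixes d m L s :: nat and \<beta> :: real and w :: "nat \<Rightarrow> nat \<Rightarrow> nat \<Rightarrow> real" and x :: "nat \<Rightarrow> real"
  assumes m_pos: "m > 0" and m_even: "even m" and L2: "L \<ge> 2" and s_pos: "s > 0" and s_le: "s \<le> m div 2" "s \<le> m div blocks L + 1"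
    and x_norm: "L2_set x {..<d} = 1"
    and dup: "\<And>r j. r < m div 2 \<Longrightarrow> j < m \<Longrightarrow> w L (r + m div 2) j = w L r j"
    and good: "good_events d m L s \<beta> w x"
begin

abbreviation (input) "D \<equiv> gate d m w x"
abbreviation (input) "nrm v \<equiv> L2_set v {..<m}"

lemma good_hid_bound:
  assumes "l < L"
  shows "(L2_set (hid d m w x l) {..<in_dim d m (Suc l)})\<^sup>2 \<le> (1 + 1 / 20 / real L) ^ l"
  using assms
proof (induction l)
  case 0
  then show ?case using x_norm by (simp add: in_dim_def)
next
  case (Suc l)
  let ?H = "(L2_set (hid d m w x l) {..<in_dim d m (Suc l)})\<^sup>2"
  have "1 \<le> Suc l" by simp
  then have "\<bar>(nrm (hid d m w x (Suc l)))\<^sup>2 - (L2_set (hid d m w x (Suc l - 1)) {..<in_dim d m (Suc l)})\<^sup>2\<bar>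
      \<le> (L2_set (hid d m w x (Suc l - 1)) {..<in_dim d m (Suc l)})\<^sup>2 / (20 * real L)"
    using good Suc.prems unfolding good_events_def by blast
  then have "\<bar>(nrm (hid d m w x (Suc l)))\<^sup>2 - ?H\<bar> \<le> ?H / (20 * real L)" by simp
  then have "(nrm (hid d m w x (Suc l)))\<^sup>2 \<le> ?H + ?H / (20 * real L)" by linarith
  also have "\<dots> = (1 + 1 / 20 / real L) * ?H" by (simp add: algebra_simps)
  also have "\<dots> \<le> (1 + 1 / 20 / real L) * (1 + 1 / 20 / real L) ^ l"
    using Suc by (intro mult_left_mono) auto
  finally show ?case by (simp add: in_dim_def)
qed

lemma good_hid_norm:
  assumes "1 \<le> l" "l < L"
  shows "nrm (hid d m w x l) \<le> 103 / 100"
proof (rule power2_le_imp_le)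
  have "in_dim d m (Suc l) = m" using assms by (simp add: in_dim_def)
  then have "(nrm (hid d m w x l))\<^sup>2 \<le> (1 + 1 / 20 / real L) ^ l"
    using good_hid_bound[OF assms(2)] by simp
  also have "\<dots> \<le> exp (1 / 20)" using assms by (intro power_one_plus_le_exp) auto
  also have "\<dots> \<le> (103 / 100)\<^sup>2" by (rule exp_one_twentieth)
  finally show "(nrm (hid d m w x l))\<^sup>2 \<le> (103 / 100)\<^sup>2" .
qed simp

text \<open>\<open>(1 + 1 / L)^L\<close> is at most \<open>e < 4\<close>, so squared norms grow by
  at most 4 at any depth.\<close>

lemma test_net_prp:
  assumes "u \<in> test_net m L s" "1 \<le> k" "k + i < L"
  shows "nrm (prp m D w k u i) \<le> 2 * nrm u"
proof (rule power2_le_imp_le)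
  have "(nrm (prp m D w k u i))\<^sup>2 \<le> (1 + 1 / real L) ^ i * (nrm u)\<^sup>2"
    using assms(3)
  proof (induction i)
    case (Suc i)
    have "(nrm (prp m D w k u (Suc i)))\<^sup>2 \<le> (1 + 1 / real L) * (nrm (prp m D w k u i))\<^sup>2"
      using good assms(1,2) Suc.prems unfolding good_events_def by blast
    also have "\<dots> \<le> (1 + 1 / real L) * ((1 + 1 / real L) ^ i * (nrm u)\<^sup>2)"
      using Suc by (intro mult_left_mono) auto
    finally show ?case by (simp add: mult.assoc)
  qed simp
  also have "\<dots> \<le> 4 * (nrm u)\<^sup>2"
  proof (rule mult_right_mono)
    have "(1 + 1 / real L) ^ i \<le> exp 1" using assms by (intro power_one_plus_le_exp) auto
    then show "(1 + 1 / real L) ^ i \<le> 4" using exp_le by linarith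
  qed simp
  finally show "(nrm (prp m D w k u i))\<^sup>2 \<le> (2 * nrm u)\<^sup>2" by (simp add: power_mult_distrib)
qed simp

lemma pre_eq: "pre m D w k u i r = sqrt (2 / real m) * lin m (w (k + Suc i)) (prp m D w k u i) r"
  by (simp add: pre_def)

lemma test_net_pre_fresh:
  assumes u: "u \<in> test_net m L s" and k: "1 \<le> k" "k + Suc i \<le> L"
    and T: "T \<subseteq> fresh_rows m L (k + Suc i)" "card T \<le> s"
  shows "L2_set (pre m D w k u i) T \<le> nrm (prp m D w k u i) / (48 * real L)"
proof (rule power2_le_imp_le)
  have "s \<le> card (fresh_rows m L (k + Suc i))" using s_le by (auto simp: fresh_rows_def)
  then obtain T' where T': "T \<subseteq> T'" "T' \<subseteq> fresh_rows m L (k + Suc i)" "card T' = s"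
    using exists_subset_between[of T s "fresh_rows m L (k + Suc i)"] T by auto
  have fin: "finite T'" using T'(2) by (rule finite_subset) (simp add: fresh_rows_def)
  have "(L2_set (pre m D w k u i) T)\<^sup>2 \<le> (L2_set (pre m D w k u i) T')\<^sup>2"
    using fin T' by (intro power_mono L2_set_subset) auto
  also have "\<dots> = 2 / real m * (\<Sum>r\<in>T'. (lin m (w (k + Suc i)) (prp m D w k u i) r)\<^sup>2)"
    unfolding L2_set_sq pre_eq by (simp add: power_mult_distrib sum_distrib_left)
  also have "\<dots> \<le> 2 / real m * (real m / (4608 * (real L)\<^sup>2) * (nrm (prp m D w k u i))\<^sup>2)"
    using good u k T' unfolding good_events_def by (intro mult_left_mono) auto
  also have "\<dots> = (nrm (prp m D w k u i) / (48 * real L))\<^sup>2"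
    using m_pos by (simp add: power_divide power_mult_distrib field_simps)
  finally show "(L2_set (pre m D w k u i) T)\<^sup>2 \<le> (nrm (prp m D w k u i) / (48 * real L))\<^sup>2" .
qed simp

text \<open>In the last layer a set of rows may meet both halves. Rows of the second half are
  copies, so shifting them down leads back to fresh rows, at the price of a factor 2.\<close>

lemma test_net_pre:
  assumes u: "u \<in> test_net m L s" and k: "1 \<le> k" "k + Suc i \<le> L" and T: "T \<subseteq> {..<m}" "card T \<le> s"
  shows "L2_set (pre m D w k u i) T \<le> 1 / (12 * real L) * nrm u"
proof -
  let ?n = "nrm (prp m D w k u i) / (48 * real L)"
  have fT: "finite T" using T(1) finite_subset by blast
  have "L2_set (pre m D w k u i) T \<le> 2 * ?n"
  proof (cases "k + Suc i = L")
    case False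
    then have "L2_set (pre m D w k u i) T \<le> ?n"
      using T by (intro test_net_pre_fresh u k) (auto simp: fresh_rows_def)
    moreover have "0 \<le> ?n" by simp
    ultimately show ?thesis by linarith
  next
    case True
    define A where "A = T \<inter> {..<m div 2}"
    define B where "B = T - {..<m div 2}"
    have AB: "T = A \<union> B" "finite A" "finite B" "card A \<le> s" "card B \<le> s"
      using T fT card_mono[OF fT, of A] card_mono[OF fT, of B] by (auto simp: A_def B_def)
    have "L2_set (pre m D w k u i) A \<le> ?n"
      using AB True by (intro test_net_pre_fresh u k) (auto simp: fresh_rows_def A_def)
    moreover have "L2_set (pre m D w k u i) B \<le> ?n"
    proof -
      let ?B = "(\<lambda>r. r - m div 2) ` B"
      have mm: "m = m div 2 + m div 2" using m_even by presburger
      have inj: "inj_on (\<lambda>r. r - m div 2) B" by (auto simp: inj_on_def B_def)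
      have "pre m D w k u i r = pre m D w k u i (r - m div 2)" if "r \<in> B" for r
      proof -
        have r: "r - m div 2 < m div 2" "r = (r - m div 2) + m div 2"
          using that T mm by (auto simp: B_def)
        then have "w L r j = w L (r - m div 2) j" if "j < m" for j
          using dup[of "r - m div 2" j] that by simp
        then show ?thesis using True by (simp add: pre_def lin_def)
      qed
      then have "L2_set (pre m D w k u i) B = L2_set (\<lambda>r. pre m D w k u i (r - m div 2)) B"
        by (intro L2_set_cong) auto
      also have "\<dots> = L2_set (pre m D w k u i) ?B"
        by (simp add: L2_set_def sum.reindex[OF inj])
      also have "\<dots> \<le> ?n"
      proof (rule test_net_pre_fresh[OF u k])
        have "r - m div 2 < m div 2" if "r \<in> B" for r using that T mm by (auto simp: B_def)
        then show "?B \<subseteq> fresh_rows m L (k + Suc i)" using True by (auto simp: fresh_rows_def)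
        show "card ?B \<le> s" using card_image_le[OF AB(3), of "\<lambda>r. r - m div 2"] AB(5) by linarith
      qed
      finally show ?thesis .
    qed
    ultimately show ?thesis
      using L2_set_Un_le[OF AB(2,3), of "pre m D w k u i"] AB(1) by simp
  qed
  also have "\<dots> \<le> 2 * (2 * nrm u / (48 * real L))"
    using test_net_prp[OF u, of k i] k L2 by (intro mult_left_mono divide_right_mono) auto
  finally show ?thesis by (simp add: field_simps)
qed

lemma sqrt_blocks: "sqrt (real (blocks L)) = 1000 * real L"
proof -
  have "real (blocks L) = (1000 * real L)\<^sup>2" by (simp add: power_mult_distrib)
  then show ?thesis by (metis of_nat_0_le_iff mult_nonneg_nonneg zero_le_numeral real_sqrt_abs abs_of_nonneg)
qed

lemma prp_seminorm:
  assumes k: "1 \<le> k" "k + i < L"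
  shows "seminorm_net (\<lambda>v. nrm (prp m D w k v i)) m s (blocks L) (m div blocks L + 1) 2"
proof
  show "nrm (prp m D w k (\<lambda>j. u j + v j) i) \<le> nrm (prp m D w k u i) + nrm (prp m D w k v i)" for u v
    unfolding prp_add by (rule L2_set_triangle_ineq)
  show "nrm (prp m D w k (\<lambda>j. c * v j) i) = \<bar>c\<bar> * nrm (prp m D w k v i)" for c v
    unfolding prp_scale by (rule L2_set_scale)
  show "nrm (prp m D w k u i) = nrm (prp m D w k v i)" if "\<And>r. r < m \<Longrightarrow> u r = v r" for u v
    using prp_cong[of m u v] that by (intro L2_set_cong) auto
  show "nrm (prp m D w k u i) \<le> 2 * nrm u"
    if "Q \<in> net_supports m s (blocks L)" "u \<in> net_on Q (m div blocks L + 1)" for Q u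
    using that k by (intro test_net_prp) (auto simp: test_net_def)
qed (use L2 s_le in auto)

lemma pre_seminorm:
  assumes k: "1 \<le> k" "k + Suc i \<le> L" and T: "T \<subseteq> {..<m}" "card T \<le> s"
  shows "seminorm_net (\<lambda>v. L2_set (pre m D w k v i) T) m s (blocks L) (m div blocks L + 1) (1 / (12 * real L))"
proof
  show "L2_set (pre m D w k (\<lambda>j. u j + v j) i) T \<le> L2_set (pre m D w k u i) T + L2_set (pre m D w k v i) T" for u v
    unfolding pre_add by (rule L2_set_triangle_ineq)
  show "L2_set (pre m D w k (\<lambda>j. c * v j) i) T = \<bar>c\<bar> * L2_set (pre m D w k v i) T" for c v
    unfolding pre_scale by (rule L2_set_scale)
  show "L2_set (pre m D w k u i) T = L2_set (pre m D w k v i) T" if "\<And>r. r < m \<Longrightarrow> u r = v r" for u v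
  proof -
    have "lin m (w (k + Suc i)) (prp m D w k u i) r = lin m (w (k + Suc i)) (prp m D w k v i) r" for r
      by (rule lin_cong) (rule prp_cong[OF that])
    then show ?thesis by (simp add: pre_def)
  qed
  show "L2_set (pre m D w k u i) T \<le> 1 / (12 * real L) * nrm u"
    if "Q \<in> net_supports m s (blocks L)" "u \<in> net_on Q (m div blocks L + 1)" for Q u
    using that k T by (intro test_net_pre) (auto simp: test_net_def)
qed (use L2 s_le in auto)

text \<open>In the last layer every counted fresh row may have one copy, which turns
  \<open>s / 8\<close> into \<open>s / 4\<close>.\<close>

lemma good_small_count:
  assumes l: "1 \<le> l" "l \<le> L"
  shows "real (card {r. r < m \<and> \<bar>preact d m w x l r\<bar> \<le> \<beta>}) \<le> real s / 4"
proof -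
  let ?A = "{r \<in> fresh_rows m L l. \<bar>preact d m w x l r\<bar> \<le> \<beta>}"
  have A: "real (card ?A) \<le> real s / 8" using good l unfolding good_events_def by blast
  have finA: "finite ?A" by (simp add: fresh_rows_def)
  have "{r. r < m \<and> \<bar>preact d m w x l r\<bar> \<le> \<beta>} \<subseteq> ?A \<union> (\<lambda>r. r + m div 2) ` ?A"
  proof
    fix r assume r: "r \<in> {r. r < m \<and> \<bar>preact d m w x l r\<bar> \<le> \<beta>}"
    have mm: "m = m div 2 + m div 2" using m_even by presburger
    show "r \<in> ?A \<union> (\<lambda>r. r + m div 2) ` ?A"
    proof (cases "l = L \<and> m div 2 \<le> r")
      case True
      then have r': "r - m div 2 < m div 2" "r = (r - m div 2) + m div 2" using r mm by auto
      have "w L r j = w L (r - m div 2) j" if "j < m" for j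
        using dup[of "r - m div 2" j] r' that by simp
      then have "preact d m w x L r = preact d m w x L (r - m div 2)"
        using L2 by (simp add: preact_def lin_def in_dim_def)
      then have "r - m div 2 \<in> ?A" using True r r' by (auto simp: fresh_rows_def)
      then show ?thesis using r'(2) by blast
    next
      case False
      then show ?thesis using r by (auto simp: fresh_rows_def)
    qed
  qed
  then have "card {r. r < m \<and> \<bar>preact d m w x l r\<bar> \<le> \<beta>} \<le> card (?A \<union> (\<lambda>r. r + m div 2) ` ?A)"
    using finA by (intro card_mono) auto
  also have "\<dots> \<le> card ?A + card ((\<lambda>r. r + m div 2) ` ?A)" by (rule card_Un_le)
  also have "\<dots> \<le> card ?A + card ?A" using card_image_le[OF finA] by (intro add_left_mono)
  finally show ?thesis using A by linarith
qed

text \<open>The value 6000 is \<open>3 * 2 * 1000\<close>: the net factor, the growth bound of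
  \<open>test_net_prp\<close>, and the \<open>1000 L\<close> of \<open>sqrt_blocks\<close>, as they
  meet in the dense propagation bound.\<close>

lemma good_init_of_events:
  assumes "0 \<le> \<rho>" "0 < \<beta>" "\<beta> \<le> 1" "128 * 6000\<^sup>2 * real L * \<rho>\<^sup>2 \<le> \<beta>\<^sup>2 * real s"
    and "1000 * 6000\<^sup>2 * real L * (sqrt (2 / real m) * sqrt (real L) * \<rho>) \<le> 1"
  shows "good_init d m L s 6000 \<beta> \<rho> w x"
proof
  show "nrm (hid d m w x l) \<le> 103 / 100" if "1 \<le> l" "l < L" for l
    using good_hid_norm that .
  show "L2_set (pre m D w k v i) T \<le> 6000 * nrm v" if k: "1 \<le> k" "k + Suc i \<le> L" and T: "T \<subseteq> {..<m}" "card T \<le> s" for k i T v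
  proof -
    have "L2_set (pre m D w k v i) T \<le> 3 * (1 / (12 * real L)) * sqrt (real (blocks L)) * nrm v"
      by (rule seminorm_net.all_bound[OF pre_seminorm[OF k T]])
    also have "\<dots> = 250 * nrm v" unfolding sqrt_blocks using L2 by simp
    also have "\<dots> \<le> 6000 * nrm v" by (intro mult_right_mono) auto
    finally show ?thesis .
  qed
  show "L2_set (pre m D w k v i) T \<le> nrm v / (4 * real L)"
    if k: "1 \<le> k" "k + Suc i \<le> L" and T: "T \<subseteq> {..<m}" "card T \<le> s"
      and Q: "Q \<subseteq> {..<m}" "card Q \<le> s" "\<And>r. r < m \<Longrightarrow> r \<notin> Q \<Longrightarrow> v r = 0" for k i T Q v
    using seminorm_net.sparse_bound[OF pre_seminorm[OF k T] Q] by simp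
  show "nrm (prp m D w k v i) \<le> 6000 * real L * nrm v" if k: "1 \<le> k" "k + i < L" for k i v
    using seminorm_net.all_bound[OF prp_seminorm[OF k], of v] unfolding sqrt_blocks by simp
  show "nrm (prp m D w k v i) \<le> 6000 * nrm v"
    if k: "1 \<le> k" "k + i < L" and Q: "Q \<subseteq> {..<m}" "card Q \<le> s" "\<And>r. r < m \<Longrightarrow> r \<notin> Q \<Longrightarrow> v r = 0" for k i Q v
  proof -
    have "nrm (prp m D w k v i) \<le> 3 * 2 * nrm v"
      by (rule seminorm_net.sparse_bound[OF prp_seminorm[OF k] Q])
    also have "\<dots> \<le> 6000 * nrm v" by (intro mult_right_mono) auto
    finally show ?thesis .
  qed
  show "real (card {r. r < m \<and> \<bar>preact d m w x l r\<bar> \<le> \<beta>}) \<le> real s / 4" if "1 \<le> l" "l \<le> L" for l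
    using good_small_count that .
qed (use assms m_pos L2 s_pos x_norm in auto)

end

section \<open>Failure events of a single layer\<close>

definition gate_event :: "nat \<Rightarrow> nat \<Rightarrow> (nat \<Rightarrow> nat \<Rightarrow> nat \<Rightarrow> real) \<Rightarrow> (nat \<Rightarrow> real) \<Rightarrow> nat \<Rightarrow> (nat \<Rightarrow> real) \<Rightarrow> real \<Rightarrow> real \<Rightarrow> bool" where
  "gate_event d m w x l z \<theta> t \<longleftrightarrow>
    0 < L2_set (hid d m w x (l - 1)) {..<in_dim d m l} \<and> 0 < L2_set z {..<in_dim d m l} \<and>
    t * (L2_set z {..<in_dim d m l})\<^sup>2 \<le> \<theta> * (\<Sum>r<m. gate d m w x l r * (lin (in_dim d m l) (w l) z r)\<^sup>2)"

definition rows_event :: "nat \<Rightarrow> (nat \<Rightarrow> nat \<Rightarrow> nat \<Rightarrow> real) \<Rightarrow> nat \<Rightarrow> (nat \<Rightarrow> real) \<Rightarrow> nat set \<Rightarrow> real \<Rightarrow> bool" where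
  "rows_event m w l z T t \<longleftrightarrow>
    0 < L2_set z {..<m} \<and> t * (L2_set z {..<m})\<^sup>2 \<le> (\<Sum>r\<in>T. (lin m (w l) z r)\<^sup>2)"

definition count_event :: "nat \<Rightarrow> nat \<Rightarrow> nat \<Rightarrow> real \<Rightarrow> (nat \<Rightarrow> nat \<Rightarrow> nat \<Rightarrow> real) \<Rightarrow> (nat \<Rightarrow> real) \<Rightarrow> nat \<Rightarrow> real \<Rightarrow> bool" where
  "count_event d m L \<beta> w x l t \<longleftrightarrow>
    1 / 2 \<le> L2_set (hid d m w x (l - 1)) {..<in_dim d m l} \<and>
    t \<le> real (card {r \<in> fresh_rows m L l. \<bar>preact d m w x l r\<bar> \<le> \<beta>})"

definition row_choices :: "nat \<Rightarrow> nat \<Rightarrow> nat \<Rightarrow> nat \<Rightarrow> nat set set" where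
  "row_choices m L s l = {T. T \<subseteq> fresh_rows m L l \<and> card T = s}"

abbreviation "thr m \<theta> \<tau> \<equiv> \<theta> * (real m / 2) * (1 + \<tau>)"

text \<open>Each event excluded by \<open>clean\<close> concerns a single layer whose inputs are nonzero; the bounds for the
  whole network in \<open>good_events\<close> follow by induction on the layers.\<close>

definition clean :: "nat \<Rightarrow> nat \<Rightarrow> nat \<Rightarrow> nat \<Rightarrow> real \<Rightarrow> (nat \<Rightarrow> nat \<Rightarrow> nat \<Rightarrow> real) \<Rightarrow> (nat \<Rightarrow> real) \<Rightarrow> bool" where
  "clean d m L s \<beta> w x \<longleftrightarrow>
    (\<forall>l\<in>{1..<L}. \<not> gate_event d m w x l (hid d m w x (l - 1)) (1 / (80 * real L)) (thr m (1 / (80 * real L)) (1 / (20 * real L)))) \<and>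
    (\<forall>l\<in>{1..<L}. \<not> gate_event d m w x l (hid d m w x (l - 1)) (- 1 / (80 * real L)) (thr m (- 1 / (80 * real L)) (- 1 / (20 * real L)))) \<and>
    (\<forall>l\<in>{1..L}. \<not> count_event d m L \<beta> w x l (real s / 8)) \<and>
    (\<forall>(k, i)\<in>{(k, i). 1 \<le> k \<and> k + Suc i < L}. \<forall>u\<in>test_net m L s.
      \<not> gate_event d m w x (k + Suc i) (prp m (gate d m w x) w k u i) (1 / (4 * real L)) (thr m (1 / (4 * real L)) (1 / real L))) \<and>
    (\<forall>(k, i)\<in>{(k, i). 1 \<le> k \<and> k + Suc i \<le> L}. \<forall>u\<in>test_net m L s. \<forall>T\<in>row_choices m L s (k + Suc i).
      \<not> rows_event m w (k + Suc i) (prp m (gate d m w x) w k u i) T (real m / (4608 * (real L)\<^sup>2)))"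

lemma layer_norm_sq:
  assumes "m > 0"
  shows "(L2_set (\<lambda>r. sqrt (2 / real m) * gate d m w x l r * y r) {..<m})\<^sup>2
    = 2 / real m * (\<Sum>r<m. gate d m w x l r * (y r)\<^sup>2)"
proof -
  have "(sqrt (2 / real m) * gate d m w x l r * y r)\<^sup>2 = 2 / real m * (gate d m w x l r * (y r)\<^sup>2)" for r
    by (simp add: gate_def power_mult_distrib)
  then show ?thesis unfolding L2_set_sq by (simp only: sum_distrib_left)
qed

lemma not_gate_event:
  assumes "\<not> gate_event d m w x l z \<theta> (thr m \<theta> \<tau>)" "m > 0"
    and "0 < L2_set (hid d m w x (l - 1)) {..<in_dim d m l}" "0 < L2_set z {..<in_dim d m l}"
  defines "X \<equiv> (L2_set (\<lambda>r. sqrt (2 / real m) * gate d m w x l r * lin (in_dim d m l) (w l) z r) {..<m})\<^sup>2"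
  shows "0 < \<theta> \<Longrightarrow> X \<le> (1 + \<tau>) * (L2_set z {..<in_dim d m l})\<^sup>2"
    and "\<theta> < 0 \<Longrightarrow> (1 + \<tau>) * (L2_set z {..<in_dim d m l})\<^sup>2 \<le> X"
proof -
  let ?S = "\<Sum>r<m. gate d m w x l r * (lin (in_dim d m l) (w l) z r)\<^sup>2"
  let ?Z = "(L2_set z {..<in_dim d m l})\<^sup>2"
  have "\<theta> * ?S < thr m \<theta> \<tau> * ?Z" using assms(1,3,4) by (auto simp: gate_event_def)
  then have lt: "\<theta> * ?S < \<theta> * (real m / 2 * (1 + \<tau>) * ?Z)" by (simp add: mult_ac)
  have X: "X = 2 / real m * ?S" unfolding X_def by (rule layer_norm_sq[OF assms(2)])
  show "X \<le> (1 + \<tau>) * ?Z" if "0 < \<theta>"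
  proof -
    have "?S < real m / 2 * (1 + \<tau>) * ?Z" using lt that by (simp only: mult_less_cancel_left_pos)
    then have "2 / real m * ?S \<le> 2 / real m * (real m / 2 * (1 + \<tau>) * ?Z)" by (intro mult_left_mono) auto
    then show ?thesis unfolding X using assms(2) by simp
  qed
  show "(1 + \<tau>) * ?Z \<le> X" if "\<theta> < 0"
  proof -
    have "real m / 2 * (1 + \<tau>) * ?Z < ?S" using lt that by (simp only: mult_less_cancel_left_neg)
    then have "2 / real m * (real m / 2 * (1 + \<tau>) * ?Z) \<le> 2 / real m * ?S" by (intro mult_left_mono) auto
    then show ?thesis unfolding X using assms(2) by simp
  qed
qed

text \<open>The excluded events speak only of nonzero inputs. The lower tails keep the activations
  away from 0, with squared norm at least \<open>19 / 20\<close> by Bernoulli's inequality; a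
  propagated vector that vanishes simply stays 0.\<close>

lemma good_events_of_clean:
  assumes m: "m > 0" and L: "L \<ge> 2" and s: "s > 0" and x: "L2_set x {..<d} = 1" and clean: "clean d m L s \<beta> w x"
  shows "good_events d m L s \<beta> w x"
proof -
  let ?H = "\<lambda>l. L2_set (hid d m w x l) {..<in_dim d m (Suc l)}"
  have hid_eq: "hid d m w x (Suc l) = (\<lambda>r. sqrt (2 / real m) * gate d m w x (Suc l) r *
      lin (in_dim d m (Suc l)) (w (Suc l)) (hid d m w x l) r)" for l
    by (rule ext) (simp only: hid_Suc_gate preact_def mult.assoc diff_Suc_1)
  have step: "(?H (Suc l))\<^sup>2 \<le> (1 + 1 / (20 * real L)) * (?H l)\<^sup>2" "(1 + - 1 / (20 * real L)) * (?H l)\<^sup>2 \<le> (?H (Suc l))\<^sup>2"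
    if l: "Suc l < L" and pos: "0 < ?H l" for l
  proof -
    have "\<not> gate_event d m w x (Suc l) (hid d m w x l) (1 / (80 * real L)) (thr m (1 / (80 * real L)) (1 / (20 * real L)))"
      "\<not> gate_event d m w x (Suc l) (hid d m w x l) (- 1 / (80 * real L)) (thr m (- 1 / (80 * real L)) (- 1 / (20 * real L)))"
      using clean l unfolding clean_def by (auto dest!: bspec[where x = "Suc l"])
    from not_gate_event(1)[OF this(1) m] not_gate_event(2)[OF this(2) m]
    show "(?H (Suc l))\<^sup>2 \<le> (1 + 1 / (20 * real L)) * (?H l)\<^sup>2" "(1 + - 1 / (20 * real L)) * (?H l)\<^sup>2 \<le> (?H (Suc l))\<^sup>2"
      using pos L unfolding hid_eq[symmetric] by (auto simp: in_dim_def)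
  qed
  have lower: "(1 + - 1 / (20 * real L)) ^ l \<le> (?H l)\<^sup>2" if "l < L" for l
    using that
  proof (induction l)
    case 0
    then show ?case using x by (simp add: in_dim_def)
  next
    case (Suc l)
    have p: "0 < 1 + - 1 / (20 * real L)" using L by (simp add: field_simps)
    have IH: "(1 + - 1 / (20 * real L)) ^ l \<le> (?H l)\<^sup>2" using Suc by simp
    moreover have "0 < (1 + - 1 / (20 * real L)) ^ l" using p by (rule zero_less_power)
    ultimately have "?H l \<noteq> 0" by (metis less_le_not_le zero_eq_power2)
    then have "0 < ?H l" using L2_set_nonneg[of "hid d m w x l"] by (simp add: order_less_le)
    then have "(1 + - 1 / (20 * real L)) * (?H l)\<^sup>2 \<le> (?H (Suc l))\<^sup>2" using step(2) Suc.prems by blast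
    moreover have "(1 + - 1 / (20 * real L)) * (1 + - 1 / (20 * real L)) ^ l \<le> (1 + - 1 / (20 * real L)) * (?H l)\<^sup>2"
      using IH p by (intro mult_left_mono) auto
    ultimately show ?case by (simp only: power_Suc)
  qed
  have half: "1 / 2 \<le> ?H l" if "l < L" for l
  proof (rule power2_le_imp_le)
    have "1 + real l * (- 1 / (20 * real L)) \<le> (1 + - 1 / (20 * real L)) ^ l"
      using L by (intro Bernoulli_inequality) (simp add: field_simps)
    moreover have "real l * (1 / (20 * real L)) \<le> 1 / 20" using that by (simp add: field_simps)
    ultimately show "(1 / 2)\<^sup>2 \<le> (?H l)\<^sup>2" using lower[OF that] by (simp add: power2_eq_square)
  qed simp
  have half': "1 / 2 \<le> L2_set (hid d m w x (l - 1)) {..<in_dim d m l}" if "1 \<le> l" "l \<le> L" for l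
    using half[of "l - 1"] that by simp
  show ?thesis
    unfolding good_events_def
  proof (intro conjI allI impI ballI)
    fix l assume l: "1 \<le> l" "l < L"
    obtain l' where l': "l = Suc l'" using l by (cases l) auto
    have "0 < ?H l'" using half[of l'] l l' by simp
    then have "(?H l)\<^sup>2 \<le> (1 + 1 / (20 * real L)) * (?H l')\<^sup>2" "(1 + - 1 / (20 * real L)) * (?H l')\<^sup>2 \<le> (?H l)\<^sup>2"
      using step[of l'] l l' by auto
    then have "\<bar>(?H l)\<^sup>2 - (?H l')\<^sup>2\<bar> \<le> (?H l')\<^sup>2 / (20 * real L)"
      by (simp add: abs_le_iff algebra_simps)
    then show "\<bar>(L2_set (hid d m w x l) {..<m})\<^sup>2 - (L2_set (hid d m w x (l - 1)) {..<in_dim d m l})\<^sup>2\<bar>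
        \<le> (L2_set (hid d m w x (l - 1)) {..<in_dim d m l})\<^sup>2 / (20 * real L)"
      using l' by (simp add: in_dim_def)
  next
    fix l assume l: "1 \<le> l" "l \<le> L"
    then have "\<not> count_event d m L \<beta> w x l (real s / 8)" using clean unfolding clean_def by simp
    then show "real (card {r \<in> fresh_rows m L l. \<bar>preact d m w x l r\<bar> \<le> \<beta>}) \<le> real s / 8"
      using half'[OF l] by (simp add: count_event_def)
  next
    fix k i u assume k: "1 \<le> k" "k + Suc i < L" and u: "u \<in> test_net m L s"
    let ?z = "prp m (gate d m w x) w k u i"
    have dim: "in_dim d m (k + Suc i) = m" using k by (simp add: in_dim_def)
    have ng: "\<not> gate_event d m w x (k + Suc i) ?z (1 / (4 * real L)) (thr m (1 / (4 * real L)) (1 / real L))"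
      using clean k u unfolding clean_def by blast
    show "(L2_set (prp m (gate d m w x) w k u (Suc i)) {..<m})\<^sup>2 \<le> (1 + 1 / real L) * (L2_set ?z {..<m})\<^sup>2"
    proof (cases "0 < L2_set ?z {..<m}")
      case True
      then show ?thesis
        using not_gate_event(1)[OF ng m] half'[of "k + Suc i"] k L by (simp add: dim[simplified])
    next
      case False
      then have "L2_set ?z {..<m} = 0" using L2_set_nonneg[of ?z "{..<m}"] by linarith
      then have "?z r = 0" if "r < m" for r using that by (auto simp: L2_set_eq_0_iff)
      then have "L2_set (prp m (gate d m w x) w k u (Suc i)) {..<m} = 0"
        by (intro L2_set_0') (simp add: lin_def)
      then show ?thesis by (simp only: power_zero_numeral mult_nonneg_nonneg zero_le_power2) simp
    qed
  next
    fix k i u T assume k: "1 \<le> k" "k + Suc i \<le> L" and u: "u \<in> test_net m L s"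
      and T: "T \<subseteq> fresh_rows m L (k + Suc i)" "card T = s"
    let ?z = "prp m (gate d m w x) w k u i"
    have ng: "\<not> rows_event m w (k + Suc i) ?z T (real m / (4608 * (real L)\<^sup>2))"
      using clean k u T unfolding clean_def row_choices_def by blast
    show "(\<Sum>r\<in>T. (lin m (w (k + Suc i)) ?z r)\<^sup>2) \<le> real m / (4608 * (real L)\<^sup>2) * (L2_set ?z {..<m})\<^sup>2"
    proof (cases "0 < L2_set ?z {..<m}")
      case True
      then show ?thesis using ng by (simp add: rows_event_def)
    next
      case False
      then have "L2_set ?z {..<m} = 0" using L2_set_nonneg[of ?z "{..<m}"] by linarith
      then have "?z r = 0" if "r < m" for r using that by (auto simp: L2_set_eq_0_iff)
      then show ?thesis by (simp add: lin_def)
    qed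
  qed
qed

section \<open>Which weights a layer depends on\<close>

lemma hid_cong:
  assumes "\<And>l' r j. 1 \<le> l' \<Longrightarrow> l' \<le> l \<Longrightarrow> r < m \<Longrightarrow> j < in_dim d m l' \<Longrightarrow> w l' r j = w' l' r j"
    and "r < in_dim d m (Suc l)"
  shows "hid d m w x l r = hid d m w' x l r"
  using assms
proof (induction l arbitrary: r)
  case (Suc l)
  have "r < m" using Suc.prems(2) by (simp add: in_dim_def)
  then have "lin (in_dim d m (Suc l)) (w (Suc l)) (hid d m w x l) r = lin (in_dim d m (Suc l)) (w' (Suc l)) (hid d m w' x l) r"
    unfolding lin_def using Suc by (intro sum.cong) auto
  then show ?case by simp
qed simp

lemma gate_cong:
  assumes "\<And>l' r j. 1 \<le> l' \<Longrightarrow> l' \<le> l \<Longrightarrow> r < m \<Longrightarrow> j < in_dim d m l' \<Longrightarrow> w l' r j = w' l' r j"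
    and "1 \<le> l" "r < m"
  shows "gate d m w x l r = gate d m w' x l r"
proof -
  have "preact d m w x l r = preact d m w' x l r"
    unfolding preact_def lin_def
    using assms hid_cong[of "l - 1" m d w w' _ x] by (intro sum.cong) auto
  then show ?thesis by (simp add: gate_def)
qed

text \<open>Propagation through layer \<open>k + i\<close> reads no later weights, which is what
  makes layer \<open>k + i + 1\<close> fresh for it.\<close>

lemma prp_cong_weights:
  assumes "\<And>l' r j. 1 \<le> l' \<Longrightarrow> l' \<le> k + i \<Longrightarrow> r < m \<Longrightarrow> j < in_dim d m l' \<Longrightarrow> w l' r j = w' l' r j"
    and "1 \<le> k" "r < m"
  shows "prp m (gate d m w x) w k u i r = prp m (gate d m w' x) w' k u i r"
  using assms
proof (induction i arbitrary: r)
  case (Suc i)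
  have "gate d m w x (k + Suc i) r = gate d m w' x (k + Suc i) r"
    using Suc.prems by (intro gate_cong) auto
  moreover have "lin m (w (k + Suc i)) (prp m (gate d m w x) w k u i) r = lin m (w' (k + Suc i)) (prp m (gate d m w' x) w' k u i) r"
    unfolding lin_def
  proof (intro sum.cong refl)
    fix j assume "j \<in> {..<m}"
    then have "prp m (gate d m w x) w k u i j = prp m (gate d m w' x) w' k u i j"
      using Suc.prems by (intro Suc.IH) auto
    moreover have "w (k + Suc i) r j = w' (k + Suc i) r j"
      using Suc.prems \<open>j \<in> {..<m}\<close> by (auto simp: in_dim_def)
    ultimately show "w (k + Suc i) r j * prp m (gate d m w x) w k u i j = w' (k + Suc i) r j * prp m (gate d m w' x) w' k u i j"
      by simp
  qed
  ultimately show ?case by simp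
qed simp

section \<open>Measurability, jointly in the weights and the random input\<close>

context
  fixes M :: "'a measure" and W :: "'a \<Rightarrow> nat \<Rightarrow> nat \<Rightarrow> nat \<Rightarrow> real" and X :: "'a \<Rightarrow> nat \<Rightarrow> real" and d m L :: nat
  assumes W_meas: "\<And>l r j. 1 \<le> l \<Longrightarrow> l \<le> L \<Longrightarrow> r < m \<Longrightarrow> j < in_dim d m l \<Longrightarrow> (\<lambda>\<omega>. W \<omega> l r j) \<in> borel_measurable M"
    and X_meas: "\<And>j. j < d \<Longrightarrow> (\<lambda>\<omega>. X \<omega> j) \<in> borel_measurable M"
begin

lemma lin_measurable:
  assumes "1 \<le> l" "l \<le> L" "r < m" "\<And>j. j < in_dim d m l \<Longrightarrow> (\<lambda>\<omega>. z \<omega> j) \<in> borel_measurable M"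
  shows "(\<lambda>\<omega>. lin (in_dim d m l) (W \<omega> l) (z \<omega>) r) \<in> borel_measurable M"
  unfolding lin_def using assms W_meas by (auto intro!: borel_measurable_sum borel_measurable_times)

lemma L2_set_measurable:
  assumes "\<And>j. j < q \<Longrightarrow> (\<lambda>\<omega>. z \<omega> j) \<in> borel_measurable M"
  shows "(\<lambda>\<omega>. L2_set (z \<omega>) {..<q}) \<in> borel_measurable M"
  unfolding L2_set_def using assms
  by (auto intro!: borel_measurable_sum borel_measurable_sqrt borel_measurable_power)

lemma hid_measurable:
  assumes "l \<le> L" "r < in_dim d m (Suc l)"
  shows "(\<lambda>\<omega>. hid d m (W \<omega>) (X \<omega>) l r) \<in> borel_measurable M"
  using assms
proof (induction l arbitrary: r)
  case 0
  then show ?case using X_meas by (simp add: in_dim_def)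
next
  case (Suc l)
  have "r < m" using Suc.prems(2) by (simp add: in_dim_def)
  then have "(\<lambda>\<omega>. lin (in_dim d m (Suc l)) (W \<omega> (Suc l)) (hid d m (W \<omega>) (X \<omega>) l) r) \<in> borel_measurable M"
    using Suc by (intro lin_measurable) auto
  then show ?case by (simp add: borel_measurable_times borel_measurable_max)
qed

lemma preact_measurable:
  assumes "1 \<le> l" "l \<le> L" "r < m"
  shows "(\<lambda>\<omega>. preact d m (W \<omega>) (X \<omega>) l r) \<in> borel_measurable M"
  unfolding preact_def using assms hid_measurable[of "l - 1"] by (intro lin_measurable) auto

lemma gate_measurable:
  assumes "1 \<le> l" "l \<le> L" "r < m"
  shows "(\<lambda>\<omega>. gate d m (W \<omega>) (X \<omega>) l r) \<in> borel_measurable M"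
proof -
  note [measurable] = preact_measurable[OF assms]
  show ?thesis unfolding gate_def by measurable
qed

lemma prp_measurable:
  assumes "1 \<le> k" "k + i \<le> L" "r < m"
  shows "(\<lambda>\<omega>. prp m (gate d m (W \<omega>) (X \<omega>)) (W \<omega>) k u i r) \<in> borel_measurable M"
  using assms
proof (induction i arbitrary: r)
  case (Suc i)
  have dim: "in_dim d m (k + Suc i) = m" using Suc.prems by (simp add: in_dim_def)
  have "(\<lambda>\<omega>. lin (in_dim d m (k + Suc i)) (W \<omega> (k + Suc i)) (prp m (gate d m (W \<omega>) (X \<omega>)) (W \<omega>) k u i) r) \<in> borel_measurable M"
    using Suc by (intro lin_measurable) (auto simp: dim simp del: add_Suc_right)
  moreover have "(\<lambda>\<omega>. gate d m (W \<omega>) (X \<omega>) (k + Suc i) r) \<in> borel_measurable M"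
    using Suc.prems by (intro gate_measurable) auto
  ultimately show ?case unfolding dim by (simp add: borel_measurable_times)
qed simp

lemma hid_prev_norm_measurable:
  assumes "1 \<le> l" "l \<le> L"
  shows "(\<lambda>\<omega>. L2_set (hid d m (W \<omega>) (X \<omega>) (l - 1)) {..<in_dim d m l}) \<in> borel_measurable M"
  using assms hid_measurable[of "l - 1"] by (intro L2_set_measurable) auto

lemma gate_event_measurable:
  assumes l: "1 \<le> l" "l \<le> L" and z: "\<And>j. j < in_dim d m l \<Longrightarrow> (\<lambda>\<omega>. z \<omega> j) \<in> borel_measurable M"
  shows "{\<omega> \<in> space M. gate_event d m (W \<omega>) (X \<omega>) l (z \<omega>) \<theta> t} \<in> sets M"
proof -
  note [measurable] = hid_prev_norm_measurable[OF l] L2_set_measurable[OF z]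
  have "(\<lambda>\<omega>. \<Sum>r<m. gate d m (W \<omega>) (X \<omega>) l r * (lin (in_dim d m l) (W \<omega> l) (z \<omega>) r)\<^sup>2) \<in> borel_measurable M"
    using gate_measurable[OF l] lin_measurable[OF l _ z] by (auto intro!: borel_measurable_sum borel_measurable_times borel_measurable_power)
  note [measurable] = this
  show ?thesis unfolding gate_event_def by measurable
qed

lemma rows_event_measurable:
  assumes l: "1 \<le> l" "l \<le> L" "in_dim d m l = m" and z: "\<And>j. j < m \<Longrightarrow> (\<lambda>\<omega>. z \<omega> j) \<in> borel_measurable M"
    and T: "T \<subseteq> {..<m}"
  shows "{\<omega> \<in> space M. rows_event m (W \<omega>) l (z \<omega>) T t} \<in> sets M"
proof -
  note [measurable] = L2_set_measurable[OF z]
  have "(\<lambda>\<omega>. \<Sum>r\<in>T. (lin m (W \<omega> l) (z \<omega>) r)\<^sup>2) \<in> borel_measurable M"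
    using lin_measurable[OF l(1,2), of _ z] T z by (auto simp: l(3) intro!: borel_measurable_sum borel_measurable_power)
  note [measurable] = this
  show ?thesis unfolding rows_event_def by measurable
qed

lemma count_event_measurable:
  assumes l: "1 \<le> l" "l \<le> L"
  shows "{\<omega> \<in> space M. count_event d m L \<beta> (W \<omega>) (X \<omega>) l t} \<in> sets M"
proof -
  note [measurable] = hid_prev_norm_measurable[OF l]
  have count: "real (card {r \<in> fresh_rows m L l. \<bar>preact d m (W \<omega>) (X \<omega>) l r\<bar> \<le> \<beta>})
    = (\<Sum>r\<in>fresh_rows m L l. if \<bar>preact d m (W \<omega>) (X \<omega>) l r\<bar> \<le> \<beta> then 1 else 0)" for \<omega>
    by (simp add: sum.If_cases Int_def)
  have "(\<lambda>\<omega>. \<Sum>r\<in>fresh_rows m L l. if \<bar>preact d m (W \<omega>) (X \<omega>) l r\<bar> \<le> \<beta> then 1 else 0 :: real) \<in> borel_measurable M"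
  proof (rule borel_measurable_sum)
    fix r assume "r \<in> fresh_rows m L l"
    then have "r < m" by (auto simp: fresh_rows_def split: if_splits)
    note [measurable] = preact_measurable[OF l this]
    show "(\<lambda>\<omega>. if \<bar>preact d m (W \<omega>) (X \<omega>) l r\<bar> \<le> \<beta> then 1 else 0 :: real) \<in> borel_measurable M" by measurable
  qed
  note [measurable] = this
  show ?thesis unfolding count_event_def count by measurable
qed

end

section \<open>Union bound\<close>

text \<open>Quantifying over the finite test net only, rather than over all vectors, makes
  \<open>clean\<close> a finite Boolean combination of events.\<close>

lemma clean_measurable:
  assumes W: "\<And>l r j. 1 \<le> l \<Longrightarrow> l \<le> L \<Longrightarrow> r < m \<Longrightarrow> j < in_dim d m l \<Longrightarrow> (\<lambda>\<omega>. W \<omega> l r j) \<in> borel_measurable M"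
    and X: "\<And>j. j < d \<Longrightarrow> (\<lambda>\<omega>. X \<omega> j) \<in> borel_measurable M"
    and fin: "finite (test_net m L s)"
  shows "{\<omega> \<in> space M. clean d m L s \<beta> (W \<omega>) (X \<omega>)} \<in> sets M"
proof -
  have K: "finite {(k, i). 1 \<le> k \<and> k + Suc i < L}" "finite {(k, i). 1 \<le> k \<and> k + Suc i \<le> L}"
    by (rule finite_subset[of _ "{..L} \<times> {..L}"]; auto)+
  have Rf: "finite (row_choices m L s l)" for l
    unfolding row_choices_def by (rule finite_subset[of _ "Pow (fresh_rows m L l)"]) auto
  have Rs: "T \<subseteq> {..<m}" if "T \<in> row_choices m L s l" for T l
    using that by (auto simp: row_choices_def fresh_rows_def split: if_splits)
  have h: "{\<omega> \<in> space M. gate_event d m (W \<omega>) (X \<omega>) l (hid d m (W \<omega>) (X \<omega>) (l - 1)) \<theta> t} \<in> sets M"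
    if "l \<in> {1..<L}" for l \<theta> t
    using that hid_measurable[OF W X, of "l - 1"] by (intro gate_event_measurable[OF W X]) auto
  have c: "{\<omega> \<in> space M. count_event d m L \<beta> (W \<omega>) (X \<omega>) l t} \<in> sets M" if "l \<in> {1..L}" for l t
    using that by (intro count_event_measurable[OF W X]) auto
  have p: "{\<omega> \<in> space M. gate_event d m (W \<omega>) (X \<omega>) (k + Suc i) (prp m (gate d m (W \<omega>) (X \<omega>)) (W \<omega>) k u i) \<theta> t} \<in> sets M"
    if "1 \<le> k" "k + Suc i < L" for k i u \<theta> t
    using that by (intro gate_event_measurable[OF W X] prp_measurable[OF W X]) (auto simp: in_dim_def)
  have r: "{\<omega> \<in> space M. rows_event m (W \<omega>) (k + Suc i) (prp m (gate d m (W \<omega>) (X \<omega>)) (W \<omega>) k u i) T t} \<in> sets M"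
    if "1 \<le> k" "k + Suc i \<le> L" "T \<in> row_choices m L s (k + Suc i)" for k i u T t
    using that Rs by (intro rows_event_measurable[OF W X] prp_measurable[OF W X]) (auto simp: in_dim_def)
  show ?thesis
    unfolding clean_def case_prod_beta
    by (intro sets.sets_Collect_conj sets.sets_Collect_finite_All sets.sets_Collect_neg h c p r K[unfolded case_prod_beta] fin Rf finite_atLeastLessThan finite_atLeastAtMost)
      auto
qed

section \<open>Cardinality of the test net\<close>

lemma finite_net_supports: "finite (net_supports m s N)"
proof -
  have "finite {Q. Q \<subseteq> {..<m} \<and> card Q = s}"
    by (rule finite_subset[of _ "Pow {..<m}"]) auto
  then show ?thesis by (simp add: net_supports_def)
qed

lemma card_net_supports:
  assumes "s \<le> m"
  shows "real (card (net_supports m s N)) \<le> real m ^ s + real N"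
proof -
  have "card (net_supports m s N) \<le> card {Q. Q \<subseteq> {..<m} \<and> card Q = s} + card (residue_block m N ` {..<N})"
    unfolding net_supports_def by (rule card_Un_le)
  also have "\<dots> \<le> (m choose s) + N"
    using n_subsets[of "{..<m}" s] card_image_le[of "{..<N}" "residue_block m N"] by simp
  also have "\<dots> \<le> m ^ s + N" using binomial_le_pow[OF assms] by simp
  finally show ?thesis by (simp only: of_nat_add of_nat_power of_nat_le_iff flip: of_nat_power of_nat_add)
qed

lemma test_net_finite_card:
  assumes "L \<ge> 2" "s \<le> m" "s \<le> m div blocks L + 1"
  shows "finite (test_net m L s)"
    "real (card (test_net m L s)) \<le> (real m ^ s + real (blocks L)) * exp (5 * real (m div blocks L + 1))"
proof -
  let ?N = "blocks L" and ?q = "m div blocks L + 1"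
  have Q: "finite Q" "card Q \<le> ?q" if "Q \<in> net_supports m s ?N" for Q
    using that assms residue_block_card[of ?N m] by (auto simp: net_supports_def intro: finite_subset)
  show "finite (test_net m L s)"
    unfolding test_net_def using finite_net_supports net_on_finite_card(1)[OF Q] by (intro finite_UN_I) auto
  have "real (card (test_net m L s)) \<le> (\<Sum>Q\<in>net_supports m s ?N. real (card (net_on Q ?q)))"
    unfolding test_net_def unfolding of_nat_sum[symmetric] of_nat_le_iff
    by (rule card_UN_le[OF finite_net_supports])
  also have "\<dots> \<le> (\<Sum>Q\<in>net_supports m s ?N. exp (5 * real ?q))"
    using net_on_finite_card(2)[OF Q] by (intro sum_mono)
  also have "\<dots> = real (card (net_supports m s ?N)) * exp (5 * real ?q)" by simp
  also have "\<dots> \<le> (real m ^ s + real ?N) * exp (5 * real ?q)"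
    by (intro mult_right_mono card_net_supports assms(2)) simp
  finally show "real (card (test_net m L s)) \<le> (real m ^ s + real ?N) * exp (5 * real ?q)" .
qed

section \<open>Failure probabilities at the random initialization\<close>

context
  fixes d m L s :: nat and \<beta> :: real and x :: "nat \<Rightarrow> real"
  assumes m_pos: "m > 0" and m_even: "even m" and L2: "L \<ge> 2" and \<beta>0: "0 \<le> \<beta>"
    and s_le: "s \<le> m div 2" "s \<le> m div blocks L + 1"
begin

abbreviation (input) "I \<equiv> init_index d m L"
abbreviation (input) "IP \<equiv> PiM (init_index d m L) (\<lambda>_. gaussian)"
abbreviation (input) "w g \<equiv> entries (init_params d m L g)"

lemma finite_init_index: "finite (init_index d m L)"
  by (rule finite_subset[of _ "{..L} \<times> {..m} \<times> {..d + m}"]) (auto simp: init_index_def in_dim_def split: if_splits)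

lemma init_entry:
  assumes "1 \<le> l" "l \<le> L" "r < m" "j < in_dim d m l"
  shows "w g l r j = g (l, if l = L \<and> m div 2 \<le> r then r - m div 2 else r, j)"
    and "(l, if l = L \<and> m div 2 \<le> r then r - m div 2 else r, j) \<in> I"
proof -
  show "w g l r j = g (l, if l = L \<and> m div 2 \<le> r then r - m div 2 else r, j)"
    using assms by (simp add: entries_def init_params_def)
  have "m = m div 2 + m div 2" using m_even by presburger
  then show "(l, if l = L \<and> m div 2 \<le> r then r - m div 2 else r, j) \<in> I"
    using assms by (auto simp: init_index_def)
qed

lemma fresh_entry:
  assumes "1 \<le> l" "l \<le> L" "r \<in> fresh_rows m L l" "j < in_dim d m l"
  shows "w g l r j = g (l, r, j)" "(l, r, j) \<in> I"
proof -
  have r: "r < m" "\<not> (l = L \<and> m div 2 \<le> r)"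
    using assms(3) by (auto simp: fresh_rows_def split: if_splits)
  show "w g l r j = g (l, r, j)" "(l, r, j) \<in> I"
    using init_entry[OF assms(1,2) r(1) assms(4)] r(2) by (simp_all only: if_False)
qed

lemma init_entry_measurable:
  assumes "1 \<le> l" "l \<le> L" "r < m" "j < in_dim d m l"
  shows "(\<lambda>g. w g l r j) \<in> borel_measurable IP"
  unfolding init_entry(1)[OF assms]
  using measurable_component_singleton[OF init_entry(2)[OF assms], of "\<lambda>_. gaussian"]
  by (simp cong: measurable_cong_sets)

text \<open>The repeated rows read entries of their own layer \<open>L\<close>, so the duplication
  couples no two layers.\<close>

lemma init_entry_cong:
  assumes "\<And>k. k \<in> I \<Longrightarrow> fst k \<noteq> l \<Longrightarrow> g k = g' k" and "1 \<le> l'" "l' \<le> L" "l' \<noteq> l" "r < m" "j < in_dim d m l'"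
  shows "w g l' r j = w g' l' r j"
  unfolding init_entry(1)[OF assms(2,3,5,6)]
  using assms(4) by (intro assms(1) init_entry(2)[OF assms(2,3,5,6)]) simp

lemma fresh_layer_init:
  assumes l: "1 \<le> l" "l \<le> L"
    and z: "\<And>j. j < in_dim d m l \<Longrightarrow> (\<lambda>g. z g j) \<in> borel_measurable IP"
    and z_dep: "\<And>g g' j. (\<And>k. k \<in> I \<Longrightarrow> fst k \<noteq> l \<Longrightarrow> g k = g' k) \<Longrightarrow> j < in_dim d m l \<Longrightarrow> z g j = z g' j"
  shows "fresh_layer I l (in_dim d m l) (fresh_rows m L l) (\<lambda>g. hid d m (w g) x (l - 1)) z"
proof
  show "finite I" by (rule finite_init_index)
  show "(l, r, j) \<in> I" if "r \<in> fresh_rows m L l" "j < in_dim d m l" for r j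
    using fresh_entry(2)[OF l that] .
  show "(\<lambda>g. hid d m (w g) x (l - 1) j) \<in> borel_measurable IP" if "j < in_dim d m l" for j
    using l that by (intro hid_measurable[where L = L] init_entry_measurable) auto
  show "hid d m (w g) x (l - 1) j = hid d m (w g') x (l - 1) j"
    if eq: "\<And>k. k \<in> I \<Longrightarrow> fst k \<noteq> l \<Longrightarrow> g k = g' k" and j: "j < in_dim d m l" for g g' j
  proof (rule hid_cong)
    show "j < in_dim d m (Suc (l - 1))" using l j by simp
    show "w g l' r j = w g' l' r j" if "1 \<le> l'" "l' \<le> l - 1" "r < m" "j < in_dim d m l'" for l' r j
      by (rule init_entry_cong[OF eq]) (use that l in auto)
  qed
qed (simp, fact z, fact z_dep)

lemma fresh_lin:
  assumes "1 \<le> l" "l \<le> L" "r \<in> fresh_rows m L l"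
  shows "(\<Sum>j<in_dim d m l. g (l, r, j) * v j) = lin (in_dim d m l) (w g l) v r"
  unfolding lin_def using fresh_entry(1)[OF assms] by (intro sum.cong) auto

text \<open>The exponent per row is \<open>\<theta>^2 - \<theta> \<tau> / 2\<close>; it is smallest
  at \<open>\<theta> = \<tau> / 4\<close>, with value \<open>- \<tau>^2 / 16\<close>.\<close>

lemma prob_gate_event:
  assumes l: "1 \<le> l" "l < L" and \<tau>: "\<bar>\<tau>\<bar> \<le> 1 / 2"
    and z: "\<And>j. j < in_dim d m l \<Longrightarrow> (\<lambda>g. z g j) \<in> borel_measurable IP"
    and z_dep: "\<And>g g' j. (\<And>k. k \<in> I \<Longrightarrow> fst k \<noteq> l \<Longrightarrow> g k = g' k) \<Longrightarrow> j < in_dim d m l \<Longrightarrow> z g j = z g' j"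
  defines "B \<equiv> {g \<in> space IP. gate_event d m (w g) x l (z g) (\<tau> / 4) (thr m (\<tau> / 4) \<tau>)}"
  shows "B \<in> sets IP" "measure IP B \<le> exp (- (real m * \<tau>\<^sup>2 / 16))"
proof -
  interpret fresh_layer I l "in_dim d m l" "fresh_rows m L l" "\<lambda>g. hid d m (w g) x (l - 1)" z
    by (rule fresh_layer_init[OF l(1) less_imp_le[OF l(2)]]) (fact z, fact z_dep)
  have R: "fresh_rows m L l = {..<m}" using l by (simp add: fresh_rows_def)
  have rd_eq: "rd g r v = lin (in_dim d m l) (w g l) v r" if "r < m" for g r v
    unfolding rd_def using fresh_lin[of l r g v] l that by (simp add: R)
  have gt_eq: "gt g r = gate d m (w g) x l r" if "r < m" for g r
    unfolding gt_def gate_def preact_def rd_eq[OF that] ..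
  have "gate_event d m (w g) x l (z g) (\<tau> / 4) (thr m (\<tau> / 4) \<tau>) \<longleftrightarrow>
    0 < L2_set (hid d m (w g) x (l - 1)) {..<in_dim d m l} \<and> 0 < L2_set (z g) {..<in_dim d m l} \<and>
    thr m (\<tau> / 4) \<tau> * (L2_set (z g) {..<in_dim d m l})\<^sup>2 \<le> \<tau> / 4 * (\<Sum>r\<in>fresh_rows m L l. gt g r * (rd g r (z g))\<^sup>2)" for g
  proof -
    have "(\<Sum>r<m. gate d m (w g) x l r * (lin (in_dim d m l) (w g l) (z g) r)\<^sup>2)
      = (\<Sum>r\<in>fresh_rows m L l. gt g r * (rd g r (z g))\<^sup>2)"
      unfolding R by (intro sum.cong refl) (simp only: rd_eq gt_eq lessThan_iff)
    then show ?thesis by (simp only: gate_event_def)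
  qed
  then have B: "B = {g \<in> space IP. 0 < L2_set (hid d m (w g) x (l - 1)) {..<in_dim d m l} \<and> 0 < L2_set (z g) {..<in_dim d m l} \<and>
    thr m (\<tau> / 4) \<tau> * (L2_set (z g) {..<in_dim d m l})\<^sup>2 \<le> \<tau> / 4 * (\<Sum>r\<in>fresh_rows m L l. gt g r * (rd g r (z g))\<^sup>2)}"
    by (simp only: B_def)
  have \<theta>: "\<bar>\<tau> / 4\<bar> \<le> 1 / 8" using \<tau> by simp
  show "B \<in> sets IP" unfolding B by (rule layer_gate(1)[OF \<theta>])
  have "measure IP B \<le> exp (real (card (fresh_rows m L l)) * (\<tau> / 4 / 2 + (\<tau> / 4)\<^sup>2) - thr m (\<tau> / 4) \<tau>)"
    unfolding B by (rule layer_gate(2)[OF \<theta>])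
  also have "real (card (fresh_rows m L l)) * (\<tau> / 4 / 2 + (\<tau> / 4)\<^sup>2) - thr m (\<tau> / 4) \<tau> = - (real m * \<tau>\<^sup>2 / 16)"
    by (simp add: R power2_eq_square field_simps)
  finally show "measure IP B \<le> exp (- (real m * \<tau>\<^sup>2 / 16))" .
qed

lemma prob_rows_event:
  fixes t :: real
  assumes l: "1 \<le> l" "l \<le> L" "in_dim d m l = m" and T: "T \<in> row_choices m L s l"
    and z: "\<And>j. j < in_dim d m l \<Longrightarrow> (\<lambda>g. z g j) \<in> borel_measurable IP"
    and z_dep: "\<And>g g' j. (\<And>k. k \<in> I \<Longrightarrow> fst k \<noteq> l \<Longrightarrow> g k = g' k) \<Longrightarrow> j < in_dim d m l \<Longrightarrow> z g j = z g' j"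
  defines "B \<equiv> {g \<in> space IP. rows_event m (w g) l (z g) T t}"
  shows "B \<in> sets IP" "measure IP B \<le> exp (real s / 2 - t / 4)"
proof -
  interpret fresh_layer I l "in_dim d m l" "fresh_rows m L l" "\<lambda>g. hid d m (w g) x (l - 1)" z
    by (rule fresh_layer_init[OF l(1,2)]) (fact z, fact z_dep)
  have T': "T \<subseteq> fresh_rows m L l" "card T = s" using T by (auto simp: row_choices_def)
  have "(\<Sum>r\<in>T. (lin m (w g l) (z g) r)\<^sup>2) = (\<Sum>r\<in>T. (rd g r (z g))\<^sup>2)" for g
  proof (intro sum.cong refl)
    fix r assume "r \<in> T"
    then show "(lin m (w g l) (z g) r)\<^sup>2 = (rd g r (z g))\<^sup>2"
      unfolding rd_def using fresh_lin[of l r g "z g"] l T' by (auto simp: subset_iff)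
  qed
  then have B: "B = {g \<in> space IP. 0 < L2_set (z g) {..<in_dim d m l} \<and>
    t * (L2_set (z g) {..<in_dim d m l})\<^sup>2 \<le> (\<Sum>r\<in>T. (rd g r (z g))\<^sup>2)}"
    by (simp only: B_def rows_event_def l(3))
  show "B \<in> sets IP" unfolding B by (rule layer_rows(1)[OF T'(1)])
  show "measure IP B \<le> exp (real s / 2 - t / 4)" unfolding B T'(2)[symmetric] by (rule layer_rows(2)[OF T'(1)])
qed

lemma prob_count_event:
  fixes t :: real
  assumes l: "1 \<le> l" "l \<le> L"
  defines "B \<equiv> {g \<in> space IP. count_event d m L \<beta> (w g) x l t}"
  shows "B \<in> sets IP" "measure IP B \<le> exp (4 * \<beta> * real m - t)"
proof -
  let ?h = "\<lambda>g. hid d m (w g) x (l - 1)"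
  \<comment> \<open>The count involves no second vector, so \<open>z\<close> is filled with
    0.\<close>
  interpret fresh_layer I l "in_dim d m l" "fresh_rows m L l" ?h "\<lambda>_ _. 0"
    by (rule fresh_layer_init) (use l in auto)
  have "{r \<in> fresh_rows m L l. \<bar>preact d m (w g) x l r\<bar> \<le> \<beta>} = {r \<in> fresh_rows m L l. \<bar>rd g r (?h g)\<bar> \<le> \<beta>}" for g
    using fresh_lin[OF l, of _ g "?h g"] by (auto simp: rd_def preact_def)
  then have B: "B = {g \<in> space IP. 1 / 2 \<le> L2_set (?h g) {..<in_dim d m l} \<and>
    t \<le> real (card {r \<in> fresh_rows m L l. \<bar>rd g r (?h g)\<bar> \<le> \<beta>})}"
    by (simp only: B_def count_event_def)
  show "B \<in> sets IP" unfolding B by (rule layer_small_ball(1)[OF \<beta>0])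
  have "measure IP B \<le> exp (4 * \<beta> * real (card (fresh_rows m L l)) - t)"
    unfolding B by (rule layer_small_ball(2)[OF \<beta>0])
  also have "\<dots> \<le> exp (4 * \<beta> * real m - t)"
    using \<beta>0 by (auto simp: fresh_rows_def intro!: mult_left_mono)
  finally show "measure IP B \<le> exp (4 * \<beta> * real m - t)" .
qed

lemma prp_init_measurable:
  assumes "1 \<le> k" "k + Suc i \<le> L" "j < in_dim d m (k + Suc i)"
  shows "(\<lambda>g. prp m (gate d m (w g) x) (w g) k u i j) \<in> borel_measurable IP"
  using assms by (intro prp_measurable[where L = L and X = "\<lambda>_. x"] init_entry_measurable) (auto simp: in_dim_def)

lemma prp_init_dep:
  assumes "\<And>k'. k' \<in> I \<Longrightarrow> fst k' \<noteq> k + Suc i \<Longrightarrow> g k' = g' k'" "1 \<le> k" "k + Suc i \<le> L" "j < in_dim d m (k + Suc i)"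
  shows "prp m (gate d m (w g) x) (w g) k u i j = prp m (gate d m (w g') x) (w g') k u i j"
proof (rule prp_cong_weights)
  show "j < m" using assms by (simp add: in_dim_def)
  show "w g l' r j = w g' l' r j" if "1 \<le> l'" "l' \<le> k + i" "r < m" "j < in_dim d m l'" for l' r j
    by (rule init_entry_cong[OF assms(1)]) (use that assms(3) in auto)
qed (rule assms(2))

lemma prob_gate_event_hid:
  assumes l: "1 \<le> l" "l < L" and \<tau>: "\<bar>\<tau>\<bar> \<le> 1 / 2"
  defines "B \<equiv> {g \<in> space IP. gate_event d m (w g) x l (hid d m (w g) x (l - 1)) (\<tau> / 4) (thr m (\<tau> / 4) \<tau>)}"
  shows "B \<in> sets IP" "measure IP B \<le> exp (- (real m * \<tau>\<^sup>2 / 16))"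
proof -
  interpret fresh_layer I l "in_dim d m l" "fresh_rows m L l" "\<lambda>g. hid d m (w g) x (l - 1)" "\<lambda>_ _. 0"
    by (rule fresh_layer_init[OF l(1) less_imp_le[OF l(2)]]) simp_all
  show "B \<in> sets IP" "measure IP B \<le> exp (- (real m * \<tau>\<^sup>2 / 16))"
    unfolding B_def by (rule prob_gate_event[OF l \<tau>]; fact h_meas h_dep)+
qed

lemma prob_gate_event_prp:
  fixes u :: "nat \<Rightarrow> real"
  assumes l: "1 \<le> k" "k + Suc i < L" and \<tau>: "\<bar>\<tau>\<bar> \<le> 1 / 2"
  defines "B \<equiv> {g \<in> space IP. gate_event d m (w g) x (k + Suc i) (prp m (gate d m (w g) x) (w g) k u i) (\<tau> / 4) (thr m (\<tau> / 4) \<tau>)}"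
  shows "B \<in> sets IP" "measure IP B \<le> exp (- (real m * \<tau>\<^sup>2 / 16))"
proof -
  have meas: "\<And>j. j < in_dim d m (k + Suc i) \<Longrightarrow> (\<lambda>g. prp m (gate d m (w g) x) (w g) k u i j) \<in> borel_measurable IP"
    by (rule prp_init_measurable[OF l(1) less_imp_le[OF l(2)]])
  have dep: "\<And>g g' j. (\<And>k'. k' \<in> I \<Longrightarrow> fst k' \<noteq> k + Suc i \<Longrightarrow> g k' = g' k') \<Longrightarrow> j < in_dim d m (k + Suc i) \<Longrightarrow>
      prp m (gate d m (w g) x) (w g) k u i j = prp m (gate d m (w g') x) (w g') k u i j"
    by (rule prp_init_dep[OF _ l(1) less_imp_le[OF l(2)]])
  have k1: "1 \<le> k + Suc i" by simp
  show "B \<in> sets IP" "measure IP B \<le> exp (- (real m * \<tau>\<^sup>2 / 16))"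
    unfolding B_def by (rule prob_gate_event[OF k1 l(2) \<tau>]; fact meas dep)+
qed

lemma prob_rows_event_prp:
  fixes u :: "nat \<Rightarrow> real" and t :: real
  assumes l: "1 \<le> k" "k + Suc i \<le> L" and T: "T \<in> row_choices m L s (k + Suc i)"
  defines "B \<equiv> {g \<in> space IP. rows_event m (w g) (k + Suc i) (prp m (gate d m (w g) x) (w g) k u i) T t}"
  shows "B \<in> sets IP" "measure IP B \<le> exp (real s / 2 - t / 4)"
proof -
  have meas: "\<And>j. j < in_dim d m (k + Suc i) \<Longrightarrow> (\<lambda>g. prp m (gate d m (w g) x) (w g) k u i j) \<in> borel_measurable IP"
    by (rule prp_init_measurable[OF l])
  have dep: "\<And>g g' j. (\<And>k'. k' \<in> I \<Longrightarrow> fst k' \<noteq> k + Suc i \<Longrightarrow> g k' = g' k') \<Longrightarrow> j < in_dim d m (k + Suc i) \<Longrightarrow>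
      prp m (gate d m (w g) x) (w g) k u i j = prp m (gate d m (w g') x) (w g') k u i j"
    by (rule prp_init_dep[OF _ l])
  have dim: "in_dim d m (k + Suc i) = m" using l by (simp add: in_dim_def)
  have k1: "1 \<le> k + Suc i" by simp
  show "B \<in> sets IP" "measure IP B \<le> exp (real s / 2 - t / 4)"
    unfolding B_def by (rule prob_rows_event[OF k1 l(2) dim T]; fact meas dep)+
qed

lemma measure_UN_le:
  assumes "finite A" "\<And>a. a \<in> A \<Longrightarrow> B a \<in> sets IP" "\<And>a. a \<in> A \<Longrightarrow> measure IP (B a) \<le> e"
  shows "(\<Union>a\<in>A. B a) \<in> sets IP" "measure IP (\<Union>a\<in>A. B a) \<le> real (card A) * e"
proof -
  interpret prob_space IP by (rule prob_space_PiM_gaussian)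
  show "(\<Union>a\<in>A. B a) \<in> sets IP" using assms by auto
  have "measure IP (\<Union>a\<in>A. B a) \<le> (\<Sum>a\<in>A. measure IP (B a))"
    using assms by (intro finite_measure_subadditive_finite) auto
  also have "\<dots> \<le> (\<Sum>a\<in>A. e)" using assms by (intro sum_mono)
  finally show "measure IP (\<Union>a\<in>A. B a) \<le> real (card A) * e" by simp
qed

text \<open>The terms stand for activation norms in both tails, small preactivations, growth of test
  vectors, and sparse sets of rows. The last two pay for the size of the net, and the last one also
  for the choice of rows, at most \<open>m^s\<close>.\<close>

lemma prob_not_clean:
  defines "U \<equiv> real (card (test_net m L s))"
  shows "measure IP {g \<in> space IP. \<not> clean d m L s \<beta> (w g) x}
    \<le> 2 * real L * exp (- (real m / (6400 * (real L)\<^sup>2))) + real L * exp (4 * \<beta> * real m - real s / 8)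
      + (real L)\<^sup>2 * U * exp (- (real m / (16 * (real L)\<^sup>2)))
      + (real L)\<^sup>2 * U * (real m ^ s * exp (real s / 2 - real m / (18432 * (real L)\<^sup>2)))"
proof -
  interpret prob_space IP by (rule prob_space_PiM_gaussian)
  let ?net = "test_net m L s"
  have fin_net: "finite ?net" using test_net_finite_card(1) L2 s_le by auto
  let ?K1 = "{(k, i). 1 \<le> k \<and> k + Suc i < L}" and ?K2 = "{(k, i). 1 \<le> k \<and> k + Suc i \<le> L}"
  have sub: "?K1 \<subseteq> {1..L} \<times> {..<L}" "?K2 \<subseteq> {1..L} \<times> {..<L}" by auto
  have cK: "finite ?K1" "finite ?K2" "real (card ?K1) \<le> (real L)\<^sup>2" "real (card ?K2) \<le> (real L)\<^sup>2"
    using finite_subset[OF sub(1)] finite_subset[OF sub(2)] card_mono[OF _ sub(1)] card_mono[OF _ sub(2)]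
    by (auto simp: power2_eq_square simp flip: of_nat_mult)
  define A1 where "A1 l = {g \<in> space IP. gate_event d m (w g) x l (hid d m (w g) x (l - 1)) (1 / (20 * real L) / 4) (thr m (1 / (20 * real L) / 4) (1 / (20 * real L)))}" for l
  define A2 where "A2 l = {g \<in> space IP. gate_event d m (w g) x l (hid d m (w g) x (l - 1)) (- 1 / (20 * real L) / 4) (thr m (- 1 / (20 * real L) / 4) (- 1 / (20 * real L)))}" for l
  define A3 where "A3 l = {g \<in> space IP. count_event d m L \<beta> (w g) x l (real s / 8)}" for l
  define A4 where "A4 = (\<lambda>((k, i), u). {g \<in> space IP. gate_event d m (w g) x (k + Suc i) (prp m (gate d m (w g) x) (w g) k u i) (1 / real L / 4) (thr m (1 / real L / 4) (1 / real L))})"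
  define A5 where "A5 = (\<lambda>((k, i), u). \<Union>T\<in>row_choices m L s (k + Suc i).
    {g \<in> space IP. rows_event m (w g) (k + Suc i) (prp m (gate d m (w g) x) (w g) k u i) T (real m / (4608 * (real L)\<^sup>2))})"
  have \<tau>: "\<bar>1 / (20 * real L)\<bar> \<le> 1 / 2" "\<bar>- 1 / (20 * real L)\<bar> \<le> 1 / 2" "\<bar>1 / real L\<bar> \<le> 1 / 2"
    using L2 by (auto simp: field_simps)
  have e1: "real m * (1 / (20 * real L))\<^sup>2 / 16 = real m / (6400 * (real L)\<^sup>2)"
    "real m * (- 1 / (20 * real L))\<^sup>2 / 16 = real m / (6400 * (real L)\<^sup>2)"
    "real m * (1 / real L)\<^sup>2 / 16 = real m / (16 * (real L)\<^sup>2)"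
    by (simp_all add: power_divide power_mult_distrib)
  have A1: "A1 l \<in> sets IP" "measure IP (A1 l) \<le> exp (- (real m / (6400 * (real L)\<^sup>2)))" if "l \<in> {1..<L}" for l
    using prob_gate_event_hid[OF _ _ \<tau>(1), of l] that unfolding A1_def e1 by auto
  have A2: "A2 l \<in> sets IP" "measure IP (A2 l) \<le> exp (- (real m / (6400 * (real L)\<^sup>2)))" if "l \<in> {1..<L}" for l
    using prob_gate_event_hid[OF _ _ \<tau>(2), of l] that unfolding A2_def e1 by auto
  have A3: "A3 l \<in> sets IP" "measure IP (A3 l) \<le> exp (4 * \<beta> * real m - real s / 8)" if "l \<in> {1..L}" for l
    using prob_count_event[of l] that unfolding A3_def by auto
  have A4: "A4 a \<in> sets IP" "measure IP (A4 a) \<le> exp (- (real m / (16 * (real L)\<^sup>2)))" if "a \<in> ?K1 \<times> ?net" for a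
  proof -
    obtain k i u where a: "a = ((k, i), u)" "1 \<le> k" "k + Suc i < L" using \<open>a \<in> ?K1 \<times> ?net\<close> by auto
    show "A4 a \<in> sets IP" "measure IP (A4 a) \<le> exp (- (real m / (16 * (real L)\<^sup>2)))"
      using prob_gate_event_prp[OF a(2,3) \<tau>(3), of u] unfolding A4_def a(1) prod.case e1 by blast+
  qed
  have A5: "A5 a \<in> sets IP" "measure IP (A5 a) \<le> real m ^ s * exp (real s / 2 - real m / (18432 * (real L)\<^sup>2))" if "a \<in> ?K2 \<times> ?net" for a
  proof -
    obtain k i u where a: "a = ((k, i), u)" "1 \<le> k" "k + Suc i \<le> L" using \<open>a \<in> ?K2 \<times> ?net\<close> by auto
    let ?l = "k + Suc i"
    have fin: "finite (row_choices m L s ?l)"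
      unfolding row_choices_def by (rule finite_subset[of _ "Pow (fresh_rows m L ?l)"]) auto
    have t4: "real m / (4608 * (real L)\<^sup>2) / 4 = real m / (18432 * (real L)\<^sup>2)" by simp
    have ev: "{g \<in> space IP. rows_event m (w g) ?l (prp m (gate d m (w g) x) (w g) k u i) T (real m / (4608 * (real L)\<^sup>2))} \<in> sets IP"
      "measure IP {g \<in> space IP. rows_event m (w g) ?l (prp m (gate d m (w g) x) (w g) k u i) T (real m / (4608 * (real L)\<^sup>2))}
        \<le> exp (real s / 2 - real m / (18432 * (real L)\<^sup>2))" if "T \<in> row_choices m L s ?l" for T
      using prob_rows_event_prp[OF a(2,3) that, of u "real m / (4608 * (real L)\<^sup>2)"] unfolding t4 by blast+
    have "card (row_choices m L s ?l) = card (fresh_rows m L ?l) choose s"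
      unfolding row_choices_def by (rule n_subsets) simp
    also have "\<dots> \<le> card (fresh_rows m L ?l) ^ s"
      using s_le by (intro binomial_le_pow) (auto simp: fresh_rows_def)
    also have "\<dots> \<le> m ^ s" by (intro power_mono) (auto simp: fresh_rows_def)
    finally have c: "real (card (row_choices m L s ?l)) \<le> real m ^ s" by (simp flip: of_nat_power)
    note un = measure_UN_le[OF fin, OF ev]
    have A5a: "A5 a = (\<Union>T\<in>row_choices m L s ?l. {g \<in> space IP. rows_event m (w g) ?l (prp m (gate d m (w g) x) (w g) k u i) T (real m / (4608 * (real L)\<^sup>2))})"
      by (simp add: A5_def a)
    show "A5 a \<in> sets IP" unfolding A5a by (rule un(1))
    have "measure IP (A5 a) \<le> real (card (row_choices m L s ?l)) * exp (real s / 2 - real m / (18432 * (real L)\<^sup>2))"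
      unfolding A5a by (rule un(2))
    also have "\<dots> \<le> real m ^ s * exp (real s / 2 - real m / (18432 * (real L)\<^sup>2))"
      using c by (intro mult_right_mono) auto
    finally show "measure IP (A5 a) \<le> real m ^ s * exp (real s / 2 - real m / (18432 * (real L)\<^sup>2))" .
  qed
  have F4: "finite (?K1 \<times> ?net)" "finite (?K2 \<times> ?net)" using cK fin_net by auto
  let ?e1 = "exp (- (real m / (6400 * (real L)\<^sup>2)))" and ?e4 = "exp (- (real m / (16 * (real L)\<^sup>2)))"
    and ?e5 = "real m ^ s * exp (real s / 2 - real m / (18432 * (real L)\<^sup>2))"
  have U1: "(\<Union>l\<in>{1..<L}. A1 l) \<in> sets IP" "measure IP (\<Union>l\<in>{1..<L}. A1 l) \<le> real (card {1..<L}) * ?e1"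
    by (rule measure_UN_le[OF _ A1]; simp)+
  have U2: "(\<Union>l\<in>{1..<L}. A2 l) \<in> sets IP" "measure IP (\<Union>l\<in>{1..<L}. A2 l) \<le> real (card {1..<L}) * ?e1"
    by (rule measure_UN_le[OF _ A2]; simp)+
  have U3: "(\<Union>l\<in>{1..L}. A3 l) \<in> sets IP" "measure IP (\<Union>l\<in>{1..L}. A3 l) \<le> real (card {1..L}) * exp (4 * \<beta> * real m - real s / 8)"
    by (rule measure_UN_le[OF _ A3]; simp)+
  have U4: "(\<Union>a\<in>?K1 \<times> ?net. A4 a) \<in> sets IP" "measure IP (\<Union>a\<in>?K1 \<times> ?net. A4 a) \<le> real (card (?K1 \<times> ?net)) * ?e4"
    by (rule measure_UN_le[OF F4(1) A4]; assumption)+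
  have U5: "(\<Union>a\<in>?K2 \<times> ?net. A5 a) \<in> sets IP" "measure IP (\<Union>a\<in>?K2 \<times> ?net. A5 a) \<le> real (card (?K2 \<times> ?net)) * ?e5"
    by (rule measure_UN_le[OF F4(2) A5]; assumption)+
  have "{g \<in> space IP. \<not> clean d m L s \<beta> (w g) x} \<subseteq>
     (\<Union>l\<in>{1..<L}. A1 l) \<union> ((\<Union>l\<in>{1..<L}. A2 l) \<union> ((\<Union>l\<in>{1..L}. A3 l) \<union> ((\<Union>a\<in>?K1 \<times> ?net. A4 a) \<union> (\<Union>a\<in>?K2 \<times> ?net. A5 a))))"
  proof
    fix g assume g: "g \<in> {g \<in> space IP. \<not> clean d m L s \<beta> (w g) x}"
    have c: "1 / (20 * real L) / 4 = 1 / (80 * real L)" "- 1 / (20 * real L) / 4 = - 1 / (80 * real L)" "1 / real L / 4 = 1 / (4 * real L)"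
      by simp_all
    from g show "g \<in> (\<Union>l\<in>{1..<L}. A1 l) \<union> ((\<Union>l\<in>{1..<L}. A2 l) \<union> ((\<Union>l\<in>{1..L}. A3 l) \<union> ((\<Union>a\<in>?K1 \<times> ?net. A4 a) \<union> (\<Union>a\<in>?K2 \<times> ?net. A5 a))))"
      unfolding clean_def A1_def A2_def A3_def A4_def A5_def c by fastforce
  qed
  then have "measure IP {g \<in> space IP. \<not> clean d m L s \<beta> (w g) x} \<le>
     measure IP ((\<Union>l\<in>{1..<L}. A1 l) \<union> ((\<Union>l\<in>{1..<L}. A2 l) \<union> ((\<Union>l\<in>{1..L}. A3 l) \<union> ((\<Union>a\<in>?K1 \<times> ?net. A4 a) \<union> (\<Union>a\<in>?K2 \<times> ?net. A5 a)))))"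
    using U1(1) U2(1) U3(1) U4(1) U5(1) cK fin_net by (intro finite_measure_mono sets.Un) auto
  also have "\<dots> \<le> measure IP (\<Union>l\<in>{1..<L}. A1 l) + (measure IP (\<Union>l\<in>{1..<L}. A2 l) + (measure IP (\<Union>l\<in>{1..L}. A3 l)
      + (measure IP (\<Union>a\<in>?K1 \<times> ?net. A4 a) + measure IP (\<Union>a\<in>?K2 \<times> ?net. A5 a))))"
    using U1(1) U2(1) U3(1) U4(1) U5(1) cK fin_net
    by (intro order_trans[OF measure_Un_le] add_left_mono sets.Un order_refl) auto
  also have "\<dots> \<le> real L * ?e1 + (real L * ?e1 + (real L * exp (4 * \<beta> * real m - real s / 8)
      + ((real L)\<^sup>2 * U * ?e4 + (real L)\<^sup>2 * U * ?e5)))"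
  proof (intro add_mono)
    have "real (card {1..<L}) * ?e1 \<le> real L * ?e1" by (intro mult_right_mono) auto
    then show "measure IP (\<Union>l\<in>{1..<L}. A1 l) \<le> real L * ?e1" "measure IP (\<Union>l\<in>{1..<L}. A2 l) \<le> real L * ?e1"
      using U1(2) U2(2) by linarith+
    show "measure IP (\<Union>l\<in>{1..L}. A3 l) \<le> real L * exp (4 * \<beta> * real m - real s / 8)" using U3(2) by simp
    have U: "0 \<le> U" by (simp add: U_def)
    have "real (card (?K1 \<times> ?net)) * ?e4 \<le> (real L)\<^sup>2 * U * ?e4"
      unfolding card_cartesian_product of_nat_mult U_def using cK by (intro mult_right_mono) auto
    then show "measure IP (\<Union>a\<in>?K1 \<times> ?net. A4 a) \<le> (real L)\<^sup>2 * U * ?e4"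
      using U4(2) by linarith
    have "real (card (?K2 \<times> ?net)) * ?e5 \<le> (real L)\<^sup>2 * U * ?e5"
      unfolding card_cartesian_product of_nat_mult U_def using cK by (intro mult_right_mono) auto
    then show "measure IP (\<Union>a\<in>?K2 \<times> ?net. A5 a) \<le> (real L)\<^sup>2 * U * ?e5"
      using U5(2) by linarith
  qed
  finally show ?thesis by simp
qed

end

section \<open>Choice of the width\<close>

text \<open>\<open>l\<close>, \<open>\<mu>\<close>, \<open>\<Lambda>\<close>, \<open>\<Phi>\<close> stand for \<open>L\<close>, \<open>ln m\<close>, \<open>ln (n L / \<delta>)\<close> and the largest value of
  \<open>F\<close> compatible with the width.\<close>

locale width_regime =
  fixes m :: nat and l \<mu> \<Lambda> \<Phi> :: real
  assumes l2: "2 \<le> l" and mu: "1 / 2 \<le> \<mu>" and Lam: "1 / 2 \<le> \<Lambda>" and Phi: "1 \<le> \<Phi>"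
    and width: "real m = 10 ^ 120 * l ^ 16 * \<mu> ^ 4 * \<Lambda> * \<Phi> ^ 4"
begin

text \<open>As \<open>\<mu>\<close> and \<open>\<Lambda>\<close> may lie below 1, lowering their
  exponents can lose factors up to 16 and 2; the gap between \<open>10^118\<close> and
  \<open>10^120\<close> absorbs them.\<close>

lemma power_ratio_ge:
  assumes "a \<le> 16" "b \<le> 4" "e \<le> 4" "f \<le> 1"
  shows "10 ^ 118 * l ^ a * \<mu> ^ b * \<Lambda> ^ f * \<Phi> ^ e \<le> real m"
proof -
  have l: "l ^ a \<le> l ^ 16" using l2 assms by (intro power_increasing) auto
  have p: "\<Phi> ^ e \<le> \<Phi> ^ 4" using Phi assms by (intro power_increasing) auto
  have x: "\<mu> ^ b \<le> 16 * \<mu> ^ 4"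
  proof -
    have "(1 / 2) ^ (4 - b) \<le> \<mu> ^ (4 - b)" using mu by (intro power_mono) auto
    moreover have "(1 / 2) ^ 4 \<le> (1 / 2 :: real) ^ (4 - b)" by (intro power_decreasing) auto
    moreover have "(1 / 2) ^ 4 = (1 / 16 :: real)" by (simp add: power_divide)
    ultimately have "1 / 16 \<le> \<mu> ^ (4 - b)" by linarith
    then have "\<mu> ^ b * 1 \<le> \<mu> ^ b * (16 * \<mu> ^ (4 - b))" using mu by (intro mult_left_mono) auto
    also have "\<dots> = 16 * (\<mu> ^ b * \<mu> ^ (4 - b))" by simp
    also have "\<mu> ^ b * \<mu> ^ (4 - b) = \<mu> ^ 4" using assms by (simp flip: power_add)
    finally show ?thesis by simp
  qed
  have y: "\<Lambda> ^ f \<le> 2 * \<Lambda>" using Lam assms(4) by (cases f) auto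
  have "10 ^ 118 * l ^ a * \<mu> ^ b * \<Lambda> ^ f * \<Phi> ^ e \<le> 10 ^ 118 * l ^ 16 * (16 * \<mu> ^ 4) * (2 * \<Lambda>) * \<Phi> ^ 4"
    using l p x y l2 mu Lam Phi by (intro mult_mono mult_nonneg_nonneg) auto
  also have "\<dots> = (32 * 10 ^ 118) * (l ^ 16 * \<mu> ^ 4 * \<Lambda> * \<Phi> ^ 4)" by simp
  also have "\<dots> \<le> 10 ^ 120 * (l ^ 16 * \<mu> ^ 4 * \<Lambda> * \<Phi> ^ 4)"
    using l2 mu Lam Phi by (intro mult_right_mono mult_nonneg_nonneg) auto
  finally show ?thesis by (simp add: width)
qed

lemma m_ge:
  "10 ^ 118 * l ^ 10 * \<mu> ^ 3 * \<Phi> ^ 4 \<le> real m"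
  "10 ^ 118 * l ^ 4 * \<Phi>\<^sup>2 \<le> real m"
  "10 ^ 118 * l\<^sup>2 * \<Lambda> \<le> real m"
  "10 ^ 118 * l ^ 3 * \<mu> * \<Lambda> * \<Phi> \<le> real m"
  "10 ^ 118 * l\<^sup>2 \<le> real m"
  using power_ratio_ge[of 10 3 4 0] power_ratio_ge[of 4 0 2 0] power_ratio_ge[of 2 0 0 1] power_ratio_ge[of 3 1 1 1] power_ratio_ge[of 2 0 0 0]
  by simp_all

text \<open>The ratio \<open>m / s\<close> up to rounding. The factor \<open>\<mu>\<close> pays for
  the \<open>m^s\<close> supports in the union bound, the factor \<open>l^3 \<Phi>\<close> for the
  linearization error.\<close>

definition K :: real where "K = 10 ^ 34 * l ^ 3 * \<Phi> * \<mu>"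

definition s :: nat where "s = nat \<lfloor>real m / K\<rfloor>"

text \<open>Squared, this is the \<open>4 F\<close> of \<open>params_dist_sq_triangle\<close> at
  \<open>F = \<Phi>\<close>.\<close>

definition \<rho> :: real where "\<rho> = 2 * sqrt \<Phi>"

text \<open>Makes the exponent \<open>4 \<beta> m - s / 8\<close> of \<open>prob_count_event\<close>
  equal to \<open>- s / 16\<close>.\<close>

definition \<beta> :: real where "\<beta> = real s / (64 * real m)"

lemma K_pos: "0 < K" using l2 mu Phi by (simp add: K_def)

lemma K_ge: "10 ^ 33 * l ^ 3 * \<Phi> \<le> K"
proof -
  have "10 ^ 33 * l ^ 3 * \<Phi> * 1 \<le> 10 ^ 33 * l ^ 3 * \<Phi> * (10 * \<mu>)"
    using l2 Phi mu by (intro mult_left_mono) auto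
  then show ?thesis by (simp add: K_def)
qed

lemma m_real_pos: "0 < real m" using m_ge(5) l2 by (smt (verit) mult_pos_pos zero_less_power)

lemma m_div_K: "10 ^ 84 * \<Lambda> \<le> real m / K"
proof -
  have "10 ^ 84 * \<Lambda> * K = 10 ^ 118 * l ^ 3 * \<mu> * \<Lambda> * \<Phi>" by (simp add: K_def)
  then show ?thesis unfolding pos_le_divide_eq[OF K_pos] using m_ge(4) by (simp only:)
qed

text \<open>As \<open>m / K >= 1\<close>, rounding down loses at most a factor 2.\<close>

lemma s_bounds: "real s \<le> real m / K" "real m / (2 * K) \<le> real s" "10 ^ 83 * \<Lambda> \<le> real s" "0 < s"
proof -
  have "1 \<le> 10 ^ 84 * \<Lambda>" using Lam by simp
  then have one: "1 \<le> real m / K" using m_div_K by linarith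
  then have fl: "real s = of_int \<lfloor>real m / K\<rfloor>" unfolding s_def by simp
  show "real s \<le> real m / K" unfolding fl by simp
  have "real m / K - 1 \<le> real s" unfolding fl by linarith
  moreover have "1 \<le> \<lfloor>real m / K\<rfloor>" using one by simp
  then have "1 \<le> real s" unfolding fl by simp
  ultimately show h: "real m / (2 * K) \<le> real s" using one by (simp add: field_simps)
  have "10 ^ 84 * \<Lambda> / 2 \<le> real m / K / 2" using m_div_K by (intro divide_right_mono) auto
  also have "\<dots> \<le> real s" using h by simp
  finally show "10 ^ 83 * \<Lambda> \<le> real s" using Lam by simp
  show "0 < s" using \<open>1 \<le> real s\<close> by simp
qed

lemma s_mu: "real s * \<mu> \<le> real m / (10 ^ 34 * l\<^sup>2)"
proof -
  have "real s * \<mu> \<le> real m / K * \<mu>" using s_bounds(1) mu by (intro mult_right_mono) auto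
  also have "\<dots> = real m / (10 ^ 34 * l ^ 3 * \<Phi>)" using mu by (simp add: K_def)
  also have "\<dots> \<le> real m / (10 ^ 34 * l\<^sup>2)"
  proof (rule divide_left_mono)
    have "l\<^sup>2 * 1 \<le> l\<^sup>2 * (l * \<Phi>)" using l2 Phi mult_mono[of 1 l 1 \<Phi>] by (intro mult_left_mono) auto
    then show "10 ^ 34 * l\<^sup>2 \<le> 10 ^ 34 * l ^ 3 * \<Phi>" by (simp add: power2_eq_square power3_eq_cube mult_ac)
  qed (use l2 Phi in auto)
  finally show ?thesis .
qed

lemma s_frac: "real s / real m \<le> 1 / (10 ^ 33 * l ^ 3 * \<Phi>)"
proof -
  have "real s / real m \<le> real m / K / real m" using s_bounds(1) by (intro divide_right_mono) auto
  also have "\<dots> = 1 / K" using m_real_pos by simp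
  also have "\<dots> \<le> 1 / (10 ^ 33 * l ^ 3 * \<Phi>)" using K_ge K_pos l2 Phi by (intro divide_left_mono) auto
  finally show ?thesis .
qed

lemma rho_sq: "\<rho>\<^sup>2 = 4 * \<Phi>" "0 \<le> \<rho>" using Phi by (simp_all add: \<rho>_def power_mult_distrib)

lemma beta_bounds: "0 < \<beta>" "\<beta> \<le> 1"
proof -
  show "0 < \<beta>" using s_bounds(4) m_real_pos by (simp add: \<beta>_def)
  have "1 \<le> 10 ^ 33 * l ^ 3 * \<Phi>"
  proof -
    have "1 * 1 \<le> l ^ 3 * \<Phi>" using l2 Phi by (intro mult_mono) (auto simp: one_le_power)
    then show ?thesis by simp
  qed
  then have "1 / (10 ^ 33 * l ^ 3 * \<Phi>) \<le> 1" using l2 Phi by (simp add: divide_le_eq)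
  then have "real s / real m \<le> 1" using s_frac by linarith
  then show "\<beta> \<le> 1" using m_real_pos by (simp add: \<beta>_def divide_le_eq)
qed

text \<open>\<open>\<beta>^2 s\<close> equals \<open>s^3 / (4096 m^2)\<close>, hence is at least
  \<open>m / (32768 K^3)\<close>. The three powers of \<open>\<Phi>\<close> in \<open>K^3\<close>
  and the one in \<open>\<rho>^2\<close> add up to the fourth power in the width.\<close>

lemma beta_s: "128 * 6000\<^sup>2 * l * \<rho>\<^sup>2 \<le> \<beta>\<^sup>2 * real s"
proof -
  have Km: "10 ^ 102 * l ^ 9 * \<Phi> ^ 3 * \<mu> ^ 3 = K ^ 3"
    by (simp add: K_def power_mult_distrib flip: power_mult)
  have "(10 ^ 15 * l * \<Phi>) * K ^ 3 = 10 ^ 117 * l ^ 10 * \<mu> ^ 3 * \<Phi> ^ 4"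
    unfolding Km[symmetric] by (simp add: power_Suc[symmetric] mult_ac numeral_eq_Suc)
  also have "\<dots> \<le> real m"
  proof -
    have "0 \<le> l ^ 10 * \<mu> ^ 3 * \<Phi> ^ 4" using l2 mu Phi by simp
    then have "10 ^ 117 * (l ^ 10 * \<mu> ^ 3 * \<Phi> ^ 4) \<le> 10 ^ 118 * (l ^ 10 * \<mu> ^ 3 * \<Phi> ^ 4)"
      by (intro mult_right_mono) auto
    then show ?thesis using m_ge(1) by (simp only: mult.assoc)
  qed
  finally have A: "10 ^ 15 * l * \<Phi> \<le> real m / K ^ 3" using K_pos by (simp add: le_divide_eq)
  have "(real m / (2 * K)) ^ 3 \<le> real s ^ 3" using s_bounds(2) K_pos by (intro power_mono) auto
  then have "(real m / (2 * K)) ^ 3 / (4096 * (real m)\<^sup>2) \<le> real s ^ 3 / (4096 * (real m)\<^sup>2)"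
    by (intro divide_right_mono) auto
  also have "\<dots> = \<beta>\<^sup>2 * real s" by (simp add: \<beta>_def power_divide power_mult_distrib power2_eq_square power3_eq_cube)
  also have "(real m / (2 * K)) ^ 3 / (4096 * (real m)\<^sup>2) = real m / K ^ 3 / 32768"
    using m_real_pos K_pos by (simp add: power_divide power_mult_distrib power2_eq_square power3_eq_cube field_simps)
  finally have B: "real m / K ^ 3 / 32768 \<le> \<beta>\<^sup>2 * real s" .
  have "0 \<le> l * \<Phi>" using l2 Phi by simp
  then show ?thesis unfolding rho_sq using A B by (simp add: mult.assoc)
qed

abbreviation "cc \<equiv> sqrt (2 / real m)"

lemma cc_small: "cc * l\<^sup>2 * \<Phi> \<le> 1 / 10 ^ 50"
proof (rule power2_le_imp_le)
  have "10 ^ 118 * (l ^ 4 * \<Phi>\<^sup>2) \<le> real m" using m_ge(2) by (simp add: mult.assoc)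
  then have "l ^ 4 * \<Phi>\<^sup>2 / real m \<le> 1 / 10 ^ 118" using m_real_pos by (simp add: divide_le_eq)
  moreover have "(cc * l\<^sup>2 * \<Phi>)\<^sup>2 = 2 * (l ^ 4 * \<Phi>\<^sup>2 / real m)"
    by (simp add: power_mult_distrib flip: power_mult)
  ultimately have "(cc * l\<^sup>2 * \<Phi>)\<^sup>2 \<le> 2 * (1 / 10 ^ 118)" by (simp only: mult_left_mono zero_le_numeral)
  also have "2 * (1 / 10 ^ 118) \<le> (1 / 10 ^ 50 :: real)\<^sup>2" by (simp add: power_divide)
  finally show "(cc * l\<^sup>2 * \<Phi>)\<^sup>2 \<le> (1 / 10 ^ 50)\<^sup>2" .
qed simp

lemma sqrt_le: "sqrt l \<le> l" "sqrt \<Phi> \<le> \<Phi>" "\<rho> \<le> 2 * \<Phi>"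
proof -
  show "sqrt l \<le> l" using l2 real_le_lsqrt[of l l] by (simp add: power2_eq_square)
  show "sqrt \<Phi> \<le> \<Phi>" using Phi real_le_lsqrt[of \<Phi> \<Phi>] by (simp add: power2_eq_square)
  then show "\<rho> \<le> 2 * \<Phi>" by (simp add: \<rho>_def)
qed

definition sr :: real where "sr = cc * sqrt l * \<rho>"

lemma sr_small: "l * sr \<le> 2 / 10 ^ 50" "0 \<le> sr"
proof -
  have "l * sr \<le> l * (cc * l * (2 * \<Phi>))"
    unfolding sr_def using sqrt_le rho_sq(2) l2 by (intro mult_left_mono mult_mono) auto
  also have "\<dots> = 2 * (cc * l\<^sup>2 * \<Phi>)" by (simp add: power2_eq_square)
  also have "\<dots> \<le> 2 * (1 / 10 ^ 50)" using cc_small by (intro mult_left_mono) auto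
  finally show "l * sr \<le> 2 / 10 ^ 50" by simp
  show "0 \<le> sr" using rho_sq(2) l2 by (simp add: sr_def)
qed

lemma rho_small: "1000 * 6000\<^sup>2 * l * (cc * sqrt l * \<rho>) \<le> 1"
  using sr_small(1) unfolding sr_def[symmetric] by simp

text \<open>Up to \<open>sqrt 2\<close> this is \<open>l^(3/2) \<rho> sqrt (s / m)\<close>, the size
  of the error from flips; in its square the factor \<open>l^3 \<Phi>\<close> cancels against
  \<open>K\<close>.\<close>

lemma key_product: "l * sqrt (real s) * (sqrt l * \<rho>) * cc \<le> 1 / 10 ^ 16"
proof (rule power2_le_imp_le)
  have "(l * sqrt (real s) * (sqrt l * \<rho>) * cc)\<^sup>2 = l\<^sup>2 * real s * (l * \<rho>\<^sup>2) * (2 / real m)"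
    using l2 by (simp add: power_mult_distrib)
  also have "\<dots> = 8 * (l ^ 3 * \<Phi>) * (real s / real m)"
    unfolding rho_sq by (simp add: power2_eq_square power3_eq_cube)
  also have "\<dots> \<le> 8 * (l ^ 3 * \<Phi>) * (1 / (10 ^ 33 * l ^ 3 * \<Phi>))"
    using s_frac l2 Phi by (intro mult_left_mono) auto
  also have "\<dots> = 8 / 10 ^ 33" using l2 Phi by simp
  also have "\<dots> \<le> (1 / 10 ^ 16)\<^sup>2" by (simp add: power_divide)
  finally show "(l * sqrt (real s) * (sqrt l * \<rho>) * cc)\<^sup>2 \<le> (1 / 10 ^ 16)\<^sup>2" .
qed simp

text \<open>The right-hand side of \<open>near_linear\<close> at \<open>C = 6000\<close>. Its term
  from flips is critical: a numerical factor of about \<open>4 * 10^13\<close> is met by the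
  \<open>10^16\<close> of \<open>key_product\<close>.\<close>

lemma linearization_error:
  "6 * \<rho> * (10 * 6000\<^sup>2 * l * sr) + 40 * 6000 ^ 3 * l\<^sup>2 * sqrt (real s) * cc * \<rho> * (10 * 6000\<^sup>2 * l * sr)
      + 24 * 6000\<^sup>2 * l * sqrt (real s) * (8 * 6000 * sr) \<le> 1 / 50"
proof -
  have nn: "0 \<le> l" "0 \<le> cc" "0 \<le> \<rho>" "0 \<le> sqrt (real s)" "0 \<le> sqrt l" "1 \<le> sqrt l" "0 \<le> \<Phi>" using l2 rho_sq(2) Phi by auto
  have "l * \<rho> * sr \<le> 4 / 10 ^ 50"
  proof -
    have "l * \<rho> * sr = l * (cc * sqrt l * \<rho>\<^sup>2)" by (simp add: sr_def power2_eq_square)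
    also have "\<dots> \<le> l * (cc * l * (4 * \<Phi>))"
      unfolding rho_sq(1) using nn sqrt_le by (intro mult_left_mono mult_mono) auto
    also have "\<dots> = 4 * (cc * l\<^sup>2 * \<Phi>)" by (simp add: power2_eq_square)
    also have "\<dots> \<le> 4 * (1 / 10 ^ 50)" using cc_small by (intro mult_left_mono) auto
    finally show ?thesis by simp
  qed
  then have t1: "6 * \<rho> * (10 * 6000\<^sup>2 * l * sr) \<le> 1 / 1000" by (simp add: mult_ac)
  have t3: "24 * 6000\<^sup>2 * l * sqrt (real s) * (8 * 6000 * sr) \<le> 1 / 100"
    using key_product by (simp add: sr_def mult_ac)
  have "l\<^sup>2 * sqrt (real s) * cc * \<rho> * (l * sr) \<le> 1 / 10 ^ 30"
  proof -
    have "l\<^sup>2 * sqrt (real s) * cc * \<rho> * (l * sr) = (l * sqrt (real s) * \<rho> * cc) * (l * (l * sr))"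
      by (simp add: power2_eq_square)
    also have "\<dots> \<le> (l * sqrt (real s) * (sqrt l * \<rho>) * cc) * (l * (l * sr))"
    proof -
      have "1 * \<rho> \<le> sqrt l * \<rho>" using nn by (intro mult_right_mono) auto
      then show ?thesis using nn sr_small(2) by (intro mult_right_mono mult_left_mono mult_nonneg_nonneg) auto
    qed
    also have "\<dots> \<le> (1 / 10 ^ 16) * (l * (l * sr))"
      using key_product nn sr_small(2) by (intro mult_right_mono) auto
    also have "l * (l * sr) \<le> 1 / 10 ^ 20"
    proof (rule power2_le_imp_le)
      have "10 ^ 118 * (l ^ 5 * \<Phi>) \<le> real m"
        using power_ratio_ge[of 5 0 1 0] by (simp add: mult.assoc)
      then have "l ^ 5 * \<Phi> / real m \<le> 1 / 10 ^ 118" using m_real_pos by (simp add: divide_le_eq)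
      moreover have "(l * (l * sr))\<^sup>2 = l\<^sup>2 * (l\<^sup>2 * (2 / real m * l * \<rho>\<^sup>2))"
        using l2 by (simp add: sr_def power_mult_distrib)
      moreover have "\<dots> = 8 * (l ^ 5 * \<Phi> / real m)"
        unfolding rho_sq by (simp add: numeral_eq_Suc)
      ultimately have "(l * (l * sr))\<^sup>2 \<le> 8 * (1 / 10 ^ 118)" by (simp only: mult_left_mono zero_le_numeral)
      also have "8 * (1 / 10 ^ 118) \<le> (1 / 10 ^ 20 :: real)\<^sup>2" by (simp add: power_divide)
      finally show "(l * (l * sr))\<^sup>2 \<le> (1 / 10 ^ 20)\<^sup>2" .
    qed simp
    finally show ?thesis by (simp add: mult_left_mono)
  qed
  then have t2: "40 * 6000 ^ 3 * l\<^sup>2 * sqrt (real s) * cc * \<rho> * (10 * 6000\<^sup>2 * l * sr) \<le> 1 / 1000" by (simp add: mult_ac)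
  show ?thesis using t1 t2 t3 by linarith
qed

lemma gradient_size: "22 / 10 + 220 * 6000 ^ 6 * l ^ 3 * (real s / real m) \<le> 12 / 5"
proof -
  have "l ^ 3 * (real s / real m) \<le> l ^ 3 * (1 / (10 ^ 33 * l ^ 3 * \<Phi>))"
    using s_frac l2 by (intro mult_left_mono) auto
  also have "\<dots> = 1 / (10 ^ 33 * \<Phi>)" using l2 by simp
  also have "\<dots> \<le> 1 / 10 ^ 33" using Phi by (intro divide_left_mono) auto
  finally show ?thesis by (simp add: mult.assoc)
qed

end

section \<open>The width condition applied to the network\<close>

locale net_width = width_regime m "real L" "ln (real m)" \<Lambda> \<Phi> for m L :: nat and \<Lambda> \<Phi> :: real +
  assumes m_even: "even m"
begin

lemma L2: "L \<ge> 2" using l2 by simp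

lemma m_pos: "m > 0" using m_real_pos by simp

lemma blocks_le: "real (blocks L) \<le> real m"
proof -
  have "10 ^ 6 * (real L)\<^sup>2 \<le> 10 ^ 118 * (real L)\<^sup>2" by (intro mult_right_mono) auto
  then have "10 ^ 6 * (real L)\<^sup>2 \<le> real m" using m_ge(5) by (rule order_trans)
  then show ?thesis by simp
qed

lemma s_le: "s \<le> m div 2" "s \<le> m div blocks L + 1" "s \<le> m"
proof -
  have K: "2 \<le> K" "real (blocks L) \<le> K"
  proof -
    have "(real L)\<^sup>2 * 1 \<le> (real L)\<^sup>2 * (real L * \<Phi>)"
      using l2 Phi mult_mono[of 1 "real L" 1 \<Phi>] by (intro mult_left_mono) auto
    then have "(real L)\<^sup>2 \<le> real L ^ 3 * \<Phi>"
      by (simp add: power2_eq_square power3_eq_cube mult_ac)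
    then have "10 ^ 6 * (real L)\<^sup>2 \<le> 10 ^ 33 * (real L ^ 3 * \<Phi>)" by (intro mult_mono) auto
    also have "\<dots> \<le> K" using K_ge by (simp only: mult.assoc)
    finally show b: "real (blocks L) \<le> K" by simp
    have "2 \<le> real (blocks L)" using l2 mult_mono[of 2 "real L" 2 "real L"] by (simp add: power2_eq_square)
    then show "2 \<le> K" using b by linarith
  qed
  have le: "s * c \<le> m" if "real c \<le> K" for c
  proof -
    have "real s * real c \<le> real m / K * K" using s_bounds(1) that K_pos by (intro mult_mono) auto
    then have "real (s * c) \<le> real m" using K_pos by simp
    then show ?thesis by (simp only: of_nat_le_iff)
  qed
  show "s \<le> m div 2" using le[of 2] K(1) by (simp add: less_eq_div_iff_mult_less_eq)
  have "s \<le> m div blocks L" using le[OF K(2)] L2 by (simp add: less_eq_div_iff_mult_less_eq)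
  then show "s \<le> m div blocks L + 1" by simp
  show "s \<le> m" using \<open>s \<le> m div 2\<close> by simp
qed

text \<open>Since \<open>exp 3 >= 8\<close>, a surplus of 3 in the exponent leaves at most an eighth
  of the budget.\<close>

lemma exp_small: "\<Lambda> + 3 \<le> X \<Longrightarrow> 8 * exp (- X) \<le> exp (- \<Lambda>)"
proof -
  assume X: "\<Lambda> + 3 \<le> X"
  have "(8 :: real) = 2 ^ 3" by simp
  also have "\<dots> \<le> exp 1 ^ 3" using exp_ge_add_one_self[of "1 :: real"] by (intro power_mono) auto
  also have "\<dots> = exp 3" by (simp flip: exp_of_nat_mult)
  finally have "8 * exp (- X) \<le> exp 3 * exp (- X)" by (intro mult_right_mono) auto
  also have "\<dots> = exp (3 - X)" by (simp add: exp_diff exp_minus field_simps)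
  also have "\<dots> \<le> exp (- \<Lambda>)" using X by simp
  finally show ?thesis .
qed

lemma m_over_l2: "10 ^ 118 * \<Lambda> \<le> real m / (real L)\<^sup>2"
  using m_ge(3) l2 by (simp add: pos_le_divide_eq mult_ac)

text \<open>For \<open>\<Lambda> = ln (n L / \<delta>)\<close> the budget
  \<open>L exp (- \<Lambda>)\<close> is \<open>\<delta> / n\<close>, which leaves room for a union
  bound over the sample. The four terms take at most one quarter and three eighths of it.\<close>

lemma total_probability:
  assumes "U \<le> (real m ^ s + real (blocks L)) * exp (5 * real (m div blocks L + 1))" "0 \<le> U"
  shows "2 * real L * exp (- (real m / (6400 * (real L)\<^sup>2))) + real L * exp (4 * \<beta> * real m - real s / 8)
      + (real L)\<^sup>2 * U * exp (- (real m / (16 * (real L)\<^sup>2)))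
      + (real L)\<^sup>2 * U * (real m ^ s * exp (real s / 2 - real m / (18432 * (real L)\<^sup>2)))
    \<le> real L * exp (- \<Lambda>)"
proof -
  let ?Y = "real m / (real L)\<^sup>2"
  define e where "e = exp (- \<Lambda>)"
  have Le: "e \<le> real L * e" using l2 by (simp add: e_def)
  have t1: "8 * exp (- (real m / (6400 * (real L)\<^sup>2))) \<le> e"
    unfolding e_def
  proof (rule exp_small)
    have "\<Lambda> + 3 \<le> ?Y / 6400" using m_over_l2 Lam by simp
    then show "\<Lambda> + 3 \<le> real m / (6400 * (real L)\<^sup>2)" by (simp add: mult.commute)
  qed
  have t2: "8 * exp (4 * \<beta> * real m - real s / 8) \<le> e"
  proof -
    have "4 * \<beta> * real m - real s / 8 = - (real s / 16)" using m_pos by (simp add: \<beta>_def)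
    moreover have "\<Lambda> + 3 \<le> real s / 16" using s_bounds(3) Lam by simp
    ultimately show ?thesis unfolding e_def by (simp only: exp_small)
  qed
  have mexp: "real m = exp (ln (real m))" using m_real_pos by simp
  have smu: "real s * ln (real m) \<le> ?Y / 10 ^ 34" using s_mu by (simp add: mult.commute)
  have s1: "1 \<le> real s" using s_bounds(4) by simp
  have mu_s: "ln (real m) \<le> real s * ln (real m)" using s1 mu mult_right_mono[of 1 "real s" "ln (real m)"] by simp
  have s_mu': "real s / 2 \<le> real s * ln (real m)" using s1 mu mult_left_mono[of "1/2" "ln (real m)" "real s"] by simp
  have ms: "real m ^ s = exp (real s * ln (real m))" using mexp by (simp add: exp_of_nat_mult)
  \<comment> \<open>One \<open>s ln m\<close> counts the supports, the other absorbs the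
    \<open>L^2\<close> pairs of layers; the term with factor 5 is the logarithm of the size of one
    net.\<close>
  have LU: "(real L)\<^sup>2 * U \<le> exp (2 * (real s * ln (real m)) + 1 + 5 * (?Y / 10 ^ 6 + 1))"
  proof -
    have "real m ^ 1 \<le> real m ^ s" using s1 m_pos by (intro power_increasing) auto
    then have "real m ^ s + real (blocks L) \<le> 2 * real m ^ s" using blocks_le unfolding power_one_right by linarith
    also have "\<dots> \<le> exp 1 * exp (real s * ln (real m))"
      unfolding ms using exp_ge_add_one_self[of "1::real"] by (intro mult_right_mono) auto
    finally have a: "real m ^ s + real (blocks L) \<le> exp (1 + real s * ln (real m))" by (simp add: exp_add)
    have "real (m div blocks L) \<le> real m / real (blocks L)" by (rule of_nat_div_le_of_nat)
    then have b: "exp (5 * real (m div blocks L + 1)) \<le> exp (5 * (?Y / 10 ^ 6 + 1))" by (simp add: mult.commute)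
    have c: "(real L)\<^sup>2 \<le> exp (real s * ln (real m))"
    proof -
      have "1 * (real L)\<^sup>2 \<le> 10 ^ 118 * (real L)\<^sup>2" by (intro mult_right_mono) auto
      then have "(real L)\<^sup>2 \<le> exp (ln (real m))" using m_ge(5) mexp by linarith
      also have "\<dots> \<le> exp (real s * ln (real m))" using mu_s by simp
      finally show ?thesis .
    qed
    have "(real L)\<^sup>2 * U \<le> exp (real s * ln (real m)) * (exp (1 + real s * ln (real m)) * exp (5 * (?Y / 10 ^ 6 + 1)))"
      using assms a b c by (intro mult_mono order_trans[OF assms(1)]) auto
    also have "\<dots> = exp (2 * (real s * ln (real m)) + 1 + 5 * (?Y / 10 ^ 6 + 1))"
      by (simp add: exp_add[symmetric])
    finally show ?thesis .
  qed
  have t4: "8 * ((real L)\<^sup>2 * U * (real m ^ s * exp (real s / 2 - real m / (18432 * (real L)\<^sup>2)))) \<le> e"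
  proof -
    have "(real L)\<^sup>2 * U * (real m ^ s * exp (real s / 2 - real m / (18432 * (real L)\<^sup>2)))
      \<le> exp (2 * (real s * ln (real m)) + 1 + 5 * (?Y / 10 ^ 6 + 1)) * (exp (real s * ln (real m)) * exp (real s * ln (real m) - ?Y / 18432))"
      unfolding ms using LU s_mu' assms(2) by (intro mult_mono) (auto simp: mult.commute)
    also have "\<dots> = exp (- (?Y / 18432 - 5 * ?Y / 10 ^ 6 - 4 * (real s * ln (real m)) - 6))"
      by (simp add: exp_add[symmetric])
    finally have "8 * ((real L)\<^sup>2 * U * (real m ^ s * exp (real s / 2 - real m / (18432 * (real L)\<^sup>2))))
      \<le> 8 * exp (- (?Y / 18432 - 5 * ?Y / 10 ^ 6 - 4 * (real s * ln (real m)) - 6))" by simp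
    \<comment> \<open>Here the number of blocks matters: \<open>5 / 10^6\<close> is well below
      \<open>1 / 18432\<close>, and \<open>smu\<close> makes the multiples of \<open>s ln m\<close>
      negligible.\<close>
    also have "\<dots> \<le> e"
      unfolding e_def using smu m_over_l2 Lam by (intro exp_small) simp
    finally show ?thesis .
  qed
  \<comment> \<open>The growth term has the better exponent and no choice of rows, so the bound for
    the rows dominates it.\<close>
  have t3: "8 * ((real L)\<^sup>2 * U * exp (- (real m / (16 * (real L)\<^sup>2)))) \<le> e"
  proof -
    have "exp (- (real m / (16 * (real L)\<^sup>2))) \<le> 1 * exp (real s / 2 - real m / (18432 * (real L)\<^sup>2))"
    proof -
      have "real m / (18432 * (real L)\<^sup>2) \<le> real m / (16 * (real L)\<^sup>2)"
        using l2 by (intro divide_left_mono) auto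
      then show ?thesis by simp
    qed
    also have "\<dots> \<le> real m ^ s * exp (real s / 2 - real m / (18432 * (real L)\<^sup>2))"
      using m_pos by (intro mult_right_mono) (auto simp: one_le_power)
    finally have "(real L)\<^sup>2 * U * exp (- (real m / (16 * (real L)\<^sup>2)))
      \<le> (real L)\<^sup>2 * U * (real m ^ s * exp (real s / 2 - real m / (18432 * (real L)\<^sup>2)))"
      using assms(2) by (intro mult_left_mono) auto
    then show ?thesis using t4 by linarith
  qed
  have "2 * real L * exp (- (real m / (6400 * (real L)\<^sup>2))) \<le> real L * e / 4"
    using mult_left_mono[OF t1, of "real L"] by simp
  moreover have "real L * exp (4 * \<beta> * real m - real s / 8) \<le> real L * e / 8"
    using mult_left_mono[OF t2, of "real L"] by simp
  moreover have "a + b + c + d' \<le> x" if "a \<le> x / 4" "b \<le> x / 8" "8 * c \<le> e" "8 * d' \<le> e" "e \<le> x" for a b c d' x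
  proof -
    have "0 \<le> e" by (simp add: e_def)
    then show ?thesis using that by linarith
  qed
  ultimately show ?thesis unfolding e_def[symmetric] using t3 t4 Le by blast
qed

lemma prob_sample_not_clean:
  shows "measure (init_measure d m L) {g \<in> space (init_measure d m L). \<not> clean d m L s \<beta> (entries (init_params d m L g)) x}
    \<le> real L * exp (- \<Lambda>)"
proof -
  have "init_measure d m L = PiM (init_index d m L) (\<lambda>_. gaussian)" by (simp add: init_measure_def)
  then show ?thesis
    using prob_not_clean[OF m_pos m_even L2 less_imp_le[OF beta_bounds(1)] s_le(1,2), of d x]
      total_probability[OF test_net_finite_card(2)[OF L2 s_le(3,2)]] by simp
qed

lemma net_init_of_clean:
  fixes a xv :: "real Matrix.vec"
  assumes x: "xv \<in> carrier_vec d" "L2_set (coords xv) {..<d} = 1" and a: "antisymmetric_signs m a"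
    and clean: "clean d m L s \<beta> (entries (init_params d m L g)) (coords xv)"
  shows "net_init d m L s 6000 \<beta> \<rho> (init_params d m L g) xv a"
proof -
  have mm: "m = m div 2 + m div 2" using m_even by presburger
  have inL: "in_dim d m L = m" using L2 by (simp add: in_dim_def)
  have dup: "entries (init_params d m L g) L (r + m div 2) j = entries (init_params d m L g) L r j"
    if "r < m div 2" "j < m" for r j
  proof -
    have "r + m div 2 < m" "r < m" using that mm by auto
    then show ?thesis using that by (simp add: entries_def init_params_def inL)
  qed
  have "good_events d m L s \<beta> (entries (init_params d m L g)) (coords xv)"
    by (rule good_events_of_clean[OF m_pos L2 s_bounds(4) x(2) clean])
  then have gi: "good_init d m L s 6000 \<beta> \<rho> (entries (init_params d m L g)) (coords xv)"
    by (intro good_init_of_events[where w = "entries (init_params d m L g)", OF m_pos m_even L2 s_bounds(4) s_le(1,2) x(2) dup] rho_sq(2) beta_bounds beta_s rho_small)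
  have sgn: "a $ r \<in> {-1, 1}" "a $ (r + m div 2) = - (a $ r)" if "r < m div 2" for r
    using a that by (auto simp: antisymmetric_signs_def)
  have a_abs: "\<bar>coords a r\<bar> = 1" if r: "r < m" for r
  proof (cases "r < m div 2")
    case True
    then show ?thesis using sgn[of r] by (auto simp: coords_def)
  next
    case False
    then have "r - m div 2 < m div 2" "r = (r - m div 2) + m div 2" using r mm by auto
    then show ?thesis using sgn[of "r - m div 2"] by (auto simp: coords_def)
  qed
  interpret N: good_init d m L s 6000 \<beta> \<rho> "entries (init_params d m L g)" "coords xv" by (rule gi)
  show ?thesis
  proof
    show "even m" by (rule m_even)
    show "\<bar>coords a r\<bar> = 1" if "r < m" for r using a_abs that .
    show "coords a (r + m div 2) = - coords a r" if "r < m div 2" for r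
      using sgn(2)[OF that] by (simp add: coords_def)
    show "entries (init_params d m L g) L (r + m div 2) j = entries (init_params d m L g) L r j"
      if "r < m div 2" "j < m" for r j using dup that .
    show "init_params d m L g \<in> param_space d m L" by (auto simp: param_space_def init_params_def)
    show "xv \<in> carrier_vec d" by (rule x)
    show "a \<in> carrier_vec m" using a by (simp add: antisymmetric_signs_def)
  qed
qed

text \<open>From \<open>F <= \<Phi>\<close> the reference model itself lies in the ball of radius
  \<open>\<rho>\<close>, so \<open>net_near_linear\<close> may compare it with every iterate there;
  \<open>gd_bound\<close> is then run with \<open>R = \<rho>^2 = 4 \<Phi>\<close>.\<close>

lemma conclusion_of_clean:
  assumes d: "d \<ge> 1" and n: "n \<ge> 1" and a: "antisymmetric_signs m a" and V: "V \<in> param_space d m L"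
    and x: "\<And>i. i < n \<Longrightarrow> fst (S i) \<in> carrier_vec d" "\<And>i. i < n \<Longrightarrow> L2_set (coords (fst (S i))) {..<d} = 1"
    and y: "\<And>i. i < n \<Longrightarrow> snd (S i) \<in> {1, -1}"
    and clean: "\<And>i. i < n \<Longrightarrow> clean d m L s \<beta> (entries (init_params d m L g)) (coords (fst (S i)))"
    and F: "ref_F m L n a S \<eta> T (init_params d m L g) V \<le> \<Phi>"
    and \<eta>: "0 < \<eta>" "\<eta> \<le> 4 / (5 * real L)" and t: "t \<le> T"
  defines "W \<equiv> gd d m L n a S \<eta> (init_params d m L g)"
  shows "Max ((\<lambda>l. (spectral_norm (W t l - V l))\<^sup>2) ` {1..L}) \<le> params_dist_sq L (W t) V"
    and "params_dist_sq L (W t) V \<le> ref_F m L n a S \<eta> T (init_params d m L g) V"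
    and "\<eta> * (\<Sum>k<t. emp_loss m L n a S (W k)) \<le> ref_F m L n a S \<eta> T (init_params d m L g) V"
proof -
  let ?W0 = "init_params d m L g"
  have W0: "?W0 \<in> param_space d m L" by (auto simp: param_space_def init_params_def)
  have pos: "0 < d" "0 < m" "0 < n" "2 \<le> L" using d n m_pos L2 by auto
  have "0 \<le> emp_loss m L n a S V"
    using logistic_pos by (auto simp: emp_loss_def less_imp_le intro!: sum_nonneg divide_nonneg_nonneg)
  then have "0 \<le> 3 * \<eta> * real T * emp_loss m L n a S V" using \<eta> by (intro mult_nonneg_nonneg) auto
  then have "params_dist_sq L ?W0 V \<le> \<Phi>" using F by (simp add: ref_F_def)
  moreover have "params_dist_sq L V ?W0 = params_dist_sq L ?W0 V"
    unfolding params_dist_sq_psum[OF V W0] params_dist_sq_psum[OF W0 V]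
    by (rule psum_cong) (rule power2_commute)
  ultimately have V_near: "params_dist_sq L V ?W0 \<le> \<rho>\<^sup>2" using Phi by (simp add: rho_sq)
  have F4: "4 * ref_F m L n a S \<eta> T ?W0 V \<le> \<rho>\<^sup>2" using F by (simp add: rho_sq)
  have lin: "\<bar>net m L a V (fst (S i)) - net m L a W' (fst (S i))
       - psum d m L (\<lambda>l r j. net_grad m L a W' (fst (S i)) l $$ (r, j) * (V l $$ (r, j) - W' l $$ (r, j)))\<bar> \<le> 1 / 50"
    and gb: "psum d m L (\<lambda>l r j. (net_grad m L a W' (fst (S i)) l $$ (r, j))\<^sup>2) \<le> 12 / 5"
    if i: "i < n" and W': "W' \<in> param_space d m L" "params_dist_sq L W' ?W0 \<le> \<rho>\<^sup>2" for i W'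
  proof -
    interpret N: net_init d m L s 6000 \<beta> \<rho> ?W0 "fst (S i)" a
      by (rule net_init_of_clean[OF x(1)[OF i] x(2)[OF i] a clean[OF i]])
    have sr: "N.sr = sr" by (simp add: N.sr_def sr_def)
    show "\<bar>net m L a V (fst (S i)) - net m L a W' (fst (S i))
       - psum d m L (\<lambda>l r j. net_grad m L a W' (fst (S i)) l $$ (r, j) * (V l $$ (r, j) - W' l $$ (r, j)))\<bar> \<le> 1 / 50"
      using N.net_near_linear[OF W' V V_near] linearization_error
      unfolding N.eta_def N.eps_def sr by (rule order_trans)
    show "psum d m L (\<lambda>l r j. (net_grad m L a W' (fst (S i)) l $$ (r, j))\<^sup>2) \<le> 12 / 5"
      using N.net_grad_total[OF W'] gradient_size by (rule order_trans)
  qed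
  show "params_dist_sq L (W t) V \<le> ref_F m L n a S \<eta> T ?W0 V"
    unfolding W_def by (rule gd_bound(1)[OF W0 V pos y lin gb \<eta> F4 t])
  show "\<eta> * (\<Sum>k<t. emp_loss m L n a S (W k)) \<le> ref_F m L n a S \<eta> T ?W0 V"
    unfolding W_def by (rule gd_bound(2)[OF W0 V pos y lin gb \<eta> F4 t])
  show "Max ((\<lambda>l. (spectral_norm (W t l - V l))\<^sup>2) ` {1..L}) \<le> params_dist_sq L (W t) V"
    unfolding W_def using pos by (intro Max_spectral_le[OF gd_param_space[OF W0] V]) auto
qed

end

section \<open>The good event over sample and initialization\<close>

lemma sphere_coordinates:
  assumes "sets \<rho> = sets (data_space d)" "z \<in> space \<rho>"
  shows "L2_set (coords (Matrix.vec d (fst z))) {..<d} = 1" "snd z \<in> {1, -1}"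
proof -
  have "z \<in> space (data_space d)" using assms sets_eq_imp_space_eq by blast
  then have z: "(\<Sum>j<d. (fst z j)\<^sup>2) = 1" "snd z \<in> {1, -1}"
    by (auto simp: data_space_def space_pair_measure space_restrict_space)
  then show "L2_set (coords (Matrix.vec d (fst z))) {..<d} = 1" "snd z \<in> {1, -1}"
    by (auto simp: L2_set_def coords_def)
qed

lemma sphere_coordinate_measurable:
  assumes "sets \<rho> = sets (data_space d)" "j < d"
  shows "(\<lambda>z. fst z j) \<in> borel_measurable \<rho>"
proof -
  have "(\<lambda>x. x j) \<in> borel_measurable (PiM {..<d} (\<lambda>_. borel :: real measure))"
    using assms(2) by (intro measurable_component_singleton) auto
  then have "(\<lambda>x. x j) \<in> borel_measurable (restrict_space (PiM {..<d} (\<lambda>_. borel :: real measure)) {x. (\<Sum>j<d. (x j)\<^sup>2) = 1})"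
    by (rule measurable_restrict_space1)
  from measurable_compose[OF measurable_fst this]
  have "(\<lambda>z. fst z j) \<in> borel_measurable (data_space d)" unfolding data_space_def .
  then show ?thesis using assms(1) by (simp cong: measurable_cong_sets)
qed

lemma pair_measure_section_bound:
  assumes M1: "prob_space M1" and M2: "prob_space M2" and X: "X \<in> sets (M1 \<Otimes>\<^sub>M M2)"
    and bound: "\<And>z. z \<in> space M1 \<Longrightarrow> measure M2 (Pair z -` X) \<le> \<delta>"
  shows "measure (M1 \<Otimes>\<^sub>M M2) X \<le> \<delta>"
proof -
  interpret M1: prob_space M1 by fact
  interpret M2: prob_space M2 by fact
  interpret pair_prob_space M1 M2 ..
  have "\<delta> \<ge> 0" using bound M1.not_empty measure_nonneg[of M2] by (meson all_not_in_conv order_trans)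
  have "emeasure (M1 \<Otimes>\<^sub>M M2) X = (\<integral>\<^sup>+z. emeasure M2 (Pair z -` X) \<partial>M1)"
    by (rule M2.emeasure_pair_measure_alt[OF X])
  also have "\<dots> \<le> (\<integral>\<^sup>+z. ennreal \<delta> \<partial>M1)"
    using bound by (intro nn_integral_mono) (simp add: M2.emeasure_eq_measure ennreal_leI)
  also have "\<dots> = ennreal \<delta>" using M1.emeasure_space_1 by simp
  finally show ?thesis using \<open>\<delta> \<ge> 0\<close> by (simp add: emeasure_eq_measure)
qed

context net_width
begin

text \<open>Sections over a fixed sample reduce the claim to deterministic inputs, each of which
  fails with probability at most \<open>\<delta> / n\<close>. Independence of sample and
  initialization enters through the product measure.\<close>

lemma good_event_exists:
  fixes n :: nat
  assumes \<rho>: "prob_space \<nu>" "sets \<nu> = sets (data_space d)" and n: "n \<ge> 1" and \<delta>: "0 < \<delta>" and Lam_eq: "exp \<Lambda> = real n * real L / \<delta>"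
  defines "E \<equiv> {\<omega> \<in> space (outcome_measure d m L n \<nu>). \<forall>i\<in>{..<n}.
      clean d m L s \<beta> (entries (init_params d m L (snd \<omega>))) (coords (Matrix.vec d (fst (fst \<omega> i))))}"
  shows "E \<in> sets (outcome_measure d m L n \<nu>)" "1 - \<delta> \<le> measure (outcome_measure d m L n \<nu>) E"
proof -
  let ?M = "outcome_measure d m L n \<nu>" and ?P = "init_measure d m L"
  let ?D = "PiM {..<n} (\<lambda>_. \<nu>)"
  have P: "?P = PiM (init_index d m L) (\<lambda>_. gaussian)" by (simp add: init_measure_def)
  have pP: "prob_space ?P" unfolding P by (rule prob_space_PiM_gaussian)
  have pD: "prob_space ?D" using \<rho>(1) by (intro prob_space_PiM)
  have M: "?M = ?D \<Otimes>\<^sub>M ?P" by (simp add: outcome_measure_def)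
  have fin: "finite (test_net m L s)" using test_net_finite_card(1)[OF L2 s_le(3,2)] .
  have W: "(\<lambda>\<omega>. entries (init_params d m L (snd \<omega>)) l r j) \<in> borel_measurable ?M"
    if "1 \<le> l" "l \<le> L" "r < m" "j < in_dim d m l" for l r j
    unfolding M P using init_entry_measurable[OF m_pos m_even L2 less_imp_le[OF beta_bounds(1)] s_le(1,2) that]
    by (rule measurable_compose[OF measurable_snd])
  have X: "(\<lambda>\<omega>. coords (Matrix.vec d (fst (fst \<omega> i))) j) \<in> borel_measurable ?M" if "i < n" "j < d" for i j
  proof -
    have "(\<lambda>z. z i) \<in> measurable ?D \<nu>" using that by (intro measurable_component_singleton) auto
    from measurable_compose[OF measurable_fst measurable_compose[OF this sphere_coordinate_measurable[OF \<rho>(2) that(2)]]]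
    have "(\<lambda>\<omega>. fst (fst \<omega> i) j) \<in> borel_measurable ?M" unfolding M .
    then show ?thesis using that by (simp add: coords_def)
  qed
  show E: "E \<in> sets ?M"
    unfolding E_def by (intro sets.sets_Collect_finite_All clean_measurable W X fin) auto
  have clean_sets: "{g \<in> space ?P. clean d m L s \<beta> (entries (init_params d m L g)) x} \<in> sets ?P" for x
    unfolding P using init_entry_measurable[OF m_pos m_even L2 less_imp_le[OF beta_bounds(1)] s_le(1,2)]
    by (intro clean_measurable fin) auto
  interpret M: prob_space ?M
    unfolding M using pair_prob_space.intro[OF pair_sigma_finite.intro] pD pP
    by (metis prob_space_pair)
  have "measure ?M (space ?M - E) \<le> \<delta>"
    unfolding M
  proof (rule pair_measure_section_bound[OF pD pP])
    show "space (?D \<Otimes>\<^sub>M ?P) - E \<in> sets (?D \<Otimes>\<^sub>M ?P)" using E unfolding M by auto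
    fix z assume z: "z \<in> space ?D"
    let ?B = "\<lambda>i. {g \<in> space ?P. \<not> clean d m L s \<beta> (entries (init_params d m L g)) (coords (Matrix.vec d (fst (z i))))}"
    interpret P: prob_space ?P by (rule pP)
    have B: "?B i \<in> sets ?P" for i using clean_sets by (intro sets.sets_Collect_neg)
    have "Pair z -` (space (?D \<Otimes>\<^sub>M ?P) - E) \<subseteq> (\<Union>i<n. ?B i)"
      using z by (auto simp: E_def M space_pair_measure)
    then have "measure ?P (Pair z -` (space (?D \<Otimes>\<^sub>M ?P) - E)) \<le> measure ?P (\<Union>i<n. ?B i)"
      using B by (intro P.finite_measure_mono) auto
    also have "\<dots> \<le> (\<Sum>i<n. measure ?P (?B i))"
      using B by (intro P.finite_measure_subadditive_finite) auto
    also have "\<dots> \<le> (\<Sum>i<n. real L * exp (- \<Lambda>))" by (intro sum_mono prob_sample_not_clean)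
    also have "\<dots> = \<delta>" using n \<delta> L2 by (simp add: exp_minus Lam_eq)
    finally show "measure ?P (Pair z -` (space (?D \<Otimes>\<^sub>M ?P) - E)) \<le> \<delta>" .
  qed
  then show "1 - \<delta> \<le> measure ?M E" using M.prob_compl[OF E] by simp
qed

end

section \<open>Assembly: eliminating the random F\<close>

lemma ln_ge_half: "2 \<le> x \<Longrightarrow> 1 / 2 \<le> ln (x :: real)"
proof -
  assume x: "2 \<le> x"
  have "exp (1 / 2 :: real) \<le> 1 + 1 / 2 + (1 / 2)\<^sup>2" by (rule exp_bound) auto
  also have "\<dots> \<le> x" using x by (simp add: power2_eq_square)
  finally show ?thesis using x by (subst ln_ge_iff) auto
qed

theorem theorem1:
  shows "\<exists>c::real. c > 0 \<and>
    (\<forall>(d::nat) (m::nat) (L::nat) (n::nat) (T::nat) (\<delta>::real) (\<eta>::real)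
      (a::real Matrix.vec) (\<rho>::data_point measure)
      (Wbar::(nat \<Rightarrow> data_point) \<times> (nat \<times> nat \<times> nat \<Rightarrow> real) \<Rightarrow> params).
      d \<ge> 1 \<and> m \<ge> 1 \<and> even m \<and> L \<ge> 2 \<and> n \<ge> 1 \<and> T \<ge> 1 \<and> 0 < \<delta> \<and> \<delta> < 1 \<and> \<eta> > 0 \<and>
      antisymmetric_signs m a \<and>
      prob_space \<rho> \<and> sets \<rho> = sets (data_space d) \<and>
      (\<forall>\<omega>\<in>space (outcome_measure d m L n \<rho>). Wbar \<omega> \<in> param_space d m L)
      \<longrightarrow>
      (\<exists>E\<in>sets (outcome_measure d m L n \<rho>).
        measure (outcome_measure d m L n \<rho>) E \<ge> 1 - \<delta> \<and>
        (\<forall>\<omega>\<in>E.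
          let S = sample_of d (fst \<omega>);
              W0 = init_params d m L (snd \<omega>);
              W = gd d m L n a S \<eta> W0;
              V = Wbar \<omega>;
              F = ref_F m L n a S \<eta> T W0 V
          in
            F \<ge> 1 \<and>
            real m \<ge> c * real L ^ 16 * ln (real m) ^ 4 * ln (real n * real L / \<delta>) * F ^ 4 \<and>
            \<eta> \<le> min (4 / (5 * real L)) (1 / (20 * real L * ref_F_tilde m L n a S V))
            \<longrightarrow>
            (\<forall>t\<le>T.
              Max ((\<lambda>l. (spectral_norm (W t l - V l))\<^sup>2) ` {1..L}) \<le> params_dist_sq L (W t) V \<and>
              params_dist_sq L (W t) V \<le> F \<and>
              \<eta> * (\<Sum>k<t. emp_loss m L n a S (W k)) \<le> F))))"
proof (rule exI[of _ "10 ^ 120"], rule conjI, simp, intro allI impI, elim conjE)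
  fix d m L n T :: nat and \<delta> \<eta> :: real and a :: "real Matrix.vec" and \<rho> :: "data_point measure"
    and Wbar :: "(nat \<Rightarrow> data_point) \<times> (nat \<times> nat \<times> nat \<Rightarrow> real) \<Rightarrow> params"
  assume d: "1 \<le> d" and m1: "1 \<le> m" and m_even: "even m" and L: "2 \<le> L" and n: "1 \<le> n" and T: "1 \<le> T"
    and \<delta>: "0 < \<delta>" "\<delta> < 1" and \<eta>: "0 < \<eta>" and a: "antisymmetric_signs m a"
    and \<rho>: "prob_space \<rho>" "sets \<rho> = sets (data_space d)"
    and Wbar: "\<forall>\<omega>\<in>space (outcome_measure d m L n \<rho>). Wbar \<omega> \<in> param_space d m L"
  let ?M = "outcome_measure d m L n \<rho>"
  define \<Lambda> where "\<Lambda> = ln (real n * real L / \<delta>)"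
  define c where "c = 10 ^ 120 * real L ^ 16 * ln (real m) ^ 4 * \<Lambda>"
  have m2: "2 \<le> real m"
  proof -
    have "m \<noteq> 1" using m_even by auto
    then have "2 \<le> m" using m1 by linarith
    then show ?thesis by simp
  qed
  have arg: "2 \<le> real n * real L / \<delta>"
  proof -
    have "1 * 2 \<le> real n * real L" using n L by (intro mult_mono) auto
    moreover have "2 * \<delta> \<le> 2" using \<delta> by simp
    ultimately show ?thesis using \<delta> by (simp add: pos_le_divide_eq)
  qed
  have mu: "1 / 2 \<le> ln (real m)" and Lam: "1 / 2 \<le> \<Lambda>" unfolding \<Lambda>_def using ln_ge_half m2 arg by auto
  have c_pos: "0 < c" using L mu Lam by (simp add: c_def)
  have M_prob: "prob_space ?M"
    unfolding outcome_measure_def init_measure_def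
    by (intro prob_space_pair prob_space_PiM \<rho>(1) prob_space_gaussian)
  show "\<exists>E\<in>sets ?M. measure ?M E \<ge> 1 - \<delta> \<and> (\<forall>\<omega>\<in>E.
          let S = sample_of d (fst \<omega>); W0 = init_params d m L (snd \<omega>); W = gd d m L n a S \<eta> W0;
              V = Wbar \<omega>; F = ref_F m L n a S \<eta> T W0 V
          in F \<ge> 1 \<and> real m \<ge> 10 ^ 120 * real L ^ 16 * ln (real m) ^ 4 * ln (real n * real L / \<delta>) * F ^ 4 \<and>
            \<eta> \<le> min (4 / (5 * real L)) (1 / (20 * real L * ref_F_tilde m L n a S V))
            \<longrightarrow> (\<forall>t\<le>T.
              Max ((\<lambda>l. (spectral_norm (W t l - V l))\<^sup>2) ` {1..L}) \<le> params_dist_sq L (W t) V \<and>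
              params_dist_sq L (W t) V \<le> F \<and>
              \<eta> * (\<Sum>k<t. emp_loss m L n a S (W k)) \<le> F))"
    (is "\<exists>E\<in>_. _ \<and> (\<forall>\<omega>\<in>E. ?concl \<omega>)")
  proof (cases "c \<le> real m")
    \<comment> \<open>Now \<open>m\<close> is too small for any value \<open>F >= 1\<close>, so the
      width condition never holds and the whole space serves as the event.\<close>
    case False
    have "?concl \<omega>" for \<omega>
      unfolding Let_def
    proof (intro impI, elim conjE)
      let ?F = "ref_F m L n a (sample_of d (fst \<omega>)) \<eta> T (init_params d m L (snd \<omega>)) (Wbar \<omega>)"
      assume F: "1 \<le> ?F" and "10 ^ 120 * real L ^ 16 * ln (real m) ^ 4 * ln (real n * real L / \<delta>) * ?F ^ 4 \<le> real m"
      then have "c * ?F ^ 4 \<le> real m" by (simp only: c_def \<Lambda>_def)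
      moreover have "c * 1 \<le> c * ?F ^ 4" using F c_pos by (intro mult_left_mono) (auto simp: one_le_power)
      ultimately have False using False by simp
      then show "\<forall>t\<le>T.
        Max ((\<lambda>l. (spectral_norm (gd d m L n a (sample_of d (fst \<omega>)) \<eta> (init_params d m L (snd \<omega>)) t l - Wbar \<omega> l))\<^sup>2) ` {1..L})
          \<le> params_dist_sq L (gd d m L n a (sample_of d (fst \<omega>)) \<eta> (init_params d m L (snd \<omega>)) t) (Wbar \<omega>) \<and>
        params_dist_sq L (gd d m L n a (sample_of d (fst \<omega>)) \<eta> (init_params d m L (snd \<omega>)) t) (Wbar \<omega>) \<le> ?F \<and>
        \<eta> * (\<Sum>k<t. emp_loss m L n a (sample_of d (fst \<omega>)) (gd d m L n a (sample_of d (fst \<omega>)) \<eta> (init_params d m L (snd \<omega>)) k)) \<le> ?F" ..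
    qed
    moreover have "measure ?M (space ?M) \<ge> 1 - \<delta>" using prob_space.prob_space[OF M_prob] \<delta> by simp
    ultimately show ?thesis by (intro bexI[of _ "space ?M"]) auto
  next
    case True
    \<comment> \<open>The largest F that the width condition permits for this \<open>m\<close>;
      unlike F it does not vary with the outcome, so it can enter the definition of the
      event.\<close>
    define \<Phi> where "\<Phi> = root 4 (real m / c)"
    have \<Phi>4: "\<Phi> ^ 4 = real m / c" unfolding \<Phi>_def using c_pos by (intro real_root_pow_pos2) auto
    have "1 \<le> real m / c" using True c_pos by (simp add: pos_le_divide_eq)
    then have \<Phi>1: "1 \<le> \<Phi>" unfolding \<Phi>_def by simp
    interpret net_width m L \<Lambda> \<Phi>
    proof
      show "real m = 10 ^ 120 * real L ^ 16 * ln (real m) ^ 4 * \<Lambda> * \<Phi> ^ 4"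
        unfolding \<Phi>4 c_def[symmetric] using c_pos by simp
    qed (use L mu Lam \<Phi>1 m_even in auto)
    have "exp \<Lambda> = real n * real L / \<delta>" unfolding \<Lambda>_def using arg by (intro exp_ln) linarith
    note ev = good_event_exists[OF \<rho> n \<delta>(1) this]
    let ?E = "{\<omega> \<in> space ?M. \<forall>i\<in>{..<n}.
      clean d m L s \<beta> (entries (init_params d m L (snd \<omega>))) (coords (Matrix.vec d (fst (fst \<omega> i))))}"
    have "?concl \<omega>" if \<omega>: "\<omega> \<in> ?E" for \<omega>
      unfolding Let_def
    proof (intro impI allI, elim conjE)
      let ?S = "sample_of d (fst \<omega>)" and ?W0 = "init_params d m L (snd \<omega>)"
      let ?F = "ref_F m L n a ?S \<eta> T ?W0 (Wbar \<omega>)"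
      fix t assume t: "t \<le> T" and F: "1 \<le> ?F"
        and w: "10 ^ 120 * real L ^ 16 * ln (real m) ^ 4 * ln (real n * real L / \<delta>) * ?F ^ 4 \<le> real m"
        and \<eta>2: "\<eta> \<le> min (4 / (5 * real L)) (1 / (20 * real L * ref_F_tilde m L n a ?S (Wbar \<omega>)))"
      have "c * ?F ^ 4 \<le> real m" using w by (simp only: c_def \<Lambda>_def)
      then have le: "?F ^ 4 \<le> \<Phi> ^ 4"
        unfolding \<Phi>4 pos_le_divide_eq[OF c_pos] mult.commute[of _ c] .
      have "Suc 3 = 4" by simp
      from le have "?F ^ Suc 3 \<le> \<Phi> ^ Suc 3" unfolding \<open>Suc 3 = 4\<close> .
      then have F\<Phi>: "?F \<le> \<Phi>" using \<Phi>1 by (intro power_le_imp_le_base[of ?F 3 \<Phi>]) auto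
      have V: "Wbar \<omega> \<in> param_space d m L" using Wbar \<omega> by auto
      have z: "fst \<omega> i \<in> space \<rho>" if "i < n" for i
      proof -
        have "fst \<omega> \<in> space (PiM {..<n} (\<lambda>_. \<rho>))" using \<omega> by (auto simp: outcome_measure_def space_pair_measure)
        then show ?thesis using that by (auto simp: space_PiM PiE_iff)
      qed
      have \<eta>3: "\<eta> \<le> 4 / (5 * real L)" using \<eta>2 by simp
      have sx: "fst (?S i) = Matrix.vec d (fst (fst \<omega> i))" "snd (?S i) = snd (fst \<omega> i)" for i
        by (simp_all add: sample_of_def)
      have x: "fst (?S i) \<in> carrier_vec d" for i by (simp add: sx)
      have xn: "L2_set (coords (fst (?S i))) {..<d} = 1" and y: "snd (?S i) \<in> {1, -1}" if "i < n" for i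
        unfolding sx using sphere_coordinates[OF \<rho>(2) z[OF that]] by auto
      have cl: "clean d m L s \<beta> (entries ?W0) (coords (fst (?S i)))" if "i < n" for i
        unfolding sx using \<omega> that by auto
      show "Max ((\<lambda>l. (spectral_norm (gd d m L n a ?S \<eta> ?W0 t l - Wbar \<omega> l))\<^sup>2) ` {1..L}) \<le> params_dist_sq L (gd d m L n a ?S \<eta> ?W0 t) (Wbar \<omega>) \<and>
          params_dist_sq L (gd d m L n a ?S \<eta> ?W0 t) (Wbar \<omega>) \<le> ?F \<and>
          \<eta> * (\<Sum>k<t. emp_loss m L n a ?S (gd d m L n a ?S \<eta> ?W0 k)) \<le> ?F"
        by (intro conjI conclusion_of_clean[OF d n a V x xn y cl F\<Phi> \<eta> \<eta>3 t])
    qed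
    then show ?thesis using ev by (intro bexI[of _ ?E] conjI ballI) auto
  qed
qed

end
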